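(* Consider the $2\pi L$-periodic case with $\sqrt{\sigma/(g[[\rho_0]])}<L$. Let $\xi_1,\xi_2\in(L^{-1}\mathbb{Z})^2$ be lattice points with $\xi_1=-\xi_2$ and $0<|\xi_j|<|\xi|_c$, $\lambda(|\xi_j|)=\Lambda_L$ for $j=1,2$. Let $\varphi,\theta,\psi$ be the normal mode functions described in the context, and define $$\hat w(\xi,x_3)=-i\varphi(\xi,x_3)e_1-i\theta(\xi,x_3)e_2+\psi(\xi,x_3)e_3 .$$ With $x'=x_1e_1+x_2e_2$ define $$\eta(x,t)=e^{\Lambda_Lt}\sum_{j=1}^2\hat w(\xi_j,x_3)e^{ix'\cdot\xi_j},\qquad v(x,t)=\Lambda_Le^{\Lambda_Lt}\sum_{j=1}^2\hat w(\xi_j,x_3)e^{ix'\cdot\xi_j},$$ $$q(x,t)=-e^{\Lambda_Lt}\rho_0(x_3)\sum_{j=1}^2\left(e_1\cdot\xi_j\,\varphi(\xi_j,x_3)+e_2\cdot\xi_j\,\theta(\xi_j,x_3)+\partial_3\psi(\xi_j,x_3)\right)e^{ix'\cdot\xi_j}.$$ Then $\eta,v,q$ are real-valued solutions of the linearized problem (equations, jump conditions and boundary conditions, as given in the context). For every integer $k\ge0$ and every $t\ge0$ we have $\eta(t),v(t),q(t)\in H^k(\Omega)$ (piecewise Sobolev space) and $$\|\eta(t)\|_{H^k}=e^{t\Lambda_L}\|\eta(0)\|_{H^k},\quad \|v(t)\|_{H^k}=e^{t\Lambda_L}\|v(0)\|_{H^k},\quad \|q(t)\|_{H^k}=e^{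t\Lambda_L}\|q(0)\|_{H^k}.$$
   Context: Parameters and steady state. Fix $g>0$, $\sigma\ge 0$, $m,\ell>0$, $L>0$. Let $P_\pm\in C^\infty((0,\infty))$ be positive and strictly increasing with $1/P_\pm'\in L^\infty_{loc}((0,\infty))$; let $\varepsilon_\pm,\delta_\pm\in C^\infty((0,\infty))$ with $\varepsilon_\pm>0$, $\delta_\pm\ge0$. Put $h_\pm(z)=\int_1^z P_\pm'(r)/r\,dr$. Assume $Z=\{z>0: P_-(z)>P_+(z),\ P_-(z)\in P_+((0,\infty))\}$ is nonempty, fix $\rho_0^-\in Z$ and set $\rho_0^+=P_+^{-1}(P_-(\rho_0^-))$. Assume $h_-(\rho_0^-)+gm\in h_-((0,\infty))$ and $h_+(\rho_0^+)-g\ell\in h_+((0,\infty))$. Define $\rho_0(x_3)=h_-^{-1}(h_-(\rho_0^-)-gx_3)$ for $-m<x_3<0$ and $\rho_0(x_3)=h_+^{-1}(h_+(\rho_0^+)-gx_3)$ for $0<x_3<\ell$; then $\rho_0$ is smooth on each side, bounded above and below by positive constants, and $\frac{d}{dx_3}P(\rho_0)=-g\rho_0$ on each side. Notation. $P'(\rho_0)$, $\varepsilon_0=\varepsilon(\rho_0)$, $\delta_0=\delta(\rho_0)$ mean the $+$ functions of $\rho_0$ for $x_3>0$ and the $-$ functions for $x_3<0$. $[[f]]=f|_{x_3=0^+}-f|_{x_3=0^-}$; $[[\rho_0]]=\rho_0^+-\rho_0^->0$. $|\xi|_c=\sqrt{g[[\rho_0]]/\sigma}$ ($=+\infty$ if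 $\sigma=0$). Variational quantities. For $|\xi|>0$, $s>0$, with $\tilde\varepsilon=s\varepsilon_0$, $\tilde\delta=s\delta_0$ and real $\varphi,\psi\in H^1_0((-m,\ell))$, let $$E(\varphi,\psi)=\frac{\sigma|\xi|^2}{2}\psi(0)^2+\frac12\int_{-m}^\ell(\tilde\delta+P'(\rho_0)\rho_0)(\psi'+|\xi|\varphi)^2-2g\rho_0|\xi|\varphi\psi+\frac12\int_{-m}^\ell\tilde\varepsilon\left((\varphi'-|\xi|\psi)^2+(\psi'-|\xi|\varphi)^2+\tfrac13(\psi'+|\xi|\varphi)^2\right),$$ $J(\varphi,\psi)=\frac12\int_{-m}^\ell\rho_0(\varphi^2+\psi^2)$, $\mathcal A=\{(\varphi,\psi)\in H_0^1((-m,\ell))^2: J(\varphi,\psi)=1\}$, $\mu(|\xi|,s)=\inf_{\mathcal A}E$ (the infimum is attained). For $0<|\xi|<|\xi|_c$ there is a unique $s>0$ with $\mu(|\xi|,s)<0$ and $s=\sqrt{-\mu(|\xi|,s)}$; this $s$ is denoted $\lambda(|\xi|)$. Normal modes. For each $|\xi|\in(0,|\xi|_c)$ fix a minimizer $(\varphi_{|\xi|},\psi_{|\xi|})\in\mathcal A$ of $E$ with $s=\lambda(|\xi|)$. For $\xi\in\mathbb{R}^2$ with $|\xi|\in(0,|\xi|_c)$, let $R\in SO(2)$ be the rotation with $R\xi=(|\xi|,0)$ and set $(\varphi(\xi,x_3),\theta(\xi,x_3))=R^{-1}(\varphi_{|\xi|}(x_3),0)$, $\psi(\xi,x_3)=\psi_{|\xi|}(x_3)$.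 Largest growth rate. When $\sqrt{\sigma/(g[[\rho_0]])}<L$, $\Lambda_L=\sup\{\lambda(|\xi|): \xi\in(L^{-1}\mathbb{Z})^2,\ |\xi|\in(0,|\xi|_c)\}>0$; it is attained. Domain and linearized problem. Let $\Omega_-=(2\pi L\mathbb{T})^2\times(-m,0)$, $\Omega_+=(2\pi L\mathbb{T})^2\times(0,\ell)$, where $2\pi L\mathbb{T}$ is the 1-torus of length $2\pi L$; $\Omega$ is the slab $(2\pi L\mathbb{T})^2\times(-m,\ell)$. The linearized problem for $\eta,v$ (vector valued) and $q$ (scalar) is, in $\Omega_\pm$ for $t>0$: $\partial_t\eta=v$, $\partial_tq+\rho_0\,\mathrm{div}\,v=0$, $$\rho_0\partial_tv+\nabla(P'(\rho_0)q)+gqe_3+g\rho_0\nabla\eta_3=\mathrm{div}\left(\varepsilon_0\left(Dv+Dv^T-\tfrac23(\mathrm{div}\,v)I\right)+\delta_0(\mathrm{div}\,v)I\right),$$ with jump conditions at $\{x_3=0\}$: $[[v]]=0$, $[[\eta]]=0$, $$[[P'(\rho_0)qI-\varepsilon_0(Dv+Dv^T)-(\delta_0-2\varepsilon_0/3)(\mathrm{div}\,v)I]]e_3=\sigma\Delta_{x_1,x_2}\eta_3e_3,$$ and boundary conditions $v=0$ at $x_3=-m$ and $x_3=\ell$. Piecewise Sobolev space. $H^k(\Omega)=\{f: f|_{\Omega_+}\in H^k(\Omega_+),\ f|_{\Omega_-}\in H^k(\Omega_-)\}$, $\|f\|_{H^k}^2=\|f\|_{H^k(\Omega_+)}^2+\|f\|_{H^k(\Omega_-)}^2$,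 with $\|f\|^2_{H^k(\Omega_\pm)}=\sum_{j=0}^k\sum_{\xi\in(L^{-1}\mathbb{Z})^2}(1+|\xi|^2)^{k-j}\|\partial_{x_3}^j\hat f_\pm(\xi,\cdot)\|^2_{L^2(I_\pm)}$, $I_-=(-m,0)$, $I_+=(0,\ell)$, $\hat f(\xi,x_3)=\int_{(2\pi L\mathbb{T})^2}f(x',x_3)e^{-ix'\cdot\xi}dx'$. *)

theory Defs
  imports "HOL-Analysis.Analysis"
begin

section \<open>One-dimensional function spaces\<close>

definition C_inf_on :: "real set \<Rightarrow> (real \<Rightarrow> real) \<Rightarrow> bool" where
  "C_inf_on S f \<longleftrightarrow> (\<forall>n. \<forall>z\<in>S. (deriv ^^ n) f differentiable (at z))"

definition Linf_loc :: "real set \<Rightarrow> (real \<Rightarrow> real) \<Rightarrow> bool" where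
  "Linf_loc S f \<longleftrightarrow> set_borel_measurable lebesgue S f \<and>
     (\<forall>K. compact K \<and> K \<subseteq> S \<longrightarrow> (\<exists>C. AE z in lebesgue. z \<in> K \<longrightarrow> \<bar>f z\<bar> \<le> C))"

definition test_fun :: "real \<Rightarrow> real \<Rightarrow> (real \<Rightarrow> real) \<Rightarrow> bool" where
  "test_fun a b u \<longleftrightarrow> C_inf_on UNIV u \<and>
     (\<exists>K. compact K \<and> K \<subseteq> {a<..<b} \<and> (\<forall>z. z \<notin> K \<longrightarrow> u z = 0))"

definition loc_integrable ::
    "real \<Rightarrow> real \<Rightarrow> (real \<Rightarrow> 'a::{banach,second_countable_topology}) \<Rightarrow> bool" where
  "loc_integrable a b f \<longleftrightarrow>
     (\<forall>K. compact K \<and> K \<subseteq> {a<..<b} \<longrightarrow> set_integrable lebesgue K f)"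

definition is_weak_deriv :: "nat \<Rightarrow> real \<Rightarrow> real \<Rightarrow>
    (real \<Rightarrow> 'a::{banach,second_countable_topology}) \<Rightarrow> (real \<Rightarrow> 'a) \<Rightarrow> bool" where
  "is_weak_deriv j a b f h \<longleftrightarrow> loc_integrable a b f \<and> loc_integrable a b h \<and>
     (\<forall>u. test_fun a b u \<longrightarrow>
        (LINT z:{a<..<b}|lebesgue. (deriv ^^ j) u z *\<^sub>R f z)
          = (-1) ^ j *\<^sub>R (LINT z:{a<..<b}|lebesgue. u z *\<^sub>R h z))"

text \<open>A representative of the weak derivative. It is unique only up to null sets, so it is used
  only inside integrals.\<close>

definition weak_derivative :: "nat \<Rightarrow> real \<Rightarrow> real \<Rightarrow>
    (real \<Rightarrow> 'a::{banach,second_countable_topology}) \<Rightarrow> real \<Rightarrow> 'a" where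
  "weak_derivative j a b f = (SOME h. is_weak_deriv j a b f h)"

definition L2sq :: "real \<Rightarrow> real \<Rightarrow> (real \<Rightarrow> 'a::real_normed_vector) \<Rightarrow> ennreal" where
  "L2sq a b f = (\<integral>\<^sup>+z\<in>{a<..<b}. ennreal ((norm (f z))\<^sup>2) \<partial>lebesgue)"

definition in_L2 :: "real \<Rightarrow> real \<Rightarrow> (real \<Rightarrow> 'a::real_normed_vector) \<Rightarrow> bool" where
  "in_L2 a b f \<longleftrightarrow> set_borel_measurable lebesgue {a<..<b} f \<and> L2sq a b f < \<infinity>"

text \<open>\<open>H\<^sup>1\<^sub>0((a,b))\<close> as the closure of the test functions in the \<open>H\<^sup>1\<close> norm. Elements are represented
  by their continuous representative on the closed interval, so that point values make sense;
  values outside \<open>[a,b]\<close> are irrelevant.\<close>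

definition H10 :: "real \<Rightarrow> real \<Rightarrow> (real \<Rightarrow> real) set" where
  "H10 a b = {f. continuous_on {a..b} f \<and> in_L2 a b f \<and>
     (\<exists>h. is_weak_deriv 1 a b f h \<and> in_L2 a b h \<and>
        (\<exists>u. (\<forall>n. test_fun a b (u n)) \<and>
             (\<lambda>n::nat. L2sq a b (\<lambda>z. u n z - f z)) \<longlonglongrightarrow> 0 \<and>
             (\<lambda>n. L2sq a b (\<lambda>z. deriv (u n) z - h z)) \<longlonglongrightarrow> 0))}"


section \<open>Parameters and steady state\<close>

text \<open>The suffixes \<open>p\<close> and \<open>m\<close> stand for the upper (\<open>+\<close>) and the lower (\<open>-\<close>) fluid; the fluids
  occupy heights \<open>0 < x\<^sub>3 < height\<close> and \<open>-depth < x\<^sub>3 < 0\<close>, and \<open>rhom\<close> is the density \<open>\<rho>\<^sub>0\<^sup>-\<close> just below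
  the interface.\<close>

record params =
  grav :: real
  surf :: real
  depth :: real
  height :: real
  perL :: real
  Pp :: "real \<Rightarrow> real"
  Pm :: "real \<Rightarrow> real"
  epsp :: "real \<Rightarrow> real"
  epsm :: "real \<Rightarrow> real"
  delp :: "real \<Rightarrow> real"
  delm :: "real \<Rightarrow> real"
  rhom :: real

definition enthalpy :: "(real \<Rightarrow> real) \<Rightarrow> real \<Rightarrow> real" where
  "enthalpy P z = (LBINT r=ereal 1..ereal z. deriv P r / r)"

definition rhop :: "params \<Rightarrow> real" where
  "rhop c = inv_into {0<..} (Pp c) (Pm c (rhom c))"

definition pressure_law :: "(real \<Rightarrow> real) \<Rightarrow> bool" where
  "pressure_law P \<longleftrightarrow> C_inf_on {0<..} P \<and> (\<forall>z>0. P z > 0) \<and> strict_mono_on {0<..} P \<and>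
     Linf_loc {0<..} (\<lambda>z. 1 / deriv P z)"

definition viscosities :: "(real \<Rightarrow> real) \<Rightarrow> (real \<Rightarrow> real) \<Rightarrow> bool" where
  "viscosities e d \<longleftrightarrow> C_inf_on {0<..} e \<and> C_inf_on {0<..} d \<and> (\<forall>z>0. e z > 0 \<and> d z \<ge> 0)"

definition admissible_densities :: "params \<Rightarrow> real set" where
  "admissible_densities c = {z. z > 0 \<and> Pm c z > Pp c z \<and> Pm c z \<in> Pp c ` {0<..}}"

definition standing :: "params \<Rightarrow> bool" where
  "standing c \<longleftrightarrow>
     grav c > 0 \<and> surf c \<ge> 0 \<and> depth c > 0 \<and> height c > 0 \<and> perL c > 0 \<and>
     pressure_law (Pp c) \<and> pressure_law (Pm c) \<and>
     viscosities (epsp c) (delp c) \<and> viscosities (epsm c) (delm c) \<and>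
     rhom c \<in> admissible_densities c \<and>
     enthalpy (Pm c) (rhom c) + grav c * depth c \<in> enthalpy (Pm c) ` {0<..} \<and>
     enthalpy (Pp c) (rhop c) - grav c * height c \<in> enthalpy (Pp c) ` {0<..}"

text \<open>The value at the interface \<open>z = 0\<close> is a convention; it enters no equation.\<close>

definition rho0 :: "params \<Rightarrow> real \<Rightarrow> real" where
  "rho0 c z =
     (if z < 0 then inv_into {0<..} (enthalpy (Pm c)) (enthalpy (Pm c) (rhom c) - grav c * z)
      else inv_into {0<..} (enthalpy (Pp c)) (enthalpy (Pp c) (rhop c) - grav c * z))"

definition dP0 :: "params \<Rightarrow> real \<Rightarrow> real" where
  "dP0 c z = (if z < 0 then deriv (Pm c) (rho0 c z) else deriv (Pp c) (rho0 c z))"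

definition eps0 :: "params \<Rightarrow> real \<Rightarrow> real" where
  "eps0 c z = (if z < 0 then epsm c (rho0 c z) else epsp c (rho0 c z))"

definition del0 :: "params \<Rightarrow> real \<Rightarrow> real" where
  "del0 c z = (if z < 0 then delm c (rho0 c z) else delp c (rho0 c z))"

definition rho_jump :: "params \<Rightarrow> real" where
  "rho_jump c = rhop c - rhom c"

definition xi_crit :: "params \<Rightarrow> ereal" where
  "xi_crit c = (if surf c = 0 then \<infinity> else ereal (sqrt (grav c * rho_jump c / surf c)))"


section \<open>Variational problem and growth rate\<close>

definition energy :: "params \<Rightarrow> real \<Rightarrow> real \<Rightarrow> (real \<Rightarrow> real) \<Rightarrow> (real \<Rightarrow> real) \<Rightarrow> real" where
  "energy c r s f p =
     (let I = {- depth c<..<height c};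
          f' = weak_derivative 1 (- depth c) (height c) f;
          p' = weak_derivative 1 (- depth c) (height c) p
      in surf c * r\<^sup>2 / 2 * (p 0)\<^sup>2
         + 1/2 * (LINT z:I|lebesgue.
              (s * del0 c z + dP0 c z * rho0 c z) * (p' z + r * f z)\<^sup>2
              - 2 * grav c * rho0 c z * r * f z * p z)
         + 1/2 * (LINT z:I|lebesgue.
              s * eps0 c z * ((f' z - r * p z)\<^sup>2 + (p' z - r * f z)\<^sup>2
                              + 1/3 * (p' z + r * f z)\<^sup>2)))"

definition Jfun :: "params \<Rightarrow> (real \<Rightarrow> real) \<Rightarrow> (real \<Rightarrow> real) \<Rightarrow> real" where
  "Jfun c f p =
     1/2 * (LINT z:{- depth c<..<height c}|lebesgue. rho0 c z * ((f z)\<^sup>2 + (p z)\<^sup>2))"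

definition admissible_set :: "params \<Rightarrow> ((real \<Rightarrow> real) \<times> (real \<Rightarrow> real)) set" where
  "admissible_set c =
     {(f, p). f \<in> H10 (- depth c) (height c) \<and> p \<in> H10 (- depth c) (height c) \<and> Jfun c f p = 1}"

definition mu :: "params \<Rightarrow> real \<Rightarrow> real \<Rightarrow> real" where
  "mu c r s = (INF (f, p) \<in> admissible_set c. energy c r s f p)"

definition is_minimizer ::
    "params \<Rightarrow> real \<Rightarrow> real \<Rightarrow> (real \<Rightarrow> real) \<Rightarrow> (real \<Rightarrow> real) \<Rightarrow> bool" where
  "is_minimizer c r s f p \<longleftrightarrow> (f, p) \<in> admissible_set c \<and>
     (\<forall>(f1, p1) \<in> admissible_set c. energy c r s f p \<le> energy c r s f1 p1)"

definition lam :: "params \<Rightarrow> real \<Rightarrow> real" where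
  "lam c r = (THE s. s > 0 \<and> mu c r s < 0 \<and> s = sqrt (- mu c r s))"

definition lattice :: "real \<Rightarrow> (real^2) set" where
  "lattice L = {\<xi>. \<forall>i. \<exists>n::int. \<xi> $ i = of_int n / L}"

definition Lambda :: "params \<Rightarrow> real" where
  "Lambda c = Sup {lam c (norm \<xi>) | \<xi>. \<xi> \<in> lattice (perL c) \<and>
                     0 < norm \<xi> \<and> ereal (norm \<xi>) < xi_crit c}"


section \<open>Normal modes\<close>

text \<open>In what follows \<open>f\<close> and \<open>p\<close> are the families \<open>r \<mapsto> \<phi>\<^sub>r\<close> and \<open>r \<mapsto> \<psi>\<^sub>r\<close> of chosen minimizers.\<close>

definition rot :: "real^2 \<Rightarrow> real^2^2" where
  "rot \<xi> = (THE R. rotation_matrix R \<and> R *v \<xi> = vector [norm \<xi>, 0])"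

definition mode_phi :: "(real \<Rightarrow> real \<Rightarrow> real) \<Rightarrow> real^2 \<Rightarrow> real \<Rightarrow> real" where
  "mode_phi f \<xi> z = (matrix_inv (rot \<xi>) *v vector [f (norm \<xi>) z, 0]) $ 1"

definition mode_theta :: "(real \<Rightarrow> real \<Rightarrow> real) \<Rightarrow> real^2 \<Rightarrow> real \<Rightarrow> real" where
  "mode_theta f \<xi> z = (matrix_inv (rot \<xi>) *v vector [f (norm \<xi>) z, 0]) $ 2"

definition mode_psi :: "(real \<Rightarrow> real \<Rightarrow> real) \<Rightarrow> real^2 \<Rightarrow> real \<Rightarrow> real" where
  "mode_psi p \<xi> z = p (norm \<xi>) z"

definition what ::
    "(real \<Rightarrow> real \<Rightarrow> real) \<Rightarrow> (real \<Rightarrow> real \<Rightarrow> real) \<Rightarrow> real^2 \<Rightarrow> real \<Rightarrow> complex^3" where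
  "what f p \<xi> z = vector [- \<i> * of_real (mode_phi f \<xi> z),
                          - \<i> * of_real (mode_theta f \<xi> z),
                          of_real (mode_psi p \<xi> z)]"

definition horiz :: "real^3 \<Rightarrow> real^2" where
  "horiz x = vector [x $ 1, x $ 2]"

definition eta_sol :: "params \<Rightarrow> (real \<Rightarrow> real \<Rightarrow> real) \<Rightarrow> (real \<Rightarrow> real \<Rightarrow> real) \<Rightarrow>
    (nat \<Rightarrow> real^2) \<Rightarrow> real \<Rightarrow> real^3 \<Rightarrow> complex^3" where
  "eta_sol c f p \<xi> t x =
     exp (Lambda c * t) *\<^sub>R (\<Sum>j=1..2. cis (horiz x \<bullet> \<xi> j) *s what f p (\<xi> j) (x $ 3))"

definition v_sol :: "params \<Rightarrow> (real \<Rightarrow> real \<Rightarrow> real) \<Rightarrow> (real \<Rightarrow> real \<Rightarrow> real) \<Rightarrow>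
    (nat \<Rightarrow> real^2) \<Rightarrow> real \<Rightarrow> real^3 \<Rightarrow> complex^3" where
  "v_sol c f p \<xi> t x =
     (Lambda c * exp (Lambda c * t)) *\<^sub>R
       (\<Sum>j=1..2. cis (horiz x \<bullet> \<xi> j) *s what f p (\<xi> j) (x $ 3))"

definition q_sol :: "params \<Rightarrow> (real \<Rightarrow> real \<Rightarrow> real) \<Rightarrow> (real \<Rightarrow> real \<Rightarrow> real) \<Rightarrow>
    (nat \<Rightarrow> real^2) \<Rightarrow> real \<Rightarrow> real^3 \<Rightarrow> complex" where
  "q_sol c f p \<xi> t x =
     - of_real (exp (Lambda c * t) * rho0 c (x $ 3)) *
       (\<Sum>j=1..2. of_real (\<xi> j $ 1 * mode_phi f (\<xi> j) (x $ 3)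
                         + \<xi> j $ 2 * mode_theta f (\<xi> j) (x $ 3)
                         + deriv (mode_psi p (\<xi> j)) (x $ 3))
                 * cis (horiz x \<bullet> \<xi> j))"


section \<open>The linearized problem\<close>

text \<open>Functions on the horizontally periodic domains are represented by periodic functions on
  their universal covers.\<close>

definition Omega :: "params \<Rightarrow> (real^3) set" where
  "Omega c = {x. - depth c < x $ 3 \<and> x $ 3 < height c}"

definition Omega_p :: "params \<Rightarrow> (real^3) set" where
  "Omega_p c = {x. 0 < x $ 3 \<and> x $ 3 < height c}"

definition Omega_m :: "params \<Rightarrow> (real^3) set" where
  "Omega_m c = {x. - depth c < x $ 3 \<and> x $ 3 < 0}"

definition periodic_on :: "real \<Rightarrow> (real^3) set \<Rightarrow> (real^3 \<Rightarrow> 'a) \<Rightarrow> bool" where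
  "periodic_on L S f \<longleftrightarrow>
     (\<forall>x\<in>S. \<forall>i\<in>{1, 2}. f (x + (2 * pi * L) *\<^sub>R axis i 1) = f x)"

definition pd :: "3 \<Rightarrow> (real^3 \<Rightarrow> 'a::real_normed_vector) \<Rightarrow> real^3 \<Rightarrow> 'a" where
  "pd i f x = vector_derivative (\<lambda>h. f (x + h *\<^sub>R axis i 1)) (at 0)"

definition has_pd :: "3 \<Rightarrow> (real^3 \<Rightarrow> 'a::real_normed_vector) \<Rightarrow> real^3 \<Rightarrow> bool" where
  "has_pd i f x \<longleftrightarrow> (\<lambda>h. f (x + h *\<^sub>R axis i 1)) differentiable (at 0)"

primrec Ck_on :: "nat \<Rightarrow> (real^3) set \<Rightarrow> (real^3 \<Rightarrow> 'a::real_normed_vector) \<Rightarrow> bool" where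
  "Ck_on 0 U f = continuous_on U f"
| "Ck_on (Suc k) U f =
     (continuous_on U f \<and> (\<forall>i. (\<forall>x\<in>U. has_pd i f x) \<and> Ck_on k U (pd i f)))"

definition dt :: "(real \<Rightarrow> real^3 \<Rightarrow> 'a::real_normed_vector) \<Rightarrow> real \<Rightarrow> real^3 \<Rightarrow> 'a" where
  "dt f t x = vector_derivative (\<lambda>s. f s x) (at t)"

definition grad :: "(real^3 \<Rightarrow> complex) \<Rightarrow> real^3 \<Rightarrow> complex^3" where
  "grad f x = (\<chi> i. pd i f x)"

definition Dmat :: "(real^3 \<Rightarrow> complex^3) \<Rightarrow> real^3 \<Rightarrow> complex^3^3" where
  "Dmat u x = (\<chi> i j. pd j (\<lambda>y. u y $ i) x)"

definition divg :: "(real^3 \<Rightarrow> complex^3) \<Rightarrow> real^3 \<Rightarrow> complex" where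
  "divg u x = (\<Sum>i\<in>UNIV. pd i (\<lambda>y. u y $ i) x)"

definition divm :: "(real^3 \<Rightarrow> complex^3^3) \<Rightarrow> real^3 \<Rightarrow> complex^3" where
  "divm M x = (\<chi> i. \<Sum>j\<in>UNIV. pd j (\<lambda>y. M y $ i $ j) x)"

abbreviation e3 :: "complex^3" where
  "e3 \<equiv> axis 3 1"

definition visc_stress :: "params \<Rightarrow> (real^3 \<Rightarrow> complex^3) \<Rightarrow> real^3 \<Rightarrow> complex^3^3" where
  "visc_stress c u x =
     eps0 c (x $ 3) *\<^sub>R (Dmat u x + transpose (Dmat u x) - mat ((2/3) *\<^sub>R divg u x))
     + del0 c (x $ 3) *\<^sub>R mat (divg u x)"

definition jump_stress ::
    "params \<Rightarrow> (real^3 \<Rightarrow> complex) \<Rightarrow> (real^3 \<Rightarrow> complex^3) \<Rightarrow> real^3 \<Rightarrow> complex^3^3" where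
  "jump_stress c q u x =
     mat (dP0 c (x $ 3) *\<^sub>R q x)
     - eps0 c (x $ 3) *\<^sub>R (Dmat u x + transpose (Dmat u x))
     - mat ((del0 c (x $ 3) - 2 * eps0 c (x $ 3) / 3) *\<^sub>R divg u x)"

text \<open>\<open>[[f]] = d\<close> at the interface point \<open>y\<close>; both one-sided traces are required to exist.\<close>

definition has_jump :: "params \<Rightarrow> (real^3 \<Rightarrow> 'a::real_normed_vector) \<Rightarrow> real^3 \<Rightarrow> 'a \<Rightarrow> bool" where
  "has_jump c f y d \<longleftrightarrow>
     (\<exists>a b. (f \<longlongrightarrow> a) (at y within Omega_p c) \<and> (f \<longlongrightarrow> b) (at y within Omega_m c) \<and> d = a - b)"

text \<open>The trace on the interface, taken from above. It is applied to \<open>\<eta>\<^sub>3\<close>, for which the traces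
  from both sides agree by \<open>[[\<eta>]] = 0\<close>.\<close>

definition trace0 :: "params \<Rightarrow> (real^3 \<Rightarrow> complex) \<Rightarrow> real^3 \<Rightarrow> complex" where
  "trace0 c f y = Lim (at y within Omega_p c) f"

definition horiz_laplacian :: "(real^3 \<Rightarrow> complex) \<Rightarrow> real^3 \<Rightarrow> complex" where
  "horiz_laplacian f y = pd 1 (pd 1 f) y + pd 2 (pd 2 f) y"

text \<open>Classical solutions. \<open>vector_derivative\<close> is total, so the existence of the derivatives in the
  equations is required explicitly. The fields are complex valued here; that the solution at hand
  is real valued is stated separately.\<close>

definition classical_regularity :: "params \<Rightarrow> (real \<Rightarrow> real^3 \<Rightarrow> complex^3) \<Rightarrow>
    (real \<Rightarrow> real^3 \<Rightarrow> complex^3) \<Rightarrow> (real \<Rightarrow> real^3 \<Rightarrow> complex) \<Rightarrow> bool" where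
  "classical_regularity c \<eta> v q \<longleftrightarrow>
     (\<forall>t>0.
        periodic_on (perL c) (Omega c) (\<eta> t) \<and> periodic_on (perL c) (Omega c) (v t) \<and>
        periodic_on (perL c) (Omega_p c \<union> Omega_m c) (q t) \<and>
        (\<forall>U\<in>{Omega_p c, Omega_m c}.
           Ck_on 2 U (\<eta> t) \<and> Ck_on 2 U (v t) \<and> Ck_on 1 U (q t) \<and>
           (\<forall>x\<in>U. (\<lambda>s. \<eta> s x) differentiable (at t) \<and> (\<lambda>s. v s x) differentiable (at t) \<and>
                   (\<lambda>s. q s x) differentiable (at t))) \<and>
        (\<forall>y. y $ 3 = 0 \<longrightarrow> (\<forall>i\<in>{1, 2}.
           has_pd i (trace0 c (\<lambda>x. \<eta> t x $ 3)) y \<and>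
           has_pd i (pd i (trace0 c (\<lambda>x. \<eta> t x $ 3))) y)))"

definition linearized_solution :: "params \<Rightarrow> (real \<Rightarrow> real^3 \<Rightarrow> complex^3) \<Rightarrow>
    (real \<Rightarrow> real^3 \<Rightarrow> complex^3) \<Rightarrow> (real \<Rightarrow> real^3 \<Rightarrow> complex) \<Rightarrow> bool" where
  "linearized_solution c \<eta> v q \<longleftrightarrow>
     classical_regularity c \<eta> v q \<and>
     (\<forall>t>0. \<forall>x \<in> Omega_p c \<union> Omega_m c.
        dt \<eta> t x = v t x \<and>
        dt q t x + rho0 c (x $ 3) *\<^sub>R divg (v t) x = 0 \<and>
        rho0 c (x $ 3) *\<^sub>R dt v t x
          + grad (\<lambda>y. dP0 c (y $ 3) *\<^sub>R q t y) x
          + (grav c *\<^sub>R q t x) *s e3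
          + (grav c * rho0 c (x $ 3)) *\<^sub>R grad (\<lambda>y. \<eta> t y $ 3) x
        = divm (visc_stress c (v t)) x) \<and>
     (\<forall>t>0. \<forall>y. y $ 3 = 0 \<longrightarrow>
        has_jump c (v t) y 0 \<and> has_jump c (\<eta> t) y 0 \<and>
        has_jump c (\<lambda>x. jump_stress c (q t) (v t) x *v e3) y
          ((surf c *\<^sub>R horiz_laplacian (trace0 c (\<lambda>x. \<eta> t x $ 3)) y) *s e3)) \<and>
     (\<forall>t>0. \<forall>y. (y $ 3 = - depth c \<longrightarrow> (v t \<longlongrightarrow> 0) (at y within Omega_m c)) \<and>
                (y $ 3 = height c \<longrightarrow> (v t \<longlongrightarrow> 0) (at y within Omega_p c)))"


section \<open>Piecewise Sobolev spaces\<close>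

definition fhat :: "real \<Rightarrow> (real^3 \<Rightarrow> complex) \<Rightarrow> real^2 \<Rightarrow> real \<Rightarrow> complex" where
  "fhat L f \<xi> z =
     (LINT y:cbox 0 (\<chi> i. 2 * pi * L)|lebesgue.
        f (vector [y $ 1, y $ 2, z]) * cis (- (y \<bullet> \<xi>)))"

definition layer :: "real \<Rightarrow> real \<Rightarrow> (real^3) set" where
  "layer a b = {x. a < x $ 3 \<and> x $ 3 < b}"

definition layer_cell :: "real \<Rightarrow> real \<Rightarrow> real \<Rightarrow> (real^3) set" where
  "layer_cell L a b = {x \<in> layer a b. \<forall>i\<in>{1, 2}. 0 \<le> x $ i \<and> x $ i \<le> 2 * pi * L}"

definition Hk_sq_layer :: "real \<Rightarrow> real \<Rightarrow> real \<Rightarrow> nat \<Rightarrow> (real^3 \<Rightarrow> complex) \<Rightarrow> ennreal" where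
  "Hk_sq_layer L a b k f =
     (\<Sum>j\<le>k. \<Sum>\<^sub>\<infinity>\<xi>\<in>lattice L. ennreal ((1 + (norm \<xi>)\<^sup>2) ^ (k - j))
                * L2sq a b (weak_derivative j a b (fhat L f \<xi>)))"

definition in_Hk_layer :: "real \<Rightarrow> real \<Rightarrow> real \<Rightarrow> nat \<Rightarrow> (real^3 \<Rightarrow> complex) \<Rightarrow> bool" where
  "in_Hk_layer L a b k f \<longleftrightarrow>
     periodic_on L (layer a b) f \<and>
     set_borel_measurable lebesgue (layer_cell L a b) f \<and>
     (\<integral>\<^sup>+x\<in>layer_cell L a b. ennreal ((norm (f x))\<^sup>2) \<partial>lebesgue) < \<infinity> \<and>
     (\<forall>\<xi>\<in>lattice L. \<forall>j\<le>k. \<exists>h. is_weak_deriv j a b (fhat L f \<xi>) h \<and> in_L2 a b h) \<and>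
     Hk_sq_layer L a b k f < \<infinity>"

definition in_Hk :: "params \<Rightarrow> nat \<Rightarrow> (real^3 \<Rightarrow> complex) \<Rightarrow> bool" where
  "in_Hk c k f \<longleftrightarrow> in_Hk_layer (perL c) 0 (height c) k f \<and> in_Hk_layer (perL c) (- depth c) 0 k f"

definition Hk_sq :: "params \<Rightarrow> nat \<Rightarrow> (real^3 \<Rightarrow> complex) \<Rightarrow> ennreal" where
  "Hk_sq c k f = Hk_sq_layer (perL c) 0 (height c) k f + Hk_sq_layer (perL c) (- depth c) 0 k f"

definition Hk_norm :: "params \<Rightarrow> nat \<Rightarrow> (real^3 \<Rightarrow> complex) \<Rightarrow> real" where
  "Hk_norm c k f = sqrt (enn2real (Hk_sq c k f))"

definition in_Hk_vec :: "params \<Rightarrow> nat \<Rightarrow> (real^3 \<Rightarrow> complex^3) \<Rightarrow> bool" where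
  "in_Hk_vec c k u \<longleftrightarrow> (\<forall>i. in_Hk c k (\<lambda>x. u x $ i))"

definition Hk_norm_vec :: "params \<Rightarrow> nat \<Rightarrow> (real^3 \<Rightarrow> complex^3) \<Rightarrow> real" where
  "Hk_norm_vec c k u = sqrt (enn2real (\<Sum>i\<in>UNIV. Hk_sq c k (\<lambda>x. u x $ i)))"

end

theory Submission
  imports Defs
begin

text \<open>The fields are obtained from a minimizer \<open>(\<phi>, \<psi>)\<close> of the energy by separation of variables, so the
  theorem comes down to showing that the minimizer is a classical solution of an ordinary boundary value
  problem. Since the two frequencies are opposite, the two modes are complex conjugate and their sum is
  real: with \<open>\<theta> = x' \<bullet> \<xi>\<close> the horizontal displacement is a multiple of \<open>\<phi> sin \<theta>\<close> in the direction of \<open>\<xi>\<close>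
  and the vertical one is a multiple of \<open>\<psi> cos \<theta>\<close> (\<open>explicit_solution\<close>).

  The link between growth rate and minimizer is the relation \<open>\<mu>(r, s) = - s\<^sup>2\<close> at \<open>s = \<lambda>(r)\<close>. The
  energy is affine in \<open>s\<close> with nonnegative slope, hence its infimum \<open>\<mu>\<close> is concave and nondecreasing and
  \<open>s\<^sup>2 + \<mu>\<close> has exactly one zero as soon as it is negative somewhere. It is negative for small \<open>s\<close> because
  the heavier fluid is on top: incompressible profiles concentrated at the interface have the energy of
  surface tension minus gravity, which is negative below the critical frequency (\<open>negative_energy_pair\<close>,
  \<open>lam_fixed_point\<close>).

  The first variation of energy plus \<open>s\<^sup>2\<close> times mass vanishes at the minimizer (\<open>first_variation\<close>). Tested with
  smooth functions it says that the tangential and the normal stress amplitudes have integrable weak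
  derivatives, except that surface tension is a point source at the interface. By the lemma of
  du Bois-Reymond they are antiderivatives, the normal one with a jump of exactly the size required by the
  jump condition (\<open>weak_ode_with_source\<close>). Solving for the derivatives of \<open>\<phi>\<close> and \<open>\<psi>\<close> gives a linear first-order
  system whose coefficients are smooth up to and beyond each closed layer; all derivatives of its solutions are
  again combinations of the four bounded unknowns, so \<open>\<phi>\<close> and \<open>\<psi>\<close> are smooth with bounded derivatives on each layer
  (\<open>minimizer_is_classical_mode\<close>). The boundary values vanish because \<open>H10\<close> convergence is uniform
  (\<open>H10_antiderivative\<close>).

  With these ordinary differential equations the linearized equations and jump conditions are identities
  between amplitudes (\<open>momentum_equation\<close>, \<open>jump_stress_condition\<close>). For the Sobolev norms each component separates into a
  vertical amplitude and \<open>sin \<theta>\<close> or \<open>cos \<theta>\<close>, whose only nonzero Fourier coefficients belong to the two frequencies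
  (\<open>wave_separated\<close>); thus each squared norm is a finite sum of one-dimensional norms, and multiplying the field
  by \<open>exp (\<Lambda> t)\<close> multiplies it by the square of that factor.\<close>

section \<open>Smooth functions of one real variable\<close>

text \<open>Differentiability of a finite order, on which closure properties can be proved by induction.\<close>

definition diff_upto :: "nat \<Rightarrow> real set \<Rightarrow> (real \<Rightarrow> real) \<Rightarrow> bool" where
  "diff_upto n S f \<longleftrightarrow> (\<forall>k<n. \<forall>z\<in>S. (deriv ^^ k) f differentiable (at z))"

lemma C_inf_on_iff_diff_upto: "C_inf_on S f \<longleftrightarrow> (\<forall>n. diff_upto n S f)"
  unfolding C_inf_on_def diff_upto_def by blast

lemma diff_upto_0 [simp]: "diff_upto 0 S f"
  by (simp add: diff_upto_def)

lemma diff_upto_Suc: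
  "diff_upto (Suc n) S f \<longleftrightarrow> (\<forall>z\<in>S. f differentiable (at z)) \<and> diff_upto n S (deriv f)"
proof -
  have "(\<forall>k<Suc n. Q k) \<longleftrightarrow> Q 0 \<and> (\<forall>k<n. Q (Suc k))" for Q :: "nat \<Rightarrow> bool"
    using less_Suc_eq_0_disj by auto
  then show ?thesis
    by (simp add: diff_upto_def funpow_swap1)
qed

lemma diff_upto_SucD: "diff_upto (Suc n) S f \<Longrightarrow> diff_upto n S f"
  by (simp add: diff_upto_def)

lemma C_inf_on_iff:
  "C_inf_on S f \<longleftrightarrow> (\<forall>z\<in>S. f differentiable (at z)) \<and> C_inf_on S (deriv f)"
proof -
  have "(\<forall>n. diff_upto n S f) \<longleftrightarrow> (\<forall>n. diff_upto (Suc n) S f)"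
    using diff_upto_SucD by blast
  then show ?thesis
    unfolding C_inf_on_iff_diff_upto by (simp add: diff_upto_Suc)
qed

lemma C_inf_on_deriv: "C_inf_on S f \<Longrightarrow> C_inf_on S (deriv f)"
  using C_inf_on_iff by blast

lemma C_inf_on_has_deriv: "C_inf_on S f \<Longrightarrow> z \<in> S \<Longrightarrow> (f has_real_derivative deriv f z) (at z)"
  using C_inf_on_iff DERIV_deriv_iff_real_differentiable by blast

lemma C_inf_on_isCont: "C_inf_on S f \<Longrightarrow> z \<in> S \<Longrightarrow> isCont f z"
  using C_inf_on_has_deriv DERIV_isCont by blast

lemma C_inf_on_continuous_on: "C_inf_on S f \<Longrightarrow> continuous_on S f"
  by (simp add: C_inf_on_isCont continuous_at_imp_continuous_on)

lemma C_inf_on_subset: "C_inf_on T f \<Longrightarrow> S \<subseteq> T \<Longrightarrow> C_inf_on S f"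
  by (auto simp: C_inf_on_def)

lemma deriv_cong_open:
  fixes f g :: "real \<Rightarrow> real"
  assumes "open S" "z \<in> S" "\<And>x. x \<in> S \<Longrightarrow> f x = g x"
  shows "deriv f z = deriv g z"
  using eventually_nhds_in_open[OF assms(1,2)] assms(3)
  by (intro deriv_cong_ev) (auto elim: eventually_mono)

lemma differentiable_cong_open:
  fixes f g :: "real \<Rightarrow> 'a::real_normed_vector"
  assumes "open S" "z \<in> S" "\<And>x. x \<in> S \<Longrightarrow> f x = g x" "g differentiable (at z)"
  shows "f differentiable (at z)"
proof -
  obtain D where "(g has_derivative D) (at z)" using assms(4) by (auto simp: differentiable_def)
  then have "(f has_derivative D) (at z)"
    using has_derivative_transform_within_open[OF _ assms(1,2), of g D UNIV f] assms(3) by auto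
  then show ?thesis by (auto simp: differentiable_def)
qed

lemma diff_upto_cong:
  assumes "open S" "\<And>x. x \<in> S \<Longrightarrow> f x = g x" "diff_upto n S g"
  shows "diff_upto n S f"
  using assms
proof (induction n arbitrary: f g)
  case (Suc n)
  have "diff_upto n S (deriv f)"
    using Suc.prems deriv_cong_open[OF Suc.prems(1), of _ f g]
    by (intro Suc.IH[of "deriv f" "deriv g"]) (auto simp: diff_upto_Suc)
  moreover have "\<forall>z\<in>S. f differentiable (at z)"
    using Suc.prems differentiable_cong_open[of S _ f g] by (auto simp: diff_upto_Suc)
  ultimately show ?case by (simp add: diff_upto_Suc)
qed simp

lemma C_inf_on_cong:
  "open S \<Longrightarrow> (\<And>x. x \<in> S \<Longrightarrow> f x = g x) \<Longrightarrow> C_inf_on S g \<Longrightarrow> C_inf_on S f"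
  using diff_upto_cong[of S f g] by (simp add: C_inf_on_iff_diff_upto)

text \<open>Being differentiable \<^term>\<open>Suc n\<close> times is tested on any function that agrees with the
  derivative; this is how every closure property below is proved by induction on the order.\<close>

lemma diff_upto_SucI:
  assumes "open S" "\<And>z. z \<in> S \<Longrightarrow> (f has_real_derivative g z) (at z)" "diff_upto n S g"
  shows "diff_upto (Suc n) S f"
proof -
  have "diff_upto n S (deriv f)"
    using assms by (intro diff_upto_cong[OF assms(1) _ assms(3)]) (auto intro: DERIV_imp_deriv)
  then show ?thesis
    using assms real_differentiable_def by (auto simp: diff_upto_Suc)
qed

lemma diff_upto_has_deriv:
  "diff_upto (Suc n) S f \<Longrightarrow> z \<in> S \<Longrightarrow> (f has_real_derivative deriv f z) (at z)"
  by (simp add: diff_upto_Suc DERIV_deriv_iff_real_differentiable)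

lemma diff_upto_add:
  assumes "open S"
  shows "diff_upto n S f \<Longrightarrow> diff_upto n S g \<Longrightarrow> diff_upto n S (\<lambda>x. f x + g x)"
proof (induction n arbitrary: f g)
  case (Suc n)
  show ?case
    by (rule diff_upto_SucI[OF assms, of _ "\<lambda>x. deriv f x + deriv g x"])
       (use Suc diff_upto_has_deriv in \<open>auto intro!: derivative_eq_intros simp: diff_upto_Suc DERIV_deriv_iff_real_differentiable\<close>)
qed simp

lemma diff_upto_mult:
  assumes "open S"
  shows "diff_upto n S f \<Longrightarrow> diff_upto n S g \<Longrightarrow> diff_upto n S (\<lambda>x. f x * g x)"
proof (induction n arbitrary: f g)
  case (Suc n)
  have d: "diff_upto n S f" "diff_upto n S g" "diff_upto n S (deriv f)" "diff_upto n S (deriv g)"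
    using Suc.prems diff_upto_SucD[OF Suc.prems(1)] diff_upto_SucD[OF Suc.prems(2)]
    by (simp_all add: diff_upto_Suc)
  have "diff_upto n S (\<lambda>x. deriv f x * g x + f x * deriv g x)"
    using d by (intro diff_upto_add[OF assms] Suc.IH)
  moreover have "((\<lambda>x. f x * g x) has_real_derivative deriv f z * g z + f z * deriv g z) (at z)"
    if "z \<in> S" for z
    using DERIV_mult'[OF diff_upto_has_deriv[OF Suc.prems(1) that] diff_upto_has_deriv[OF Suc.prems(2) that]]
    by (simp add: add.commute)
  ultimately show ?case
    by (intro diff_upto_SucI[OF assms, of "\<lambda>x. f x * g x" "\<lambda>x. deriv f x * g x + f x * deriv g x"])
qed simp

lemma diff_upto_const: "diff_upto n S (\<lambda>x. k)"
  by (induction n arbitrary: k) (auto simp: diff_upto_Suc)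

lemma diff_upto_compose:
  assumes "open S" "\<And>x. x \<in> S \<Longrightarrow> g x \<in> T"
  shows "diff_upto n T f \<Longrightarrow> diff_upto n S g \<Longrightarrow> diff_upto n S (\<lambda>x. f (g x))"
proof (induction n arbitrary: f)
  case (Suc n)
  have d: "diff_upto n T (deriv f)" "diff_upto n S g" "diff_upto n S (deriv g)"
    using Suc.prems diff_upto_SucD[OF Suc.prems(2)] by (simp_all add: diff_upto_Suc)
  have "diff_upto n S (\<lambda>x. deriv f (g x) * deriv g x)"
    by (rule diff_upto_mult[OF assms(1) Suc.IH[OF d(1,2)] d(3)])
  then show ?case
  proof (intro diff_upto_SucI[OF assms(1), of "\<lambda>x. f (g x)" "\<lambda>x. deriv f (g x) * deriv g x"])
    fix z assume "z \<in> S"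
    then show "((\<lambda>x. f (g x)) has_real_derivative deriv f (g z) * deriv g z) (at z)"
      using diff_upto_has_deriv[OF Suc.prems(1)] diff_upto_has_deriv[OF Suc.prems(2)] assms(2)
      by (intro DERIV_chain2[of f _ g]) auto
  qed
qed simp

lemma diff_upto_inverse: "diff_upto n (- {0}) (inverse :: real \<Rightarrow> real)"
proof (induction n)
  case (Suc n)
  have "diff_upto n (- {0::real}) (\<lambda>x. (-1) * (inverse x * inverse x))"
    using Suc by (intro diff_upto_mult diff_upto_const) auto
  then show ?case
    by (intro diff_upto_SucI[of _ inverse "\<lambda>x. (-1) * (inverse x * inverse x)"])
       (auto intro!: derivative_eq_intros)
qed simp

text \<open>A solution of an autonomous equation \<^term>\<open>y' = F y\<close> is as smooth as its right-hand side.\<close>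

lemma diff_upto_ode:
  assumes "open S" "\<And>x. x \<in> S \<Longrightarrow> y x \<in> T" "C_inf_on T F"
    "\<And>x. x \<in> S \<Longrightarrow> (y has_real_derivative F (y x)) (at x)"
  shows "diff_upto n S y"
proof (induction n)
  case (Suc n)
  have "diff_upto n T F"
    using assms(3) by (simp add: C_inf_on_iff_diff_upto)
  then have "diff_upto n S (\<lambda>x. F (y x))"
    using diff_upto_compose[of S y T n F] assms(1,2) Suc.IH by blast
  then show ?case
    using diff_upto_SucI[of S y "\<lambda>x. F (y x)" n] assms(1,4) by blast
qed simp

lemma C_inf_on_ode:
  assumes "open S" "\<And>x. x \<in> S \<Longrightarrow> y x \<in> T" "C_inf_on T F"
    "\<And>x. x \<in> S \<Longrightarrow> (y has_real_derivative F (y x)) (at x)"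
  shows "C_inf_on S y"
  using diff_upto_ode[OF assms] by (simp add: C_inf_on_iff_diff_upto)

lemma C_inf_on_add: "open S \<Longrightarrow> C_inf_on S f \<Longrightarrow> C_inf_on S g \<Longrightarrow> C_inf_on S (\<lambda>x. f x + g x)"
  and C_inf_on_mult: "open S \<Longrightarrow> C_inf_on S f \<Longrightarrow> C_inf_on S g \<Longrightarrow> C_inf_on S (\<lambda>x. f x * g x)"
  and C_inf_on_const: "C_inf_on S (\<lambda>x. k)"
  by (simp_all add: C_inf_on_iff_diff_upto diff_upto_add diff_upto_mult diff_upto_const)

lemma C_inf_on_compose:
  "open S \<Longrightarrow> (\<And>x. x \<in> S \<Longrightarrow> g x \<in> T) \<Longrightarrow> C_inf_on T f \<Longrightarrow> C_inf_on S g \<Longrightarrow> C_inf_on S (\<lambda>x. f (g x))"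
  by (simp add: C_inf_on_iff_diff_upto diff_upto_compose[of S g T])

lemma C_inf_on_id: "C_inf_on S (\<lambda>x. x)"
  by (subst C_inf_on_iff) (simp add: C_inf_on_const)

lemma C_inf_on_cmult: "open S \<Longrightarrow> C_inf_on S f \<Longrightarrow> C_inf_on S (\<lambda>x. k * f x)"
  by (rule C_inf_on_mult[OF _ C_inf_on_const])

lemma C_inf_on_minus: "open S \<Longrightarrow> C_inf_on S f \<Longrightarrow> C_inf_on S (\<lambda>x. - f x)"
  using C_inf_on_cmult[of S f "-1"] by simp

lemma C_inf_on_diff: "open S \<Longrightarrow> C_inf_on S f \<Longrightarrow> C_inf_on S g \<Longrightarrow> C_inf_on S (\<lambda>x. f x - g x)"
  using C_inf_on_add[of S f "\<lambda>x. - g x"] C_inf_on_minus by simp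

lemma C_inf_on_divide:
  assumes "open S" "C_inf_on S f" "C_inf_on S g" "\<And>x. x \<in> S \<Longrightarrow> g x \<noteq> 0"
  shows "C_inf_on S (\<lambda>x. f x / g x)"
proof -
  have "C_inf_on S (\<lambda>x. inverse (g x))"
    using assms diff_upto_inverse
    by (intro C_inf_on_compose[of S g "- {0}" inverse]) (auto simp: C_inf_on_iff_diff_upto)
  then show ?thesis
    using C_inf_on_mult[OF assms(1,2)] by (simp add: divide_inverse)
qed

lemmas C_inf_on_intros =
  C_inf_on_add C_inf_on_mult C_inf_on_const C_inf_on_id C_inf_on_minus C_inf_on_diff C_inf_on_divide

lemma higher_deriv_cong_open:
  fixes f g :: "real \<Rightarrow> real"
  assumes "open S"
  shows "(\<And>x. x \<in> S \<Longrightarrow> f x = g x) \<Longrightarrow> z \<in> S \<Longrightarrow> (deriv ^^ n) f z = (deriv ^^ n) g z"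
proof (induction n arbitrary: f g)
  case (Suc n)
  have "(deriv ^^ n) (deriv f) z = (deriv ^^ n) (deriv g) z"
    using Suc.prems deriv_cong_open[OF assms _ Suc.prems(1)] by (intro Suc.IH) auto
  then show ?case by (simp add: funpow_swap1)
qed simp

lemma higher_deriv_cmult:
  assumes "open S" "z \<in> S"
  shows "C_inf_on S f \<Longrightarrow> (deriv ^^ n) (\<lambda>x. k * f x) z = k * (deriv ^^ n) f z"
proof (induction n arbitrary: f)
  case (Suc n)
  have "deriv (\<lambda>x. k * f x) x = k * deriv f x" if "x \<in> S" for x
    using C_inf_on_has_deriv[OF Suc.prems that] by (intro DERIV_imp_deriv DERIV_cmult)
  then have "(deriv ^^ n) (deriv (\<lambda>x. k * f x)) z = (deriv ^^ n) (\<lambda>x. k * deriv f x) z"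
    by (rule higher_deriv_cong_open[OF assms(1) _ assms(2)])
  also have "\<dots> = k * (deriv ^^ n) (deriv f) z"
    by (rule Suc.IH[OF C_inf_on_deriv[OF Suc.prems]])
  finally show ?case by (simp add: funpow_swap1)
qed simp

section \<open>Test functions and the fundamental lemma\<close>

text \<open>The powers of \<open>1 / x\<close> make the family closed under differentiation, so that smoothness of
  the whole family follows at once; the bump functions are built from the member \<open>flat 0\<close>.\<close>

definition flat :: "nat \<Rightarrow> real \<Rightarrow> real" where
  "flat k x = (if x > 0 then (1 / x) ^ k * exp (- (1 / x)) else 0)"

text \<open>With \<open>y = 1 / x\<close> this is the decay of \<open>y ^ k / exp y\<close> at infinity.\<close>

lemma flat_tendsto_0: "(flat k \<longlongrightarrow> 0) (at 0)"
proof -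
  have "((\<lambda>x::real. x ^ k / exp x) \<longlongrightarrow> 0) at_top"
    by (rule tendsto_power_div_exp_0)
  then have "((\<lambda>x::real. inverse x ^ k / exp (inverse x)) \<longlongrightarrow> 0) (at_right 0)"
    using filterlim_compose filterlim_inverse_at_top_right by blast
  then have "(flat k \<longlongrightarrow> 0) (at_right 0)"
    by (rule Lim_transform_eventually)
       (auto simp: eventually_at_filter flat_def exp_minus field_simps)
  moreover have "(flat k \<longlongrightarrow> 0) (at_left 0)"
    by (rule tendsto_eventually) (auto simp: eventually_at_filter flat_def)
  ultimately show ?thesis
    by (simp add: filterlim_split_at)
qed

lemma flat_has_deriv:
  "(flat k has_real_derivative flat (k + 2) x - real k * flat (k + 1) x) (at x)"
proof -
  consider "x < 0" | "x > 0" | "x = 0" by linarith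
  then show ?thesis
  proof cases
    case 1
    have "((\<lambda>_. 0) has_real_derivative flat (k + 2) x - real k * flat (k + 1) x) (at x)"
      using 1 by (simp add: flat_def)
    then show ?thesis
      by (rule has_field_derivative_transform_within_open[of _ _ _ "{..<0}"]) (use 1 in \<open>auto simp: flat_def\<close>)
  next
    case 2
    have "((\<lambda>x. (1 / x) ^ k * exp (- (1 / x))) has_real_derivative
       (real k * (1 / x) ^ (k - 1) * (- 1 / x^2)) * exp (- (1 / x)) + (1 / x) ^ k * (exp (- (1 / x)) * (1 / x^2))) (at x)"
      using 2 by (auto intro!: derivative_eq_intros simp: power2_eq_square)
    moreover have "(real k * (1 / x) ^ (k - 1) * (- 1 / x^2)) * exp (- (1 / x)) + (1 / x) ^ k * (exp (- (1 / x)) * (1 / x^2))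
       = flat (k + 2) x - real k * flat (k + 1) x"
      using 2 by (cases k) (auto simp: flat_def power2_eq_square field_simps)
    ultimately have "((\<lambda>x. (1 / x) ^ k * exp (- (1 / x))) has_real_derivative flat (k + 2) x - real k * flat (k + 1) x) (at x)"
      by simp
    then show ?thesis
      by (rule has_field_derivative_transform_within_open[of _ _ _ "{0<..}"]) (use 2 in \<open>auto simp: flat_def\<close>)
  next
    case 3
    have "(flat k y - flat k 0) / (y - 0) = flat (k + 1) y" if "y \<noteq> 0" for y
      using that by (auto simp: flat_def field_simps)
    then have "((\<lambda>y. (flat k y - flat k 0) / (y - 0)) \<longlongrightarrow> 0) (at 0)"
      using flat_tendsto_0[of "k + 1"]
      by (rule_tac Lim_transform_eventually[OF flat_tendsto_0[of "k + 1"]]) (auto simp: eventually_at_filter)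
    then show ?thesis
      using 3 by (simp add: has_field_derivative_iff flat_def)
  qed
qed

lemma C_inf_on_flat: "C_inf_on UNIV (flat k)"
proof -
  have "diff_upto n UNIV (flat k)" for n
  proof (induction n arbitrary: k)
    case (Suc n)
    have "diff_upto n UNIV (\<lambda>x. flat (k + 2) x + (- real k) * flat (k + 1) x)"
      by (intro diff_upto_add diff_upto_mult diff_upto_const Suc) auto
    then show ?case
      by (rule diff_upto_SucI[rotated 2]) (use flat_has_deriv in auto)
  qed simp
  then show ?thesis by (simp add: C_inf_on_iff_diff_upto)
qed

text \<open>For large \<open>N\<close> this bump approaches the indicator of the interval, since \<open>exp (- 1 / (N y))\<close>
  tends to \<open>1\<close> for every \<open>y > 0\<close>.\<close>

definition plateau :: "real \<Rightarrow> real \<Rightarrow> real \<Rightarrow> real \<Rightarrow> real" where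
  "plateau N c d x = flat 0 (N * (x - c)) * flat 0 (N * (d - x))"

lemma C_inf_on_plateau: "C_inf_on UNIV (plateau N c d)"
  unfolding plateau_def
  by (intro C_inf_on_mult C_inf_on_compose[OF _ _ C_inf_on_flat] C_inf_on_intros) auto

lemma plateau_bounds: "0 \<le> plateau N c d x" "plateau N c d x \<le> 1"
proof -
  have *: "0 \<le> flat 0 y \<and> flat 0 y \<le> 1" for y by (simp add: flat_def)
  show "0 \<le> plateau N c d x" "plateau N c d x \<le> 1"
    unfolding plateau_def using *[of "N * (x - c)"] *[of "N * (d - x)"]
    by (auto intro: mult_le_one)
qed

lemma plateau_eq_0: "N > 0 \<Longrightarrow> x \<notin> {c<..<d} \<Longrightarrow> plateau N c d x = 0"
  by (auto simp: plateau_def flat_def zero_less_mult_iff)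

lemma test_fun_plateau:
  assumes "N > 0" "a < c" "d < b"
  shows "test_fun a b (plateau N c d)"
  unfolding test_fun_def
  using assms by (intro conjI C_inf_on_plateau exI[of _ "{c..d}"]) (auto intro!: plateau_eq_0)

lemma plateau_tendsto: "(\<lambda>n. plateau (real (Suc n)) c d x) \<longlonglongrightarrow> indicator {c<..<d} x"
proof (cases "x \<in> {c<..<d}")
  case True
  have *: "(\<lambda>n. flat 0 (real (Suc n) * y)) \<longlonglongrightarrow> 1" if "y > 0" for y
  proof -
    have "(\<lambda>n. (1 / y) * (1 / real (Suc n))) \<longlonglongrightarrow> (1 / y) * 0"
      by (intro tendsto_mult tendsto_const LIMSEQ_Suc lim_1_over_n)
    then have "(\<lambda>n. exp (- ((1 / y) * (1 / real (Suc n))))) \<longlonglongrightarrow> exp (- ((1/y) * 0))"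
      by (intro tendsto_exp tendsto_minus)
    then show ?thesis
      using that by (simp add: flat_def zero_less_mult_iff mult.commute)
  qed
  have "(\<lambda>n. plateau (real (Suc n)) c d x) \<longlonglongrightarrow> 1 * 1"
    unfolding plateau_def using True by (intro tendsto_mult *) auto
  then show ?thesis using True by simp
next
  case False
  then show ?thesis by (simp add: plateau_eq_0)
qed

lemma test_fun_C_inf: "test_fun a b u \<Longrightarrow> C_inf_on UNIV u"
  by (simp add: test_fun_def)

lemma test_fun_continuous: "test_fun a b u \<Longrightarrow> continuous_on S u"
  using C_inf_on_continuous_on[OF test_fun_C_inf] continuous_on_subset by blast

lemma test_fun_has_deriv: "test_fun a b u \<Longrightarrow> (u has_real_derivative deriv u z) (at z)"
  using C_inf_on_has_deriv[OF test_fun_C_inf] by blast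

lemma test_fun_support:
  assumes "test_fun a b u" "a < b"
  obtains c d where "a < c" "c < d" "d < b" "\<And>z. z \<notin> {c..d} \<Longrightarrow> u z = 0"
proof -
  obtain K where K: "compact K" "K \<subseteq> {a<..<b}" "\<And>z. z \<notin> K \<Longrightarrow> u z = 0"
    using assms by (auto simp: test_fun_def)
  show ?thesis
  proof (cases "K = {}")
    case True
    then show ?thesis
      using that[of "a + (b - a)/3" "a + 2*(b - a)/3"] K assms(2) by (simp add: field_simps)
  next
    case False
    obtain c where c: "c \<in> K" "\<And>x. x \<in> K \<Longrightarrow> c \<le> x"
      using compact_attains_inf[OF K(1) False] by blast
    obtain d where d: "d \<in> K" "\<And>x. x \<in> K \<Longrightarrow> x \<le> d"
      using compact_attains_sup[OF K(1) False] by blast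
    have ab: "a < c" "c \<le> d" "d < b" using c d K(2) by auto
    then show ?thesis
      using that[of c "(d + b) / 2"] c d K(3) by fastforce
  qed
qed

lemma test_fun_outside: "test_fun a b u \<Longrightarrow> z \<notin> {a<..<b} \<Longrightarrow> u z = 0"
  by (auto simp: test_fun_def)

lemma deriv_eq_0_outside:
  assumes "\<And>z. z \<notin> {c..d} \<Longrightarrow> u z = 0" "z \<notin> {c..d}"
  shows "deriv u z = (0::real)"
proof -
  have "deriv u z = deriv (\<lambda>_. 0) z"
    by (rule deriv_cong_open[of "- {c..d}"]) (use assms in auto)
  then show ?thesis by simp
qed

lemma test_fun_deriv:
  assumes "test_fun a b u" "a < b"
  shows "test_fun a b (deriv u)"
proof -
  obtain c d where cd: "a < c" "c < d" "d < b" "\<And>z. z \<notin> {c..d} \<Longrightarrow> u z = 0"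
    using test_fun_support[OF assms] by blast
  show ?thesis
    unfolding test_fun_def
  proof (intro conjI exI[of _ "{c..d}"])
    show "C_inf_on UNIV (deriv u)" by (rule C_inf_on_deriv[OF test_fun_C_inf[OF assms(1)]])
    show "\<forall>z. z \<notin> {c..d} \<longrightarrow> deriv u z = 0" using deriv_eq_0_outside[of c d u] cd(4) by blast
  qed (use cd in auto)
qed

lemma test_fun_add: 
  assumes "test_fun a b u" "test_fun a b w" 
  shows "test_fun a b (\<lambda>z. u z + w z)"
proof -
  obtain K1 K2 where "compact K1" "K1 \<subseteq> {a<..<b}" "\<forall>z. z \<notin> K1 \<longrightarrow> u z = 0"
    "compact K2" "K2 \<subseteq> {a<..<b}" "\<forall>z. z \<notin> K2 \<longrightarrow> w z = 0"
    using assms by (auto simp: test_fun_def)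
  then show ?thesis
    unfolding test_fun_def using assms
    by (intro conjI C_inf_on_add exI[of _ "K1 \<union> K2"]) (auto simp: test_fun_C_inf)
qed

lemma test_fun_cmult: "test_fun a b u \<Longrightarrow> test_fun a b (\<lambda>z. k * u z)"
  unfolding test_fun_def by (auto intro: C_inf_on_cmult)

lemma test_fun_bounded: 
  assumes "test_fun a b u" "a < b" obtains C where "\<And>z. \<bar>u z\<bar> \<le> C" "C \<ge> 0"
proof -
  obtain c d where cd: "\<And>z. z \<notin> {c..d} \<Longrightarrow> u z = 0"
    using test_fun_support[OF assms] by blast
  have "bounded (u ` {c..d})"
    by (intro compact_imp_bounded compact_continuous_image test_fun_continuous[OF assms(1)]) auto
  then obtain C where "\<And>x. x \<in> u ` {c..d} \<Longrightarrow> norm x \<le> C" by (auto simp: bounded_iff)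
  then have "\<bar>u z\<bar> \<le> max C 0" for z
    using cd[of z] by (cases "z \<in> {c..d}") (auto simp: le_max_iff_disj)
  then show ?thesis using that[of "max C 0"] by auto
qed

lemma bounded_mult_absolutely_integrable:
  fixes h :: "real \<Rightarrow> 'a::euclidean_space" and c :: "real \<Rightarrow> real"
  assumes "S \<in> sets lebesgue" "c \<in> borel_measurable (lebesgue_on S)" "bounded (c ` S)"
    "h absolutely_integrable_on S"
  shows "(\<lambda>z. c z *\<^sub>R h z) absolutely_integrable_on S"
  by (rule absolutely_integrable_bounded_measurable_product[OF _ assms(2,1,3,4)])
     (simp add: bilinear_conv_bounded_bilinear bounded_bilinear_scaleR)

lemma test_fun_times_integrable:
  fixes h :: "real \<Rightarrow> 'a::euclidean_space"
  assumes "test_fun a b u" "loc_integrable a b h"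
  shows "(\<lambda>z. u z *\<^sub>R h z) absolutely_integrable_on {a<..<b}"
proof -
  obtain K where K: "compact K" "K \<subseteq> {a<..<b}" "\<And>z. z \<notin> K \<Longrightarrow> u z = 0"
    using assms by (auto simp: test_fun_def)
  have Ks: "K \<in> sets lebesgue" using K(1) lmeasurable_compact by blast
  have "(\<lambda>z. u z *\<^sub>R h z) absolutely_integrable_on K"
  proof (rule bounded_mult_absolutely_integrable[OF Ks])
    show "u \<in> borel_measurable (lebesgue_on K)"
      by (rule continuous_imp_measurable_on_sets_lebesgue[OF test_fun_continuous[OF assms(1)] Ks])
    show "bounded (u ` K)"
      by (intro compact_imp_bounded compact_continuous_image test_fun_continuous[OF assms(1)] K(1))
    show "h absolutely_integrable_on K" using assms(2) K by (simp add: loc_integrable_def)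
  qed
  moreover have "indicat_real K z *\<^sub>R u z *\<^sub>R h z = indicat_real {a<..<b} z *\<^sub>R u z *\<^sub>R h z" for z
    using K by (auto simp: indicator_def)
  ultimately show ?thesis unfolding set_integrable_def by (simp only:)
qed

text \<open>An integrable function is determined by its integrals over half-lines, because the measures
  with densities the positive and the negative part are.\<close>

lemma AE_zero_if_halfline_integrals_zero_borel:
  fixes g :: "real \<Rightarrow> real"
  assumes g: "integrable lborel g" and z: "\<And>x. (\<integral>y\<in>{x<..}. g y \<partial>lborel) = 0"
  shows "AE x in lborel. g x = 0"
proof -
  have gm [measurable]: "g \<in> borel_measurable lborel" using g by auto
  let ?p = "\<lambda>x. ennreal (g x)" and ?n = "\<lambda>x. ennreal (- g x)"
  have fin: "integral\<^sup>N lborel ?p < \<infinity>" "integral\<^sup>N lborel ?n < \<infinity>"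
    using g by (simp_all add: real_integrable_def top.not_eq_extremum)
  have eq: "emeasure (density lborel ?p) {x<..} = emeasure (density lborel ?n) {x<..}" for x
  proof -
    let ?h = "\<lambda>y. indicator {x<..} y * g y"
    have h: "integrable lborel ?h"
      using integrable_mult_indicator[OF _ g, of "{x<..}"] by simp
    have "integral\<^sup>L lborel ?h = enn2real (\<integral>\<^sup>+y. ennreal (?h y) \<partial>lborel) - enn2real (\<integral>\<^sup>+y. ennreal (- ?h y) \<partial>lborel)"
      by (rule real_lebesgue_integral_def[OF h])
    moreover have "integral\<^sup>L lborel ?h = 0"
      using z[of x] by (simp add: set_lebesgue_integral_def)
    ultimately have "enn2real (\<integral>\<^sup>+y. ennreal (?h y) \<partial>lborel) = enn2real (\<integral>\<^sup>+y. ennreal (- ?h y) \<partial>lborel)"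
      by simp
    then have "ennreal (enn2real (\<integral>\<^sup>+y. ennreal (?h y) \<partial>lborel)) = ennreal (enn2real (\<integral>\<^sup>+y. ennreal (- ?h y) \<partial>lborel))"
      by simp
    moreover have "(\<integral>\<^sup>+y. ennreal (?h y) \<partial>lborel) < top" "(\<integral>\<^sup>+y. ennreal (- ?h y) \<partial>lborel) < top"
      using h by (simp_all add: real_integrable_def top.not_eq_extremum)
    ultimately have "(\<integral>\<^sup>+y. ennreal (?h y) \<partial>lborel) = (\<integral>\<^sup>+y. ennreal (- ?h y) \<partial>lborel)"
      by (simp add: ennreal_enn2real)
    moreover have "ennreal (?h y) = ?p y * indicator {x<..} y" "ennreal (- ?h y) = ?n y * indicator {x<..} y" for y
      by (auto simp: indicator_def)
    ultimately show ?thesis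
      by (simp add: emeasure_density)
  qed
  have "density lborel ?p = density lborel ?n"
  proof (rule measure_eqI_lessThan)
    show "emeasure (density lborel ?p) {x<..} < \<infinity>" for x
    proof -
      have "emeasure (density lborel ?p) {x<..} \<le> emeasure (density lborel ?p) UNIV"
        by (intro emeasure_mono) auto
      also have "\<dots> = integral\<^sup>N lborel ?p"
        by (simp add: emeasure_density)
      finally show ?thesis using fin by (simp add: le_less_trans)
    qed
  qed (use eq in auto)
  then have "AE x in lborel. ?p x = ?n x"
    by (subst (asm) sigma_finite_measure.density_unique_iff[OF sigma_finite_lborel]) auto
  then show ?thesis
  proof eventually_elim
    case (elim x)
    then show ?case by (cases rule: linorder_cases[of "g x" 0]) (auto simp: ennreal_neg)
  qed
qed

lemma AE_zero_if_halfline_integrals_zero: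
  fixes g :: "real \<Rightarrow> real"
  assumes g: "integrable lebesgue g" and z: "\<And>x. (\<integral>y\<in>{x<..}. g y \<partial>lebesgue) = 0"
  shows "AE x in lebesgue. g x = 0"
proof -
  obtain g' where g': "g' \<in> borel_measurable lborel" "AE x in lborel. g x = g' x"
    using completion_ex_borel_measurable_real[of g lborel] g by auto
  have ae: "AE x in lebesgue. g x = g' x" using g'(2) by (simp add: AE_completion)
  have g'l: "integrable lebesgue g'"
    using integrable_cong_AE[of g lebesgue g'] g g' ae by (simp add: measurable_completion)
  then have "integrable lborel g'" using g' integrable_completion by blast
  moreover have "(\<integral>y\<in>{x<..}. g' y \<partial>lborel) = 0" for x
  proof -
    have "(\<integral>y\<in>{x<..}. g' y \<partial>lborel) = (\<integral>y\<in>{x<..}. g' y \<partial>lebesgue)"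
      unfolding set_lebesgue_integral_def
      by (rule integral_completion[symmetric]) (use g' in measurable)
    also have "\<dots> = (\<integral>y\<in>{x<..}. g y \<partial>lebesgue)"
      unfolding set_lebesgue_integral_def
    proof (rule integral_cong_AE)
      show "AE y in lebesgue. indicat_real {x<..} y *\<^sub>R g' y = indicat_real {x<..} y *\<^sub>R g y"
        using ae by eventually_elim simp
    qed (use integrable_mult_indicator[OF _ g, of "{x<..}"] integrable_mult_indicator[OF _ g'l, of "{x<..}"] in auto)
    finally show ?thesis using z by simp
  qed
  ultimately have "AE x in lborel. g' x = 0"
    by (rule AE_zero_if_halfline_integrals_zero_borel)
  then have "AE x in lebesgue. g' x = 0" by (simp add: AE_completion)
  with ae show ?thesis by eventually_elim simp
qed

lemma loc_integrable_imp_interval: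
  "loc_integrable a b h \<Longrightarrow> a < c \<Longrightarrow> d < b \<Longrightarrow> h absolutely_integrable_on {c..d}"
  unfolding loc_integrable_def by (drule spec[of _ "{c..d}"]) auto

text \<open>The plateaus converge boundedly to the indicator of the interval.\<close>

lemma integral_interval_zero_if_test_zero:
  fixes h :: "real \<Rightarrow> real"
  assumes h: "loc_integrable a b h"
    and z: "\<And>u. test_fun a b u \<Longrightarrow> (LINT z:{a<..<b}|lebesgue. u z *\<^sub>R h z) = 0"
    and cd: "a < c" "d < b"
  shows "(LINT z:{c<..<d}|lebesgue. h z) = 0"
proof -
  let ?u = "\<lambda>n. plateau (real (Suc n)) c d"
  have hi: "integrable lebesgue (\<lambda>z. indicat_real {c..d} z *\<^sub>R h z)"
    using loc_integrable_imp_interval[OF h cd] by (simp add: set_integrable_def)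
  have um [measurable]: "plateau N c d \<in> borel_measurable lebesgue" for N
    using C_inf_on_continuous_on[OF C_inf_on_plateau]
    by (intro measurable_completion) (simp add: borel_measurable_continuous_onI)
  have hm: "(\<lambda>z. indicat_real {c..d} z *\<^sub>R h z) \<in> borel_measurable lebesgue" using hi by auto
  have "(\<lambda>n. LINT z|lebesgue. ?u n z * (indicat_real {c..d} z *\<^sub>R h z)) \<longlonglongrightarrow>
      (LINT z|lebesgue. indicat_real {c<..<d} z * (indicat_real {c..d} z *\<^sub>R h z))"
  proof (rule integral_dominated_convergence[where w = "\<lambda>z. norm (indicat_real {c..d} z *\<^sub>R h z)"])
    show "integrable lebesgue (\<lambda>z. norm (indicat_real {c..d} z *\<^sub>R h z))" using hi by auto
    show "AE z in lebesgue. (\<lambda>n. ?u n z * (indicat_real {c..d} z *\<^sub>R h z)) \<longlonglongrightarrow>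
        indicat_real {c<..<d} z * (indicat_real {c..d} z *\<^sub>R h z)"
      by (intro AE_I2 tendsto_mult plateau_tendsto tendsto_const)
    show "AE z in lebesgue. norm (?u n z * (indicat_real {c..d} z *\<^sub>R h z)) \<le> norm (indicat_real {c..d} z *\<^sub>R h z)" for n
      using plateau_bounds[of "real (Suc n)" c d]
      by (intro AE_I2) (simp add: abs_mult mult_left_le_one_le)
    show "(\<lambda>z. indicat_real {c<..<d} z * (indicat_real {c..d} z *\<^sub>R h z)) \<in> borel_measurable lebesgue"
      by (rule borel_measurable_times[OF borel_measurable_indicator hm]) simp
    show "(\<lambda>z. ?u n z * (indicat_real {c..d} z *\<^sub>R h z)) \<in> borel_measurable lebesgue" for n
      by (rule borel_measurable_times[OF um hm])
  qed
  moreover have "(LINT z|lebesgue. ?u n z * (indicat_real {c..d} z *\<^sub>R h z)) = 0" for n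
  proof -
    have "indicat_real {a<..<b} z *\<^sub>R ?u n z *\<^sub>R h z = ?u n z * (indicat_real {c..d} z *\<^sub>R h z)" for z
      using plateau_eq_0[of "real (Suc n)" z c d] cd by (auto simp: indicator_def)
    moreover have "test_fun a b (?u n)" by (rule test_fun_plateau) (use cd in auto)
    ultimately show ?thesis
      using z[of "?u n"] unfolding set_lebesgue_integral_def by (simp only:)
  qed
  moreover have "indicat_real {c<..<d} z * (indicat_real {c..d} z *\<^sub>R h z) = indicat_real {c<..<d} z *\<^sub>R h z" for z
    by (auto simp: indicator_def)
  ultimately have "(\<lambda>n::nat. 0::real) \<longlonglongrightarrow> (LINT z|lebesgue. indicat_real {c<..<d} z *\<^sub>R h z)"
    by (simp only:)
  then show ?thesis
    by (simp add: set_lebesgue_integral_def LIMSEQ_const_iff)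
qed

text \<open>Restricted to a compact subinterval the function has vanishing integrals over all half-lines;
  countably many subintervals exhaust the interval.\<close>

lemma AE_zero_if_test_zero_real:
  fixes h :: "real \<Rightarrow> real"
  assumes h: "loc_integrable a b h"
    and z: "\<And>u. test_fun a b u \<Longrightarrow> (LINT z:{a<..<b}|lebesgue. u z *\<^sub>R h z) = 0"
  shows "AE z in lebesgue. z \<in> {a<..<b} \<longrightarrow> h z = 0"
proof -
  have *: "AE z in lebesgue. z \<in> {c<..<d} \<longrightarrow> h z = 0" if cd: "a < c" "d < b" for c d
  proof -
    have i: "integrable lebesgue (\<lambda>z. indicat_real {c<..<d} z *\<^sub>R h z)"
      using set_integrable_subset[OF loc_integrable_imp_interval[OF h cd], of "{c<..<d}"]
        greaterThanLessThan_subseteq_atLeastAtMost_iff[of c d c d]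
      by (simp add: set_integrable_def)
    have "(\<integral>y\<in>{x<..}. (indicat_real {c<..<d} y *\<^sub>R h y) \<partial>lebesgue) = 0" for x
    proof -
      have "indicat_real {x<..} y *\<^sub>R (indicat_real {c<..<d} y *\<^sub>R h y) = indicat_real {max x c<..<d} y *\<^sub>R h y" for y
        by (auto simp: indicator_def)
      then show ?thesis
        using integral_interval_zero_if_test_zero[OF h z, of "max x c" d] cd
        unfolding set_lebesgue_integral_def by (simp only: less_max_iff_disj simp_thms)
    qed
    then have "AE z in lebesgue. indicat_real {c<..<d} z *\<^sub>R h z = 0"
      by (rule AE_zero_if_halfline_integrals_zero[OF i])
    then show ?thesis by eventually_elim auto
  qed
  have "AE z in lebesgue. \<forall>n. z \<in> {a + 1 / real (Suc n) <..< b - 1 / real (Suc n)} \<longrightarrow> h z = 0"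
    by (subst AE_all_countable) (intro allI *, auto)
  then show ?thesis
  proof eventually_elim
    case (elim z)
    show ?case
    proof
      assume z: "z \<in> {a<..<b}"
      then obtain n where "1 / real (Suc n) < min (z - a) (b - z)"
        using nat_approx_posE[of "min (z - a) (b - z)"] by auto
      then show "h z = 0" using elim[rule_format, of n] by auto
    qed
  qed
qed

lemma AE_zero_if_test_zero:
  fixes h :: "real \<Rightarrow> 'a::euclidean_space"
  assumes h: "loc_integrable a b h"
    and z: "\<And>u. test_fun a b u \<Longrightarrow> (LINT z:{a<..<b}|lebesgue. u z *\<^sub>R h z) = 0"
  shows "AE z in lebesgue. z \<in> {a<..<b} \<longrightarrow> h z = 0"
proof -
  have "AE z in lebesgue. z \<in> {a<..<b} \<longrightarrow> h z \<bullet> e = 0" if "e \<in> Basis" for e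
  proof (rule AE_zero_if_test_zero_real)
    show "loc_integrable a b (\<lambda>z. h z \<bullet> e)"
      unfolding loc_integrable_def
    proof (intro allI impI)
      fix K assume K: "compact K \<and> K \<subseteq> {a<..<b}"
      then have "set_integrable lebesgue K h" using h by (simp add: loc_integrable_def)
      then show "set_integrable lebesgue K (\<lambda>z. h z \<bullet> e)"
        unfolding set_integrable_def using integrable_inner_left[of e lebesgue "\<lambda>z. indicat_real K z *\<^sub>R h z"] by simp
    qed
    fix u assume u: "test_fun a b u"
    have "(LINT z:{a<..<b}|lebesgue. u z *\<^sub>R (h z \<bullet> e)) = (LINT z:{a<..<b}|lebesgue. u z *\<^sub>R h z) \<bullet> e"
      unfolding set_lebesgue_integral_def
      using integral_inner_left[of e lebesgue "\<lambda>z. indicat_real {a<..<b} z *\<^sub>R u z *\<^sub>R h z"]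
        test_fun_times_integrable[OF u h] by (simp add: set_integrable_def mult.assoc)
    then show "(LINT z:{a<..<b}|lebesgue. u z *\<^sub>R (h z \<bullet> e)) = 0" using z[OF u] by simp
  qed
  then have "AE z in lebesgue. \<forall>e\<in>Basis. z \<in> {a<..<b} \<longrightarrow> h z \<bullet> e = 0"
    by (simp only: AE_ball_countable[OF countable_finite[OF finite_Basis]]) blast
  then show ?thesis
  proof eventually_elim
    case (elim z)
    then show ?case using euclidean_eqI[of "h z" 0] by simp
  qed
qed

lemma loc_integrable_diff:
  "loc_integrable a b f \<Longrightarrow> loc_integrable a b g \<Longrightarrow> loc_integrable a b (\<lambda>z. f z - g z)"
  by (simp add: loc_integrable_def set_integral_diff(1))

lemma weak_deriv_unique:
  fixes f :: "real \<Rightarrow> 'a::euclidean_space"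
  assumes "is_weak_deriv j a b f h1" "is_weak_deriv j a b f h2"
  shows "AE z in lebesgue. z \<in> {a<..<b} \<longrightarrow> h1 z = h2 z"
proof -
  have l: "loc_integrable a b h1" "loc_integrable a b h2"
    using assms by (auto simp: is_weak_deriv_def)
  have "AE z in lebesgue. z \<in> {a<..<b} \<longrightarrow> h1 z - h2 z = 0"
  proof (rule AE_zero_if_test_zero[OF loc_integrable_diff[OF l]])
    fix u assume u: "test_fun a b u"
    have *: "(LINT z:{a<..<b}|lebesgue. (deriv ^^ j) u z *\<^sub>R f z) = (-1) ^ j *\<^sub>R (LINT z:{a<..<b}|lebesgue. u z *\<^sub>R h z)"
      if "is_weak_deriv j a b f h" for h
      using that u unfolding is_weak_deriv_def by blast
    have "(-1) ^ j *\<^sub>R (LINT z:{a<..<b}|lebesgue. u z *\<^sub>R h1 z) = ((-1) ^ j *\<^sub>R (LINT z:{a<..<b}|lebesgue. u z *\<^sub>R h2 z))"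
      using *[OF assms(1)] *[OF assms(2)] by simp
    then have "(LINT z:{a<..<b}|lebesgue. u z *\<^sub>R h1 z) = (LINT z:{a<..<b}|lebesgue. u z *\<^sub>R h2 z)"
      by simp
    then show "(LINT z:{a<..<b}|lebesgue. u z *\<^sub>R (h1 z - h2 z)) = 0"
      using set_integral_diff(2)[OF test_fun_times_integrable[OF u l(1)] test_fun_times_integrable[OF u l(2)]]
      by (simp add: scaleR_diff_right)
  qed
  then show ?thesis by eventually_elim auto
qed

text \<open>The representative selected by \<open>weak_derivative\<close> may be replaced by any known weak derivative.\<close>

lemma weak_derivative_AE_eq:
  fixes f :: "real \<Rightarrow> 'a::euclidean_space"
  assumes "is_weak_deriv j a b f h"
  shows "AE z in lebesgue. z \<in> {a<..<b} \<longrightarrow> weak_derivative j a b f z = h z"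
proof -
  have "is_weak_deriv j a b f (weak_derivative j a b f)"
    unfolding weak_derivative_def by (rule someI[of _ h]) (rule assms)
  then show ?thesis using weak_deriv_unique assms by blast
qed

lemma L2sq_cong_AE:
  assumes "AE z in lebesgue. z \<in> {a<..<b} \<longrightarrow> f z = g z"
  shows "L2sq a b f = L2sq a b g"
  unfolding L2sq_def
  by (rule nn_integral_cong_AE) (use assms in \<open>eventually_elim, auto simp: indicator_def\<close>)

text \<open>The du Bois-Reymond lemma: correcting \<^term>\<open>u\<close> by a multiple of one fixed test function of
  integral one makes it the derivative of a test function.\<close>

lemma AE_const_if_test_deriv_zero:
  fixes g :: "real \<Rightarrow> real"
  assumes ab: "a < b" and g: "loc_integrable a b g"
    and z: "\<And>u. test_fun a b u \<Longrightarrow> (LINT z:{a<..<b}|lebesgue. deriv u z *\<^sub>R g z) = 0"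
  shows "\<exists>k. AE z in lebesgue. z \<in> {a<..<b} \<longrightarrow> g z = k"
proof -
  define c d where "c = a + (b - a) / 3" and "d = a + 2 * (b - a) / 3"
  have cd: "a < c" "c < d" "d < b" using ab by (auto simp: c_def d_def field_simps)
  define p where "p = plateau 1 c d"
  have p: "test_fun a b p" unfolding p_def by (rule test_fun_plateau) (use cd in auto)
  have cont: "continuous_on S p" for S by (rule test_fun_continuous[OF p])
  define m where "m = integral {a..b} p"
  have "m \<noteq> 0"
  proof
    assume "m = 0"
    then have "p ((c + d) / 2) = 0"
      using integral_eq_0_iff[OF cont, of a b] ab plateau_bounds(1) cd unfolding m_def p_def by auto
    then show False using cd by (simp add: p_def plateau_def flat_def)
  qed
  define k where "k = (LINT z:{a<..<b}|lebesgue. p z *\<^sub>R g z) / m"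
  have lc: "loc_integrable a b (\<lambda>z. k)"
    unfolding loc_integrable_def using absolutely_integrable_on_const lmeasurable_compact by blast
  have "AE z in lebesgue. z \<in> {a<..<b} \<longrightarrow> g z - k = 0"
  proof (rule AE_zero_if_test_zero[OF loc_integrable_diff[OF g lc]])
    fix u assume u: "test_fun a b u"
    (* chosen such that u - s * p has integral zero *)
    define s where "s = integral {a..b} u / m"
    define w where "w z = u z - s * p z" for z
    have wt: "test_fun a b w"
      using test_fun_add[OF u test_fun_cmult[OF p, of "- s"]] by (simp add: w_def[abs_def])
    obtain c' d' where cd': "a < c'" "c' < d'" "d' < b" "\<And>z. z \<notin> {c'..d'} \<Longrightarrow> w z = 0"
      using test_fun_support[OF wt ab] by blast
    define U where "U z = integral {a..z} w" for z
    have w0: "integral {a..b} w = 0"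
      unfolding w_def s_def using \<open>m \<noteq> 0\<close>
      by (subst integral_diff) (auto intro!: integrable_continuous_real test_fun_continuous[OF u] continuous_intros cont simp: m_def)
    have wint: "w integrable_on {x..y}" for x y
      by (intro integrable_continuous_real test_fun_continuous[OF wt])
    have U0: "U z = 0" if "z \<notin> {c'..d'}" for z
    proof (cases "z < c'")
      case True
      have "integral {a..z} w = integral {a..z} (\<lambda>_. 0)"
        by (rule integral_cong) (use True cd' in auto)
      then show ?thesis by (simp add: U_def)
    next
      case False
      then have zd: "z > d'" using that by auto
      show ?thesis
      proof (cases "z \<le> b")
        case True
        have "integral {a..z} w + integral {z..b} w = integral {a..b} w"
          by (rule Henstock_Kurzweil_Integration.integral_combine) (use True zd cd' wint in auto)
        moreover have "integral {z..b} w = integral {z..b} (\<lambda>_. 0)"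
          by (rule integral_cong) (use zd cd' in auto)
        ultimately show ?thesis using w0 by (simp add: U_def)
      next
        case F: False
        have "integral {a..b} w + integral {b..z} w = integral {a..z} w"
          by (rule Henstock_Kurzweil_Integration.integral_combine) (use F ab wint in auto)
        moreover have "integral {b..z} w = integral {b..z} (\<lambda>_. 0)"
          by (rule integral_cong) (use cd' in auto)
        ultimately show ?thesis using w0 by (simp add: U_def)
      qed
    qed
    have Ud: "(U has_real_derivative w z) (at z)" for z
    proof (cases "z \<in> {a<..<\<bar>b\<bar> + \<bar>z\<bar> + 1}")
      case True
      have "((\<lambda>x. integral {a..x} w) has_vector_derivative w z) (at z within {a..\<bar>b\<bar> + \<bar>z\<bar> + 1})"
        by (rule integral_has_vector_derivative[OF test_fun_continuous[OF wt]]) (use True in auto)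
      then show ?thesis
        using True at_within_Icc_at[of a z "\<bar>b\<bar> + \<bar>z\<bar> + 1"]
        by (simp add: has_real_derivative_iff_has_vector_derivative U_def[abs_def])
    next
      case False
      then have zc: "z < c'" using cd' by auto
      have "((\<lambda>_. 0) has_real_derivative w z) (at z)"
        using zc cd'(4)[of z] by auto
      then show ?thesis
        by (rule has_field_derivative_transform_within_open[of _ _ _ "{..<c'}"]) (use zc U0 in auto)
    qed
    have dU: "deriv U = w" using Ud DERIV_imp_deriv by blast
    have Ut: "test_fun a b U"
      unfolding test_fun_def
    proof (intro conjI exI[of _ "{c'..d'}"])
      show "C_inf_on UNIV U"
        by (subst C_inf_on_iff) (use Ud dU test_fun_C_inf[OF wt] real_differentiable_def in auto)
    qed (use cd' U0 in auto)
    have "(LINT z:{a<..<b}|lebesgue. w z *\<^sub>R g z) = 0" using z[OF Ut] dU by simp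
    moreover have "(LINT z:{a<..<b}|lebesgue. w z *\<^sub>R g z) =
       (LINT z:{a<..<b}|lebesgue. u z *\<^sub>R g z) - s * (LINT z:{a<..<b}|lebesgue. p z *\<^sub>R g z)"
    proof -
      have "w z *\<^sub>R g z = u z *\<^sub>R g z - s * (p z *\<^sub>R g z)" for z by (simp add: w_def algebra_simps)
      then show ?thesis
        using set_integral_diff(2)[OF test_fun_times_integrable[OF u g]
            set_integrable_mult_right[of s lebesgue "{a<..<b}" "\<lambda>z. p z *\<^sub>R g z"]] test_fun_times_integrable[OF p g]
        by simp
    qed
    moreover have "s * (LINT z:{a<..<b}|lebesgue. p z *\<^sub>R g z) = integral {a..b} u * k"
      by (simp add: s_def k_def)
    moreover have "(LINT z:{a<..<b}|lebesgue. u z) = integral {a..b} u"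
    proof -
      have "(\<lambda>z. u z *\<^sub>R (1::real)) absolutely_integrable_on {a<..<b}"
        by (rule test_fun_times_integrable[OF u])
           (use absolutely_integrable_on_const lmeasurable_compact in \<open>auto simp: loc_integrable_def\<close>)
      then have "(LINT z:{a<..<b}|lebesgue. u z) = integral {a<..<b} u"
        using set_lebesgue_integral_eq_integral(2) by fastforce
      then show ?thesis by (simp add: integral_open_interval_real)
    qed
    moreover have "(LINT z:{a<..<b}|lebesgue. u z *\<^sub>R (g z - k)) = (LINT z:{a<..<b}|lebesgue. u z *\<^sub>R g z) - (LINT z:{a<..<b}|lebesgue. u z) * k"
      using set_integral_diff(2)[OF test_fun_times_integrable[OF u g] test_fun_times_integrable[OF u lc]]
      by (simp add: scaleR_diff_right algebra_simps)
    ultimately show "(LINT z:{a<..<b}|lebesgue. u z *\<^sub>R (g z - k)) = 0" by simp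
  qed
  then show ?thesis by (intro exI[of _ k]) simp
qed

section \<open>Square-integrable functions on an interval\<close>

lemma set_borel_measurable_lebesgue_on:
  fixes f :: "real \<Rightarrow> 'a::real_normed_vector"
  shows "set_borel_measurable lebesgue {a<..<b} f \<longleftrightarrow> f \<in> borel_measurable (lebesgue_on {a<..<b})"
  unfolding set_borel_measurable_def by (subst borel_measurable_restrict_space_iff) auto

lemma in_L2_measurable: "in_L2 a b f \<Longrightarrow> f \<in> borel_measurable (lebesgue_on {a<..<b})"
  by (simp add: in_L2_def set_borel_measurable_lebesgue_on)

lemma in_L2_iff:
  fixes f :: "real \<Rightarrow> real"
  shows "in_L2 a b f \<longleftrightarrow> f \<in> borel_measurable (lebesgue_on {a<..<b}) \<and> (\<lambda>z. (f z)\<^sup>2) absolutely_integrable_on {a<..<b}"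
proof -
  have "L2sq a b f = (\<integral>\<^sup>+z. ennreal (norm (indicat_real {a<..<b} z *\<^sub>R (f z)\<^sup>2)) \<partial>lebesgue)"
    unfolding L2sq_def by (intro nn_integral_cong) (auto simp: indicator_def)
  moreover have "(\<lambda>z. indicat_real {a<..<b} z *\<^sub>R (f z)\<^sup>2) \<in> borel_measurable lebesgue"
    if "f \<in> borel_measurable (lebesgue_on {a<..<b})"
  proof -
    have "(\<lambda>z. (f z)\<^sup>2) \<in> borel_measurable (lebesgue_on {a<..<b})" using that by measurable
    then show ?thesis by (subst (asm) borel_measurable_restrict_space_iff) auto
  qed
  ultimately show ?thesis
    unfolding in_L2_def set_borel_measurable_lebesgue_on set_integrable_def integrable_iff_bounded
    by auto
qed

lemma L2sq_eq_integral:
  fixes f :: "real \<Rightarrow> real"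
  assumes "in_L2 a b f"
  shows "L2sq a b f = ennreal (LINT z:{a<..<b}|lebesgue. (f z)\<^sup>2)"
proof -
  have "L2sq a b f = (\<integral>\<^sup>+z. ennreal (indicat_real {a<..<b} z *\<^sub>R (f z)\<^sup>2) \<partial>lebesgue)"
    unfolding L2sq_def by (intro nn_integral_cong) (auto simp: indicator_def)
  then show ?thesis
    using assms by (simp add: set_lebesgue_integral_def in_L2_iff set_integrable_def nn_integral_eq_integral)
qed

lemma absolutely_integrable_if_bounded:
  fixes f g :: "real \<Rightarrow> real"
  assumes "f \<in> borel_measurable (lebesgue_on {a<..<b})" "g absolutely_integrable_on {a<..<b}"
    "\<And>z. z \<in> {a<..<b} \<Longrightarrow> \<bar>f z\<bar> \<le> g z"
  shows "f absolutely_integrable_on {a<..<b}"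
proof -
  have "(\<lambda>z. indicat_real {a<..<b} z *\<^sub>R f z) \<in> borel_measurable lebesgue"
    using assms(1) by (subst (asm) borel_measurable_restrict_space_iff) auto
  then show ?thesis
    using assms(2,3) unfolding set_integrable_def
    by (elim Bochner_Integration.integrable_bound[rotated]) (auto simp: indicator_def intro!: AE_I2 order_trans[OF _ abs_ge_self])
qed

text \<open>From \<open>2 \<bar>f g\<bar> \<le> f\<^sup>2 + g\<^sup>2\<close>.\<close>

lemma L2_mult_integrable:
  fixes f g :: "real \<Rightarrow> real"
  assumes "in_L2 a b f" "in_L2 a b g"
  shows "(\<lambda>z. f z * g z) absolutely_integrable_on {a<..<b}"
proof (rule absolutely_integrable_if_bounded)
  show "(\<lambda>z. f z * g z) \<in> borel_measurable (lebesgue_on {a<..<b})"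
    using assms by (auto simp: in_L2_iff)
  show "(\<lambda>z. (f z)\<^sup>2 + (g z)\<^sup>2) absolutely_integrable_on {a<..<b}"
    using assms by (intro set_integral_add) (auto simp: in_L2_iff)
  fix z
  have "0 \<le> (\<bar>f z\<bar> - \<bar>g z\<bar>)\<^sup>2" by simp
  then have "2 * (\<bar>f z\<bar> * \<bar>g z\<bar>) \<le> (f z)\<^sup>2 + (g z)\<^sup>2" by (simp add: power2_diff)
  moreover have "0 \<le> \<bar>f z\<bar> * \<bar>g z\<bar>" by simp
  ultimately show "\<bar>f z * g z\<bar> \<le> (f z)\<^sup>2 + (g z)\<^sup>2"
    unfolding abs_mult by linarith
qed

lemma L2_bounded_mult:
  fixes f c :: "real \<Rightarrow> real"
  assumes "in_L2 a b f" "c \<in> borel_measurable (lebesgue_on {a<..<b})" "bounded (c ` {a<..<b})"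
  shows "in_L2 a b (\<lambda>z. c z * f z)"
proof -
  obtain M where M0: "\<forall>z\<in>{a<..<b}. \<bar>c z\<bar> \<le> M" using assms(3) by (auto simp: bounded_iff)
  then have M: "\<bar>c z\<bar> \<le> M" if "z \<in> {a<..<b}" for z using that by blast
  have "(\<lambda>z. (c z * f z)\<^sup>2) absolutely_integrable_on {a<..<b}"
  proof (rule absolutely_integrable_if_bounded)
    show "(\<lambda>z. M\<^sup>2 * (f z)\<^sup>2) absolutely_integrable_on {a<..<b}"
      using assms by (intro set_integrable_mult_right) (simp add: in_L2_iff)
    show "(\<lambda>z. (c z * f z)\<^sup>2) \<in> borel_measurable (lebesgue_on {a<..<b})"
      using assms(2) in_L2_measurable[OF assms(1)] by measurable
    show "\<bar>(c z * f z)\<^sup>2\<bar> \<le> M\<^sup>2 * (f z)\<^sup>2" if "z \<in> {a<..<b}" for z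
      using M[OF that] abs_le_square_iff[of "c z" M] by (auto simp: power_mult_distrib intro!: mult_right_mono)
  qed
  then show ?thesis
    using assms(2) in_L2_measurable[OF assms(1)] unfolding in_L2_iff by simp
qed

lemma L2_add:
  fixes f g :: "real \<Rightarrow> real"
  assumes "in_L2 a b f" "in_L2 a b g"
  shows "in_L2 a b (\<lambda>z. f z + g z)"
proof -
  have "(\<lambda>z. (f z)\<^sup>2 + (g z)\<^sup>2 + 2 * (f z * g z)) absolutely_integrable_on {a<..<b}"
    using assms by (intro set_integral_add(1) set_integrable_mult_right L2_mult_integrable) (simp_all add: in_L2_iff)
  then have "(\<lambda>z. (f z + g z)\<^sup>2) absolutely_integrable_on {a<..<b}"
    by (simp add: power2_sum algebra_simps)
  then show ?thesis using assms by (auto simp: in_L2_iff)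
qed

lemma L2_cmult: "in_L2 a b f \<Longrightarrow> in_L2 a b (\<lambda>z. k * f z :: real)"
  by (rule L2_bounded_mult) (auto simp: bounded_iff)

lemma L2_diff: 
  fixes f g :: "real \<Rightarrow> real"
  shows "in_L2 a b f \<Longrightarrow> in_L2 a b g \<Longrightarrow> in_L2 a b (\<lambda>z. f z - g z)"
  using L2_add[of a b f "\<lambda>z. -1 * g z"] L2_cmult[of a b g "-1"] by simp

lemma L2_const: "in_L2 a b (\<lambda>z. k :: real)"
  unfolding in_L2_iff by (auto intro!: absolutely_integrable_on_const)

lemma L2_bounded:
  fixes c :: "real \<Rightarrow> real"
  assumes "c \<in> borel_measurable (lebesgue_on {a<..<b})" "bounded (c ` {a<..<b})"
  shows "in_L2 a b c"
  using L2_bounded_mult[OF L2_const[of a b 1] assms] by simp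

lemma L2_integrable: "in_L2 a b f \<Longrightarrow> (f :: real \<Rightarrow> real) absolutely_integrable_on {a<..<b}"
  using L2_mult_integrable[OF _ L2_const[of a b 1], of f] by simp

lemma continuous_on_Icc_measurable:
  fixes f :: "real \<Rightarrow> real"
  assumes "continuous_on {a..b} f"
  shows "f \<in> borel_measurable (lebesgue_on {a<..<b})" "bounded (f ` {a<..<b})"
proof -
  show "f \<in> borel_measurable (lebesgue_on {a<..<b})"
    by (rule continuous_imp_measurable_on_sets_lebesgue[OF continuous_on_subset[OF assms]]) auto
  have "bounded (f ` {a..b})" using assms compact_continuous_image compact_imp_bounded by blast
  then show "bounded (f ` {a<..<b})" by (rule bounded_subset) auto
qed

lemma L2_continuous: "continuous_on {a..b} f \<Longrightarrow> in_L2 a b (f :: real \<Rightarrow> real)"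
  by (rule L2_bounded[OF continuous_on_Icc_measurable])

lemma loc_integrable_if_integrable:
  assumes "h absolutely_integrable_on {a<..<b}" shows "loc_integrable a b h"
  unfolding loc_integrable_def
  by (intro allI impI set_integrable_subset[OF assms]) (auto dest: lmeasurable_compact)

lemma LINT_open_eq_integral:
  fixes h :: "real \<Rightarrow> 'a::euclidean_space"
  assumes "h absolutely_integrable_on {a<..<b}"
  shows "(LINT z:{a<..<b}|lebesgue. h z) = integral {a..b} h"
  using set_lebesgue_integral_eq_integral(2)[OF assms] by (simp add: integral_open_interval_real)

section \<open>Weak antiderivatives\<close>

lemma antiderivative_eq_halfline:
  fixes h :: "real \<Rightarrow> real"
  assumes "z \<in> {a..b}" "h absolutely_integrable_on {a<..<b}"
  shows "integral {a..z} h = (LINT y|lebesgue. indicat_real {..z} y * (indicat_real {a<..<b} y * h y))"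
proof -
  have s: "{a<..<z} \<subseteq> {a<..<b}" using assms by auto
  have "h absolutely_integrable_on {a<..<z}"
    using set_integrable_subset[OF assms(2) _ s] by simp
  then have "integral {a..z} h = (LINT y:{a<..<z}|lebesgue. h y)"
    by (simp add: LINT_open_eq_integral)
  also have "\<dots> = (LINT y|lebesgue. indicat_real {..z} y * (indicat_real {a<..<b} y * h y))"
    unfolding set_lebesgue_integral_def
  proof (rule integral_cong_AE)
    have i: "integrable lebesgue (\<lambda>y. indicat_real {a<..<b} y * h y)"
      using assms(2) by (simp add: set_integrable_def)
    show "(\<lambda>y. indicat_real {..z} y * (indicat_real {a<..<b} y * h y)) \<in> borel_measurable lebesgue"
      by (rule borel_measurable_times[OF borel_measurable_indicator]) (use i in auto)
    show "(\<lambda>y. indicat_real {a<..<z} y *\<^sub>R h y) \<in> borel_measurable lebesgue"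
      using \<open>h absolutely_integrable_on {a<..<z}\<close> by (auto simp: set_integrable_def)
    have "AE y in lebesgue. y \<noteq> z" by (rule AE_completion) (rule AE_lborel_singleton)
    then show "AE y in lebesgue. indicat_real {a<..<z} y *\<^sub>R h y = indicat_real {..z} y * (indicat_real {a<..<b} y * h y)"
      by eventually_elim (use assms(1) in \<open>auto simp: indicator_def\<close>)
  qed
  finally show ?thesis .
qed

lemma antiderivative_continuous:
  fixes h :: "real \<Rightarrow> real"
  assumes "h absolutely_integrable_on {a<..<b}"
  shows "continuous_on {a..b} (\<lambda>z. integral {a..z} h)" "h integrable_on {a..b}"
proof -
  show "h integrable_on {a..b}"
    using set_lebesgue_integral_eq_integral(1)[OF assms] by (simp add: integrable_on_Icc_iff_Ioo)
  then show "continuous_on {a..b} (\<lambda>z. integral {a..z} h)"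
    by (rule indefinite_integral_continuous_1)
qed

text \<open>Integration by parts for a merely integrable \<^term>\<open>h\<close>: writing \<^term>\<open>u\<close> as the integral of its
  derivative, both sides are iterated integrals over the triangle, exchanged by Fubini's theorem.\<close>

lemma weak_integration_by_parts:
  fixes h :: "real \<Rightarrow> real"
  assumes ab: "a < b" and h: "h absolutely_integrable_on {a<..<b}" and u: "test_fun a b u"
  shows "(LINT z:{a<..<b}|lebesgue. deriv u z * integral {a..z} h) = - (LINT z:{a<..<b}|lebesgue. u z * h z)"
proof -
  let ?g = "\<lambda>z. indicat_real {a<..<b} z * h z"
  have g: "integrable lebesgue ?g" using h by (simp add: set_integrable_def)
  then obtain g' where g': "g' \<in> borel_measurable lborel" "AE x in lborel. ?g x = g' x"
    using completion_ex_borel_measurable_real[of ?g lborel] by auto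
  have ae: "AE x in lebesgue. ?g x = g' x" using g'(2) by (simp add: AE_completion)
  have "integrable lebesgue g'"
    using integrable_cong_AE[of ?g lebesgue g'] g g' ae by (simp add: measurable_completion)
  then have gi: "integrable lborel g'" using g' integrable_completion by blast
  note u' = test_fun_deriv[OF u ab]
  obtain M where M: "\<And>z. \<bar>deriv u z\<bar> \<le> M" "M \<ge> 0" using test_fun_bounded[OF u' ab] by blast
  have [measurable]: "g' \<in> borel_measurable borel" using g' by simp
  have [measurable]: "deriv u \<in> borel_measurable borel"
    by (intro borel_measurable_continuous_onI test_fun_continuous[OF u'])
  have dint: "integrable lborel (deriv u)"
  proof -
    have "integrable lborel (\<lambda>z. indicator {a..b} z *\<^sub>R deriv u z)"
      using borel_integrable_atLeastAtMost'[OF test_fun_continuous[OF u'], of a b] by (simp add: set_integrable_def)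
    moreover have "indicator {a..b} z *\<^sub>R deriv u z = deriv u z" for z
      using test_fun_outside[OF u', of z] by (cases "z \<in> {a<..<b}") (auto simp: indicator_def)
    ultimately show ?thesis by (simp only:)
  qed
  define F where "F = (\<lambda>(x::real, y::real). indicat_real {..y} x * g' x * deriv u y)"
  have Fm [measurable]: "F \<in> borel_measurable (lborel \<Otimes>\<^sub>M lborel)"
  proof -
    have "F = (\<lambda>p. (if fst p \<le> snd p then 1 else 0) * g' (fst p) * deriv u (snd p))"
      by (auto simp: F_def indicator_def fun_eq_iff)
    also have "\<dots> \<in> borel_measurable (lborel \<Otimes>\<^sub>M lborel)" by measurable
    finally show ?thesis .
  qed
  have Fi: "integrable (lborel \<Otimes>\<^sub>M lborel) F"
  proof (rule lborel_pair.Fubini_integrable[OF Fm])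
    have sec: "integrable lborel (\<lambda>y. F (x, y))" for x
    proof -
      have "integrable lborel (\<lambda>y. indicat_real {x..} y *\<^sub>R (g' x * deriv u y))"
        by (intro integrable_mult_indicator integrable_mult_right dint) simp
      moreover have "indicat_real {x..} y *\<^sub>R (g' x * deriv u y) = F (x, y)" for y
        by (auto simp: F_def indicator_def)
      ultimately show ?thesis by simp
    qed
    then show "AE x in lborel. integrable lborel (\<lambda>y. F (x, y))" by simp
    define N where "N = (LBINT y. \<bar>deriv u y\<bar>)"
    show "integrable lborel (\<lambda>x. LBINT y. norm (F (x, y)))"
    proof (rule Bochner_Integration.integrable_bound[OF integrable_mult_right[OF gi, of N]])
      show "(\<lambda>x. LBINT y. norm (F (x, y))) \<in> borel_measurable lborel" by measurable
      have "norm (LBINT y. norm (F (x, y))) \<le> norm (N * g' x)" for x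
      proof -
        have "(LBINT y. norm (F (x, y))) \<le> (LBINT y. \<bar>g' x\<bar> * \<bar>deriv u y\<bar>)"
          by (intro integral_mono integrable_norm sec integrable_mult_right integrable_abs dint)
             (auto simp: F_def indicator_def abs_mult)
        also have "\<dots> = \<bar>g' x\<bar> * N" by (simp add: N_def)
        finally show ?thesis
          by (simp add: N_def abs_mult mult.commute)
      qed
      then show "AE x in lborel. norm (LBINT y. norm (F (x, y))) \<le> norm (N * g' x)" by simp
    qed
  qed
  have "(LBINT y. LBINT x. F (x, y)) = (LBINT x. LBINT y. F (x, y))"
    using lborel_pair.Fubini_integral[of "\<lambda>x y. F (x, y)"] Fi by simp
  moreover have "(LBINT y. LBINT x. F (x, y)) = (LINT z:{a<..<b}|lebesgue. deriv u z * integral {a..z} h)"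
  proof -
    have inner: "(LBINT x. F (x, y)) = indicat_real {a<..<b} y *\<^sub>R (deriv u y * integral {a..y} h)" for y
    proof (cases "y \<in> {a<..<b}")
      case True
      have "(LBINT x. F (x, y)) = (LBINT x. indicat_real {..y} x * g' x) * deriv u y"
        by (simp add: F_def)
      also have "(LBINT x. indicat_real {..y} x * g' x) = (LINT x|lebesgue. indicat_real {..y} x * g' x)"
        by (rule integral_completion[symmetric]) measurable
      also have "\<dots> = (LINT x|lebesgue. indicat_real {..y} x * ?g x)"
      proof (rule integral_cong_AE)
        show "AE x in lebesgue. indicat_real {..y} x * g' x = indicat_real {..y} x * ?g x"
          using ae by eventually_elim simp
        show "(\<lambda>x. indicat_real {..y} x * ?g x) \<in> borel_measurable lebesgue"
          by (rule borel_measurable_times[OF borel_measurable_indicator]) (use g in auto)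
        show "(\<lambda>x. indicat_real {..y} x * g' x) \<in> borel_measurable lebesgue"
          by (intro measurable_completion) measurable
      qed
      also have "\<dots> = integral {a..y} h"
        using antiderivative_eq_halfline[OF _ h, of y] True by auto
      finally show ?thesis using True by simp
    next
      case False
      then show ?thesis using test_fun_outside[OF u', of y] by (simp add: F_def)
    qed
    have m: "(\<lambda>y. LBINT x. F (x, y)) \<in> borel_measurable lborel"
      using lborel_pair.integrable_snd[of "\<lambda>x y. F (x, y)"] Fi by auto
    have "(LINT z:{a<..<b}|lebesgue. deriv u z * integral {a..z} h) = (LINT y|lebesgue. (LBINT x. F (x, y)))"
      by (simp only: set_lebesgue_integral_def inner)
    also have "\<dots> = (LBINT y. LBINT x. F (x, y))"
      by (rule integral_completion[OF m])
    finally show ?thesis by simp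
  qed
  moreover have "(LBINT x. LBINT y. F (x, y)) = - (LINT z:{a<..<b}|lebesgue. u z * h z)"
  proof -
    have tail: "(LBINT y. indicat_real {x..} y * deriv u y) = - u x" for x
    proof -
      (* any point to the right of both x and the support of u *)
      define e where "e = max x b + 1"
      have e: "x \<le> e" "b < e" by (auto simp: e_def)
      have "indicat_real {x..} y * deriv u y = indicat_real {x..e} y *\<^sub>R deriv u y" for y
        using test_fun_outside[OF u', of y] e by (auto simp: indicator_def)
      then have "(LBINT y. indicat_real {x..} y * deriv u y) = (\<integral>y. indicat_real {x..e} y *\<^sub>R deriv u y \<partial>lborel)"
        by (simp only:)
      also have "\<dots> = u e - u x"
        using test_fun_has_deriv[OF u] e
        by (intro integral_FTC_Icc) (auto intro: test_fun_continuous[OF u'] has_field_derivative_at_within simp flip: has_real_derivative_iff_has_vector_derivative)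
      finally show ?thesis using test_fun_outside[OF u, of e] e by simp
    qed
    have inner: "(LBINT y. F (x, y)) = g' x * (- u x)" for x
    proof -
      have "F (x, y) = g' x * (indicat_real {x..} y * deriv u y)" for y
        by (auto simp: F_def indicator_def)
      then show ?thesis using tail by simp
    qed
    have [measurable]: "u \<in> borel_measurable borel"
      by (intro borel_measurable_continuous_onI test_fun_continuous[OF u])
    have "(LBINT x. LBINT y. F (x, y)) = - (LBINT x. g' x * u x)"
      unfolding inner by simp
    also have "(LBINT x. g' x * u x) = (LINT x|lebesgue. g' x * u x)"
      by (rule integral_completion[symmetric]) measurable
    also have "\<dots> = (LINT z:{a<..<b}|lebesgue. u z * h z)"
      unfolding set_lebesgue_integral_def
    proof (rule integral_cong_AE)
      show "AE x in lebesgue. g' x * u x = indicat_real {a<..<b} x *\<^sub>R (u x * h x)"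
        using ae
      proof eventually_elim
        case (elim x)
        show ?case unfolding elim[symmetric] by simp
      qed
      show "(\<lambda>x. g' x * u x) \<in> borel_measurable lebesgue"
        by (intro measurable_completion) measurable
      show "(\<lambda>x. indicat_real {a<..<b} x *\<^sub>R (u x * h x)) \<in> borel_measurable lebesgue"
        using test_fun_times_integrable[OF u loc_integrable_if_integrable[OF h]] by (auto simp: set_integrable_def)
    qed
    finally show ?thesis .
  qed
  ultimately show ?thesis by simp
qed

text \<open>A point source \<^term>\<open>\<kappa>\<close> at \<^term>\<open>p\<close> in the weak form of a first-order equation shows up as a
  jump of the flux \<^term>\<open>A\<close>.\<close>

lemma weak_ode_with_source:
  fixes A C :: "real \<Rightarrow> real"
  assumes p: "a < p" "p < b"
    and A: "A absolutely_integrable_on {a<..<b}" and C: "C absolutely_integrable_on {a<..<b}"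
    and weak: "\<And>u. test_fun a b u \<Longrightarrow> \<kappa> * u p + (LINT z:{a<..<b}|lebesgue. A z * deriv u z + C z * u z) = 0"
  shows "\<exists>k. AE z in lebesgue. z \<in> {a<..<b} \<longrightarrow> A z = k + integral {a..z} C + \<kappa> * indicat_real {p<..} z"
proof -
  have ab: "a < b" using p by simp
  define S where "S z = \<kappa> * indicat_real {p<..} z" for z
  define Q where "Q z = integral {a..z} C" for z
  have Qc: "continuous_on {a..b} Q"
    unfolding Q_def by (rule antiderivative_continuous[OF C])
  have Qi: "Q absolutely_integrable_on {a<..<b}" by (rule L2_integrable[OF L2_continuous[OF Qc]])
  have Si: "S absolutely_integrable_on {a<..<b}"
  proof (intro L2_integrable L2_bounded)
    show "S \<in> borel_measurable (lebesgue_on {a<..<b})"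
      unfolding S_def by (intro borel_measurable_times borel_measurable_const measurable_restrict_space1 borel_measurable_indicator) auto
    show "bounded (S ` {a<..<b})"
      unfolding S_def bounded_iff by (intro exI[of _ "\<bar>\<kappa>\<bar>"]) (auto simp: indicator_def)
  qed
  define g where "g z = A z - Q z - S z" for z
  have gi: "g absolutely_integrable_on {a<..<b}"
    unfolding g_def by (intro set_integral_diff(1) A Qi Si)
  have "\<exists>k. AE z in lebesgue. z \<in> {a<..<b} \<longrightarrow> g z = k"
  proof (rule AE_const_if_test_deriv_zero[OF ab loc_integrable_if_integrable[OF gi]])
    fix u assume u: "test_fun a b u"
    note u' = test_fun_deriv[OF u ab]
    note tint = test_fun_times_integrable[OF u' loc_integrable_if_integrable, unfolded real_scaleR_def]
    have i1: "(\<lambda>z. A z * deriv u z) absolutely_integrable_on {a<..<b}"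
      using tint[OF A] by (simp add: mult.commute)
    have i2: "(\<lambda>z. C z * u z) absolutely_integrable_on {a<..<b}"
      using test_fun_times_integrable[OF u loc_integrable_if_integrable[OF C]] by (simp add: mult.commute)
    have "(LINT z:{a<..<b}|lebesgue. deriv u z * S z) = - \<kappa> * u p"
    proof -
      have "(LINT z:{a<..<b}|lebesgue. deriv u z * S z) = \<kappa> * (LINT z:{p<..<b}|lebesgue. deriv u z)"
      proof -
        have "indicat_real {a<..<b} z *\<^sub>R (deriv u z * S z) = \<kappa> * (indicat_real {p<..<b} z *\<^sub>R deriv u z)" for z
          using p by (auto simp: S_def indicator_def)
        then show ?thesis unfolding set_lebesgue_integral_def by (simp only: integral_mult_right_zero)
      qed
      also have "(LINT z:{p<..<b}|lebesgue. deriv u z) = integral {p..b} (deriv u)"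
        by (intro LINT_open_eq_integral L2_integrable L2_continuous test_fun_continuous[OF u'])
      also have "\<dots> = u b - u p"
        using p test_fun_has_deriv[OF u]
        by (intro integral_unique fundamental_theorem_of_calculus) (auto intro: has_field_derivative_at_within simp flip: has_real_derivative_iff_has_vector_derivative)
      finally show ?thesis using test_fun_outside[OF u, of b] by simp
    qed
    moreover have "(LINT z:{a<..<b}|lebesgue. deriv u z * Q z) = - (LINT z:{a<..<b}|lebesgue. u z * C z)"
      unfolding Q_def by (rule weak_integration_by_parts[OF ab C u])
    moreover have "(LINT z:{a<..<b}|lebesgue. A z * deriv u z + C z * u z)
        = (LINT z:{a<..<b}|lebesgue. A z * deriv u z) + (LINT z:{a<..<b}|lebesgue. C z * u z)"
      by (rule set_integral_add(2)[OF i1 i2])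
    moreover have "(LINT z:{a<..<b}|lebesgue. deriv u z *\<^sub>R g z) =
        (LINT z:{a<..<b}|lebesgue. deriv u z * A z) - (LINT z:{a<..<b}|lebesgue. deriv u z * Q z) - (LINT z:{a<..<b}|lebesgue. deriv u z * S z)"
      unfolding g_def
      using set_integral_diff[OF tint[OF A] tint[OF Qi]] set_integral_diff(2)[OF set_integral_diff(1)[OF tint[OF A] tint[OF Qi]] tint[OF Si]]
      by (simp add: right_diff_distrib)
    ultimately show "(LINT z:{a<..<b}|lebesgue. deriv u z *\<^sub>R g z) = 0"
      using weak[OF u] by (simp add: mult.commute)
  qed
  then obtain k where "AE z in lebesgue. z \<in> {a<..<b} \<longrightarrow> g z = k" by blast
  then have "AE z in lebesgue. z \<in> {a<..<b} \<longrightarrow> A z = k + integral {a..z} C + \<kappa> * indicat_real {p<..} z"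
    by eventually_elim (auto simp: g_def Q_def S_def)
  then show ?thesis by blast
qed

section \<open>The space of finite energy profiles\<close>

text \<open>The converse direction, from an integral representation to a weak derivative, produces the weak
  derivatives of all competitors in the minimization.\<close>

lemma is_weak_deriv_antiderivative:
  fixes f h :: "real \<Rightarrow> real"
  assumes ab: "a < b" and h: "h absolutely_integrable_on {a<..<b}"
    and f: "\<And>z. z \<in> {a<..<b} \<Longrightarrow> f z = integral {a..z} h"
  shows "is_weak_deriv 1 a b f h"
proof -
  have "(\<lambda>z. integral {a..z} h) absolutely_integrable_on {a<..<b}"
    by (intro L2_integrable L2_continuous antiderivative_continuous h)
  then have fi: "f absolutely_integrable_on {a<..<b}"
    using set_integrable_cong[of lebesgue lebesgue "{a<..<b}" "{a<..<b}" f "\<lambda>z. integral {a..z} h"] f by auto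
  have "(LINT z:{a<..<b}|lebesgue. deriv u z * f z) = - (LINT z:{a<..<b}|lebesgue. u z * h z)"
    if u: "test_fun a b u" for u
  proof -
    have "(LINT z:{a<..<b}|lebesgue. deriv u z * f z) = (LINT z:{a<..<b}|lebesgue. deriv u z * integral {a..z} h)"
      by (rule set_lebesgue_integral_cong) (use f in auto)
    then show ?thesis using weak_integration_by_parts[OF ab h u] by simp
  qed
  then show ?thesis
    unfolding is_weak_deriv_def using loc_integrable_if_integrable[OF fi] loc_integrable_if_integrable[OF h] by simp
qed

lemma test_fun_eq_integral_deriv:
  assumes "a \<le> z" "test_fun a b u"
  shows "u z = integral {a..z} (deriv u)"
proof -
  have "integral {a..z} (deriv u) = u z - u a"
    using test_fun_has_deriv[OF assms(2)] assms(1)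
    by (intro integral_unique fundamental_theorem_of_calculus) (auto intro: has_field_derivative_at_within simp flip: has_real_derivative_iff_has_vector_derivative)
  then show ?thesis using test_fun_outside[OF assms(2), of a] by simp
qed

text \<open>Convergence of the approximating test functions in the \<^term>\<open>H10\<close> norm is uniform on the closed
  interval, since the \<^term>\<open>L2sq\<close> norm of the derivative controls its integral.\<close>

lemma H10_antiderivative:
  assumes ab: "a < b" and f: "f \<in> H10 a b"
  obtains h where "is_weak_deriv 1 a b f h" "in_L2 a b h" "\<And>z. z \<in> {a..b} \<Longrightarrow> f z = integral {a..z} h" "f b = 0"
proof -
  obtain h u where h: "is_weak_deriv 1 a b f h" "in_L2 a b h" and u: "\<And>n. test_fun a b (u n)"
    and lim0: "(\<lambda>n::nat. L2sq a b (\<lambda>z. u n z - f z)) \<longlonglongrightarrow> 0"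
    and lim1: "(\<lambda>n. L2sq a b (\<lambda>z. deriv (u n) z - h z)) \<longlonglongrightarrow> 0"
    using f unfolding H10_def by auto
  have fc: "continuous_on {a..b} f" using f by (simp add: H10_def)
  define F where "F z = integral {a..z} h" for z
  have hi: "h absolutely_integrable_on {a<..<b}" by (rule L2_integrable[OF h(2)])
  have Fc: "continuous_on {a..b} F" and hint: "h integrable_on {a..b}"
    unfolding F_def by (rule antiderivative_continuous[OF hi])+
  note u' = test_fun_deriv[OF u ab]
  define d where "d n z = deriv (u n) z - h z" for n z
  have d2: "in_L2 a b (d n)" for n
    unfolding d_def by (intro L2_diff h(2) L2_continuous test_fun_continuous[OF u'])
  have di: "d n absolutely_integrable_on {a<..<b}" for n by (rule L2_integrable[OF d2])
  have dabs: "d n integrable_on {a..b}" "(\<lambda>z. \<bar>d n z\<bar>) integrable_on {a..b}" for n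
    using antiderivative_continuous(2)[OF di] antiderivative_continuous(2)[OF set_integrable_abs[OF di]] by auto
  define L where "L n = (LINT z:{a<..<b}|lebesgue. (d n z)\<^sup>2)" for n
  have L0: "L n \<ge> 0" for n unfolding L_def set_lebesgue_integral_def by (intro integral_nonneg_AE) simp
  have "L2sq a b (\<lambda>z. deriv (u n) z - h z) = ennreal (L n)" for n
    using L2sq_eq_integral[OF d2[of n]] by (simp add: L_def d_def[abs_def])
  then have "(\<lambda>n. ennreal (L n)) \<longlonglongrightarrow> 0"
    using lim1 by simp
  then have Llim: "L \<longlonglongrightarrow> 0" using L0 by (subst (asm) ennreal_tendsto_0_iff) auto
  define e where "e n = integral {a..b} (\<lambda>z. \<bar>d n z\<bar>)" for n
  (* the weight in the inequality d <= kappa + d^2 / kappa; the summand 1 / (n + 1) keeps it positive *)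
  define \<kappa> where "\<kappa> n = sqrt (L n) + 1 / real (Suc n)" for n
  have \<kappa>: "\<kappa> n > 0" "L n \<le> (\<kappa> n)\<^sup>2" for n
  proof -
    show "\<kappa> n > 0" unfolding \<kappa>_def using L0[of n] by (intro add_nonneg_pos) auto
    have "L n = (sqrt (L n))\<^sup>2" using L0 by simp
    also have "\<dots> \<le> (\<kappa> n)\<^sup>2" unfolding \<kappa>_def using L0[of n] by (intro power_mono) auto
    finally show "L n \<le> (\<kappa> n)\<^sup>2" .
  qed
  have \<kappa>lim: "\<kappa> \<longlonglongrightarrow> 0"
  proof -
    have "(\<lambda>n. sqrt (L n) + 1 / real (Suc n)) \<longlonglongrightarrow> sqrt 0 + 0"
      by (intro tendsto_add tendsto_real_sqrt Llim LIMSEQ_Suc lim_1_over_n)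
    then show ?thesis by (simp add: \<kappa>_def[abs_def])
  qed
  have e_bound: "e n \<le> \<kappa> n * (b - a) + \<kappa> n" for n
  proof -
    have i1: "(\<lambda>z. \<kappa> n + (d n z)\<^sup>2 / \<kappa> n) integrable_on {a..b}" "integral {a..b} (\<lambda>z. \<kappa> n + (d n z)\<^sup>2 / \<kappa> n) = \<kappa> n * (b - a) + L n / \<kappa> n"
    proof -
      have s: "(\<lambda>z. (d n z)\<^sup>2) absolutely_integrable_on {a<..<b}" using d2 by (simp add: in_L2_iff)
      have s1: "(\<lambda>z. (d n z)\<^sup>2) integrable_on {a..b}" by (rule antiderivative_continuous(2)[OF s])
      have s2: "integral {a..b} (\<lambda>z. (d n z)\<^sup>2) = L n" unfolding L_def using LINT_open_eq_integral[OF s] by simp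
      have "((\<lambda>z. \<kappa> n + (d n z)\<^sup>2 / \<kappa> n) has_integral \<kappa> n * (b - a) + L n / \<kappa> n) {a..b}"
      proof (rule has_integral_add)
        show "((\<lambda>z. \<kappa> n) has_integral \<kappa> n * (b - a)) {a..b}"
          using has_integral_const_real[of "\<kappa> n" a b] ab by (simp add: mult.commute)
        show "((\<lambda>z. (d n z)\<^sup>2 / \<kappa> n) has_integral L n / \<kappa> n) {a..b}"
          using has_integral_divide[OF integrable_integral[OF s1], of "\<kappa> n"] s2 by simp
      qed
      then show "(\<lambda>z. \<kappa> n + (d n z)\<^sup>2 / \<kappa> n) integrable_on {a..b}" "integral {a..b} (\<lambda>z. \<kappa> n + (d n z)\<^sup>2 / \<kappa> n) = \<kappa> n * (b - a) + L n / \<kappa> n"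
        by (auto simp: integrable_on_def integral_unique)
    qed
    have "\<bar>d n z\<bar> \<le> \<kappa> n + (d n z)\<^sup>2 / \<kappa> n" for z
    proof -
      (* completing the square *)
      have "0 \<le> (\<bar>d n z\<bar> - \<kappa> n)\<^sup>2 + \<bar>d n z\<bar> * \<kappa> n" using \<kappa>[of n] by simp
      also have "\<dots> = \<kappa> n * (\<kappa> n + (d n z)\<^sup>2 / \<kappa> n - \<bar>d n z\<bar>)" using \<kappa>[of n] by (simp add: power2_eq_square field_simps)
      finally show ?thesis using \<kappa>(1)[of n] by (simp add: zero_le_mult_iff)
    qed
    then have "e n \<le> \<kappa> n * (b - a) + L n / \<kappa> n"
      unfolding e_def i1(2)[symmetric] by (intro integral_le dabs i1) auto
    also have "L n / \<kappa> n \<le> \<kappa> n" using \<kappa>[of n] by (simp add: divide_le_eq power2_eq_square)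
    finally show ?thesis by simp
  qed
  have e0: "0 \<le> e n" for n unfolding e_def by (rule integral_nonneg[OF dabs(2)]) auto
  have elim: "e \<longlonglongrightarrow> 0"
  proof (rule tendsto_sandwich[of "\<lambda>_. 0" e sequentially "\<lambda>n. \<kappa> n * (b - a) + \<kappa> n"])
    have "(\<lambda>n. \<kappa> n * (b - a) + \<kappa> n) \<longlonglongrightarrow> 0 * (b - a) + 0"
      by (intro tendsto_intros \<kappa>lim)
    then show "(\<lambda>n. \<kappa> n * (b - a) + \<kappa> n) \<longlonglongrightarrow> 0" by simp
  qed (use e_bound e0 in auto)
  have unif: "\<bar>u n z - F z\<bar> \<le> e n" if z: "z \<in> {a..b}" for n z
  proof -
    have s: "{a..z} \<subseteq> {a..b}" using z by auto
    note sub = integrable_on_subinterval[OF _ s]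
    have "u n z - F z = integral {a..z} (d n)"
      unfolding F_def d_def using test_fun_eq_integral_deriv[OF _ u, of z n] z
      by (subst integral_diff) (auto intro!: integrable_continuous_real test_fun_continuous[OF u'] sub[OF hint])
    also have "norm \<dots> \<le> integral {a..z} (\<lambda>z. \<bar>d n z\<bar>)"
      by (rule integral_norm_bound_integral) (auto intro: sub dabs)
    also have "\<dots> \<le> e n"
      unfolding e_def by (rule integral_subset_le[OF s]) (auto intro: sub dabs)
    finally show ?thesis by simp
  qed
  have "f z = F z" if z: "z \<in> {a..b}" for z
  proof -
    define D where "D n = (LINT z:{a<..<b}|lebesgue. (u n z - f z)\<^sup>2)" for n
    have uf2: "in_L2 a b (\<lambda>z. u n z - f z)" for n
      by (intro L2_diff L2_continuous fc test_fun_continuous[OF u])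
    have D0: "D n \<ge> 0" for n unfolding D_def set_lebesgue_integral_def by (intro integral_nonneg_AE) simp
    have "(\<lambda>n. ennreal (D n)) \<longlonglongrightarrow> 0"
      using lim0 L2sq_eq_integral[OF uf2] by (simp add: D_def)
    then have Dlim: "D \<longlonglongrightarrow> 0" using D0 by (subst (asm) ennreal_tendsto_0_iff) auto
    define m where "m = integral {a..b} (\<lambda>z. (f z - F z)\<^sup>2)"
    have cont: "continuous_on {a..b} (\<lambda>z. (f z - F z)\<^sup>2)" by (intro continuous_intros fc Fc)
    have "m \<le> 2 * D n + 2 * (e n)\<^sup>2 * (b - a)" for n
    proof -
      have c1: "continuous_on {a..b} (\<lambda>z. (u n z - f z)\<^sup>2)" by (intro continuous_intros fc test_fun_continuous[OF u])
      have "D n = integral {a..b} (\<lambda>z. (u n z - f z)\<^sup>2)"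
        unfolding D_def by (rule LINT_open_eq_integral[OF L2_integrable[OF L2_continuous[OF c1]]])
      moreover have "m \<le> integral {a..b} (\<lambda>z. 2 * (u n z - f z)\<^sup>2 + 2 * (e n)\<^sup>2)"
        unfolding m_def
      proof (intro integral_le integrable_continuous_real cont continuous_intros fc test_fun_continuous[OF u])
        fix z assume z: "z \<in> {a..b}"
        have "(f z - F z)\<^sup>2 + ((u n z - f z) - (u n z - F z) + 2 * (u n z - F z))\<^sup>2 = 2 * (u n z - f z)\<^sup>2 + 2 * (u n z - F z)\<^sup>2"
          by (simp add: power2_eq_square algebra_simps)
        then have "(f z - F z)\<^sup>2 \<le> 2 * (u n z - f z)\<^sup>2 + 2 * (u n z - F z)\<^sup>2"
          using zero_le_power2[of "(u n z - f z) - (u n z - F z) + 2 * (u n z - F z)"] by linarith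
        also have "(u n z - F z)\<^sup>2 \<le> (e n)\<^sup>2"
          using unif[OF z, of n] e0[of n] by (simp add: abs_le_square_iff[symmetric])
        finally show "(f z - F z)\<^sup>2 \<le> 2 * (u n z - f z)\<^sup>2 + 2 * (e n)\<^sup>2" by simp
      qed
      moreover have "integral {a..b} (\<lambda>z. 2 * (u n z - f z)\<^sup>2 + 2 * (e n)\<^sup>2) = 2 * integral {a..b} (\<lambda>z. (u n z - f z)\<^sup>2) + 2 * (e n)\<^sup>2 * (b - a)"
        using ab by (subst integral_add) (auto intro!: integrable_continuous_real continuous_intros c1 fc test_fun_continuous[OF u])
      ultimately show ?thesis by simp
    qed
    moreover have "(\<lambda>n. 2 * D n + 2 * (e n)\<^sup>2 * (b - a)) \<longlonglongrightarrow> 2 * 0 + 2 * 0\<^sup>2 * (b - a)"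
      by (intro tendsto_intros Dlim elim)
    ultimately have "m \<le> 0" by (intro LIMSEQ_le_const[of "\<lambda>n. 2 * D n + 2 * (e n)\<^sup>2 * (b - a)"]) auto
    moreover have "m \<ge> 0" unfolding m_def by (intro integral_nonneg integrable_continuous_real cont) auto
    ultimately have "m = 0" by simp
    then show ?thesis
      using integral_eq_0_iff[OF cont ab] z unfolding m_def by auto
  qed
  moreover have "F b = 0"
  proof -
    have "(\<lambda>n. \<bar>u n b - F b\<bar>) \<longlonglongrightarrow> 0"
      by (rule tendsto_sandwich[of "\<lambda>_. 0" _ sequentially e]) (use unif[of b] ab elim in auto)
    then have "(\<lambda>n::nat. \<bar>F b\<bar>) \<longlonglongrightarrow> 0"
      using test_fun_outside[OF u, of b] by simp
    then show ?thesis by (simp add: LIMSEQ_const_iff)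
  qed
  ultimately show ?thesis
    using that[OF h] ab by (simp add: F_def)
qed

lemma H10_continuous: "f \<in> H10 a b \<Longrightarrow> continuous_on {a..b} f"
  by (simp add: H10_def)

text \<open>Variations of a profile: adding a test function to \<open>f\<close> and to its approximations leaves their
  distances unchanged.\<close>

lemma H10_add_test_fun:
  assumes ab: "a < b" and f: "f \<in> H10 a b" and w: "test_fun a b w"
  shows "(\<lambda>z. f z + t * w z) \<in> H10 a b"
    and "is_weak_deriv 1 a b f h \<Longrightarrow> in_L2 a b h \<Longrightarrow> is_weak_deriv 1 a b (\<lambda>z. f z + t * w z) (\<lambda>z. h z + t * deriv w z)"
proof -
  note w' = test_fun_deriv[OF w ab]
  show *: "is_weak_deriv 1 a b (\<lambda>z. f z + t * w z) (\<lambda>z. h z + t * deriv w z)"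
    if h: "is_weak_deriv 1 a b f h" "in_L2 a b h" for h
  proof (rule is_weak_deriv_antiderivative[OF ab])
    show "(\<lambda>z. h z + t * deriv w z) absolutely_integrable_on {a<..<b}"
      by (intro L2_integrable L2_add h L2_cmult L2_continuous test_fun_continuous[OF w'])
    obtain h' where h': "is_weak_deriv 1 a b f h'" "\<And>z. z \<in> {a..b} \<Longrightarrow> f z = integral {a..z} h'"
      using H10_antiderivative[OF ab f] by blast
    have ae: "AE z in lebesgue. z \<in> {a<..<b} \<longrightarrow> h' z = h z" by (rule weak_deriv_unique[OF h'(1) h(1)])
    fix z assume z: "z \<in> {a<..<b}"
    have "negligible {x \<in> {a<..<b}. h' x \<noteq> h x}"
      using ae unfolding negligible_iff_null_sets eventually_ae_filter
      by (auto intro: completion.complete2)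
    then have "integral {a..z} h' = integral {a..z} h"
      by (intro integral_spike[of "insert a {x \<in> {a<..<b}. h' x \<noteq> h x}"]) (use z in \<open>auto simp: negligible_insert\<close>)
    then have "f z = integral {a..z} h" using h'(2) z by simp
    moreover have "w z = integral {a..z} (deriv w)" using test_fun_eq_integral_deriv[OF _ w] z by simp
    moreover have "h integrable_on {a..z}"
      using integrable_on_subinterval[OF antiderivative_continuous(2)[OF L2_integrable[OF h(2)]]] z by auto
    ultimately show "f z + t * w z = integral {a..z} (\<lambda>z. h z + t * deriv w z)"
      by (subst integral_add) (auto intro!: integrable_continuous_real continuous_intros test_fun_continuous[OF w'])
  qed
  obtain h u where h: "is_weak_deriv 1 a b f h" "in_L2 a b h" and u: "\<And>n. test_fun a b (u n)"
    and lim0: "(\<lambda>n::nat. L2sq a b (\<lambda>z. u n z - f z)) \<longlonglongrightarrow> 0"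
    and lim1: "(\<lambda>n. L2sq a b (\<lambda>z. deriv (u n) z - h z)) \<longlonglongrightarrow> 0"
    using f unfolding H10_def by auto
  have c: "continuous_on {a..b} (\<lambda>z. f z + t * w z)"
    by (intro continuous_intros H10_continuous[OF f] test_fun_continuous[OF w])
  have du: "deriv (\<lambda>z. u n z + t * w z) z = deriv (u n) z + t * deriv w z" for n z
    by (intro DERIV_imp_deriv DERIV_add DERIV_cmult test_fun_has_deriv[OF u] test_fun_has_deriv[OF w])
  show "(\<lambda>z. f z + t * w z) \<in> H10 a b"
    unfolding H10_def
  proof (intro CollectI conjI exI[of _ "\<lambda>z. h z + t * deriv w z"] exI[of _ "\<lambda>n z. u n z + t * w z"] allI)
    show "in_L2 a b (\<lambda>z. h z + t * deriv w z)"
      by (intro L2_add h L2_cmult L2_continuous test_fun_continuous[OF w'])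
    show "test_fun a b (\<lambda>z. u n z + t * w z)" for n by (intro test_fun_add u test_fun_cmult w)
    show "(\<lambda>n. L2sq a b (\<lambda>z. u n z + t * w z - (f z + t * w z))) \<longlonglongrightarrow> 0" using lim0 by simp
    show "(\<lambda>n. L2sq a b (\<lambda>z. deriv (\<lambda>z. u n z + t * w z) z - (h z + t * deriv w z))) \<longlonglongrightarrow> 0"
      using lim1 by (simp add: du)
  qed (use c L2_continuous[OF c] *[OF h] in simp_all)
qed

lemma L2sq_cmult:
  fixes f :: "real \<Rightarrow> 'a::real_normed_field"
  assumes "in_L2 a b f"
  shows "L2sq a b (\<lambda>z. k * f z) = ennreal ((norm k)\<^sup>2) * L2sq a b f"
proof -
  have "(\<lambda>z. indicat_real {a<..<b} z *\<^sub>R f z) \<in> borel_measurable lebesgue"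
    using assms by (simp add: in_L2_def set_borel_measurable_def)
  then have [measurable]: "(\<lambda>z. ennreal ((norm (indicat_real {a<..<b} z *\<^sub>R f z))\<^sup>2)) \<in> borel_measurable lebesgue"
    by measurable
  have "L2sq a b (\<lambda>z. k * f z) = (\<integral>\<^sup>+z. ennreal ((norm k)\<^sup>2) * ennreal ((norm (indicat_real {a<..<b} z *\<^sub>R f z))\<^sup>2) \<partial>lebesgue)"
    unfolding L2sq_def by (intro nn_integral_cong) (auto simp: indicator_def norm_mult power_mult_distrib ennreal_mult')
  also have "\<dots> = ennreal ((norm k)\<^sup>2) * (\<integral>\<^sup>+z. ennreal ((norm (indicat_real {a<..<b} z *\<^sub>R f z))\<^sup>2) \<partial>lebesgue)"
    by (rule nn_integral_cmult) measurable
  also have "(\<integral>\<^sup>+z. ennreal ((norm (indicat_real {a<..<b} z *\<^sub>R f z))\<^sup>2) \<partial>lebesgue) = L2sq a b f"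
    unfolding L2sq_def by (intro nn_integral_cong) (auto simp: indicator_def)
  finally show ?thesis .
qed

lemma is_weak_deriv_cmult:
  fixes f h :: "real \<Rightarrow> 'a::{real_normed_field,euclidean_space}"
  assumes "is_weak_deriv j a b f h"
  shows "is_weak_deriv j a b (\<lambda>z. k * f z) (\<lambda>z. k * h z)"
proof -
  have "(LINT z:{a<..<b}|lebesgue. v z *\<^sub>R (k * g z)) = k * (LINT z:{a<..<b}|lebesgue. v z *\<^sub>R g z)"
    for v :: "real \<Rightarrow> real" and g :: "real \<Rightarrow> 'a"
  proof -
    have "indicat_real {a<..<b} z *\<^sub>R v z *\<^sub>R (k * g z) = k * (indicat_real {a<..<b} z *\<^sub>R v z *\<^sub>R g z)" for z
      by simp
    then show ?thesis unfolding set_lebesgue_integral_def by (simp only: integral_mult_right_zero)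
  qed
  then show ?thesis
    using assms unfolding is_weak_deriv_def loc_integrable_def by auto
qed

lemma H10_cmult:
  assumes "a < b" "f \<in> H10 a b"
  shows "(\<lambda>z. k * f z) \<in> H10 a b"
proof -
  obtain h u where h: "is_weak_deriv 1 a b f h" "in_L2 a b h" and u: "\<And>n. test_fun a b (u n)"
    and lim0: "(\<lambda>n::nat. L2sq a b (\<lambda>z. u n z - f z)) \<longlonglongrightarrow> 0"
    and lim1: "(\<lambda>n. L2sq a b (\<lambda>z. deriv (u n) z - h z)) \<longlonglongrightarrow> 0"
    using assms(2) unfolding H10_def by auto
  note u' = test_fun_deriv[OF u assms(1)]
  have c: "continuous_on {a..b} (\<lambda>z. k * f z)" by (intro continuous_intros H10_continuous[OF assms(2)])
  have du: "deriv (\<lambda>z. k * u n z) z = k * deriv (u n) z" for n z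
    by (intro DERIV_imp_deriv DERIV_cmult test_fun_has_deriv[OF u])
  have lim: "(\<lambda>n. L2sq a b (\<lambda>z. k * v n z - k * g z)) \<longlonglongrightarrow> 0"
    if "\<And>n. in_L2 a b (\<lambda>z. v n z - g z)" "(\<lambda>n::nat. L2sq a b (\<lambda>z. v n z - g z)) \<longlonglongrightarrow> 0" for v :: "nat \<Rightarrow> real \<Rightarrow> real" and g
  proof -
    have "(\<lambda>n. ennreal ((norm k)\<^sup>2) * L2sq a b (\<lambda>z. v n z - g z)) \<longlonglongrightarrow> ennreal ((norm k)\<^sup>2) * 0"
      by (intro ennreal_tendsto_cmult that) auto
    then show ?thesis using L2sq_cmult[OF that(1), of k] by (simp add: right_diff_distrib)
  qed
  show ?thesis
    unfolding H10_def
  proof (intro CollectI conjI exI[of _ "\<lambda>z. k * h z"] exI[of _ "\<lambda>n z. k * u n z"] allI)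
    show "is_weak_deriv 1 a b (\<lambda>z. k * f z) (\<lambda>z. k * h z)" by (rule is_weak_deriv_cmult[OF h(1)])
    show "in_L2 a b (\<lambda>z. k * h z)" by (rule L2_cmult[OF h(2)])
    show "test_fun a b (\<lambda>z. k * u n z)" for n by (rule test_fun_cmult[OF u])
    show "(\<lambda>n. L2sq a b (\<lambda>z. k * u n z - k * f z)) \<longlonglongrightarrow> 0"
      by (rule lim[OF _ lim0]) (intro L2_diff L2_continuous test_fun_continuous[OF u] H10_continuous[OF assms(2)])
    show "(\<lambda>n. L2sq a b (\<lambda>z. deriv (\<lambda>z. k * u n z) z - k * h z)) \<longlonglongrightarrow> 0"
      unfolding du by (rule lim[OF _ lim1]) (intro L2_diff h(2) L2_continuous test_fun_continuous[OF u'])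
  qed (use c L2_continuous[OF c] in simp_all)
qed

lemma H10_zero: "(\<lambda>z. 0) \<in> H10 a b"
proof -
  have z: "test_fun a b (\<lambda>z. 0)" by (auto simp: test_fun_def C_inf_on_const intro!: exI[of _ "{}"])
  have w: "is_weak_deriv 1 a b (\<lambda>z. 0 :: real) (\<lambda>z. 0)"
    by (auto simp: is_weak_deriv_def loc_integrable_def)
  show ?thesis
    unfolding H10_def
    by (intro CollectI conjI exI[of _ "\<lambda>z. 0"] exI[of _ "\<lambda>n z. 0"] allI)
       (use z w L2_const[of a b 0] in \<open>simp_all add: L2sq_def\<close>)
qed

lemma test_fun_in_H10: "a < b \<Longrightarrow> test_fun a b w \<Longrightarrow> w \<in> H10 a b"
  using H10_add_test_fun(1)[OF _ H10_zero, of a b w 1] by simp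

section \<open>The steady state\<close>

text \<open>A zero of the derivative would, by continuity and strict monotonicity, be accompanied by an open set
  on which the derivative is positive but arbitrarily small.\<close>

lemma pressure_law_deriv_pos:
  assumes P: "pressure_law P" and z: "z > 0"
  shows "deriv P z > 0"
proof -
  have sm: "C_inf_on {0<..} P" and mono: "strict_mono_on {0<..} P" and loc: "Linf_loc {0<..} (\<lambda>z. 1 / deriv P z)"
    using P by (auto simp: pressure_law_def)
  have nonneg: "deriv P x \<ge> 0" if x: "x > 0" for x
  proof (rule ccontr)
    assume "\<not> deriv P x \<ge> 0"
    then obtain d where d: "d > 0" "\<And>h. 0 < h \<Longrightarrow> h < d \<Longrightarrow> P (x + h) < P x"
      using DERIV_neg_dec_right[OF C_inf_on_has_deriv[OF sm, of x]] x by auto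
    have "P (x + d / 2) < P x" using d by auto
    moreover have "P x < P (x + d / 2)" using mono x d(1) by (auto simp: strict_mono_on_def)
    ultimately show False by simp
  qed
  have "deriv P z \<noteq> 0"
  proof
    assume z0: "deriv P z = 0"
    obtain C where C: "AE x in lebesgue. x \<in> {z/2..2*z} \<longrightarrow> \<bar>1 / deriv P x\<bar> \<le> C"
      using loc z unfolding Linf_loc_def by (metis atLeastAtMost_iff compact_Icc field_sum_of_halves greaterThan_iff half_gt_zero order_less_le_trans subsetI)
    (* where the derivative is below epsilon its inverse exceeds C *)
    define \<epsilon> where "\<epsilon> = 1 / (\<bar>C\<bar> + 1)"
    have \<epsilon>: "\<epsilon> > 0" by (simp add: \<epsilon>_def)
    have "isCont (deriv P) z" using C_inf_on_isCont[OF C_inf_on_deriv[OF sm]] z by auto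
    then have "(deriv P \<longlongrightarrow> deriv P z) (nhds z)"
      by (simp add: isCont_def tendsto_at_iff_tendsto_nhds)
    then have "\<forall>\<^sub>F x in nhds z. deriv P x < \<epsilon>"
      by (rule order_tendstoD(2)) (use z0 \<epsilon> in simp)
    then obtain d where d: "d > 0" "\<And>x. dist x z < d \<Longrightarrow> deriv P x < \<epsilon>"
      by (auto simp: eventually_nhds_metric)
    define b where "b = min (z + d / 2) (2 * z)"
    have b: "z < b" "b \<le> 2 * z" "b < z + d" using z d(1) by (auto simp: b_def)
    obtain y where y: "z < y" "y < b" "P b - P z = (b - z) * deriv P y"
      using MVT2[OF b(1), of P "deriv P"] C_inf_on_has_deriv[OF sm] z by auto
    have "P z < P b" using mono z b by (auto simp: strict_mono_on_def)
    then have "0 < (b - z) * deriv P y" using y(3) by linarith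
    then have "deriv P y > 0" using b(1) by (simp add: zero_less_mult_iff)
    moreover have "open {z<..<b}" by simp
    moreover have "continuous_on {z<..<b} (deriv P)"
      by (rule continuous_on_subset[OF C_inf_on_continuous_on[OF C_inf_on_deriv[OF sm]]]) (use z in auto)
    ultimately have op: "open ({z<..<b} \<inter> deriv P -` {0<..})"
      using continuous_open_preimage[of "{z<..<b}" "deriv P" "{0<..}"] by auto
    have "y \<in> {x. \<bar>1 / deriv P x\<bar> \<le> C}" if "closed {x. x \<notin> {z<..<b} \<inter> deriv P -` {0<..}}"
    proof -
      have ae: "AE x \<in> {z<..<b} \<inter> deriv P -` {0<..} in lebesgue. x \<in> {x. x \<notin> {z<..<b} \<inter> deriv P -` {0<..}}"
        using C
      proof eventually_elim
        case (elim x)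
        show ?case
        proof
          assume x: "x \<in> {z<..<b} \<inter> deriv P -` {0<..}"
          then have "deriv P x < \<epsilon>" "deriv P x > 0"
            using d(2)[of x] b by (auto simp: dist_real_def)
          then have "1 / deriv P x > \<bar>C\<bar> + 1" by (simp add: \<epsilon>_def field_simps)
          moreover have "\<bar>1 / deriv P x\<bar> \<le> C" using elim x z b by auto
          ultimately show "x \<in> {x. x \<notin> {z<..<b} \<inter> deriv P -` {0<..}}" by linarith
        qed
      qed
      have "y \<in> {x. x \<notin> {z<..<b} \<inter> deriv P -` {0<..}}"
        by (rule mem_closed_if_AE_lebesgue_open[OF op that ae]) (use y \<open>deriv P y > 0\<close> in auto)
      then show ?thesis using y \<open>deriv P y > 0\<close> by auto
    qed
    moreover have "closed {x. x \<notin> {z<..<b} \<inter> deriv P -` {0<..}}"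
      using closed_Compl[OF op] by (simp only: Compl_eq)
    ultimately have "\<bar>1 / deriv P y\<bar> \<le> C" by auto
    moreover have "deriv P y < \<epsilon>" using d(2)[of y] y b by (auto simp: dist_real_def)
    then have "1 / deriv P y > \<bar>C\<bar> + 1" using \<open>deriv P y > 0\<close> by (simp add: \<epsilon>_def field_simps)
    ultimately show False by linarith
  qed
  then show ?thesis using nonneg[OF z] by simp
qed

lemma enthalpy_has_deriv:
  assumes P: "pressure_law P" and z: "z > 0"
  shows "(enthalpy P has_real_derivative deriv P z / z) (at z)"
proof -
  have sm: "C_inf_on {0<..} P" using P by (auto simp: pressure_law_def)
  define a b where "a = min 1 z / 2" and "b = max 1 z + 1"
  have ab: "0 < a" "a < 1" "a < z" "z < b" "1 < b" using z by (auto simp: a_def b_def min_def)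
  have "continuous_on {a..b} (\<lambda>r. deriv P r / r)"
    by (intro continuous_intros continuous_on_subset[OF C_inf_on_continuous_on[OF C_inf_on_deriv[OF sm]]]) (use ab in auto)
  then have "((\<lambda>u. LBINT y=ereal 1..ereal u. deriv P y / y) has_vector_derivative deriv P z / z) (at z within {a..b})"
    by (rule interval_integral_FTC2[rotated 2]) (use ab in auto)
  then show ?thesis
    using ab at_within_Icc_at[of a z b]
    by (simp add: has_real_derivative_iff_has_vector_derivative enthalpy_def[abs_def])
qed

text \<open>The enthalpy has a positive derivative.\<close>

lemma enthalpy_inj_on:
  assumes P: "pressure_law P"
  shows "inj_on (enthalpy P) {0<..}"
proof -
  have "strict_mono_on {0<..} (enthalpy P)"
  proof (rule strict_mono_onI)
    fix x y :: real assume xy: "x \<in> {0<..}" "y \<in> {0<..}" "x < y"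
    show "enthalpy P x < enthalpy P y"
    proof (rule DERIV_pos_imp_increasing[OF xy(3)])
      fix w assume "x \<le> w" "w \<le> y"
      then show "\<exists>D. (enthalpy P has_real_derivative D) (at w) \<and> 0 < D"
        using enthalpy_has_deriv[OF P, of w] pressure_law_deriv_pos[OF P, of w] xy(1)
        by (intro exI[of _ "deriv P w / w"]) auto
    qed
  qed
  then show ?thesis by (rule strict_mono_on_imp_inj_on)
qed

definition profile :: "(real \<Rightarrow> real) \<Rightarrow> real \<Rightarrow> real \<Rightarrow> real \<Rightarrow> real" where
  "profile P d g z = inv_into {0<..} (enthalpy P) (enthalpy P d - g * z)"

text \<open>Since the enthalpy is an open map, the profile extends smoothly beyond the closed interval.\<close>

lemma profile_smooth:
  assumes P: "pressure_law P" and d: "d > 0" and g: "g > 0"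
    and ends: "enthalpy P d - g * lo \<in> enthalpy P ` {0<..}" "enthalpy P d - g * hi \<in> enthalpy P ` {0<..}"
  obtains T where "open T" "{lo..hi} \<subseteq> T" "C_inf_on T (profile P d g)"
    "\<And>z. z \<in> T \<Longrightarrow> profile P d g z > 0"
    "\<And>z. z \<in> T \<Longrightarrow> (profile P d g has_real_derivative - g * profile P d g z / deriv P (profile P d g z)) (at z)"
    "profile P d g 0 = d"
proof -
  let ?h = "enthalpy P" and ?r = "profile P d g"
  have sm: "C_inf_on {0<..} P" using P by (auto simp: pressure_law_def)
  have hc: "continuous_on {0<..} ?h"
    using DERIV_isCont[OF enthalpy_has_deriv[OF P]] by (intro continuous_at_imp_continuous_on) simp
  have inj: "inj_on ?h {0<..}" by (rule enthalpy_inj_on[OF P])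
  have op: "open (?h ` {0<..})" by (rule invariance_of_domain[OF hc _ inj]) auto
  define T where "T = (\<lambda>z. ?h d - g * z) -` (?h ` {0<..})"
  have T: "open T"
    unfolding T_def by (rule open_vimage[OF op]) (intro continuous_intros)
  have conn: "connected (?h ` {0<..})"
    by (rule connected_continuous_image[OF hc]) auto
  have sub: "{lo..hi} \<subseteq> T"
  proof
    fix z assume z: "z \<in> {lo..hi}"
    have "?h d - g * z \<in> ?h ` {0<..}"
      by (rule connectedD_interval[OF conn ends(2,1)]) (use z g in auto)
    then show "z \<in> T" by (simp add: T_def)
  qed
  have pos: "?r z > 0" and inv: "?h (?r z) = ?h d - g * z" if "z \<in> T" for z
    using that inv_into_into[of "?h d - g * z" ?h "{0<..}"] f_inv_into_f[of "?h d - g * z" ?h "{0<..}"]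
    by (auto simp: T_def profile_def)
  have der: "(?r has_real_derivative - g * ?r z / deriv P (?r z)) (at z)" if z: "z \<in> T" for z
  proof -
    have pd: "deriv P (?r z) > 0" by (rule pressure_law_deriv_pos[OF P pos[OF z]])
    have "(inv_into {0<..} ?h has_real_derivative inverse (deriv P (?r z) / ?r z)) (at (?h (?r z)))"
      unfolding has_field_derivative_def
    proof (rule has_derivative_inverse_strong[of "{0<..}" "?r z" ?h _ "(*) (deriv P (?r z) / ?r z)"])
      show "(?h has_derivative (*) (deriv P (?r z) / ?r z)) (at (?r z))"
        using enthalpy_has_deriv[OF P pos[OF z]] by (simp add: has_field_derivative_def)
      show "(*) (deriv P (?r z) / ?r z) \<circ> (*) (inverse (deriv P (?r z) / ?r z)) = id"
        using pd pos[OF z] by (auto simp: fun_eq_iff)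
    qed (use pos[OF z] hc inj in auto)
    then have d1: "(inv_into {0<..} ?h has_real_derivative inverse (deriv P (?r z) / ?r z)) (at (?h d - g * z))"
      by (simp add: inv[OF z])
    have d2: "((\<lambda>z. ?h d - g * z) has_real_derivative - g) (at z)"
      by (auto intro!: derivative_eq_intros)
    have "((\<lambda>z. inv_into {0<..} ?h (?h d - g * z)) has_real_derivative inverse (deriv P (?r z) / ?r z) * - g) (at z)"
      by (rule DERIV_chain2[OF d1 d2])
    then show ?thesis
      by (simp add: profile_def[abs_def] mult.commute)
  qed
  have "C_inf_on T ?r"
  proof (rule C_inf_on_ode[OF T, of ?r "{0<..}" "\<lambda>y. - g * y / deriv P y"])
    show "C_inf_on {0<..} (\<lambda>y. - g * y / deriv P y)"
      by (intro C_inf_on_divide C_inf_on_mult C_inf_on_const C_inf_on_id C_inf_on_deriv sm)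
         (use pressure_law_deriv_pos[OF P] in \<open>auto simp: less_imp_neq[symmetric]\<close>)
  qed (use pos der in auto)
  moreover have "?r 0 = d"
    using inv_into_f_f[OF inj, of d] d by (simp add: profile_def)
  ultimately show ?thesis using that[OF T sub] pos der by blast
qed

lemma rho0_eq_profile:
  "rho0 c z = (if z < 0 then profile (Pm c) (rhom c) (grav c) z else profile (Pp c) (rhop c) (grav c) z)"
  by (simp add: rho0_def profile_def)

text \<open>Both fluids have the same pressure at the interface, where the lower one would have the larger
  pressure at equal density; hence the upper one is denser there. This is the source of the instability.\<close>

lemma rhop_properties:
  assumes "standing c"
  shows "rhom c > 0" "rhop c > 0" "rho_jump c > 0"
proof -
  have a: "rhom c > 0" "Pm c (rhom c) > Pp c (rhom c)" "Pm c (rhom c) \<in> Pp c ` {0<..}"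
    and mono: "strict_mono_on {0<..} (Pp c)"
    using assms by (auto simp: standing_def admissible_densities_def pressure_law_def)
  show "rhom c > 0" by (rule a)
  show p: "rhop c > 0"
    using inv_into_into[OF a(3)] by (simp add: rhop_def)
  have "Pp c (rhop c) = Pm c (rhom c)"
    using f_inv_into_f[OF a(3)] by (simp add: rhop_def)
  then have "Pp c (rhom c) < Pp c (rhop c)" using a by simp
  then have "\<not> rhop c \<le> rhom c"
    using mono p a(1) strict_mono_onD[OF mono, of "rhop c" "rhom c"] by (cases "rhop c = rhom c") auto
  then show "rho_jump c > 0" by (simp add: rho_jump_def)
qed

text \<open>On either closed layer the coefficients of the problem extend to smooth functions on a
  neighbourhood of the layer, with the same signs.\<close>

definition layer_coeffs :: "params \<Rightarrow> real set \<Rightarrow> (real \<Rightarrow> real) \<Rightarrow> (real \<Rightarrow> real) \<Rightarrow> (real \<Rightarrow> real) \<Rightarrow> (real \<Rightarrow> real) \<Rightarrow> bool" where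
  "layer_coeffs c T \<rho> Q e d \<longleftrightarrow> open T \<and> C_inf_on T \<rho> \<and> C_inf_on T Q \<and> C_inf_on T e \<and> C_inf_on T d \<and>
     (\<forall>z\<in>T. \<rho> z > 0 \<and> Q z > 0 \<and> e z > 0 \<and> d z \<ge> 0 \<and> (\<rho> has_real_derivative - grav c * \<rho> z / Q z) (at z))"

lemma layer_coeffs_exist:
  assumes P: "pressure_law P" and v: "viscosities e d" and r: "r > 0" and g: "grav c > 0"
    and ends: "enthalpy P r - grav c * lo \<in> enthalpy P ` {0<..}" "enthalpy P r - grav c * hi \<in> enthalpy P ` {0<..}"
  defines "\<rho> \<equiv> profile P r (grav c)"
  shows "\<exists>T. {lo..hi} \<subseteq> T \<and> \<rho> 0 = r \<and>
    layer_coeffs c T \<rho> (\<lambda>z. deriv P (\<rho> z)) (\<lambda>z. e (\<rho> z)) (\<lambda>z. d (\<rho> z))"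
proof -
  obtain T where T: "open T" "{lo..hi} \<subseteq> T" "C_inf_on T \<rho>" "\<And>z. z \<in> T \<Longrightarrow> \<rho> z > 0"
    "\<And>z. z \<in> T \<Longrightarrow> (\<rho> has_real_derivative - grav c * \<rho> z / deriv P (\<rho> z)) (at z)" "\<rho> 0 = r"
    unfolding \<rho>_def using profile_smooth[OF P r g ends] by blast
  have sm: "C_inf_on {0<..} (deriv P)" "C_inf_on {0<..} e" "C_inf_on {0<..} d"
    using P v by (auto simp: pressure_law_def viscosities_def intro: C_inf_on_deriv)
  have comp: "C_inf_on T (\<lambda>z. f (\<rho> z))" if "C_inf_on {0<..} f" for f
    by (rule C_inf_on_compose[OF T(1) _ that T(3)]) (use T(4) in auto)
  have "e (\<rho> z) > 0 \<and> d (\<rho> z) \<ge> 0" if "z \<in> T" for z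
    using v T(4)[OF that] by (simp add: viscosities_def)
  then show ?thesis
    using T comp[OF sm(1)] comp[OF sm(2)] comp[OF sm(3)] pressure_law_deriv_pos[OF P T(4)]
    by (intro exI[of _ T]) (simp add: layer_coeffs_def)
qed

lemma upper_coeffs:
  assumes s: "standing c"
  obtains T \<rho> Q e d where "{0..height c} \<subseteq> T" "\<rho> 0 = rhop c" "layer_coeffs c T \<rho> Q e d"
    "\<And>z. z \<ge> 0 \<Longrightarrow> rho0 c z = \<rho> z \<and> dP0 c z = Q z \<and> eps0 c z = e z \<and> del0 c z = d z"
proof -
  have "\<exists>T. {0..height c} \<subseteq> T \<and> profile (Pp c) (rhop c) (grav c) 0 = rhop c \<and>
    layer_coeffs c T (profile (Pp c) (rhop c) (grav c)) (\<lambda>z. deriv (Pp c) (profile (Pp c) (rhop c) (grav c) z))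
      (\<lambda>z. epsp c (profile (Pp c) (rhop c) (grav c) z)) (\<lambda>z. delp c (profile (Pp c) (rhop c) (grav c) z))"
    by (rule layer_coeffs_exist) (use s rhop_properties[OF s] in \<open>auto simp: standing_def\<close>)
  then show ?thesis using that by (auto simp: rho0_eq_profile dP0_def eps0_def del0_def)
qed

lemma lower_coeffs:
  assumes s: "standing c"
  obtains T \<rho> Q e d where "{- depth c..0} \<subseteq> T" "\<rho> 0 = rhom c" "layer_coeffs c T \<rho> Q e d"
    "\<And>z. z < 0 \<Longrightarrow> rho0 c z = \<rho> z \<and> dP0 c z = Q z \<and> eps0 c z = e z \<and> del0 c z = d z"
proof -
  have "\<exists>T. {- depth c..0} \<subseteq> T \<and> profile (Pm c) (rhom c) (grav c) 0 = rhom c \<and>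
    layer_coeffs c T (profile (Pm c) (rhom c) (grav c)) (\<lambda>z. deriv (Pm c) (profile (Pm c) (rhom c) (grav c) z))
      (\<lambda>z. epsm c (profile (Pm c) (rhom c) (grav c) z)) (\<lambda>z. delm c (profile (Pm c) (rhom c) (grav c) z))"
    by (rule layer_coeffs_exist) (use s rhop_properties[OF s] in \<open>auto simp: standing_def\<close>)
  then show ?thesis using that by (auto simp: rho0_eq_profile dP0_def eps0_def del0_def)
qed

section \<open>The energy as a quadratic form\<close>

definition bdd_meas :: "params \<Rightarrow> (real \<Rightarrow> real) \<Rightarrow> bool" where
  "bdd_meas c k \<longleftrightarrow> k \<in> borel_measurable (lebesgue_on {- depth c<..<height c}) \<and> bounded (k ` {- depth c<..<height c})"

lemma piecewise_continuous_bdd_meas: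
  assumes f: "continuous_on {- depth c..0} f1" "continuous_on {0..height c} f2"
    and eq: "\<And>z. z < 0 \<Longrightarrow> f z = f1 z" "\<And>z. z \<ge> 0 \<Longrightarrow> f z = f2 z"
  shows "bdd_meas c f"
proof -
  let ?I = "{- depth c<..<height c}" and ?L = "{- depth c<..<min 0 (height c)}" and ?U = "{0..<height c} \<inter> {- depth c<..}"
  have "(\<lambda>z. indicator ?L z *\<^sub>R f1 z) \<in> borel_measurable borel"
    by (rule borel_measurable_continuous_on_indicator[OF _ continuous_on_subset[OF f(1)]]) auto
  moreover have "(\<lambda>z. indicator ?U z *\<^sub>R f2 z) \<in> borel_measurable borel"
    by (rule borel_measurable_continuous_on_indicator[OF _ continuous_on_subset[OF f(2)]]) auto
  ultimately have "(\<lambda>z. indicator ?L z *\<^sub>R f1 z + indicator ?U z *\<^sub>R f2 z) \<in> borel_measurable borel"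
    by (rule borel_measurable_add)
  moreover have "indicat_real ?I z *\<^sub>R f z = indicator ?L z *\<^sub>R f1 z + indicator ?U z *\<^sub>R f2 z" for z
    using eq by (auto simp: indicator_def)
  ultimately have "(\<lambda>z. indicat_real ?I z *\<^sub>R f z) \<in> borel_measurable lborel" by simp
  then have "f \<in> borel_measurable (lebesgue_on ?I)"
    unfolding set_borel_measurable_lebesgue_on[symmetric] set_borel_measurable_def by (rule measurable_completion)
  moreover have "bounded (f1 ` {- depth c..0} \<union> f2 ` {0..height c})"
    using f by (intro bounded_Un[THEN iffD2] conjI compact_imp_bounded compact_continuous_image) auto
  then have "bounded (f ` ?I)"
    by (rule bounded_subset) (use eq in \<open>auto simp: image_iff not_less intro: exI, metis atLeastAtMost_iff less_imp_le linorder_not_less\<close>)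
  ultimately show ?thesis by (simp add: bdd_meas_def)
qed

lemma coeffs_bdd_meas:
  assumes s: "standing c"
  shows "bdd_meas c (rho0 c)" "bdd_meas c (dP0 c)" "bdd_meas c (eps0 c)" "bdd_meas c (del0 c)"
    and "\<And>z. z \<in> {- depth c<..<height c} \<Longrightarrow> rho0 c z > 0 \<and> dP0 c z > 0 \<and> eps0 c z > 0 \<and> del0 c z \<ge> 0"
proof -
  obtain T \<rho> Q e d where u: "{0..height c} \<subseteq> T" "layer_coeffs c T \<rho> Q e d"
    "\<And>z. z \<ge> 0 \<Longrightarrow> rho0 c z = \<rho> z \<and> dP0 c z = Q z \<and> eps0 c z = e z \<and> del0 c z = d z"
    using upper_coeffs[OF s] by metis
  obtain T' \<rho>' Q' e' d' where l: "{- depth c..0} \<subseteq> T'" "layer_coeffs c T' \<rho>' Q' e' d'"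
    "\<And>z. z < 0 \<Longrightarrow> rho0 c z = \<rho>' z \<and> dP0 c z = Q' z \<and> eps0 c z = e' z \<and> del0 c z = d' z"
    using lower_coeffs[OF s] by metis
  have cu: "continuous_on {0..height c} k" if "C_inf_on T k" for k
    by (rule continuous_on_subset[OF C_inf_on_continuous_on[OF that] u(1)])
  have cl: "continuous_on {- depth c..0} k" if "C_inf_on T' k" for k
    by (rule continuous_on_subset[OF C_inf_on_continuous_on[OF that] l(1)])
  note U = u(2)[unfolded layer_coeffs_def] and L = l(2)[unfolded layer_coeffs_def]
  show "bdd_meas c (rho0 c)"
    by (rule piecewise_continuous_bdd_meas[of c \<rho>' \<rho>]) (use cu[of \<rho>] cl[of \<rho>'] U L u(3) l(3) in auto)
  show "bdd_meas c (dP0 c)"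
    by (rule piecewise_continuous_bdd_meas[of c Q' Q]) (use cu[of Q] cl[of Q'] U L u(3) l(3) in auto)
  show "bdd_meas c (eps0 c)"
    by (rule piecewise_continuous_bdd_meas[of c e' e]) (use cu[of e] cl[of e'] U L u(3) l(3) in auto)
  show "bdd_meas c (del0 c)"
    by (rule piecewise_continuous_bdd_meas[of c d' d]) (use cu[of d] cl[of d'] U L u(3) l(3) in auto)
  fix z assume z: "z \<in> {- depth c<..<height c}"
  show "rho0 c z > 0 \<and> dP0 c z > 0 \<and> eps0 c z > 0 \<and> del0 c z \<ge> 0"
  proof (cases "z < 0")
    case True
    then have "z \<in> T'" using l(1) z by auto
    then show ?thesis using l(3)[OF True] L by auto
  next
    case False
    then have "z \<in> T" using u(1) z by auto
    then show ?thesis using u(3)[of z] False U by auto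
  qed
qed

lemma bdd_meas_L2:
  "bdd_meas c k \<Longrightarrow> in_L2 (- depth c) (height c) f \<Longrightarrow> in_L2 (- depth c) (height c) (\<lambda>z. k z * f z)"
  using L2_bounded_mult unfolding bdd_meas_def by blast

text \<open>The integrand of the energy, in terms of a pair and of its weak derivatives.\<close>

definition dens :: "params \<Rightarrow> real \<Rightarrow> real \<Rightarrow> (real \<Rightarrow> real) \<Rightarrow> (real \<Rightarrow> real) \<Rightarrow> (real \<Rightarrow> real) \<Rightarrow> (real \<Rightarrow> real) \<Rightarrow> real \<Rightarrow> real" where
  "dens c r s f f' p p' z =
     (s * del0 c z + dP0 c z * rho0 c z) * (p' z + r * f z)\<^sup>2 - 2 * grav c * rho0 c z * r * f z * p z
     + s * eps0 c z * ((f' z - r * p z)\<^sup>2 + (p' z - r * f z)\<^sup>2 + 1/3 * (p' z + r * f z)\<^sup>2)"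

text \<open>The polar form of \<open>dens\<close>; the first variation of the energy is its integral.\<close>

definition polar :: "params \<Rightarrow> real \<Rightarrow> real \<Rightarrow> (real \<Rightarrow> real) \<Rightarrow> (real \<Rightarrow> real) \<Rightarrow> (real \<Rightarrow> real) \<Rightarrow> (real \<Rightarrow> real) \<Rightarrow>
    (real \<Rightarrow> real) \<Rightarrow> (real \<Rightarrow> real) \<Rightarrow> (real \<Rightarrow> real) \<Rightarrow> (real \<Rightarrow> real) \<Rightarrow> real \<Rightarrow> real" where
  "polar c r s f f' p p' u u' w w' z =
     (s * del0 c z + dP0 c z * rho0 c z) * (p' z + r * f z) * (w' z + r * u z)
     - grav c * rho0 c z * r * (f z * w z + u z * p z)
     + s * eps0 c z * ((f' z - r * p z) * (u' z - r * w z) + (p' z - r * f z) * (w' z - r * u z)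
                       + 1/3 * (p' z + r * f z) * (w' z + r * u z))"

lemma dens_variation:
  "dens c r s (\<lambda>z. f z + t * u z) (\<lambda>z. f' z + t * u' z) (\<lambda>z. p z + t * w z) (\<lambda>z. p' z + t * w' z) z
   = dens c r s f f' p p' z + 2 * t * polar c r s f f' p p' u u' w w' z + t\<^sup>2 * dens c r s u u' w w' z"
  by (simp add: dens_def polar_def power2_eq_square algebra_simps add_divide_distrib)

lemma dens_eq_polar: "dens c r s f f' p p' = polar c r s f f' p p' f f' p p'"
  by (rule ext) (simp add: dens_def polar_def power2_eq_square field_simps)

lemma polar_integrable:
  assumes s: "standing c"
    and L2: "in_L2 (- depth c) (height c) f" "in_L2 (- depth c) (height c) f'" "in_L2 (- depth c) (height c) p" "in_L2 (- depth c) (height c) p'"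
      "in_L2 (- depth c) (height c) u" "in_L2 (- depth c) (height c) u'" "in_L2 (- depth c) (height c) w" "in_L2 (- depth c) (height c) w'"
  shows "polar c r t f f' p p' u u' w w' absolutely_integrable_on {- depth c<..<height c}"
proof -
  let ?L = "in_L2 (- depth c) (height c)"
  note k = coeffs_bdd_meas(1-4)[OF s]
  have D: "?L (\<lambda>z. p' z + r * f z)" "?L (\<lambda>z. f' z - r * p z)" "?L (\<lambda>z. p' z - r * f z)"
    "?L (\<lambda>z. w' z + r * u z)" "?L (\<lambda>z. u' z - r * w z)" "?L (\<lambda>z. w' z - r * u z)"
    by (intro L2_add L2_diff L2_cmult L2)+
  have *: "(\<lambda>z. t * (del0 c z * (p' z + r * f z)) * (w' z + r * u z) + dP0 c z * (rho0 c z * (p' z + r * f z)) * (w' z + r * u z)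
     - (grav c * r) * ((rho0 c z * f z) * w z + (rho0 c z * u z) * p z)
     + (t * ((eps0 c z * (f' z - r * p z)) * (u' z - r * w z) + (eps0 c z * (p' z - r * f z)) * (w' z - r * u z)
                       + 1/3 * ((eps0 c z * (p' z + r * f z)) * (w' z + r * u z))))) absolutely_integrable_on {- depth c<..<height c}"
    by (intro set_integral_add(1) set_integral_diff(1) set_integrable_mult_right L2_mult_integrable bdd_meas_L2 L2_cmult k L2 D)
  have "polar c r t f f' p p' u u' w w' = (\<lambda>z. t * (del0 c z * (p' z + r * f z)) * (w' z + r * u z) + dP0 c z * (rho0 c z * (p' z + r * f z)) * (w' z + r * u z)
     - (grav c * r) * ((rho0 c z * f z) * w z + (rho0 c z * u z) * p z)
     + (t * ((eps0 c z * (f' z - r * p z)) * (u' z - r * w z) + (eps0 c z * (p' z - r * f z)) * (w' z - r * u z)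
                       + 1/3 * ((eps0 c z * (p' z + r * f z)) * (w' z + r * u z)))))"
    by (rule ext) (simp add: polar_def algebra_simps add_divide_distrib)
  then show ?thesis using * by simp
qed

lemma set_integral_cong_AE_lebesgue:
  fixes f g :: "real \<Rightarrow> real"
  assumes ae: "AE z in lebesgue. z \<in> S \<longrightarrow> f z = g z" and g: "g absolutely_integrable_on S"
  shows "(LINT z:S|lebesgue. f z) = (LINT z:S|lebesgue. g z)"
proof -
  have *: "AE z in lebesgue. indicat_real S z *\<^sub>R g z = indicat_real S z *\<^sub>R f z"
    using ae by eventually_elim (auto simp: indicator_def)
  have gm: "(\<lambda>z. indicat_real S z *\<^sub>R g z) \<in> borel_measurable lebesgue"
    using g by (auto simp: set_integrable_def)
  have fm: "(\<lambda>z. indicat_real S z *\<^sub>R f z) \<in> borel_measurable lebesgue"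
    by (rule borel_measurable_AE[OF gm *])
  show ?thesis
    unfolding set_lebesgue_integral_def by (rule integral_cong_AE[OF fm gm]) (use * in eventually_elim, auto)
qed

text \<open>Both integrals of the definition converge, so they may be merged into one, and the selected weak
  derivatives may be replaced by given ones.\<close>

lemma energy_eq:
  assumes s: "standing c"
    and f: "in_L2 (- depth c) (height c) f" and p: "in_L2 (- depth c) (height c) p"
    and f': "is_weak_deriv 1 (- depth c) (height c) f f'" "in_L2 (- depth c) (height c) f'"
    and p': "is_weak_deriv 1 (- depth c) (height c) p p'" "in_L2 (- depth c) (height c) p'"
  shows "energy c r t f p = surf c * r\<^sup>2 / 2 * (p 0)\<^sup>2 + 1/2 * (LINT z:{- depth c<..<height c}|lebesgue. dens c r t f f' p p' z)"
proof -
  let ?a = "- depth c" and ?b = "height c"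
  let ?L = "in_L2 ?a ?b"
  let ?f = "weak_derivative 1 ?a ?b f" and ?p = "weak_derivative 1 ?a ?b p"
  note k = coeffs_bdd_meas(1-4)[OF s]
  have D: "?L (\<lambda>z. p' z + r * f z)" "?L (\<lambda>z. f' z - r * p z)" "?L (\<lambda>z. p' z - r * f z)"
    by (intro L2_add L2_diff L2_cmult f p f' p')+
  have ae: "AE z in lebesgue. z \<in> {?a<..<?b} \<longrightarrow> ?f z = f' z" "AE z in lebesgue. z \<in> {?a<..<?b} \<longrightarrow> ?p z = p' z"
    by (rule weak_derivative_AE_eq[OF f'(1)], rule weak_derivative_AE_eq[OF p'(1)])
  let ?X = "\<lambda>z. (t * del0 c z + dP0 c z * rho0 c z) * (p' z + r * f z)\<^sup>2 - 2 * grav c * rho0 c z * r * f z * p z"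
  let ?Y = "\<lambda>z. t * eps0 c z * ((f' z - r * p z)\<^sup>2 + (p' z - r * f z)\<^sup>2 + 1/3 * (p' z + r * f z)\<^sup>2)"
  have X: "?X absolutely_integrable_on {?a<..<?b}"
  proof -
    have "(\<lambda>z. t * ((del0 c z * (p' z + r * f z)) * (p' z + r * f z)) + dP0 c z * (rho0 c z * (p' z + r * f z)) * (p' z + r * f z)
     - (2 * grav c * r) * ((rho0 c z * f z) * p z)) absolutely_integrable_on {?a<..<?b}"
      by (intro set_integral_add(1) set_integral_diff(1) set_integrable_mult_right L2_mult_integrable bdd_meas_L2 L2_cmult k f p D)
    moreover have "?X = (\<lambda>z. t * ((del0 c z * (p' z + r * f z)) * (p' z + r * f z)) + dP0 c z * (rho0 c z * (p' z + r * f z)) * (p' z + r * f z)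
     - (2 * grav c * r) * ((rho0 c z * f z) * p z))"
      by (rule ext) (simp add: power2_eq_square algebra_simps)
    ultimately show ?thesis by simp
  qed
  have Y: "?Y absolutely_integrable_on {?a<..<?b}"
  proof -
    have "(\<lambda>z. t * ((eps0 c z * (f' z - r * p z)) * (f' z - r * p z) + (eps0 c z * (p' z - r * f z)) * (p' z - r * f z)
                       + 1/3 * ((eps0 c z * (p' z + r * f z)) * (p' z + r * f z)))) absolutely_integrable_on {?a<..<?b}"
      by (intro set_integral_add(1) set_integral_diff(1) set_integrable_mult_right L2_mult_integrable bdd_meas_L2 L2_cmult k f p D)
    moreover have "?Y = (\<lambda>z. t * ((eps0 c z * (f' z - r * p z)) * (f' z - r * p z) + (eps0 c z * (p' z - r * f z)) * (p' z - r * f z)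
                       + 1/3 * ((eps0 c z * (p' z + r * f z)) * (p' z + r * f z))))"
      by (rule ext) (simp add: power2_eq_square algebra_simps add_divide_distrib)
    ultimately show ?thesis by simp
  qed
  have X1: "(LINT z:{?a<..<?b}|lebesgue. (t * del0 c z + dP0 c z * rho0 c z) * (?p z + r * f z)\<^sup>2 - 2 * grav c * rho0 c z * r * f z * p z)
      = (LINT z:{?a<..<?b}|lebesgue. ?X z)"
    by (rule set_integral_cong_AE_lebesgue[OF _ X]) (use ae in eventually_elim, simp)
  have Y1: "(LINT z:{?a<..<?b}|lebesgue. t * eps0 c z * ((?f z - r * p z)\<^sup>2 + (?p z - r * f z)\<^sup>2 + 1/3 * (?p z + r * f z)\<^sup>2))
      = (LINT z:{?a<..<?b}|lebesgue. ?Y z)"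
    by (rule set_integral_cong_AE_lebesgue[OF _ Y]) (use ae in eventually_elim, simp)
  have "(LINT z:{?a<..<?b}|lebesgue. dens c r t f f' p p' z) = (LINT z:{?a<..<?b}|lebesgue. ?X z) + (LINT z:{?a<..<?b}|lebesgue. ?Y z)"
    unfolding dens_def by (rule set_integral_add(2)[OF X Y])
  then show ?thesis
    unfolding energy_def Let_def X1 Y1 by (simp add: algebra_simps)
qed

section \<open>The growth rate as a fixed point\<close>

text \<open>An infimum of affine functions of \<^term>\<open>s\<close> with nonnegative slopes is concave, hence continuous, and
  nondecreasing. Adding \<^term>\<open>s^2\<close> makes it strictly increasing, and the sum changes sign exactly once.\<close>

lemma affine_infimum_fixed_point:
  fixes X :: "'x set" and e0 e1 :: "'x \<Rightarrow> real"
  assumes slope: "\<And>x. x \<in> X \<Longrightarrow> e1 x \<ge> 0" and bound: "\<And>x. x \<in> X \<Longrightarrow> e0 x \<ge> - M"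
    and neg: "x0 \<in> X" "e0 x0 < 0"
  defines "m \<equiv> \<lambda>s. INF x\<in>X. e0 x + s * e1 x"
  shows "\<exists>!s. s > 0 \<and> m s < 0 \<and> s = sqrt (- m s)"
proof -
  have X: "X \<noteq> {}" using neg by auto
  have bdd: "bdd_below ((\<lambda>x. e0 x + s * e1 x) ` X)" if "s \<ge> 0" for s
    unfolding bdd_below_def
  proof (intro exI[of _ "- M"] ballI)
    fix y assume "y \<in> (\<lambda>x. e0 x + s * e1 x) ` X"
    then obtain x where "x \<in> X" "y = e0 x + s * e1 x" by auto
    then show "- M \<le> y" using bound[of x] mult_nonneg_nonneg[OF that slope[of x]] by auto
  qed
  have low: "m s \<le> e0 x + s * e1 x" if "s \<ge> 0" "x \<in> X" for s x
    unfolding m_def by (rule cINF_lower[OF bdd[OF that(1)] that(2)])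
  have great: "k \<le> m s" if "\<And>x. x \<in> X \<Longrightarrow> k \<le> e0 x + s * e1 x" for k s
    unfolding m_def by (rule cINF_greatest[OF X that])
  have mono: "m s \<le> m t" if "0 \<le> s" "s \<le> t" for s t
  proof (rule great)
    fix x assume x: "x \<in> X"
    then have "s * e1 x \<le> t * e1 x" by (intro mult_right_mono that slope)
    then show "m s \<le> e0 x + t * e1 x" using low[OF that(1) x] by simp
  qed
  have "convex_on {0<..} (\<lambda>s. - m s)"
  proof (intro convex_onI)
    fix t x y :: real assume t: "0 < t" "t < 1" and xy: "x \<in> {0<..}" "y \<in> {0<..}"
    have "(1 - t) * m x + t * m y \<le> m ((1 - t) * x + t * y)"
    proof (rule great)
      fix z assume z: "z \<in> X"
      have "(1 - t) * m x + t * m y \<le> (1 - t) * (e0 z + x * e1 z) + t * (e0 z + y * e1 z)"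
        by (intro add_mono mult_left_mono low z) (use t xy in auto)
      then show "(1 - t) * m x + t * m y \<le> e0 z + ((1 - t) * x + t * y) * e1 z"
        by (simp add: algebra_simps)
    qed
    then show "- m ((1 - t) *\<^sub>R x + t *\<^sub>R y) \<le> (1 - t) * - m x + t * - m y" by simp
  qed simp
  then have "continuous_on {0<..} (\<lambda>s. - m s)" by (rule convex_on_continuous[rotated]) simp
  then have mc: "continuous_on {0<..} m" using continuous_on_minus[of "{0<..}" "\<lambda>s. - m s"] by simp
  (* small enough for the negative number e0 x0 to dominate s * e1 x0 + s^2 *)
  define s0 where "s0 = min 1 (- e0 x0 / (2 * (e1 x0 + 1)))"
  have e1: "e1 x0 \<ge> 0" by (rule slope[OF neg(1)])
  have "- e0 x0 / (2 * (e1 x0 + 1)) > 0" using neg(2) e1 by (intro divide_pos_pos) auto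
  then have s0: "0 < s0" "s0 \<le> 1" by (auto simp: s0_def)
  have "s0\<^sup>2 \<le> s0" using s0 by (simp add: power2_eq_square mult_left_le)
  moreover have "s0 \<le> - e0 x0 / (2 * (e1 x0 + 1))" by (simp add: s0_def)
  then have "s0 * (2 * (e1 x0 + 1)) \<le> - e0 x0"
    using e1 by (subst (asm) pos_le_divide_eq) auto
  then have "2 * (s0 * e1 x0) + 2 * s0 \<le> - e0 x0" by (simp add: algebra_simps)
  ultimately have "s0\<^sup>2 + m s0 < 0" using low[of s0 x0] s0 neg by simp
  (* large enough for s^2 to dominate the lower bound - M *)
  define s1 where "s1 = \<bar>M\<bar> + 1"
  have "s1 \<le> s1\<^sup>2" by (rule self_le_power) (auto simp: s1_def)
  then have "\<bar>M\<bar> < s1\<^sup>2" by (simp add: s1_def)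
  moreover have "m s1 \<ge> - M"
    by (rule great) (use bound slope in \<open>auto simp: s1_def intro!: add_increasing2 mult_nonneg_nonneg\<close>)
  ultimately have "s1\<^sup>2 + m s1 > 0" by linarith
  have "\<exists>s\<ge>s0. s \<le> s1 \<and> s\<^sup>2 + m s = 0"
  proof (rule IVT')
    show "continuous_on {s0..s1} (\<lambda>s. s\<^sup>2 + m s)"
      by (intro continuous_intros continuous_on_subset[OF mc]) (use s0 in auto)
  qed (use \<open>s0\<^sup>2 + m s0 < 0\<close> \<open>s1\<^sup>2 + m s1 > 0\<close> s0 in \<open>auto simp: s1_def\<close>)
  then obtain s where s: "s \<ge> s0" "s\<^sup>2 + m s = 0" by auto
  have char: "t\<^sup>2 + m t = 0" if "t > 0 \<and> m t < 0 \<and> t = sqrt (- m t)" for t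
    using that real_sqrt_pow2[of "- m t"] by simp
  show ?thesis
  proof (rule ex1I[of _ s])
    have "- m s = s\<^sup>2" "s > 0" using s s0 by auto
    then show "s > 0 \<and> m s < 0 \<and> s = sqrt (- m s)" by (simp add: s(2)) (smt (verit) zero_less_power)
    fix t assume t: "t > 0 \<and> m t < 0 \<and> t = sqrt (- m t)"
    show "t = s"
    proof (rule ccontr)
      assume "t \<noteq> s"
      moreover have "x\<^sup>2 + m x < y\<^sup>2 + m y" if "0 < x" "x < y" for x y
        using mono[of x y] that power_strict_mono[of x y 2] by simp
      ultimately show False using char[OF t] s s0 t by (metis less_irrefl less_le_trans linorder_neqE_linordered_idom)
    qed
  qed
qed

lemma H10_facts:
  assumes s: "standing c" and f: "f \<in> H10 (- depth c) (height c)"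
  obtains f' where "in_L2 (- depth c) (height c) f" "is_weak_deriv 1 (- depth c) (height c) f f'" "in_L2 (- depth c) (height c) f'"
    "\<And>z. z \<in> {- depth c..height c} \<Longrightarrow> f z = integral {- depth c..z} f'" "f (height c) = 0"
proof -
  have "- depth c < height c" using s by (simp add: standing_def)
  then show ?thesis
    using H10_antiderivative[OF _ f] that L2_continuous[OF H10_continuous[OF f]] by metis
qed

definition massd :: "params \<Rightarrow> (real \<Rightarrow> real) \<Rightarrow> (real \<Rightarrow> real) \<Rightarrow> real \<Rightarrow> real" where
  "massd c f p z = rho0 c z * ((f z)\<^sup>2 + (p z)\<^sup>2)"

lemma massd_integrable:
  assumes s: "standing c" and L2: "in_L2 (- depth c) (height c) f" "in_L2 (- depth c) (height c) p"
  shows "massd c f p absolutely_integrable_on {- depth c<..<height c}"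
proof -
  have "(\<lambda>z. (rho0 c z * f z) * f z + (rho0 c z * p z) * p z) absolutely_integrable_on {- depth c<..<height c}"
    by (intro set_integral_add(1) L2_mult_integrable bdd_meas_L2 L2 coeffs_bdd_meas(1)[OF s])
  moreover have "massd c f p = (\<lambda>z. (rho0 c z * f z) * f z + (rho0 c z * p z) * p z)"
    by (rule ext) (simp add: massd_def power2_eq_square algebra_simps)
  ultimately show ?thesis by simp
qed

lemma Jfun_eq: "Jfun c f p = 1/2 * (LINT z:{- depth c<..<height c}|lebesgue. massd c f p z)"
  by (simp add: Jfun_def massd_def)

lemma dens_affine: "dens c r s f f' p p' z = dens c r 0 f f' p p' z + s * (dens c r 1 f f' p p' z - dens c r 0 f f' p p' z)"
  by (simp add: dens_def algebra_simps)

lemma dens_slope_nonneg: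
  assumes "standing c" "z \<in> {- depth c<..<height c}"
  shows "dens c r 1 f f' p p' z - dens c r 0 f f' p p' z \<ge> 0"
proof -
  have k: "eps0 c z > 0" "del0 c z \<ge> 0" using coeffs_bdd_meas(5)[OF assms] by auto
  have "dens c r 1 f f' p p' z - dens c r 0 f f' p p' z = del0 c z * (p' z + r * f z)\<^sup>2
     + eps0 c z * ((f' z - r * p z)\<^sup>2 + (p' z - r * f z)\<^sup>2 + 1/3 * (p' z + r * f z)\<^sup>2)"
    by (simp add: dens_def algebra_simps)
  also have "\<dots> \<ge> 0" using k by (intro add_nonneg_nonneg mult_nonneg_nonneg) auto
  finally show ?thesis .
qed

text \<open>Without viscosity only the gravity term can be negative, and \<open>2 \<phi> \<psi> \<le> \<phi>\<^sup>2 + \<psi>\<^sup>2\<close>.\<close>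

lemma dens_lower_bound:
  assumes "standing c" "z \<in> {- depth c<..<height c}" "r > 0"
  shows "dens c r 0 f f' p p' z \<ge> - (grav c * r) * massd c f p z"
proof -
  have k: "rho0 c z > 0" "dP0 c z > 0" "grav c > 0" using coeffs_bdd_meas(5)[OF assms(1,2)] assms(1) by (auto simp: standing_def)
  have "grav c * r * rho0 c z * ((f z - p z)\<^sup>2) \<ge> 0" using k assms(3) by auto
  moreover have "dP0 c z * rho0 c z * (p' z + r * f z)\<^sup>2 \<ge> 0" using k by auto
  ultimately show ?thesis
    by (simp add: dens_def massd_def power2_eq_square algebra_simps)
qed

text \<open>The first part is the affine dependence on the viscosity parameter, the second part bounds the
  infimum from below uniformly in that parameter.\<close>

lemma energy_lower_bound:
  assumes s: "standing c" and r: "r > 0"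
    and f: "f \<in> H10 (- depth c) (height c)" and p: "p \<in> H10 (- depth c) (height c)"
  shows "\<exists>e1\<ge>0. \<forall>t. energy c r t f p = energy c r 0 f p + t * e1" and "energy c r 0 f p \<ge> - (grav c * r) * Jfun c f p"
proof -
  let ?I = "{- depth c<..<height c}"
  obtain f' where f': "in_L2 (- depth c) (height c) f" "is_weak_deriv 1 (- depth c) (height c) f f'" "in_L2 (- depth c) (height c) f'"
    using H10_facts[OF s f] by metis
  obtain p' where p': "in_L2 (- depth c) (height c) p" "is_weak_deriv 1 (- depth c) (height c) p p'" "in_L2 (- depth c) (height c) p'"
    using H10_facts[OF s p] by metis
  note E = energy_eq[OF s f'(1) p'(1) f'(2,3) p'(2,3)]
  have di: "dens c r t f f' p p' absolutely_integrable_on ?I" for t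
    unfolding dens_eq_polar by (rule polar_integrable[OF s f'(1,3) p'(1,3) f'(1,3) p'(1,3)])
  let ?D = "\<lambda>z. dens c r 1 f f' p p' z - dens c r 0 f f' p p' z"
  have Di: "?D absolutely_integrable_on ?I" by (intro set_integral_diff(1) di)
  have mi: "massd c f p absolutely_integrable_on ?I" by (rule massd_integrable[OF s f'(1) p'(1)])
  show "\<exists>e1\<ge>0. \<forall>t. energy c r t f p = energy c r 0 f p + t * e1"
  proof (intro exI[of _ "1/2 * (LINT z:?I|lebesgue. ?D z)"] conjI allI)
    have "(LINT z:?I|lebesgue. ?D z) \<ge> 0"
      unfolding set_lebesgue_integral_def
      using dens_slope_nonneg[OF s, of _ r f f' p p'] by (intro integral_nonneg_AE AE_I2) (auto simp: indicator_def)
    then show "0 \<le> 1/2 * (LINT z:?I|lebesgue. ?D z)" by simp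
    fix t
    have "(LINT z:?I|lebesgue. dens c r t f f' p p' z) = (LINT z:?I|lebesgue. dens c r 0 f f' p p' z + t * ?D z)"
      by (subst dens_affine) simp
    also have "\<dots> = (LINT z:?I|lebesgue. dens c r 0 f f' p p' z) + t * (LINT z:?I|lebesgue. ?D z)"
      by (subst set_integral_add(2)) (auto intro!: di set_integrable_mult_right Di)
    finally show "energy c r t f p = energy c r 0 f p + t * (1/2 * (LINT z:?I|lebesgue. ?D z))"
      unfolding E by (simp add: algebra_simps)
  qed
  have "(LINT z:?I|lebesgue. - (grav c * r) * massd c f p z) \<le> (LINT z:?I|lebesgue. dens c r 0 f f' p p' z)"
    by (intro set_integral_mono set_integrable_mult_right mi di dens_lower_bound s r)
  moreover have "(LINT z:?I|lebesgue. - (grav c * r) * massd c f p z) = - (grav c * r) * (LINT z:?I|lebesgue. massd c f p z)"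
    by (simp only: set_integral_mult_right)
  moreover have "(LINT z:?I|lebesgue. massd c f p z) = 2 * Jfun c f p" by (simp add: Jfun_eq)
  ultimately have "(LINT z:?I|lebesgue. dens c r 0 f f' p p' z) \<ge> - (grav c * r) * (2 * Jfun c f p)" by simp
  moreover have "surf c * r\<^sup>2 / 2 * (p 0)\<^sup>2 \<ge> 0" using s by (simp add: standing_def)
  ultimately show "energy c r 0 f p \<ge> - (grav c * r) * Jfun c f p" unfolding E by linarith
qed

lemma Jfun_scale: "Jfun c (\<lambda>z. k * f z) (\<lambda>z. k * p z) = k\<^sup>2 * Jfun c f p"
proof -
  have "massd c (\<lambda>z. k * f z) (\<lambda>z. k * p z) z = k\<^sup>2 * massd c f p z" for z
    by (simp add: massd_def power_mult_distrib algebra_simps)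
  then show ?thesis by (simp add: Jfun_eq)
qed

lemma energy_scale:
  assumes s: "standing c" and f: "f \<in> H10 (- depth c) (height c)" and p: "p \<in> H10 (- depth c) (height c)"
  shows "energy c r t (\<lambda>z. k * f z) (\<lambda>z. k * p z) = k\<^sup>2 * energy c r t f p"
proof -
  obtain f' where f': "in_L2 (- depth c) (height c) f" "is_weak_deriv 1 (- depth c) (height c) f f'" "in_L2 (- depth c) (height c) f'"
    using H10_facts[OF s f] by metis
  obtain p' where p': "in_L2 (- depth c) (height c) p" "is_weak_deriv 1 (- depth c) (height c) p p'" "in_L2 (- depth c) (height c) p'"
    using H10_facts[OF s p] by metis
  have E: "energy c r t (\<lambda>z. k * f z) (\<lambda>z. k * p z) = surf c * r\<^sup>2 / 2 * (k * p 0)\<^sup>2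
      + 1/2 * (LINT z:{- depth c<..<height c}|lebesgue. dens c r t (\<lambda>z. k * f z) (\<lambda>z. k * f' z) (\<lambda>z. k * p z) (\<lambda>z. k * p' z) z)"
    by (rule energy_eq[OF s]) (intro L2_cmult is_weak_deriv_cmult f' p')+
  have "dens c r t (\<lambda>z. k * f z) (\<lambda>z. k * f' z) (\<lambda>z. k * p z) (\<lambda>z. k * p' z) z = k\<^sup>2 * dens c r t f f' p p' z" for z
    by (simp add: dens_def power2_eq_square algebra_simps add_divide_distrib)
  then have "(LINT z:{- depth c<..<height c}|lebesgue. dens c r t (\<lambda>z. k * f z) (\<lambda>z. k * f' z) (\<lambda>z. k * p z) (\<lambda>z. k * p' z) z)
      = k\<^sup>2 * (LINT z:{- depth c<..<height c}|lebesgue. dens c r t f f' p p' z)"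
    by (simp only: set_integral_mult_right)
  then show ?thesis
    unfolding E energy_eq[OF s f'(1) p'(1) f'(2,3) p'(2,3)] by (simp add: power_mult_distrib algebra_simps)
qed

text \<open>Normalization turns the minimization over \<^term>\<open>admissible_set c\<close> into a homogeneous inequality.\<close>

lemma normalize_admissible:
  assumes "standing c" "f \<in> H10 (- depth c) (height c)" "p \<in> H10 (- depth c) (height c)" "Jfun c f p > 0"
  defines "k \<equiv> 1 / sqrt (Jfun c f p)"
  shows "((\<lambda>z. k * f z), (\<lambda>z. k * p z)) \<in> admissible_set c"
    and "energy c r t (\<lambda>z. k * f z) (\<lambda>z. k * p z) = energy c r t f p / Jfun c f p"
proof -
  have k: "k\<^sup>2 = 1 / Jfun c f p" using assms(4) by (simp add: k_def power_divide)
  have "- depth c < height c" using assms(1) by (simp add: standing_def)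
  then show "((\<lambda>z. k * f z), (\<lambda>z. k * p z)) \<in> admissible_set c"
    using assms(4) by (simp add: admissible_set_def H10_cmult assms(2,3) Jfun_scale k)
  show "energy c r t (\<lambda>z. k * f z) (\<lambda>z. k * p z) = energy c r t f p / Jfun c f p"
    by (simp add: energy_scale[OF assms(1-3)] k)
qed

text \<open>The integrand is half the derivative of \<open>\<rho> w\<^sup>2\<close> up to the term \<open>\<rho>' w\<^sup>2 / 2\<close>, which only sees an interval
  of length \<open>2 / N\<close>.\<close>

lemma side_integral_bound:
  assumes k: "layer_coeffs c T \<rho> Q e d" and sub: "{lo..hi} \<subseteq> T" and lh: "lo \<le> hi"
  shows "\<exists>C. \<forall>N w. N > 0 \<longrightarrow> C_inf_on UNIV w \<longrightarrow> (\<forall>z. \<bar>w z\<bar> \<le> 1) \<longrightarrow> (\<forall>z. z \<notin> {- (1/N)..1/N} \<longrightarrow> w z = 0) \<longrightarrow>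
     integral {lo..hi} (\<lambda>z. \<rho> z * (deriv w z * w z)) \<le> (\<rho> hi * (w hi)\<^sup>2 - \<rho> lo * (w lo)\<^sup>2) / 2 + C / N"
proof -
  have sm: "C_inf_on T \<rho>" using k by (simp add: layer_coeffs_def)
  have dc: "continuous_on {lo..hi} (deriv \<rho>)" and rc: "continuous_on {lo..hi} \<rho>"
    by (rule continuous_on_subset[OF C_inf_on_continuous_on sub], intro C_inf_on_deriv sm)+
  have "bounded (deriv \<rho> ` {lo..hi})"
    by (intro compact_imp_bounded compact_continuous_image dc) auto
  then obtain C where C: "\<forall>z\<in>{lo..hi}. \<bar>deriv \<rho> z\<bar> \<le> C" by (auto simp: bounded_iff)
  have C0: "C \<ge> 0" using C lh by (metis abs_ge_zero atLeastAtMost_iff order_refl order_trans)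
  show ?thesis
  proof (intro exI[of _ C] allI impI)
    fix N :: real and w assume N: "N > 0" and w: "C_inf_on UNIV w" and w1: "\<forall>z. \<bar>w z\<bar> \<le> 1"
      and w0: "\<forall>z. z \<notin> {- (1/N)..1/N} \<longrightarrow> w z = 0"
    have wc: "continuous_on S w" "continuous_on S (deriv w)" for S
      using continuous_on_subset[OF C_inf_on_continuous_on[OF w]] continuous_on_subset[OF C_inf_on_continuous_on[OF C_inf_on_deriv[OF w]]] by auto
    let ?F = "\<lambda>z. \<rho> z * (w z)\<^sup>2 / 2"
    have "((\<lambda>z. deriv \<rho> z * (w z)\<^sup>2 / 2 + \<rho> z * (deriv w z * w z)) has_integral (?F hi - ?F lo)) {lo..hi}"
    proof (rule fundamental_theorem_of_calculus[OF lh])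
      fix x assume x: "x \<in> {lo..hi}"
      have "(?F has_real_derivative (deriv \<rho> x * (w x)\<^sup>2 + (2 * w x * deriv w x) * \<rho> x) / 2) (at x)"
        using C_inf_on_has_deriv[OF sm, of x] C_inf_on_has_deriv[OF w, of x] x sub
        by (auto intro!: derivative_eq_intros)
      then show "(?F has_vector_derivative deriv \<rho> x * (w x)\<^sup>2 / 2 + \<rho> x * (deriv w x * w x)) (at x within {lo..hi})"
        unfolding has_real_derivative_iff_has_vector_derivative[symmetric]
        by (rule DERIV_cong[OF has_field_derivative_at_within]) (simp add: field_simps)
    qed
    then have "integral {lo..hi} (\<lambda>z. deriv \<rho> z * (w z)\<^sup>2 / 2 + \<rho> z * (deriv w z * w z)) = ?F hi - ?F lo"
      by (rule integral_unique)
    then have split: "integral {lo..hi} (\<lambda>z. deriv \<rho> z * (w z)\<^sup>2 / 2) + integral {lo..hi} (\<lambda>z. \<rho> z * (deriv w z * w z)) = ?F hi - ?F lo"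
      by (subst (asm) integral_add) (auto intro!: integrable_continuous_real continuous_intros dc rc wc)
    define g where "g z = (if z \<in> {- (1/N)..1/N} then C / 2 else 0)" for z :: real
    have cap: "{lo..hi} \<inter> {- (1/N)..1/N} = {max lo (- (1/N))..min hi (1/N)}" by auto
    have gint: "integral {lo..hi} g = integral ({lo..hi} \<inter> {- (1/N)..1/N}) (\<lambda>z. C / 2)"
      unfolding g_def by (simp only: integral_restrict_Int Int_commute)
    have "g integrable_on {lo..hi}"
      unfolding g_def integrable_restrict_Int[of "{- (1/N)..1/N}" "\<lambda>z. C / 2" "{lo..hi}"] Int_commute[of "{- (1/N)..1/N}"] cap
      by (rule integrable_const_ivl)
    then have "norm (integral {lo..hi} (\<lambda>z. deriv \<rho> z * (w z)\<^sup>2 / 2)) \<le> integral {lo..hi} g"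
    proof (intro integral_norm_bound_integral)
      show "(\<lambda>z. deriv \<rho> z * (w z)\<^sup>2 / 2) integrable_on {lo..hi}"
        by (auto intro!: integrable_continuous_real continuous_intros dc wc)
      fix z assume z: "z \<in> {lo..hi}"
      have "(w z)\<^sup>2 \<le> 1" using w1 by (simp add: abs_square_le_1)
      then have "\<bar>deriv \<rho> z\<bar> * (w z)\<^sup>2 \<le> C * 1" using C z C0 by (intro mult_mono) auto
      then show "norm (deriv \<rho> z * (w z)\<^sup>2 / 2) \<le> g z"
        using w0 by (auto simp: g_def abs_mult)
    qed
    also have "\<dots> \<le> C / N"
    proof -
      have "integral ({lo..hi} \<inter> {- (1/N)..1/N}) (\<lambda>z. C / 2) \<le> integral {- (1/N)..1/N} (\<lambda>z. C / 2)"
        by (rule integral_subset_le) (use C0 cap in auto)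
      also have "\<dots> = C / N" using N by simp
      finally show ?thesis unfolding gint .
    qed
    finally have "- (C / N) \<le> integral {lo..hi} (\<lambda>z. deriv \<rho> z * (w z)\<^sup>2 / 2)" by simp
    then show "integral {lo..hi} (\<lambda>z. \<rho> z * (deriv w z * w z)) \<le> (\<rho> hi * (w hi)\<^sup>2 - \<rho> lo * (w lo)\<^sup>2) / 2 + C / N"
      using split by (simp add: diff_divide_distrib)
  qed
qed

text \<open>Divergence-free pairs, \<^term>\<open>\<psi>' + r * \<phi> = 0\<close>, concentrated at the interface have negative energy
  without viscosity: below the critical frequency, gravity overcomes surface tension there.\<close>

lemma negative_energy_pair:
  assumes s: "standing c" and r: "r > 0" "ereal r < xi_crit c"
  shows "\<exists>(f, p)\<in>admissible_set c. energy c r 0 f p < 0"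
proof -
  let ?a = "- depth c" and ?b = "height c"
  have pos: "grav c > 0" "depth c > 0" "height c > 0" "surf c \<ge> 0" using s by (auto simp: standing_def)
  then have ab: "?a < ?b" by simp
  have crit: "surf c * r\<^sup>2 < grav c * rho_jump c"
  proof (cases "surf c = 0")
    case True
    then show ?thesis using rhop_properties(3)[OF s] pos by simp
  next
    case False
    then have "r < sqrt (grav c * rho_jump c / surf c)" using r by (simp add: xi_crit_def)
    then have "r\<^sup>2 < (sqrt (grav c * rho_jump c / surf c))\<^sup>2" using r by (intro power_strict_mono) auto
    also have "\<dots> = grav c * rho_jump c / surf c" using rhop_properties(3)[OF s] pos by simp
    finally show ?thesis using False pos by (simp add: field_simps)
  qed
  obtain T \<rho> Q e d where u: "{0..height c} \<subseteq> T" "\<rho> 0 = rhop c" "layer_coeffs c T \<rho> Q e d"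
    "\<And>z. z \<ge> 0 \<Longrightarrow> rho0 c z = \<rho> z \<and> dP0 c z = Q z \<and> eps0 c z = e z \<and> del0 c z = d z"
    using upper_coeffs[OF s] by blast
  obtain T' \<rho>' Q' e' d' where l: "{- depth c..0} \<subseteq> T'" "\<rho>' 0 = rhom c" "layer_coeffs c T' \<rho>' Q' e' d'"
    "\<And>z. z < 0 \<Longrightarrow> rho0 c z = \<rho>' z \<and> dP0 c z = Q' z \<and> eps0 c z = e' z \<and> del0 c z = d' z"
    using lower_coeffs[OF s] by blast
  obtain C1 where C1: "\<forall>N w. N > 0 \<longrightarrow> C_inf_on UNIV w \<longrightarrow> (\<forall>z. \<bar>w z\<bar> \<le> 1) \<longrightarrow> (\<forall>z. z \<notin> {- (1/N)..1/N} \<longrightarrow> w z = 0) \<longrightarrow>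
     integral {0..?b} (\<lambda>z. \<rho> z * (deriv w z * w z)) \<le> (\<rho> ?b * (w ?b)\<^sup>2 - \<rho> 0 * (w 0)\<^sup>2) / 2 + C1 / N"
    using side_integral_bound[OF u(3,1) less_imp_le[OF pos(3)]] by (rule exE)
  have "?a \<le> 0" using pos by simp
  obtain C2 where C2: "\<forall>N w. N > 0 \<longrightarrow> C_inf_on UNIV w \<longrightarrow> (\<forall>z. \<bar>w z\<bar> \<le> 1) \<longrightarrow> (\<forall>z. z \<notin> {- (1/N)..1/N} \<longrightarrow> w z = 0) \<longrightarrow>
     integral {?a..0} (\<lambda>z. \<rho>' z * (deriv w z * w z)) \<le> (\<rho>' 0 * (w 0)\<^sup>2 - \<rho>' ?a * (w ?a)\<^sup>2) / 2 + C2 / N"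
    using side_integral_bound[OF l(3,1) \<open>?a \<le> 0\<close>] by (rule exE)
  define \<kappa> where "\<kappa> = (exp (- 1) * exp (- 1))\<^sup>2 / 2 * (grav c * rho_jump c - surf c * r\<^sup>2)"
  have \<kappa>: "\<kappa> > 0" unfolding \<kappa>_def using crit by (intro mult_pos_pos) auto
  (* the support of the bump has to fit into both layers and the error terms C / N must not exceed kappa *)
  define N where "N = 1 / depth c + 1 / height c + 1 + grav c * (\<bar>C1\<bar> + \<bar>C2\<bar>) / \<kappa>"
  have N: "N > 0" "1 / N < depth c" "1 / N < height c" "grav c * (C1 + C2) / N < \<kappa>"
  proof -
    have t: "1 / depth c > 0" "1 / height c > 0" "grav c * (\<bar>C1\<bar> + \<bar>C2\<bar>) / \<kappa> \<ge> 0" using pos \<kappa> by auto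
    show n: "N > 0" unfolding N_def using t by linarith
    have "1 / depth c < N" "1 / height c < N" "grav c * (\<bar>C1\<bar> + \<bar>C2\<bar>) / \<kappa> < N" unfolding N_def using t by linarith+
    then show "1 / N < depth c" "1 / N < height c" using pos n by (simp_all add: field_simps)
    have "grav c * (C1 + C2) \<le> grav c * (\<bar>C1\<bar> + \<bar>C2\<bar>)" using pos by (intro mult_left_mono) auto
    also have "\<dots> < N * \<kappa>" using \<open>grav c * (\<bar>C1\<bar> + \<bar>C2\<bar>) / \<kappa> < N\<close> \<kappa> by (simp add: pos_divide_less_eq)
    finally show "grav c * (C1 + C2) / N < \<kappa>" using n by (simp add: pos_divide_less_eq mult.commute)
  qed
  define w where "w = plateau N (- (1/N)) (1/N)"
  have wt: "test_fun ?a ?b w" unfolding w_def by (rule test_fun_plateau) (use N in auto)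
  have wt': "test_fun ?a ?b (deriv w)" by (rule test_fun_deriv[OF wt ab])
  have w1: "\<forall>z. \<bar>w z\<bar> \<le> 1" using plateau_bounds[of N] by (simp add: w_def)
  have w0: "\<forall>z. z \<notin> {- (1/N)..1/N} \<longrightarrow> w z = 0" using plateau_eq_0[OF N(1)] by (auto simp: w_def)
  have w00: "w 0 = exp (- 1) * exp (- 1)" using N(1) by (simp add: w_def plateau_def flat_def)
  have wends: "w ?a = 0" "w ?b = 0" using test_fun_outside[OF wt] by auto
  (* makes the profile divergence-free, which removes the compression energy *)
  define f where "f z = - (1 / r) * deriv w z" for z
  have ft: "test_fun ?a ?b f" unfolding f_def by (rule test_fun_cmult[OF wt'])
  have fH: "f \<in> H10 ?a ?b" and wH: "w \<in> H10 ?a ?b" using test_fun_in_H10[OF ab] ft wt by auto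
  have L2: "in_L2 ?a ?b v" if "test_fun ?a ?b v" for v by (intro L2_continuous test_fun_continuous[OF that])
  have wd: "is_weak_deriv 1 ?a ?b v (deriv v)" if v: "test_fun ?a ?b v" for v
    by (rule is_weak_deriv_antiderivative[OF ab L2_integrable[OF L2[OF test_fun_deriv[OF v ab]]]])
       (use test_fun_eq_integral_deriv[OF _ v] in auto)
  have "energy c r 0 f w = surf c * r\<^sup>2 / 2 * (w 0)\<^sup>2 + 1/2 * (LINT z:{?a<..<?b}|lebesgue. dens c r 0 f (deriv f) w (deriv w) z)"
    by (rule energy_eq[OF s L2[OF ft] L2[OF wt] wd[OF ft] L2[OF test_fun_deriv[OF ft ab]] wd[OF wt] L2[OF wt']])
  also have "dens c r 0 f (deriv f) w (deriv w) = (\<lambda>z. (2 * grav c) * (rho0 c z * deriv w z * w z))"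
    using r by (auto simp: dens_def f_def)
  also have "(LINT z:{?a<..<?b}|lebesgue. (2 * grav c) * (rho0 c z * deriv w z * w z))
      = 2 * grav c * (integral {?a..0} (\<lambda>z. \<rho>' z * (deriv w z * w z)) + integral {0..?b} (\<lambda>z. \<rho> z * (deriv w z * w z)))"
  proof -
    have i: "(\<lambda>z. rho0 c z * deriv w z * w z) absolutely_integrable_on {?a<..<?b}"
      by (intro L2_mult_integrable bdd_meas_L2 L2 wt wt' coeffs_bdd_meas(1)[OF s])
    have "(LINT z:{?a<..<?b}|lebesgue. (2 * grav c) * (rho0 c z * deriv w z * w z)) = 2 * grav c * integral {?a..?b} (\<lambda>z. rho0 c z * deriv w z * w z)"
      by (simp only: set_integral_mult_right LINT_open_eq_integral[OF i])
    also have "integral {?a..?b} (\<lambda>z. rho0 c z * deriv w z * w z) = integral {?a..0} (\<lambda>z. rho0 c z * deriv w z * w z) + integral {0..?b} (\<lambda>z. rho0 c z * deriv w z * w z)"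
      by (rule Henstock_Kurzweil_Integration.integral_combine[symmetric]) (use pos antiderivative_continuous(2)[OF i] in auto)
    also have "integral {?a..0} (\<lambda>z. rho0 c z * deriv w z * w z) = integral {?a..0} (\<lambda>z. \<rho>' z * (deriv w z * w z))"
      by (rule integral_spike[of "{0}"]) (use l(4) in auto)
    also have "integral {0..?b} (\<lambda>z. rho0 c z * deriv w z * w z) = integral {0..?b} (\<lambda>z. \<rho> z * (deriv w z * w z))"
      by (rule integral_cong) (use u(4) in auto)
    finally show ?thesis .
  qed
  also have "surf c * r\<^sup>2 / 2 * (w 0)\<^sup>2 + 1/2 * (2 * grav c * (integral {?a..0} (\<lambda>z. \<rho>' z * (deriv w z * w z)) + integral {0..?b} (\<lambda>z. \<rho> z * (deriv w z * w z))))
     \<le> surf c * r\<^sup>2 / 2 * (w 0)\<^sup>2 + 1/2 * (2 * grav c * ((\<rho>' 0 * (w 0)\<^sup>2 / 2 + C2 / N) + (- \<rho> 0 * (w 0)\<^sup>2 / 2 + C1 / N)))"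
    using C1[THEN spec, THEN spec, THEN mp, OF N(1), THEN mp, OF test_fun_C_inf[OF wt], THEN mp, OF w1, THEN mp, OF w0]
      C2[THEN spec, THEN spec, THEN mp, OF N(1), THEN mp, OF test_fun_C_inf[OF wt], THEN mp, OF w1, THEN mp, OF w0] pos(1)
    by (intro add_left_mono mult_left_mono add_mono) (auto simp: wends)
  also have "\<dots> = - \<kappa> + grav c * (C1 + C2) / N"
    by (simp add: \<kappa>_def w00 u(2) l(2) rho_jump_def algebra_simps add_divide_distrib)
  also have "\<dots> < 0" using N(4) by simp
  finally have neg: "energy c r 0 f w < 0" .
  have "- (grav c * r) * Jfun c f w < 0"
    using energy_lower_bound(2)[OF s r(1) fH wH] neg by simp
  moreover have "grav c * r > 0" using pos r by simp
  ultimately have J: "Jfun c f w > 0" using zero_less_mult_pos[of "grav c * r" "Jfun c f w"] by simp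
  note normalize_admissible[OF s fH wH J]
  moreover have "energy c r 0 f w / Jfun c f w < 0" using neg J by (rule divide_neg_pos)
  ultimately show ?thesis
    by (intro bexI[OF _ normalize_admissible(1)[OF s fH wH J]]) simp
qed

text \<open>Below the critical frequency the hypotheses of \<open>affine_infimum_fixed_point\<close> hold: the energies are affine in the
  viscosity parameter with nonnegative slopes, bounded below without viscosity, and negative for one pair.
  So the definite description that defines \<open>lam\<close> is meaningful.\<close>

theorem lam_fixed_point:
  assumes s: "standing c" and r: "r > 0" "ereal r < xi_crit c"
  shows "lam c r > 0" "mu c r (lam c r) = - (lam c r)\<^sup>2"
proof -
  let ?A = "admissible_set c"
  define e0 where "e0 = (\<lambda>(f, p). energy c r 0 f p)"
  define e1 where "e1 = (\<lambda>(f, p). energy c r 1 f p - energy c r 0 f p)"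
  have aff: "(case x of (f, p) \<Rightarrow> energy c r t f p) = e0 x + t * e1 x" and slope: "e1 x \<ge> 0" and bound: "e0 x \<ge> - (grav c * r)"
    if x: "x \<in> ?A" for x t
  proof -
    obtain f p where fp: "x = (f, p)" by (cases x)
    have H: "f \<in> H10 (- depth c) (height c)" "p \<in> H10 (- depth c) (height c)" and J: "Jfun c f p = 1"
      using x fp by (auto simp: admissible_set_def)
    obtain k where k: "k \<ge> 0" "\<And>t. energy c r t f p = energy c r 0 f p + t * k"
      using energy_lower_bound(1)[OF s r(1) H] by blast
    show "(case x of (f, p) \<Rightarrow> energy c r t f p) = e0 x + t * e1 x" "e1 x \<ge> 0"
      using k(2)[of t] k(2)[of 1] k(1) by (simp_all add: fp e0_def e1_def)
    show "e0 x \<ge> - (grav c * r)"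
      using energy_lower_bound(2)[OF s r(1) H] J by (simp add: fp e0_def)
  qed
  have mu: "mu c r = (\<lambda>t. INF x\<in>?A. e0 x + t * e1 x)"
    unfolding mu_def by (rule ext, rule INF_cong[OF refl]) (use aff in simp)
  obtain x0 where x0: "x0 \<in> ?A" "e0 x0 < 0"
    using negative_energy_pair[OF s r] by (auto simp: e0_def)
  have "\<exists>!t. t > 0 \<and> mu c r t < 0 \<and> t = sqrt (- mu c r t)"
    unfolding mu by (rule affine_infimum_fixed_point[of ?A e1 "grav c * r" e0 x0]) (use slope bound x0 in auto)
  then have "lam c r > 0 \<and> mu c r (lam c r) < 0 \<and> lam c r = sqrt (- mu c r (lam c r))"
    unfolding lam_def by (rule theI')
  then show "lam c r > 0" "mu c r (lam c r) = - (lam c r)\<^sup>2"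
    using real_sqrt_pow2[of "- mu c r (lam c r)"] by auto
qed

section \<open>The Euler-Lagrange equation\<close>

text \<open>Scaling a pair of positive mass to mass one.\<close>

lemma minimizer_inequality:
  assumes s: "standing c" and r: "r > 0" "ereal r < xi_crit c"
    and m: "is_minimizer c r (lam c r) \<phi> \<psi>"
  shows "energy c r (lam c r) \<phi> \<psi> = - (lam c r)\<^sup>2"
    and "f \<in> H10 (- depth c) (height c) \<Longrightarrow> p \<in> H10 (- depth c) (height c) \<Longrightarrow> Jfun c f p > 0 \<Longrightarrow>
      energy c r (lam c r) f p + (lam c r)\<^sup>2 * Jfun c f p \<ge> 0"
proof -
  have "mu c r (lam c r) = energy c r (lam c r) \<phi> \<psi>"
    unfolding mu_def
  proof (rule cInf_eq_minimum)
    show "energy c r (lam c r) \<phi> \<psi> \<in> (\<lambda>(f, p). energy c r (lam c r) f p) ` admissible_set c"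
      using m by (intro image_eqI[of _ _ "(\<phi>, \<psi>)"]) (auto simp: is_minimizer_def)
  qed (use m in \<open>auto simp: is_minimizer_def\<close>)
  then show e: "energy c r (lam c r) \<phi> \<psi> = - (lam c r)\<^sup>2" using lam_fixed_point(2)[OF s r] by simp
  assume H: "f \<in> H10 (- depth c) (height c)" "p \<in> H10 (- depth c) (height c)" and J: "Jfun c f p > 0"
  have "energy c r (lam c r) \<phi> \<psi> \<le> energy c r (lam c r) f p / Jfun c f p"
    using m normalize_admissible(1)[OF s H J] normalize_admissible(2)[OF s H J, of r "lam c r"]
    by (auto simp: is_minimizer_def)
  then have "- (lam c r)\<^sup>2 * Jfun c f p \<le> energy c r (lam c r) f p"
    unfolding e using J by (simp add: pos_le_divide_eq)
  then show "energy c r (lam c r) f p + (lam c r)\<^sup>2 * Jfun c f p \<ge> 0" by simp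
qed

text \<open>Along a line through the minimizer, energy plus \<open>\<lambda>\<^sup>2\<close> times mass is a quadratic polynomial that
  vanishes at the minimizer and is nonnegative as long as the mass stays positive.\<close>

lemma first_variation:
  assumes s: "standing c" and r: "r > 0" "ereal r < xi_crit c"
    and m: "is_minimizer c r (lam c r) \<phi> \<psi>"
    and \<phi>': "is_weak_deriv 1 (- depth c) (height c) \<phi> \<phi>'" "in_L2 (- depth c) (height c) \<phi>'"
    and \<psi>': "is_weak_deriv 1 (- depth c) (height c) \<psi> \<psi>'" "in_L2 (- depth c) (height c) \<psi>'"
    and u: "test_fun (- depth c) (height c) u" and w: "test_fun (- depth c) (height c) w"
  shows "surf c * r\<^sup>2 * \<psi> 0 * w 0 + (LINT z:{- depth c<..<height c}|lebesgue.
      polar c r (lam c r) \<phi> \<phi>' \<psi> \<psi>' u (deriv u) w (deriv w) z + (lam c r)\<^sup>2 * (rho0 c z * (\<phi> z * u z + \<psi> z * w z))) = 0"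
proof -
  let ?a = "- depth c" and ?b = "height c"
  let ?I = "{?a<..<?b}"
  let ?s = "lam c r"
  have ab: "?a < ?b" using s by (simp add: standing_def)
  have H: "\<phi> \<in> H10 ?a ?b" "\<psi> \<in> H10 ?a ?b" and J: "Jfun c \<phi> \<psi> = 1"
    using m by (auto simp: is_minimizer_def admissible_set_def)
  have L: "in_L2 ?a ?b \<phi>" "in_L2 ?a ?b \<psi>" using H by (simp_all add: H10_def)
  have Lt: "in_L2 ?a ?b u" "in_L2 ?a ?b (deriv u)" "in_L2 ?a ?b w" "in_L2 ?a ?b (deriv w)"
    by (intro L2_continuous test_fun_continuous[OF u] test_fun_continuous[OF w] test_fun_continuous[OF test_fun_deriv[OF u ab]]
        test_fun_continuous[OF test_fun_deriv[OF w ab]])+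
  let ?D0 = "dens c r ?s \<phi> \<phi>' \<psi> \<psi>'" and ?D1 = "polar c r ?s \<phi> \<phi>' \<psi> \<psi>' u (deriv u) w (deriv w)" and ?D2 = "dens c r ?s u (deriv u) w (deriv w)"
  let ?M1 = "\<lambda>z. rho0 c z * (\<phi> z * u z + \<psi> z * w z)"
  have i: "?D0 absolutely_integrable_on ?I" "?D1 absolutely_integrable_on ?I" "?D2 absolutely_integrable_on ?I"
    unfolding dens_eq_polar by (rule polar_integrable[OF s]; intro L Lt \<phi>' \<psi>')+
  have M0: "massd c \<phi> \<psi> absolutely_integrable_on ?I" "massd c u w absolutely_integrable_on ?I"
    by (intro massd_integrable s L Lt)+
  have M1: "?M1 absolutely_integrable_on ?I"
  proof -
    have "(\<lambda>z. (rho0 c z * \<phi> z) * u z + (rho0 c z * \<psi> z) * w z) absolutely_integrable_on ?I"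
      by (intro set_integral_add(1) L2_mult_integrable bdd_meas_L2 L Lt coeffs_bdd_meas(1)[OF s])
    then show ?thesis by (simp add: algebra_simps)
  qed
  define d0 d1 d2 m0 m1 m2 where "d0 = (LINT z:?I|lebesgue. ?D0 z)" and "d1 = (LINT z:?I|lebesgue. ?D1 z)" and "d2 = (LINT z:?I|lebesgue. ?D2 z)"
    and "m0 = (LINT z:?I|lebesgue. massd c \<phi> \<psi> z)" and "m1 = (LINT z:?I|lebesgue. ?M1 z)" and "m2 = (LINT z:?I|lebesgue. massd c u w z)"
  define q where "q t = surf c * r\<^sup>2 / 2 * (\<psi> 0 + t * w 0)\<^sup>2 + 1/2 * (d0 + 2 * t * d1 + t\<^sup>2 * d2) + ?s\<^sup>2 * (1/2 * (m0 + 2 * t * m1 + t\<^sup>2 * m2))" for t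
  have Jt: "Jfun c (\<lambda>z. \<phi> z + t * u z) (\<lambda>z. \<psi> z + t * w z) = 1/2 * (m0 + 2 * t * m1 + t\<^sup>2 * m2)" for t
  proof -
    have "massd c (\<lambda>z. \<phi> z + t * u z) (\<lambda>z. \<psi> z + t * w z) z = massd c \<phi> \<psi> z + (2 * t) * ?M1 z + t\<^sup>2 * massd c u w z" for z
      by (simp add: massd_def power2_eq_square algebra_simps)
    then have "(LINT z:?I|lebesgue. massd c (\<lambda>z. \<phi> z + t * u z) (\<lambda>z. \<psi> z + t * w z) z) = m0 + (2 * t) * m1 + t\<^sup>2 * m2"
      unfolding m0_def m1_def m2_def using M0 M1
      by (simp only: set_integral_add set_integral_mult_right set_integrable_mult_right)
    then show ?thesis by (simp add: Jfun_eq)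
  qed
  have Et: "energy c r ?s (\<lambda>z. \<phi> z + t * u z) (\<lambda>z. \<psi> z + t * w z) = surf c * r\<^sup>2 / 2 * (\<psi> 0 + t * w 0)\<^sup>2 + 1/2 * (d0 + 2 * t * d1 + t\<^sup>2 * d2)" for t
  proof -
    have "energy c r ?s (\<lambda>z. \<phi> z + t * u z) (\<lambda>z. \<psi> z + t * w z) = surf c * r\<^sup>2 / 2 * (\<psi> 0 + t * w 0)\<^sup>2
       + 1/2 * (LINT z:?I|lebesgue. dens c r ?s (\<lambda>z. \<phi> z + t * u z) (\<lambda>z. \<phi>' z + t * deriv u z) (\<lambda>z. \<psi> z + t * w z) (\<lambda>z. \<psi>' z + t * deriv w z) z)"
      by (rule energy_eq[OF s]) (intro L2_add L2_cmult L Lt \<phi>' \<psi>' H10_add_test_fun(2)[OF ab H(1) u] H10_add_test_fun(2)[OF ab H(2) w])+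
    also have "(LINT z:?I|lebesgue. dens c r ?s (\<lambda>z. \<phi> z + t * u z) (\<lambda>z. \<phi>' z + t * deriv u z) (\<lambda>z. \<psi> z + t * w z) (\<lambda>z. \<psi>' z + t * deriv w z) z)
       = d0 + 2 * t * d1 + t\<^sup>2 * d2"
      unfolding d0_def d1_def d2_def dens_variation using i
      by (simp only: set_integral_add set_integral_mult_right set_integrable_mult_right)
    finally show ?thesis .
  qed
  have "q 0 = 0"
    using Et[of 0] Jt[of 0] minimizer_inequality(1)[OF s r m] J by (simp add: q_def)
  have "isCont (\<lambda>t. 1/2 * (m0 + 2 * t * m1 + t\<^sup>2 * m2)) 0" by (intro continuous_intros)
  moreover have "1/2 * m0 = 1" using Jt[of 0] J by simp
  ultimately have "((\<lambda>t. 1/2 * (m0 + 2 * t * m1 + t\<^sup>2 * m2)) \<longlongrightarrow> 1) (at 0)"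
    by (simp add: isCont_def)
  then have "((\<lambda>t. 1/2 * (m0 + 2 * t * m1 + t\<^sup>2 * m2)) \<longlongrightarrow> 1) (nhds 0)"
    using \<open>1/2 * m0 = 1\<close> tendsto_at_iff_tendsto_nhds[of "\<lambda>t. 1/2 * (m0 + 2 * t * m1 + t\<^sup>2 * m2)" 0] by simp
  then have "\<forall>\<^sub>F t in nhds 0. 1/2 * (m0 + 2 * t * m1 + t\<^sup>2 * m2) > 0"
    by (rule order_tendstoD(1)) simp
  then obtain \<delta> where \<delta>: "\<delta> > 0" "\<And>t. dist t 0 < \<delta> \<Longrightarrow> 1/2 * (m0 + 2 * t * m1 + t\<^sup>2 * m2) > 0"
    unfolding eventually_nhds_metric by blast
  have min: "q 0 \<le> q t" if "\<bar>0 - t\<bar> < \<delta>" for t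
  proof -
    have "Jfun c (\<lambda>z. \<phi> z + t * u z) (\<lambda>z. \<psi> z + t * w z) > 0" unfolding Jt using \<delta>(2)[of t] that by (simp add: dist_real_def)
    then have "energy c r ?s (\<lambda>z. \<phi> z + t * u z) (\<lambda>z. \<psi> z + t * w z) + ?s\<^sup>2 * Jfun c (\<lambda>z. \<phi> z + t * u z) (\<lambda>z. \<psi> z + t * w z) \<ge> 0"
      by (intro minimizer_inequality(2)[OF s r m] H10_add_test_fun(1)[OF ab] H u w)
    then show ?thesis using \<open>q 0 = 0\<close> by (simp add: Et Jt q_def)
  qed
  have "(q has_real_derivative surf c * r\<^sup>2 * \<psi> 0 * w 0 + d1 + ?s\<^sup>2 * m1) (at 0)"
    unfolding q_def[abs_def] by (auto intro!: derivative_eq_intros)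
  then have "surf c * r\<^sup>2 * \<psi> 0 * w 0 + d1 + ?s\<^sup>2 * m1 = 0"
    by (rule DERIV_local_min[OF _ \<delta>(1)]) (use min in blast)
  moreover have "(LINT z:?I|lebesgue. ?D1 z + ?s\<^sup>2 * ?M1 z) = d1 + ?s\<^sup>2 * m1"
    unfolding d1_def m1_def using i(2) M1 by (simp only: set_integral_add set_integral_mult_right set_integrable_mult_right)
  ultimately show ?thesis by simp
qed

section \<open>Linear systems with smooth coefficients\<close>

definition smooth_bdd :: "real set \<Rightarrow> (real \<Rightarrow> real) \<Rightarrow> bool" where
  "smooth_bdd S f \<longleftrightarrow> C_inf_on S f \<and> (\<forall>n. bounded ((deriv ^^ n) f ` S))"

lemma C_inf_on_sum:
  assumes "open S" "finite I" "\<And>i. i \<in> I \<Longrightarrow> C_inf_on S (f i)"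
  shows "C_inf_on S (\<lambda>z. \<Sum>i\<in>I. f i z)"
  using assms(2,3)
  by (induction I rule: finite_induct) (auto intro: C_inf_on_const C_inf_on_add[OF assms(1)])

lemma bounded_times_on:
  fixes f g :: "real \<Rightarrow> real"
  assumes "bounded (f ` S)" "bounded (g ` S)"
  shows "bounded ((\<lambda>z. f z * g z) ` S)"
proof -
  obtain a b where "\<forall>z\<in>S. \<bar>f z\<bar> \<le> a" "\<forall>z\<in>S. \<bar>g z\<bar> \<le> b"
    using assms by (auto simp: bounded_iff)
  then have "\<bar>f z * g z\<bar> \<le> a * b" if "z \<in> S" for z
    unfolding abs_mult using that by (intro mult_mono) (auto intro: order_trans[OF abs_ge_zero])
  then show ?thesis by (auto simp: bounded_iff)
qed

text \<open>The combinations of the unknowns with coefficients that are smooth on a neighbourhood of the closed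
  layer are closed under differentiation; each of them is bounded, hence so are all their derivatives.\<close>

lemma linear_system_smooth:
  fixes y :: "nat \<Rightarrow> real \<Rightarrow> real"
  assumes S: "open S" "S \<subseteq> K" and K: "compact K" "K \<subseteq> T" and T: "open T"
    and M: "\<And>i j. i < N \<Longrightarrow> j < N \<Longrightarrow> C_inf_on T (M i j)"
    and y: "\<And>i z. i < N \<Longrightarrow> z \<in> S \<Longrightarrow> (y i has_real_derivative (\<Sum>j<N. M i j z * y j z)) (at z)"
    and bdd: "\<And>i. i < N \<Longrightarrow> bounded (y i ` S)"
    and k: "\<And>i. i < N \<Longrightarrow> C_inf_on T (k i)" and f: "\<And>z. z \<in> S \<Longrightarrow> f z = (\<Sum>i<N. k i z * y i z)"
  shows "smooth_bdd S f"
proof -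
  define V where "V = {f. \<exists>k. (\<forall>i<N. C_inf_on T (k i)) \<and> (\<forall>z\<in>S. f z = (\<Sum>i<N. k i z * y i z))}"
  have der: "(\<forall>z\<in>S. g differentiable (at z)) \<and> deriv g \<in> V" if "g \<in> V" for g
  proof -
    obtain k where "(\<forall>i<N. C_inf_on T (k i)) \<and> (\<forall>z\<in>S. g z = (\<Sum>i<N. k i z * y i z))"
      using \<open>g \<in> V\<close> by (auto simp: V_def)
    then have k: "\<And>i. i < N \<Longrightarrow> C_inf_on T (k i)" and g: "\<And>z. z \<in> S \<Longrightarrow> g z = (\<Sum>i<N. k i z * y i z)"
      by auto
    (* the coefficients of the derivative of the combination *)
    define k' where "k' j z = deriv (k j) z + (\<Sum>i<N. k i z * M i j z)" for j z
    have k': "C_inf_on T (k' j)" if "j < N" for j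
      unfolding k'_def using that by (intro C_inf_on_add C_inf_on_deriv C_inf_on_sum C_inf_on_mult T k M) auto
    have d: "(g has_real_derivative (\<Sum>j<N. k' j z * y j z)) (at z)" if z: "z \<in> S" for z
    proof -
      have zT: "z \<in> T" using z S K by blast
      have "((\<lambda>z. \<Sum>i<N. k i z * y i z) has_real_derivative (\<Sum>i<N. deriv (k i) z * y i z + (\<Sum>j<N. M i j z * y j z) * k i z)) (at z)"
        by (intro DERIV_sum DERIV_mult C_inf_on_has_deriv[OF k zT] y z) auto
      moreover have "(\<Sum>i<N. deriv (k i) z * y i z + (\<Sum>j<N. M i j z * y j z) * k i z) = (\<Sum>j<N. k' j z * y j z)"
      proof -
        have "(\<Sum>i<N. (\<Sum>j<N. M i j z * y j z) * k i z) = (\<Sum>i<N. \<Sum>j<N. k i z * M i j z * y j z)"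
          by (simp add: sum_distrib_left sum_distrib_right mult_ac)
        also have "\<dots> = (\<Sum>j<N. \<Sum>i<N. k i z * M i j z * y j z)" by (rule sum.swap)
        finally show ?thesis by (simp add: k'_def sum.distrib sum_distrib_right distrib_right)
      qed
      ultimately have "((\<lambda>z. \<Sum>i<N. k i z * y i z) has_real_derivative (\<Sum>j<N. k' j z * y j z)) (at z)" by simp
      then show ?thesis
        by (rule has_field_derivative_transform_within_open[OF _ S(1) z]) (use g in auto)
    qed
    have "deriv g \<in> V"
      unfolding V_def using k' DERIV_imp_deriv[OF d] by blast
    then show ?thesis using d real_differentiable_def by blast
  qed
  have iter: "(deriv ^^ n) f \<in> V" for n
  proof (induction n)
    case 0
    show ?case using k f by (auto simp: V_def)
  next
    case (Suc n)
    then show ?case using der by simp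
  qed
  have "bounded (g ` S)" if "g \<in> V" for g
  proof -
    obtain k where "(\<forall>i<N. C_inf_on T (k i)) \<and> (\<forall>z\<in>S. g z = (\<Sum>i<N. k i z * y i z))"
      using \<open>g \<in> V\<close> by (auto simp: V_def)
    then have k: "\<And>i. i < N \<Longrightarrow> C_inf_on T (k i)" and g: "\<And>z. z \<in> S \<Longrightarrow> g z = (\<Sum>i<N. k i z * y i z)"
      by auto
    have "bounded ((\<lambda>z. \<Sum>i\<in>I. k i z * y i z) ` S)" if "finite I" "I \<subseteq> {..<N}" for I
      using that
    proof (induction I rule: finite_induct)
      case (insert i I)
      have "bounded (k i ` K)"
        using insert.prems continuous_on_subset[OF C_inf_on_continuous_on[OF k] K(2), of i]
        by (intro compact_imp_bounded compact_continuous_image K(1)) auto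
      then have "bounded (k i ` S)" by (rule bounded_subset) (use S in auto)
      then have "bounded ((\<lambda>z. k i z * y i z) ` S)"
        using bounded_times_on[of "k i" S "y i"] bdd[of i] insert.prems by auto
      then show ?case
        using insert by (simp add: bounded_plus_comp)
    qed (auto simp: image_constant_conv)
    from this[of "{..<N}"] have "bounded ((\<lambda>z. \<Sum>i<N. k i z * y i z) ` S)" by simp
    moreover have "g ` S = (\<lambda>z. \<Sum>i<N. k i z * y i z) ` S" using g by (rule image_cong[OF refl])
    ultimately show ?thesis by simp
  qed
  then show ?thesis
    unfolding smooth_bdd_def C_inf_on_def using iter der by blast
qed

text \<open>The fundamental theorem of calculus at points where the integrand agrees almost everywhere with
  a function continuous there.\<close>

lemma antiderivative_has_deriv:
  fixes h G :: "real \<Rightarrow> real"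
  assumes h: "h absolutely_integrable_on {a<..<b}" and ae: "AE z in lebesgue. z \<in> {a<..<b} \<longrightarrow> h z = G z"
    and z: "z \<in> {a<..<b}" and G: "isCont G z"
  shows "((\<lambda>x. integral {a..x} h) has_real_derivative G z) (at z)"
proof -
  obtain N where N: "N \<in> null_sets lebesgue" "{x. \<not> (x \<in> {a<..<b} \<longrightarrow> h x = G x)} \<subseteq> N"
    using ae by (auto simp: eventually_ae_filter)
  have neg: "negligible (insert a (insert b N))"
    using N(1) by (simp add: negligible_iff_null_sets negligible_insert)
  have eq: "h x = G x" if "x \<in> {a..b} - insert a (insert b N)" for x
    using that subsetD[OF N(2), of x] by auto
  have "h integrable_on {a..b}" by (rule antiderivative_continuous(2)[OF h])
  then have Gi: "G integrable_on {a..b}"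
    by (rule integrable_spike[OF _ neg]) (use eq in auto)
  have "((\<lambda>u. integral {a..u} G) has_vector_derivative G z) (at z within {a..b} - {})"
    by (rule integral_has_vector_derivative_continuous_at[OF Gi]) (use z G in \<open>auto intro: continuous_at_imp_continuous_at_within\<close>)
  then have "((\<lambda>u. integral {a..u} G) has_real_derivative G z) (at z)"
    using z at_within_Icc_at[of a z b] by (simp add: has_real_derivative_iff_has_vector_derivative)
  then show ?thesis
  proof (rule has_field_derivative_transform_within_open[of _ _ _ "{a<..<b}"])
    fix x assume x: "x \<in> {a<..<b}"
    show "integral {a..x} G = integral {a..x} h"
      by (rule integral_spike[OF neg]) (use eq x in auto)
  qed (use z in auto)
qed

section \<open>Regularity of the minimizers\<close>

text \<open>The amplitudes of the tangential and of the normal stress on horizontal planes, and their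
  derivatives according to the Euler-Lagrange equations.\<close>

definition flux_phi :: "params \<Rightarrow> real \<Rightarrow> real \<Rightarrow> (real \<Rightarrow> real) \<Rightarrow> (real \<Rightarrow> real) \<Rightarrow> real \<Rightarrow> real" where
  "flux_phi c r s \<phi> \<psi> z = s * eps0 c z * (deriv \<phi> z - r * \<psi> z)"

definition flux_psi :: "params \<Rightarrow> real \<Rightarrow> real \<Rightarrow> (real \<Rightarrow> real) \<Rightarrow> (real \<Rightarrow> real) \<Rightarrow> real \<Rightarrow> real" where
  "flux_psi c r s \<phi> \<psi> z = (s * del0 c z + dP0 c z * rho0 c z) * (deriv \<psi> z + r * \<phi> z)
     + s * eps0 c z * (2 * deriv \<psi> z - 2/3 * (deriv \<psi> z + r * \<phi> z))"

definition rhs_phi :: "params \<Rightarrow> real \<Rightarrow> real \<Rightarrow> (real \<Rightarrow> real) \<Rightarrow> (real \<Rightarrow> real) \<Rightarrow> real \<Rightarrow> real" where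
  "rhs_phi c r s \<phi> \<psi> z = r * (s * del0 c z + dP0 c z * rho0 c z) * (deriv \<psi> z + r * \<phi> z) - grav c * rho0 c z * r * \<psi> z
     + s * eps0 c z * r * (2 * r * \<phi> z - 2/3 * (deriv \<psi> z + r * \<phi> z)) + s\<^sup>2 * rho0 c z * \<phi> z"

definition rhs_psi :: "params \<Rightarrow> real \<Rightarrow> real \<Rightarrow> (real \<Rightarrow> real) \<Rightarrow> (real \<Rightarrow> real) \<Rightarrow> real \<Rightarrow> real" where
  "rhs_psi c r s \<phi> \<psi> z = - grav c * rho0 c z * r * \<phi> z - r * flux_phi c r s \<phi> \<psi> z + s\<^sup>2 * rho0 c z * \<psi> z"

definition coeffs_smooth :: "params \<Rightarrow> real set \<Rightarrow> bool" where
  "coeffs_smooth c S \<longleftrightarrow> C_inf_on S (rho0 c) \<and> C_inf_on S (dP0 c) \<and> C_inf_on S (eps0 c) \<and> C_inf_on S (del0 c)"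

definition layer_mode :: "params \<Rightarrow> real \<Rightarrow> real \<Rightarrow> (real \<Rightarrow> real) \<Rightarrow> (real \<Rightarrow> real) \<Rightarrow> real set \<Rightarrow> bool" where
  "layer_mode c r s \<phi> \<psi> S \<longleftrightarrow> coeffs_smooth c S \<and> smooth_bdd S \<phi> \<and> smooth_bdd S \<psi> \<and>
     smooth_bdd S (\<lambda>z. rho0 c z * (r * \<phi> z + deriv \<psi> z)) \<and>
     (\<forall>z\<in>S. (flux_phi c r s \<phi> \<psi> has_real_derivative rhs_phi c r s \<phi> \<psi> z) (at z) \<and>
            (flux_psi c r s \<phi> \<psi> has_real_derivative rhs_psi c r s \<phi> \<psi> z) (at z))"

text \<open>What the partial differential equations ask of a profile: smoothness with bounded derivatives on the
  layers, the balance of both stresses, continuity and boundary values of the profile, and the two jump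
  conditions in the form of one-sided limits of the stresses.\<close>

definition classical_mode :: "params \<Rightarrow> real \<Rightarrow> real \<Rightarrow> (real \<Rightarrow> real) \<Rightarrow> (real \<Rightarrow> real) \<Rightarrow> bool" where
  "classical_mode c r s \<phi> \<psi> \<longleftrightarrow>
     continuous_on {- depth c..height c} \<phi> \<and> continuous_on {- depth c..height c} \<psi> \<and>
     \<phi> (- depth c) = 0 \<and> \<phi> (height c) = 0 \<and> \<psi> (- depth c) = 0 \<and> \<psi> (height c) = 0 \<and>
     layer_mode c r s \<phi> \<psi> {0<..<height c} \<and> layer_mode c r s \<phi> \<psi> {- depth c<..<0} \<and>
     (\<exists>a b. (flux_phi c r s \<phi> \<psi> \<longlongrightarrow> a) (at_right 0) \<and> (flux_phi c r s \<phi> \<psi> \<longlongrightarrow> a) (at_left 0) \<and>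
            (flux_psi c r s \<phi> \<psi> \<longlongrightarrow> b + surf c * r\<^sup>2 * \<psi> 0) (at_right 0) \<and> (flux_psi c r s \<phi> \<psi> \<longlongrightarrow> b) (at_left 0))"

text \<open>On a layer the functions \<^term>\<open>\<phi>\<close>, \<^term>\<open>\<psi>\<close> and the two fluxes solve a linear first-order system.\<close>

lemma layer_mode_from_system:
  assumes k: "layer_coeffs c T \<rho> Q e d" and S: "S = {lo<..<hi}" "{lo..hi} \<subseteq> T"
    and s: "s > 0"
    and eq: "\<And>z. z \<in> S \<Longrightarrow> rho0 c z = \<rho> z \<and> dP0 c z = Q z \<and> eps0 c z = e z \<and> del0 c z = d z"
    and bdd: "bounded (\<phi> ` S)" "bounded (\<psi> ` S)" "bounded (A ` S)" "bounded (B ` S)"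
    and d\<phi>: "\<And>z. z \<in> S \<Longrightarrow> (\<phi> has_real_derivative A z / (s * eps0 c z) + r * \<psi> z) (at z)"
    and d\<psi>: "\<And>z. z \<in> S \<Longrightarrow> (\<psi> has_real_derivative
      (B z - r * (s * del0 c z + dP0 c z * rho0 c z - 2/3 * s * eps0 c z) * \<phi> z) / (s * del0 c z + dP0 c z * rho0 c z + 4/3 * s * eps0 c z)) (at z)"
    and dA: "\<And>z. z \<in> S \<Longrightarrow> (A has_real_derivative rhs_phi c r s \<phi> \<psi> z) (at z)"
    and dB: "\<And>z. z \<in> S \<Longrightarrow> (B has_real_derivative rhs_psi c r s \<phi> \<psi> z) (at z)"
  shows "layer_mode c r s \<phi> \<psi> S" and "\<And>z. z \<in> S \<Longrightarrow> flux_phi c r s \<phi> \<psi> z = A z \<and> flux_psi c r s \<phi> \<psi> z = B z"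
proof -
  note k' = k[unfolded layer_coeffs_def]
  have T: "open T" and So: "open S" and ST: "\<And>z. z \<in> S \<Longrightarrow> z \<in> T" using k' S by auto
  define \<alpha> \<beta> \<gamma> where "\<alpha> z = s * d z + Q z * \<rho> z" and "\<beta> z = \<alpha> z + 4/3 * s * e z" and "\<gamma> z = r * (\<alpha> z - 2/3 * s * e z)" for z
  have pos: "\<rho> z > 0" "Q z > 0" "e z > 0" "d z \<ge> 0" "\<beta> z > 0" if "z \<in> T" for z
    using k' that s by (auto simp: \<alpha>_def \<beta>_def intro!: add_nonneg_pos add_nonneg_nonneg)
  have sm: "C_inf_on T \<rho>" "C_inf_on T Q" "C_inf_on T e" "C_inf_on T d" using k' by auto
  have "C_inf_on T \<alpha>" unfolding \<alpha>_def by (intro C_inf_on_intros T sm)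
  then have "C_inf_on T \<beta>" "C_inf_on T \<gamma>" unfolding \<beta>_def \<gamma>_def by (intro C_inf_on_intros T sm; assumption)+
  note sm = sm \<open>C_inf_on T \<alpha>\<close> this
  have \<phi>1: "deriv \<phi> z = A z / (s * e z) + r * \<psi> z" and \<psi>1: "deriv \<psi> z = (B z - \<gamma> z * \<phi> z) / \<beta> z" if z: "z \<in> S" for z
    using DERIV_imp_deriv[OF d\<phi>[OF z]] DERIV_imp_deriv[OF d\<psi>[OF z]] eq[OF z] by (simp_all add: \<alpha>_def \<beta>_def \<gamma>_def)
  have fl: "flux_phi c r s \<phi> \<psi> z = A z" "flux_psi c r s \<phi> \<psi> z = B z" if z: "z \<in> S" for z
  proof -
    show "flux_phi c r s \<phi> \<psi> z = A z"
      using pos(3)[OF ST[OF z]] s by (simp add: flux_phi_def eq[OF z] \<phi>1[OF z])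
    have "flux_psi c r s \<phi> \<psi> z = \<beta> z * deriv \<psi> z + \<gamma> z * \<phi> z"
      by (simp add: flux_psi_def eq[OF z] \<alpha>_def \<beta>_def \<gamma>_def algebra_simps)
    then show "flux_psi c r s \<phi> \<psi> z = B z"
      using pos(5)[OF ST[OF z]] by (simp add: \<psi>1[OF z])
  qed
  then show "\<And>z. z \<in> S \<Longrightarrow> flux_phi c r s \<phi> \<psi> z = A z \<and> flux_psi c r s \<phi> \<psi> z = B z" by blast
  define y where "y i = [\<phi>, \<psi>, A, B] ! i" for i
  (* the system for phi, psi, the tangential and the normal stress, in this order *)
  define M where "M i j z = [[0, r, 1 / (s * e z), 0], [- \<gamma> z / \<beta> z, 0, 0, 1 / \<beta> z],
      [\<gamma> z * (r - \<gamma> z / \<beta> z) + 2 * s * r\<^sup>2 * e z + s\<^sup>2 * \<rho> z, - (grav c * r) * \<rho> z, 0, \<gamma> z / \<beta> z],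
      [- (grav c * r) * \<rho> z, s\<^sup>2 * \<rho> z, - r, 0]] ! i ! j" for i j z
  have less4: "i = 0 \<or> i = 1 \<or> i = 2 \<or> i = 3" if "i < 4" for i :: nat using that by auto
  have MC: "C_inf_on T (M i j)" if "i < 4" "j < 4" for i j
  proof -
    have nz: "\<And>z. z \<in> T \<Longrightarrow> s * e z \<noteq> 0" "\<And>z. z \<in> T \<Longrightarrow> \<beta> z \<noteq> 0" using pos s by fastforce+
    show ?thesis
      using less4[OF that(1)] less4[OF that(2)]
      by (elim disjE; simp add: M_def[abs_def] numeral_2_eq_2 numeral_3_eq_3)
         (intro C_inf_on_intros T sm nz; assumption)+
  qed
  have sum4: "(\<Sum>j<4. g j) = g 0 + g 1 + g 2 + g 3" for g :: "nat \<Rightarrow> real"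
    by (simp add: eval_nat_numeral)
  have ybdd: "bounded (y i ` S)" if "i < 4" for i
    using less4[OF that] bdd by (auto simp: y_def numeral_2_eq_2 numeral_3_eq_3)
  have yd: "(y i has_real_derivative (\<Sum>j<4. M i j z * y j z)) (at z)" if i: "i < 4" and z: "z \<in> S" for i z
  proof -
    have p: "e z > 0" "\<beta> z > 0" using pos ST[OF z] by auto
    have D: "deriv \<psi> z + r * \<phi> z = B z / \<beta> z + (r - \<gamma> z / \<beta> z) * \<phi> z"
      by (simp add: \<psi>1[OF z] diff_divide_distrib algebra_simps)
    have "rhs_phi c r s \<phi> \<psi> z = \<gamma> z * (deriv \<psi> z + r * \<phi> z) - grav c * r * \<rho> z * \<psi> z + 2 * s * r\<^sup>2 * e z * \<phi> z + s\<^sup>2 * \<rho> z * \<phi> z"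
      by (simp add: rhs_phi_def eq[OF z] \<gamma>_def \<alpha>_def power2_eq_square field_simps)
    then have rA: "rhs_phi c r s \<phi> \<psi> z = (\<Sum>j<4. M 2 j z * y j z)"
      unfolding D sum4 by (simp add: M_def y_def numeral_2_eq_2 numeral_3_eq_3 algebra_simps)
    have rB: "rhs_psi c r s \<phi> \<psi> z = (\<Sum>j<4. M 3 j z * y j z)"
      unfolding sum4 rhs_psi_def fl(1)[OF z] by (simp add: M_def y_def numeral_2_eq_2 numeral_3_eq_3 eq[OF z] algebra_simps)
    have r0: "A z / (s * eps0 c z) + r * \<psi> z = (\<Sum>j<4. M 0 j z * y j z)"
      unfolding sum4 by (simp add: M_def y_def numeral_2_eq_2 numeral_3_eq_3 eq[OF z])
    have r1: "(B z - r * (s * del0 c z + dP0 c z * rho0 c z - 2/3 * s * eps0 c z) * \<phi> z) / (s * del0 c z + dP0 c z * rho0 c z + 4/3 * s * eps0 c z)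
        = (\<Sum>j<4. M 1 j z * y j z)"
    proof -
      have "(B z - r * (s * del0 c z + dP0 c z * rho0 c z - 2/3 * s * eps0 c z) * \<phi> z) / (s * del0 c z + dP0 c z * rho0 c z + 4/3 * s * eps0 c z)
        = (B z - \<gamma> z * \<phi> z) / \<beta> z"
        by (simp add: eq[OF z] \<alpha>_def \<beta>_def \<gamma>_def)
      then show ?thesis
        unfolding sum4 by (simp add: M_def y_def numeral_2_eq_2 numeral_3_eq_3 diff_divide_distrib)
    qed
    show ?thesis
      using less4[OF i] d\<phi>[OF z] d\<psi>[OF z] dA[OF z] dB[OF z] unfolding r0 r1 rA rB
      by (elim disjE) (simp_all add: y_def numeral_2_eq_2 numeral_3_eq_3)
  qed
  have comb: "smooth_bdd S f" if "\<And>i. i < 4 \<Longrightarrow> C_inf_on T (k i)" "\<And>z. z \<in> S \<Longrightarrow> f z = (\<Sum>i<4. k i z * y i z)" for f k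
    by (rule linear_system_smooth[of S "{lo..hi}" T 4 M y k f]) (use So S T MC yd ybdd that in auto)
  have comb': "smooth_bdd S f" if "C_inf_on T k0" "C_inf_on T k1" "C_inf_on T k2" "C_inf_on T k3"
    "\<And>z. z \<in> S \<Longrightarrow> f z = k0 z * \<phi> z + k1 z * \<psi> z + k2 z * A z + k3 z * B z" for f k0 k1 k2 k3
  proof (rule comb[of "\<lambda>i. [k0, k1, k2, k3] ! i"])
    fix i :: nat assume "i < 4"
    show "C_inf_on T ([k0, k1, k2, k3] ! i)"
      using less4[OF \<open>i < 4\<close>] that(1-4) by (elim disjE) (simp_all add: numeral_2_eq_2 numeral_3_eq_3)
  next
    fix z assume "z \<in> S"
    then show "f z = (\<Sum>i<4. ([k0, k1, k2, k3] ! i) z * y i z)"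
      unfolding sum4 using that(5) by (simp add: y_def numeral_2_eq_2 numeral_3_eq_3)
  qed
  have "smooth_bdd S \<phi>"
    by (rule comb'[of "\<lambda>z. 1" "\<lambda>z. 0" "\<lambda>z. 0" "\<lambda>z. 0"]) (auto intro: C_inf_on_const)
  moreover have "smooth_bdd S \<psi>"
    by (rule comb'[of "\<lambda>z. 0" "\<lambda>z. 1" "\<lambda>z. 0" "\<lambda>z. 0"]) (auto intro: C_inf_on_const)
  moreover have "smooth_bdd S (\<lambda>z. rho0 c z * (r * \<phi> z + deriv \<psi> z))"
  proof (rule comb'[of "\<lambda>z. \<rho> z * (r - \<gamma> z / \<beta> z)" "\<lambda>z. 0" "\<lambda>z. 0" "\<lambda>z. \<rho> z / \<beta> z"])
    have nz: "\<And>z. z \<in> T \<Longrightarrow> \<beta> z \<noteq> 0" using pos(5) by fastforce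
    show "C_inf_on T (\<lambda>z. \<rho> z * (r - \<gamma> z / \<beta> z))" "C_inf_on T (\<lambda>z. \<rho> z / \<beta> z)"
      by (intro C_inf_on_intros T sm nz; assumption)+
  qed (auto intro: C_inf_on_const simp: eq \<psi>1 diff_divide_distrib algebra_simps)
  moreover have "coeffs_smooth c S"
    unfolding coeffs_smooth_def
    using C_inf_on_cong[OF So, of "rho0 c" \<rho>] C_inf_on_cong[OF So, of "dP0 c" Q] C_inf_on_cong[OF So, of "eps0 c" e] C_inf_on_cong[OF So, of "del0 c" d]
      C_inf_on_subset[of T _ S] sm(1-4) eq ST by blast
  moreover have "(flux_phi c r s \<phi> \<psi> has_real_derivative rhs_phi c r s \<phi> \<psi> z) (at z)" if z: "z \<in> S" for z
    by (rule has_field_derivative_transform_within_open[OF dA[OF z] So z]) (simp add: fl(1))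
  moreover have "(flux_psi c r s \<phi> \<psi> has_real_derivative rhs_psi c r s \<phi> \<psi> z) (at z)" if z: "z \<in> S" for z
    by (rule has_field_derivative_transform_within_open[OF dB[OF z] So z]) (simp add: fl(2))
  ultimately show "layer_mode c r s \<phi> \<psi> S" unfolding layer_mode_def by blast
qed

lemma isCont_cong_open:
  fixes f g :: "real \<Rightarrow> real"
  assumes "open S" "z \<in> S" "isCont g z" "\<And>x. x \<in> S \<Longrightarrow> f x = g x"
  shows "isCont f z"
proof -
  have "\<forall>\<^sub>F x in nhds z. f x = g x"
    using eventually_nhds_in_open[OF assms(1,2)] by (rule eventually_mono) (rule assms(4))
  then show ?thesis using isCont_cong[of f g z] assms(3) by simp
qed

lemma test_fun_zero: "test_fun a b (\<lambda>z. 0)"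
  by (auto simp: test_fun_def C_inf_on_const intro!: exI[of _ "{}"])

text \<open>The weak Euler-Lagrange equations make both fluxes antiderivatives of integrable functions, the second
  one with a jump. Solving for the derivatives, these are continuous on each layer, and so are then
  the derivatives of the fluxes; from there on the linear system takes over.\<close>

theorem minimizer_is_classical_mode:
  assumes s: "standing c" and r: "r > 0" "ereal r < xi_crit c"
    and m: "is_minimizer c r (lam c r) \<phi> \<psi>"
  shows "classical_mode c r (lam c r) \<phi> \<psi>"
proof -
  let ?a = "- depth c" and ?b = "height c" and ?s = "lam c r"
  let ?I = "{?a<..<?b}"
  have pos: "depth c > 0" "height c > 0" using s by (auto simp: standing_def)
  then have ab: "?a < ?b" by simp
  have s0: "?s > 0" by (rule lam_fixed_point(1)[OF s r])
  have H: "\<phi> \<in> H10 ?a ?b" "\<psi> \<in> H10 ?a ?b"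
    using m by (auto simp: is_minimizer_def admissible_set_def)
  note cont = H10_continuous[OF H(1)] H10_continuous[OF H(2)]
  obtain \<phi>' where \<phi>: "in_L2 ?a ?b \<phi>" "is_weak_deriv 1 ?a ?b \<phi> \<phi>'" "in_L2 ?a ?b \<phi>'"
    "\<And>z. z \<in> {?a..?b} \<Longrightarrow> \<phi> z = integral {?a..z} \<phi>'" "\<phi> ?b = 0"
    using H10_facts[OF s H(1)] by blast
  obtain \<psi>' where \<psi>: "in_L2 ?a ?b \<psi>" "is_weak_deriv 1 ?a ?b \<psi> \<psi>'" "in_L2 ?a ?b \<psi>'"
    "\<And>z. z \<in> {?a..?b} \<Longrightarrow> \<psi> z = integral {?a..z} \<psi>'" "\<psi> ?b = 0"
    using H10_facts[OF s H(2)] by blast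
  note bm = coeffs_bdd_meas(1-4)[OF s]
  define D where "D z = \<psi>' z + r * \<phi> z" for z
  define D2 where "D2 z = \<psi>' z - r * \<phi> z" for z
  define A0 where "A0 z = ?s * (eps0 c z * (\<phi>' z - r * \<psi> z))" for z
  define C0 where "C0 z = r * (?s * (del0 c z * D z) + dP0 c z * (rho0 c z * D z)) - (grav c * r) * (rho0 c z * \<psi> z)
     - (r * ?s) * (eps0 c z * D2 z) + (r * ?s / 3) * (eps0 c z * D z) + ?s\<^sup>2 * (rho0 c z * \<phi> z)" for z
  define B0 where "B0 z = ?s * (del0 c z * D z) + dP0 c z * (rho0 c z * D z) + ?s * (eps0 c z * D2 z) + (?s / 3) * (eps0 c z * D z)" for z
  define K0 where "K0 z = (- (grav c * r)) * (rho0 c z * \<phi> z) - r * A0 z + ?s\<^sup>2 * (rho0 c z * \<psi> z)" for z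
  have LD: "in_L2 ?a ?b D" "in_L2 ?a ?b D2"
    unfolding D_def D2_def by (intro L2_add L2_diff L2_cmult \<phi> \<psi>)+
  have LA: "in_L2 ?a ?b A0" unfolding A0_def by (intro L2_cmult L2_diff bdd_meas_L2 bm \<phi> \<psi>)
  have LC: "in_L2 ?a ?b C0" unfolding C0_def by (intro L2_cmult L2_diff L2_add bdd_meas_L2 bm \<phi> \<psi> LD)
  have LB: "in_L2 ?a ?b B0" unfolding B0_def by (intro L2_cmult L2_diff L2_add bdd_meas_L2 bm \<phi> \<psi> LD)
  have LK: "in_L2 ?a ?b K0" unfolding K0_def by (intro L2_cmult L2_diff L2_add bdd_meas_L2 bm \<phi> \<psi> LA)
  define \<kappa> where "\<kappa> = surf c * r\<^sup>2 * \<psi> 0"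
  have weak1: "0 * u 0 + (LINT z:?I|lebesgue. A0 z * deriv u z + C0 z * u z) = 0" if u: "test_fun ?a ?b u" for u
  proof -
    have "polar c r ?s \<phi> \<phi>' \<psi> \<psi>' u (deriv u) (\<lambda>z. 0) (deriv (\<lambda>z. 0)) z + ?s\<^sup>2 * (rho0 c z * (\<phi> z * u z + \<psi> z * 0)) = A0 z * deriv u z + C0 z * u z" for z
      by (simp add: polar_def A0_def C0_def D_def D2_def field_simps)
    then show ?thesis
      using first_variation[OF s r m \<phi>(2,3) \<psi>(2,3) u test_fun_zero] by simp
  qed
  have weak2: "\<kappa> * w 0 + (LINT z:?I|lebesgue. B0 z * deriv w z + K0 z * w z) = 0" if w: "test_fun ?a ?b w" for w
  proof -
    have "polar c r ?s \<phi> \<phi>' \<psi> \<psi>' (\<lambda>z. 0) (deriv (\<lambda>z. 0)) w (deriv w) z + ?s\<^sup>2 * (rho0 c z * (\<phi> z * 0 + \<psi> z * w z)) = B0 z * deriv w z + K0 z * w z" for z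
      by (simp add: polar_def A0_def B0_def K0_def D_def D2_def field_simps)
    then show ?thesis
      using first_variation[OF s r m \<phi>(2,3) \<psi>(2,3) test_fun_zero w] by (simp add: \<kappa>_def)
  qed
  have p0: "?a < 0" "0 < ?b" using pos by auto
  obtain k1 where k1: "AE z in lebesgue. z \<in> ?I \<longrightarrow> A0 z = k1 + integral {?a..z} C0 + 0 * indicat_real {0<..} z"
    using weak_ode_with_source[OF p0 L2_integrable[OF LA] L2_integrable[OF LC] weak1] by (rule exE)
  obtain k2 where k2: "AE z in lebesgue. z \<in> ?I \<longrightarrow> B0 z = k2 + integral {?a..z} K0 + \<kappa> * indicat_real {0<..} z"
    using weak_ode_with_source[OF p0 L2_integrable[OF LB] L2_integrable[OF LK] weak2] by (rule exE)
  define A where "A z = k1 + integral {?a..z} C0" for z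
  define Bc where "Bc z = k2 + integral {?a..z} K0" for z
  define B where "B z = Bc z + \<kappa> * indicat_real {0<..} z" for z
  have Ac: "continuous_on {?a..?b} A" and Bcc: "continuous_on {?a..?b} Bc"
    unfolding A_def Bc_def by (intro continuous_intros antiderivative_continuous L2_integrable LC LK)+
  have aeA: "AE z in lebesgue. z \<in> ?I \<longrightarrow> A0 z = A z" using k1 by (simp add: A_def)
  have aeB: "AE z in lebesgue. z \<in> ?I \<longrightarrow> B0 z = B z" using k2 by (simp add: B_def Bc_def)
  define \<beta> \<gamma> where "\<beta> z = ?s * del0 c z + dP0 c z * rho0 c z + 4/3 * ?s * eps0 c z"
    and "\<gamma> z = r * (?s * del0 c z + dP0 c z * rho0 c z - 2/3 * ?s * eps0 c z)" for z
  (* the derivatives of phi and psi expressed by the fluxes *)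
  define G1 G2 where "G1 z = A z / (?s * eps0 c z) + r * \<psi> z" and "G2 z = (B z - \<gamma> z * \<phi> z) / \<beta> z" for z
  have cpos: "eps0 c z > 0" "\<beta> z > 0" if "z \<in> ?I" for z
  proof -
    have "rho0 c z > 0 \<and> dP0 c z > 0 \<and> eps0 c z > 0 \<and> del0 c z \<ge> 0" by (rule coeffs_bdd_meas(5)[OF s that])
    then show "eps0 c z > 0" "\<beta> z > 0" using s0 by (auto simp: \<beta>_def intro!: add_nonneg_pos add_nonneg_nonneg)
  qed
  have ae1: "AE z in lebesgue. z \<in> ?I \<longrightarrow> \<phi>' z = G1 z"
    using aeA
  proof eventually_elim
    case (elim z)
    show ?case
    proof
      assume z: "z \<in> ?I"
      then have "?s * eps0 c z * (\<phi>' z - r * \<psi> z) = A z" using elim by (simp add: A0_def)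
      then show "\<phi>' z = G1 z" using cpos(1)[OF z] s0 by (simp add: G1_def field_simps)
    qed
  qed
  have ae2: "AE z in lebesgue. z \<in> ?I \<longrightarrow> \<psi>' z = G2 z"
    using aeB
  proof eventually_elim
    case (elim z)
    show ?case
    proof
      assume z: "z \<in> ?I"
      have "B0 z = \<beta> z * \<psi>' z + \<gamma> z * \<phi> z" by (simp add: B0_def \<beta>_def \<gamma>_def D_def D2_def field_simps)
      then have "\<beta> z * \<psi>' z = B z - \<gamma> z * \<phi> z" using elim z by simp
      then show "\<psi>' z = G2 z" using cpos(2)[OF z] by (simp add: G2_def field_simps)
    qed
  qed
  obtain T \<rho> Q e d where u: "{0..?b} \<subseteq> T" "layer_coeffs c T \<rho> Q e d"
    "\<And>z. z \<ge> 0 \<Longrightarrow> rho0 c z = \<rho> z \<and> dP0 c z = Q z \<and> eps0 c z = e z \<and> del0 c z = d z"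
    using upper_coeffs[OF s] by metis
  obtain T' \<rho>' Q' e' d' where l: "{?a..0} \<subseteq> T'" "layer_coeffs c T' \<rho>' Q' e' d'"
    "\<And>z. z < 0 \<Longrightarrow> rho0 c z = \<rho>' z \<and> dP0 c z = Q' z \<and> eps0 c z = e' z \<and> del0 c z = d' z"
    using lower_coeffs[OF s] by metis
  let ?X = "?I - {0}"
  have I0: "open ?X" by auto
  have cc: "isCont (rho0 c) z" "isCont (dP0 c) z" "isCont (eps0 c) z" "isCont (del0 c) z" if z: "z \<in> ?X" for z
  proof -
    have "isCont (rho0 c) z \<and> isCont (dP0 c) z \<and> isCont (eps0 c) z \<and> isCont (del0 c) z"
    proof (cases "z > 0")
      case True
      have "isCont \<rho> z \<and> isCont Q z \<and> isCont e z \<and> isCont d z"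
      proof -
        have "z \<in> T" using subsetD[OF u(1), of z] z True by simp
        then show ?thesis using C_inf_on_isCont u(2) unfolding layer_coeffs_def by blast
      qed
      then show ?thesis
        using isCont_cong_open[of "{0<..}" z \<rho> "rho0 c"]
          isCont_cong_open[of "{0<..}" z Q "dP0 c"]
          isCont_cong_open[of "{0<..}" z e "eps0 c"]
          isCont_cong_open[of "{0<..}" z d "del0 c"]
          u(3) True by simp
    next
      case False
      then have neg: "z < 0" using z by auto
      have "isCont \<rho>' z \<and> isCont Q' z \<and> isCont e' z \<and> isCont d' z"
      proof -
        have "z \<in> T'" using subsetD[OF l(1), of z] z neg by simp
        then show ?thesis using C_inf_on_isCont l(2) unfolding layer_coeffs_def by blast
      qed
      then show ?thesis
        using isCont_cong_open[of "{..<0}" z \<rho>' "rho0 c"]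
          isCont_cong_open[of "{..<0}" z Q' "dP0 c"]
          isCont_cong_open[of "{..<0}" z e' "eps0 c"]
          isCont_cong_open[of "{..<0}" z d' "del0 c"]
          l(3) neg by simp
    qed
    then show "isCont (rho0 c) z" "isCont (dP0 c) z" "isCont (eps0 c) z" "isCont (del0 c) z" by auto
  qed
  have inner: "isCont f z" if "continuous_on {?a..?b} f" "z \<in> ?X" for f :: "real \<Rightarrow> real" and z
    using continuous_on_interior[OF that(1)] that(2) by simp
  have Bz: "B x = Bc x + \<kappa> * indicat_real {0<..} z" if "(x > 0) = (z > 0)" for x z
    using that by (simp add: B_def indicator_def)
  have sign: "\<exists>S. open S \<and> z \<in> S \<and> S \<subseteq> ?X \<and> (\<forall>x\<in>S. (x > 0) = (z > 0))" if z: "z \<in> ?X" for z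
  proof (cases "z > 0")
    case True
    then show ?thesis using z pos by (intro exI[of _ "{0<..<?b}"]) auto
  next
    case False
    then show ?thesis using z pos by (intro exI[of _ "{?a<..<0}"]) auto
  qed
  have Bcont: "isCont B z" if z: "z \<in> ?X" for z
  proof -
    obtain S where S: "open S" "z \<in> S" "\<forall>x\<in>S. (x > 0) = (z > 0)" using sign[OF z] by blast
    have "isCont (\<lambda>x. Bc x + \<kappa> * indicat_real {0<..} z) z"
      by (intro continuous_intros inner[OF Bcc z])
    then show ?thesis
      by (rule isCont_cong_open[OF S(1,2)]) (rule Bz, use S(3) in blast)
  qed
  have G1c: "isCont G1 z" and G2c: "isCont G2 z" if z: "z \<in> ?X" for z
  proof -
    have p: "eps0 c z > 0" "\<beta> z > 0" using cpos z by auto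
    have \<beta>c: "isCont \<beta> z" "isCont \<gamma> z"
      unfolding \<beta>_def \<gamma>_def by (intro continuous_intros cc[OF z])+
    show "isCont G1 z" "isCont G2 z"
      unfolding G1_def G2_def using p s0
      by (intro continuous_intros cc[OF z] \<beta>c inner[OF Ac z] inner[OF cont(1) z] inner[OF cont(2) z] Bcont[OF z]; simp)+
  qed
  have d\<phi>: "(\<phi> has_real_derivative G1 z) (at z)" if z: "z \<in> ?X" for z
  proof (rule has_field_derivative_transform_within_open[of "\<lambda>x. integral {?a..x} \<phi>'" _ _ "?I"])
    show "((\<lambda>x. integral {?a..x} \<phi>') has_real_derivative G1 z) (at z)"
      by (rule antiderivative_has_deriv[OF L2_integrable[OF \<phi>(3)] ae1 _ G1c[OF z]]) (use z in auto)
  qed (use z \<phi>(4) in auto)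
  have d\<psi>: "(\<psi> has_real_derivative G2 z) (at z)" if z: "z \<in> ?X" for z
  proof (rule has_field_derivative_transform_within_open[of "\<lambda>x. integral {?a..x} \<psi>'" _ _ "?I"])
    show "((\<lambda>x. integral {?a..x} \<psi>') has_real_derivative G2 z) (at z)"
      by (rule antiderivative_has_deriv[OF L2_integrable[OF \<psi>(3)] ae2 _ G2c[OF z]]) (use z in auto)
  qed (use z \<psi>(4) in auto)
  have dc: "isCont (deriv \<phi>) z" "isCont (deriv \<psi>) z" if z: "z \<in> ?X" for z
    using isCont_cong_open[OF I0 z G1c[OF z] DERIV_imp_deriv[OF d\<phi>]] isCont_cong_open[OF I0 z G2c[OF z] DERIV_imp_deriv[OF d\<psi>]]
    by blast+
  have fp: "flux_phi c r ?s \<phi> \<psi> z = A z" if z: "z \<in> ?X" for z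
    using DERIV_imp_deriv[OF d\<phi>[OF z]] cpos(1)[of z] z s0 by (simp add: flux_phi_def G1_def)
  have ne: "AE z in lebesgue. z \<noteq> (0::real)" by (rule AE_completion) (rule AE_lborel_singleton)
  have ae3: "AE z in lebesgue. z \<in> ?I \<longrightarrow> C0 z = rhs_phi c r ?s \<phi> \<psi> z"
    using ae2 ne
  proof eventually_elim
    case (elim z)
    show ?case
    proof
      assume z: "z \<in> ?I"
      then have "\<psi>' z = deriv \<psi> z" using elim DERIV_imp_deriv[OF d\<psi>[of z]] by auto
      then show "C0 z = rhs_phi c r ?s \<phi> \<psi> z"
        by (simp add: C0_def rhs_phi_def D_def D2_def power2_eq_square field_simps)
    qed
  qed
  have ae4: "AE z in lebesgue. z \<in> ?I \<longrightarrow> K0 z = rhs_psi c r ?s \<phi> \<psi> z"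
    using aeA ne
  proof eventually_elim
    case (elim z)
    show ?case
    proof
      assume z: "z \<in> ?I"
      then have "A0 z = flux_phi c r ?s \<phi> \<psi> z" using elim fp[of z] by auto
      then show "K0 z = rhs_psi c r ?s \<phi> \<psi> z"
        by (simp add: K0_def rhs_psi_def)
    qed
  qed
  have dA: "(A has_real_derivative rhs_phi c r ?s \<phi> \<psi> z) (at z)" if z: "z \<in> ?X" for z
  proof -
    have "isCont (rhs_phi c r ?s \<phi> \<psi>) z"
      unfolding rhs_phi_def[abs_def] by (intro continuous_intros cc[OF z] dc[OF z] inner[OF cont(1) z] inner[OF cont(2) z])
    then have "((\<lambda>x. integral {?a..x} C0) has_real_derivative rhs_phi c r ?s \<phi> \<psi> z) (at z)"
      by (rule antiderivative_has_deriv[OF L2_integrable[OF LC] ae3, rotated]) (use z in auto)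
    then show ?thesis
      unfolding A_def[abs_def] by (auto intro!: derivative_eq_intros)
  qed
  have dB: "(B has_real_derivative rhs_psi c r ?s \<phi> \<psi> z) (at z)" if z: "z \<in> ?X" for z
  proof -
    have "isCont (rhs_psi c r ?s \<phi> \<psi>) z"
      unfolding rhs_psi_def[abs_def] flux_phi_def[abs_def]
      by (intro continuous_intros cc[OF z] dc[OF z] inner[OF cont(1) z] inner[OF cont(2) z])
    then have "((\<lambda>x. integral {?a..x} K0) has_real_derivative rhs_psi c r ?s \<phi> \<psi> z) (at z)"
      by (rule antiderivative_has_deriv[OF L2_integrable[OF LK] ae4, rotated]) (use z in auto)
    then have d: "((\<lambda>x. Bc x + \<kappa> * indicat_real {0<..} z) has_real_derivative rhs_psi c r ?s \<phi> \<psi> z) (at z)"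
      unfolding Bc_def[abs_def] by (auto intro!: derivative_eq_intros)
    obtain S where S: "open S" "z \<in> S" "\<forall>x\<in>S. (x > 0) = (z > 0)" using sign[OF z] by blast
    show ?thesis
      by (rule has_field_derivative_transform_within_open[OF d S(1,2)]) (use S(3) Bz[of _ z] in simp)
  qed
  have bd: "bounded (f ` S)" if "continuous_on {?a..?b} f" "S \<subseteq> {?a..?b}" for f :: "real \<Rightarrow> real" and S
    by (rule bounded_subset[OF compact_imp_bounded[OF compact_continuous_image[OF that(1)]]]) (use that(2) in auto)
  have Bbd: "bounded (B ` S)" if "S \<subseteq> {?a..?b}" for S
  proof -
    have "bounded ((\<lambda>z. \<kappa> * indicat_real {0<..} z) ` S)"
      unfolding bounded_iff by (intro exI[of _ "\<bar>\<kappa>\<bar>"]) (auto simp: indicator_def)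
    then show ?thesis unfolding B_def[abs_def] by (intro bounded_plus_comp bd[OF Bcc that])
  qed
  have up: "layer_mode c r ?s \<phi> \<psi> {0<..<?b}" "\<And>z. z \<in> {0<..<?b} \<Longrightarrow> flux_phi c r ?s \<phi> \<psi> z = A z \<and> flux_psi c r ?s \<phi> \<psi> z = B z"
  proof -
    have z: "z \<in> ?X" if "z \<in> {0<..<?b}" for z using that pos by auto
    show "layer_mode c r ?s \<phi> \<psi> {0<..<?b}" "\<And>z. z \<in> {0<..<?b} \<Longrightarrow> flux_phi c r ?s \<phi> \<psi> z = A z \<and> flux_psi c r ?s \<phi> \<psi> z = B z"
      by (rule layer_mode_from_system[OF u(2) refl u(1) s0 _ bd[OF cont(1)] bd[OF cont(2)] bd[OF Ac] Bbd
        d\<phi>[OF z, unfolded G1_def] d\<psi>[OF z, unfolded G2_def \<gamma>_def \<beta>_def] dA[OF z] dB[OF z]]; use u(3) pos in auto)+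
  qed
  have lo: "layer_mode c r ?s \<phi> \<psi> {?a<..<0}" "\<And>z. z \<in> {?a<..<0} \<Longrightarrow> flux_phi c r ?s \<phi> \<psi> z = A z \<and> flux_psi c r ?s \<phi> \<psi> z = B z"
  proof -
    have z: "z \<in> ?X" if "z \<in> {?a<..<0}" for z using that pos by auto
    show "layer_mode c r ?s \<phi> \<psi> {?a<..<0}" "\<And>z. z \<in> {?a<..<0} \<Longrightarrow> flux_phi c r ?s \<phi> \<psi> z = A z \<and> flux_psi c r ?s \<phi> \<psi> z = B z"
      by (rule layer_mode_from_system[OF l(2) refl l(1) s0 _ bd[OF cont(1)] bd[OF cont(2)] bd[OF Ac] Bbd
        d\<phi>[OF z, unfolded G1_def] d\<psi>[OF z, unfolded G2_def \<gamma>_def \<beta>_def] dA[OF z] dB[OF z]]; use l(3) pos in auto)+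
  qed
  have evr: "\<forall>\<^sub>F z in at_right 0. z \<in> {0<..<?b}" by (rule eventually_at_rightI[of 0 ?b]) (use pos in auto)
  have evl: "\<forall>\<^sub>F z in at_left 0. z \<in> {?a<..<0}" by (rule eventually_at_leftI[of ?a 0]) (use pos in auto)
  have lim: "(f \<longlongrightarrow> f 0) (at_right 0)" "(f \<longlongrightarrow> f 0) (at_left 0)" if "continuous_on {?a..?b} f" for f :: "real \<Rightarrow> real"
  proof -
    have "isCont f 0" using continuous_on_interior[OF that, of 0] pos by simp
    then have "(f \<longlongrightarrow> f 0) (at 0)" by (simp add: isCont_def)
    show "(f \<longlongrightarrow> f 0) (at_right 0)" "(f \<longlongrightarrow> f 0) (at_left 0)"
      by (rule tendsto_mono[OF at_le[OF subset_UNIV] \<open>f \<midarrow>0\<rightarrow> f 0\<close>])+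
  qed
  have "(flux_phi c r ?s \<phi> \<psi> \<longlongrightarrow> A 0) (at_right 0)"
    by (rule Lim_transform_eventually[OF lim(1)[OF Ac]]) (use evr in eventually_elim, use up(2) in simp)
  moreover have "(flux_phi c r ?s \<phi> \<psi> \<longlongrightarrow> A 0) (at_left 0)"
    by (rule Lim_transform_eventually[OF lim(2)[OF Ac]]) (use evl in eventually_elim, use lo(2) in simp)
  moreover have "(flux_psi c r ?s \<phi> \<psi> \<longlongrightarrow> Bc 0 + surf c * r\<^sup>2 * \<psi> 0) (at_right 0)"
    by (rule Lim_transform_eventually[OF tendsto_add[OF lim(1)[OF Bcc] tendsto_const]])
       (use evr in eventually_elim, use up(2) in \<open>simp add: B_def \<kappa>_def\<close>)
  moreover have "(flux_psi c r ?s \<phi> \<psi> \<longlongrightarrow> Bc 0) (at_left 0)"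
    by (rule Lim_transform_eventually[OF lim(2)[OF Bcc]]) (use evl in eventually_elim, use lo(2) in \<open>simp add: B_def\<close>)
  moreover have "\<phi> ?a = 0" "\<psi> ?a = 0" using \<phi>(4)[of ?a] \<psi>(4)[of ?a] ab by auto
  ultimately show ?thesis
    unfolding classical_mode_def using cont \<phi>(5) \<psi>(5) up(1) lo(1) by blast
qed

section \<open>Rotations and the explicit form of the solution\<close>

text \<open>The explicit form of \<open>rot\<close>; its second row is forced by orthogonality and by the determinant.\<close>

definition rot_matrix :: "real^2 \<Rightarrow> real^2^2" where
  "rot_matrix \<xi> = vector [vector [\<xi> $ 1 / norm \<xi>, \<xi> $ 2 / norm \<xi>], vector [- \<xi> $ 2 / norm \<xi>, \<xi> $ 1 / norm \<xi>]]"

lemma norm_sq_2: "(norm (\<xi> :: real^2))\<^sup>2 = (\<xi> $ 1)\<^sup>2 + (\<xi> $ 2)\<^sup>2"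
  by (simp add: norm_vec_def L2_set_def sum_2)

lemma rotation_matrix_2:
  fixes a b :: real
  assumes "a * a + b * b = 1"
  defines "M \<equiv> vector [vector [a, b], vector [- b, a]] :: real^2^2"
  shows "transpose M ** M = mat 1" "M ** transpose M = mat 1" "det M = 1"
  using assms(1) unfolding M_def
  by (simp_all add: vec_eq_iff matrix_matrix_mult_def sum_2 forall_2 transpose_def mat_def det_2 algebra_simps)

lemma rot_eq:
  assumes "\<xi> \<noteq> 0"
  shows "rot \<xi> = rot_matrix \<xi>" and "matrix_inv (rot \<xi>) = transpose (rot_matrix \<xi>)"
proof -
  let ?n = "norm \<xi>" and ?x = "\<xi> $ 1" and ?y = "\<xi> $ 2"
  have n: "?n \<noteq> 0" using assms by simp
  have n2: "?n * ?n = ?x * ?x + ?y * ?y" using norm_sq_2[of \<xi>] by (simp add: power2_eq_square)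
  have ab: "?x / ?n * (?x / ?n) + ?y / ?n * (?y / ?n) = 1"
    using n by (simp add: add_divide_distrib[symmetric] n2[symmetric])
  have TR: "transpose (rot_matrix \<xi>) ** rot_matrix \<xi> = mat 1" and RT: "rot_matrix \<xi> ** transpose (rot_matrix \<xi>) = mat 1"
    and dt: "det (rot_matrix \<xi>) = 1"
    using rotation_matrix_2[OF ab] by (simp_all add: rot_matrix_def)
  have rm: "rotation_matrix (rot_matrix \<xi>)"
    using TR RT dt by (simp add: rotation_matrix_def orthogonal_matrix_def)
  have rx: "rot_matrix \<xi> *v \<xi> = vector [?n, 0]"
    using n n2 by (simp add: vec_eq_iff matrix_vector_mult_def sum_2 forall_2 rot_matrix_def divide_simps)
  have uniq: "S = rot_matrix \<xi>" if S: "rotation_matrix S" "S *v \<xi> = vector [?n, 0]" for S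
  proof -
    have "transpose S *v (S *v \<xi>) = \<xi>"
      using S(1) by (simp add: matrix_vector_mul_assoc rotation_matrix_def orthogonal_matrix_def)
    then have "transpose S *v vector [?n, 0] = \<xi>" using S(2) by simp
    (* the first row of S is determined by its transpose mapping back to xi *)
    then have e1: "S $ 1 $ 1 * ?n = ?x" "S $ 1 $ 2 * ?n = ?y"
      by (simp_all add: vec_eq_iff matrix_vector_mult_def sum_2 forall_2 transpose_def)
    have e2: "S $ 2 $ 1 * ?x + S $ 2 $ 2 * ?y = 0"
      using S(2) by (simp add: vec_eq_iff matrix_vector_mult_def sum_2 forall_2)
    have "S $ 1 $ 1 * S $ 2 $ 2 - S $ 1 $ 2 * S $ 2 $ 1 = 1"
      using S(1) by (simp add: rotation_matrix_def det_2)
    then have "(S $ 1 $ 1 * ?n) * S $ 2 $ 2 - (S $ 1 $ 2 * ?n) * S $ 2 $ 1 = ?n" by (simp add: algebra_simps flip: distrib_left right_diff_distrib)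
    then have e3: "?x * S $ 2 $ 2 - ?y * S $ 2 $ 1 = ?n" unfolding e1 .
    have "S $ 2 $ 2 * (?n * ?n) = ?x * (?x * S $ 2 $ 2 - ?y * S $ 2 $ 1) + ?y * (S $ 2 $ 1 * ?x + S $ 2 $ 2 * ?y)"
      unfolding n2 by (simp add: algebra_simps)
    then have e4: "S $ 2 $ 2 * ?n = ?x" using n unfolding e2 e3 by simp
    have "S $ 2 $ 1 * (?n * ?n) = - ?y * (?x * S $ 2 $ 2 - ?y * S $ 2 $ 1) + ?x * (S $ 2 $ 1 * ?x + S $ 2 $ 2 * ?y)"
      unfolding n2 by (simp add: algebra_simps)
    then have "(S $ 2 $ 1 * ?n) * ?n = (- ?y) * ?n" unfolding e2 e3 by (simp add: mult.assoc)
    then have e5: "S $ 2 $ 1 * ?n = - ?y" using n by (simp only: mult_cancel_right simp_thms)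
    show ?thesis
    proof -
      have "S $ 1 $ 1 = ?x / ?n" "S $ 1 $ 2 = ?y / ?n" "S $ 2 $ 1 = - ?y / ?n" "S $ 2 $ 2 = ?x / ?n"
        using n e1 e4 e5 by (simp_all only: eq_divide_eq if_False if_True not_False_eq_True simp_thms)
      then show ?thesis by (simp add: vec_eq_iff forall_2 rot_matrix_def)
    qed
  qed
  show R: "rot \<xi> = rot_matrix \<xi>"
    unfolding rot_def
  proof (rule the_equality)
    show "rotation_matrix (rot_matrix \<xi>) \<and> rot_matrix \<xi> *v \<xi> = vector [?n, 0]" using rm rx by (rule conjI)
  qed (elim conjE, rule uniq)
  show "matrix_inv (rot \<xi>) = transpose (rot_matrix \<xi>)"
  proof -
    have "rot_matrix \<xi> ** matrix_inv (rot_matrix \<xi>) = mat 1"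
      unfolding matrix_inv_def using someI[of "\<lambda>A. rot_matrix \<xi> ** A = mat 1 \<and> A ** rot_matrix \<xi> = mat 1", OF conjI[OF RT TR]] by blast
    then have "transpose (rot_matrix \<xi>) ** (rot_matrix \<xi> ** matrix_inv (rot_matrix \<xi>)) = transpose (rot_matrix \<xi>)" by simp
    then show ?thesis unfolding R matrix_mul_assoc TR by simp
  qed
qed

lemma mode_phi_theta:
  assumes "\<xi> \<noteq> 0"
  shows "mode_phi f \<xi> z = \<xi> $ 1 / norm \<xi> * f (norm \<xi>) z" and "mode_theta f \<xi> z = \<xi> $ 2 / norm \<xi> * f (norm \<xi>) z"
  unfolding mode_phi_def mode_theta_def rot_eq(2)[OF assms]
  by (simp_all add: matrix_vector_mult_def sum_2 rot_matrix_def transpose_def)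

text \<open>Scalar fields of a single horizontal frequency with a vertical amplitude. Horizontal derivatives
  exchange the two kinds and vertical derivatives act on the amplitude.\<close>

definition swave :: "real^2 \<Rightarrow> (real \<Rightarrow> real) \<Rightarrow> real^3 \<Rightarrow> complex" where
  "swave k a x = complex_of_real (a (x $ 3) * sin (horiz x \<bullet> k))"

definition cwave :: "real^2 \<Rightarrow> (real \<Rightarrow> real) \<Rightarrow> real^3 \<Rightarrow> complex" where
  "cwave k a x = complex_of_real (a (x $ 3) * cos (horiz x \<bullet> k))"

lemma inner_horiz: "horiz x \<bullet> k = x $ 1 * k $ 1 + x $ 2 * k $ 2"
  by (simp add: horiz_def inner_vec_def sum_2)

text \<open>The modes of opposite frequencies are conjugate, so that their sum is real.\<close>

lemma explicit_solution:
  assumes opp: "\<xi> 1 = - \<xi> 2" and nz: "\<xi> 1 \<noteq> 0"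
  defines "k \<equiv> \<xi> 1" and "r \<equiv> norm (\<xi> 1)"
  shows "eta_sol c f p \<xi> t x $ 1 = swave k (\<lambda>z. 2 * exp (Lambda c * t) * k $ 1 / r * f r z) x"
    and "eta_sol c f p \<xi> t x $ 2 = swave k (\<lambda>z. 2 * exp (Lambda c * t) * k $ 2 / r * f r z) x"
    and "eta_sol c f p \<xi> t x $ 3 = cwave k (\<lambda>z. 2 * exp (Lambda c * t) * p r z) x"
    and "v_sol c f p \<xi> t x = Lambda c *\<^sub>R eta_sol c f p \<xi> t x"
    and "q_sol c f p \<xi> t x = cwave k (\<lambda>z. - (2 * exp (Lambda c * t) * (rho0 c z * (r * f r z + deriv (p r) z)))) x"
proof -
  have o2: "\<xi> 2 = - k" using opp by (simp add: k_def)
  have kz: "k \<noteq> 0" "- k \<noteq> 0" using nz by (auto simp: k_def)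
  have rk: "norm k = r" by (simp add: r_def k_def)
  have S: "(\<Sum>j=1..2. g j) = g 1 + g 2" for g :: "nat \<Rightarrow> 'x::comm_monoid_add"
    by (simp add: eval_nat_numeral)
  have c1: "horiz x \<bullet> - k = - (horiz x \<bullet> k)" by simp
  show "eta_sol c f p \<xi> t x $ 1 = swave k (\<lambda>z. 2 * exp (Lambda c * t) * k $ 1 / r * f r z) x"
    "eta_sol c f p \<xi> t x $ 2 = swave k (\<lambda>z. 2 * exp (Lambda c * t) * k $ 2 / r * f r z) x"
    "eta_sol c f p \<xi> t x $ 3 = cwave k (\<lambda>z. 2 * exp (Lambda c * t) * p r z) x"
    unfolding eta_sol_def S o2 k_def[symmetric] what_def mode_phi_theta[OF kz(1)] mode_phi_theta[OF kz(2)] mode_psi_def c1 swave_def cwave_def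
    by (simp_all add: rk complex_eq_iff cis.ctr scaleR_complex.ctr algebra_simps)
  show "v_sol c f p \<xi> t x = Lambda c *\<^sub>R eta_sol c f p \<xi> t x"
    by (simp add: v_sol_def eta_sol_def)
  have r2: "k $ 1 * k $ 1 + k $ 2 * k $ 2 = r * r" and r0: "r \<noteq> 0"
    using norm_sq_2[of k] nz by (auto simp: rk power2_eq_square r_def)
  have D: "k $ 1 * (k $ 1 / r * y) + k $ 2 * (k $ 2 / r * y) = r * y" for y
  proof -
    have "k $ 1 * (k $ 1 / r * y) + k $ 2 * (k $ 2 / r * y) = (k $ 1 * k $ 1 + k $ 2 * k $ 2) * y / r"
      by (simp add: add_divide_distrib algebra_simps)
    then show ?thesis using r0 unfolding r2 by simp
  qed
  have psi: "mode_psi p k = p r" "mode_psi p (- k) = p r" by (auto simp: mode_psi_def rk fun_eq_iff)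
  have D2: "(- k) $ 1 * ((- k) $ 1 / r * y) + (- k) $ 2 * ((- k) $ 2 / r * y) = r * y" for y
    using D[of y] by simp
  show "q_sol c f p \<xi> t x = cwave k (\<lambda>z. - (2 * exp (Lambda c * t) * (rho0 c z * (r * f r z + deriv (p r) z)))) x"
    unfolding q_sol_def S o2 k_def[symmetric] mode_phi_theta[OF kz(1)] mode_phi_theta[OF kz(2)] psi c1 cwave_def norm_minus_cancel rk D D2
    by (simp add: complex_eq_iff cis.ctr algebra_simps)
qed

section \<open>Calculus of waves on a layer\<close>

lemma has_vector_derivative_vec:
  fixes f :: "real \<Rightarrow> 'a::real_normed_vector ^ 'n::finite"
  assumes "\<And>i. ((\<lambda>x. f x $ i) has_vector_derivative D $ i) (at x)"
  shows "(f has_vector_derivative D) (at x)"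
proof -
  have bl: "bounded_linear (\<lambda>c::'a. axis i c :: 'a^'n)" for i
    by (rule bounded_linear_intro[of _ 1])
       (auto simp: vec_eq_iff axis_def norm_vec_def L2_set_def if_distrib[of norm] if_distrib[of "\<lambda>x. x\<^sup>2"] cong: if_cong)
  have "((\<lambda>x. \<Sum>i\<in>UNIV. axis i (f x $ i)) has_vector_derivative (\<Sum>i\<in>UNIV. axis i (D $ i))) (at x)"
    by (intro has_vector_derivative_sum bounded_linear.has_vector_derivative[OF bl] assms)
  moreover have "(\<Sum>i\<in>UNIV. axis i (v $ i)) = v" for v :: "'a^'n"
    by (simp add: vec_eq_iff axis_def if_distrib[of "\<lambda>v. v $ _"] sum.delta cong: if_cong)
  ultimately show ?thesis by simp
qed

lemma pd_cong_open:
  assumes "open U" "x \<in> U" "\<And>y. y \<in> U \<Longrightarrow> f y = g y"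
  shows "pd i f x = pd i g x" and "has_pd i g x \<Longrightarrow> has_pd i f x"
proof -
  define V where "V = (\<lambda>h. x + h *\<^sub>R axis i 1) -` U"
  have V: "open V" "0 \<in> V"
    unfolding V_def using assms(1,2) by (auto intro!: open_vimage continuous_intros)
  have eq: "f (x + h *\<^sub>R axis i 1) = g (x + h *\<^sub>R axis i 1)" if "h \<in> V" for h
    using assms(3) that by (simp add: V_def)
  show "pd i f x = pd i g x"
    unfolding pd_def
    by (rule vector_derivative_cong_eq) (use eventually_nhds_in_open[OF V] eq in \<open>auto elim: eventually_mono\<close>)
  show "has_pd i f x" if "has_pd i g x"
    unfolding has_pd_def
    by (rule differentiable_cong_open[OF V, of _ "\<lambda>h. g (x + h *\<^sub>R axis i 1)"]) (use eq that in \<open>auto simp: has_pd_def\<close>)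
qed

lemma Ck_on_cong:
  assumes "open U"
  shows "(\<And>y. y \<in> U \<Longrightarrow> f y = g y) \<Longrightarrow> Ck_on n U g \<Longrightarrow> Ck_on n U f"
proof (induction n arbitrary: f g)
  case 0
  then show ?case using continuous_on_cong[of U U f g] by simp
next
  case (Suc n)
  have "Ck_on n U (pd i f)" for i
    by (rule Suc.IH[of "pd i f" "pd i g"]) (use Suc.prems pd_cong_open(1)[OF assms _ Suc.prems(1)] in auto)
  moreover have "has_pd i f x" if "x \<in> U" for i x
    using pd_cong_open(2)[OF assms that Suc.prems(1)] Suc.prems(2) that by auto
  ultimately show ?case using Suc.prems continuous_on_cong[of U U f g] by simp
qed

lemma Ck_on_vec:
  fixes f :: "real^3 \<Rightarrow> complex^3"
  assumes "open U"
  shows "(\<And>i. Ck_on n U (\<lambda>x. f x $ i)) \<Longrightarrow> Ck_on n U f"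
proof (induction n arbitrary: f)
  case 0
  have "continuous_on U (\<lambda>x. \<chi> i. f x $ i)" using 0 by (intro continuous_on_vec_lambda) auto
  then show ?case by simp
next
  case (Suc n)
  have "continuous_on U (\<lambda>x. \<chi> i. f x $ i)" using Suc.prems by (intro continuous_on_vec_lambda) auto
  moreover have hv: "((\<lambda>h. f (x + h *\<^sub>R axis j 1)) has_vector_derivative (\<chi> i. pd j (\<lambda>x. f x $ i) x)) (at 0)" if x: "x \<in> U" for j x
  proof (rule has_vector_derivative_vec)
    fix i
    have "has_pd j (\<lambda>x. f x $ i) x" using Suc.prems[of i] x by simp
    then show "((\<lambda>h. f (x + h *\<^sub>R axis j 1) $ i) has_vector_derivative (\<chi> i. pd j (\<lambda>x. f x $ i) x) $ i) (at 0)"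
      unfolding has_pd_def pd_def by (simp add: vector_derivative_works)
  qed
  moreover have "Ck_on n U (pd j f)" for j
  proof (rule Ck_on_cong[OF assms, of _ "\<lambda>x. \<chi> i. pd j (\<lambda>x. f x $ i) x"])
    show "pd j f x = (\<chi> i. pd j (\<lambda>x. f x $ i) x)" if "x \<in> U" for x
      unfolding pd_def[of j f] by (rule vector_derivative_at[OF hv[OF that]])
    show "Ck_on n U (\<lambda>x. \<chi> i. pd j (\<lambda>x. f x $ i) x)"
      by (rule Suc.IH) (use Suc.prems in simp)
  qed
  moreover have "has_pd j f x" if "x \<in> U" for j x
    unfolding has_pd_def by (rule differentiableI_vector[OF hv[OF that]])
  ultimately show ?case by simp
qed

lemma UNIV_3_cases: "(i :: 3) = 1 \<or> i = 2 \<or> i = 3"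
  using exhaust_3 by blast

lemma axis_components:
  "(x + h *\<^sub>R axis 1 1) $ 1 = x $ 1 + h" "(x + h *\<^sub>R axis 1 1) $ 2 = x $ 2" "(x + h *\<^sub>R axis 1 1) $ 3 = x $ 3"
  "(x + h *\<^sub>R axis 2 1) $ 1 = x $ 1" "(x + h *\<^sub>R axis 2 1) $ 2 = x $ 2 + h" "(x + h *\<^sub>R axis 2 1) $ 3 = x $ 3"
  "(x + h *\<^sub>R axis 3 1) $ 1 = x $ 1" "(x + h *\<^sub>R axis 3 1) $ 2 = x $ 2" "(x + h *\<^sub>R axis 3 1) $ 3 = x $ 3 + h"
  for x :: "real^3"
  by (simp_all add: axis_def)

lemma has_vector_derivative_of_real_complex:
  "(g has_real_derivative D) (at h) \<Longrightarrow> ((\<lambda>h. complex_of_real (g h)) has_vector_derivative complex_of_real D) (at h)"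
  using bounded_linear.has_vector_derivative[OF bounded_linear_of_real]
  by (simp add: has_real_derivative_iff_has_vector_derivative)

lemma wave_deriv_horizontal:
  "((\<lambda>h. swave k a (x + h *\<^sub>R axis 1 1)) has_vector_derivative cwave k (\<lambda>z. k $ 1 * a z) x) (at 0)"
  "((\<lambda>h. swave k a (x + h *\<^sub>R axis 2 1)) has_vector_derivative cwave k (\<lambda>z. k $ 2 * a z) x) (at 0)"
  "((\<lambda>h. cwave k a (x + h *\<^sub>R axis 1 1)) has_vector_derivative swave k (\<lambda>z. - (k $ 1 * a z)) x) (at 0)"
  "((\<lambda>h. cwave k a (x + h *\<^sub>R axis 2 1)) has_vector_derivative swave k (\<lambda>z. - (k $ 2 * a z)) x) (at 0)"
  unfolding swave_def cwave_def inner_horiz axis_components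
  by (auto simp del: of_real_mult of_real_minus intro!: has_vector_derivative_of_real_complex derivative_eq_intros)

lemma wave_deriv_vertical:
  assumes "(a has_real_derivative a' (x $ 3)) (at (x $ 3))"
  shows "((\<lambda>h. swave k a (x + h *\<^sub>R axis 3 1)) has_vector_derivative swave k a' x) (at 0)"
    and "((\<lambda>h. cwave k a (x + h *\<^sub>R axis 3 1)) has_vector_derivative cwave k a' x) (at 0)"
proof -
  have "((\<lambda>h. a (x $ 3 + h)) has_real_derivative a' (x $ 3)) (at 0)"
    using DERIV_shift[of a "a' (x $ 3)" "0" "x $ 3"] assms by (simp add: add.commute)
  then show "((\<lambda>h. swave k a (x + h *\<^sub>R axis 3 1)) has_vector_derivative swave k a' x) (at 0)"
    "((\<lambda>h. cwave k a (x + h *\<^sub>R axis 3 1)) has_vector_derivative cwave k a' x) (at 0)"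
    unfolding swave_def cwave_def inner_horiz axis_components
    by (auto simp del: of_real_mult intro!: has_vector_derivative_of_real_complex derivative_eq_intros)
qed

lemma pd_wave_horizontal:
  "pd 1 (swave k a) = cwave k (\<lambda>z. k $ 1 * a z)" "pd 2 (swave k a) = cwave k (\<lambda>z. k $ 2 * a z)"
  "pd 1 (cwave k a) = swave k (\<lambda>z. - (k $ 1 * a z))" "pd 2 (cwave k a) = swave k (\<lambda>z. - (k $ 2 * a z))"
  unfolding pd_def fun_eq_iff
  using wave_deriv_horizontal[of k a]
  by (auto intro!: vector_derivative_at)

lemma pd_wave_vertical:
  assumes "(a has_real_derivative a' (x $ 3)) (at (x $ 3))"
  shows "pd 3 (swave k a) x = swave k a' x" "pd 3 (cwave k a) x = cwave k a' x"
  unfolding pd_def using wave_deriv_vertical[of a a' x, OF assms] by (auto intro!: vector_derivative_at)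

definition strip :: "real set \<Rightarrow> (real^3) set" where
  "strip S = {x. x $ 3 \<in> S}"

lemma open_strip: "open S \<Longrightarrow> open (strip S)"
proof -
  assume "open S"
  moreover have "strip S = (\<lambda>x. x $ 3) -` S" by (auto simp: strip_def)
  ultimately show ?thesis by (simp add: open_vimage continuous_intros)
qed

lemma continuous_on_wave:
  assumes "continuous_on S a"
  shows "continuous_on (strip S) (swave k a)" "continuous_on (strip S) (cwave k a)"
proof -
  have "continuous_on (strip S) (\<lambda>x. a (x $ 3))"
    by (rule continuous_on_compose2[OF assms]) (auto intro!: continuous_intros simp: strip_def)
  then show "continuous_on (strip S) (swave k a)" "continuous_on (strip S) (cwave k a)"
    unfolding swave_def cwave_def inner_horiz by (auto intro!: continuous_intros)
qed

text \<open>Every partial derivative of a wave with smooth amplitude is again such a wave.\<close>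

lemma Ck_on_wave:
  assumes S: "open S"
  shows "C_inf_on S a \<Longrightarrow> Ck_on n (strip S) (swave k a) \<and> Ck_on n (strip S) (cwave k a)"
proof (induction n arbitrary: a)
  case 0
  then show ?case using continuous_on_wave[OF C_inf_on_continuous_on] by simp
next
  case (Suc n)
  have sm: "C_inf_on S (\<lambda>z. m * a z)" "C_inf_on S (\<lambda>z. - (m * a z))" for m
    by (intro C_inf_on_intros S Suc.prems)+
  have d: "(a has_real_derivative deriv a (x $ 3)) (at (x $ 3))" if "x \<in> strip S" for x
    using C_inf_on_has_deriv[OF Suc.prems] that by (simp add: strip_def)
  have "Ck_on n (strip S) (pd i (swave k a)) \<and> Ck_on n (strip S) (pd i (cwave k a))" for i
  proof -
    have "Ck_on n (strip S) (pd 3 (swave k a))"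
      by (rule Ck_on_cong[OF open_strip[OF S], of _ "swave k (deriv a)"])
         (use Suc.IH[OF C_inf_on_deriv[OF Suc.prems]] pd_wave_vertical(1)[of a "deriv a", OF d] in auto)
    moreover have "Ck_on n (strip S) (pd 3 (cwave k a))"
      by (rule Ck_on_cong[OF open_strip[OF S], of _ "cwave k (deriv a)"])
         (use Suc.IH[OF C_inf_on_deriv[OF Suc.prems]] pd_wave_vertical(2)[of a "deriv a", OF d] in auto)
    ultimately show ?thesis
      using UNIV_3_cases[of i] Suc.IH[OF sm(1)] Suc.IH[OF sm(2)] by (auto simp: pd_wave_horizontal)
  qed
  moreover have "has_pd i (swave k a) x \<and> has_pd i (cwave k a) x" if "x \<in> strip S" for i x
    unfolding has_pd_def
    using UNIV_3_cases[of i] wave_deriv_horizontal[of k a x] wave_deriv_vertical[of a "deriv a", OF d[OF that], of k]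
    by (auto intro: differentiableI_vector)
  ultimately show ?case
    using continuous_on_wave[OF C_inf_on_continuous_on[OF Suc.prems]] by simp
qed

lemma wave_periodic:
  assumes "k \<in> lattice L" "L > 0"
  shows "periodic_on L S (swave k a)" "periodic_on L S (cwave k a)"
proof -
  obtain n1 n2 :: int where n: "k $ 1 = of_int n1 / L" "k $ 2 = of_int n2 / L"
  proof -
    have "\<exists>n1 n2 :: int. k $ 1 = of_int n1 / L \<and> k $ 2 = of_int n2 / L"
      using assms(1) unfolding lattice_def by blast
    then show ?thesis using that by auto
  qed
  have e: "sin (y + 2 * pi * of_int n) = sin y" "cos (y + 2 * pi * of_int n) = cos y" for y :: real and n :: int
    using sin_add[of y "2 * pi * of_int n"] cos_add[of y "2 * pi * of_int n"] sin_int_2pin[of n] cos_int_2pin[of n]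
    by simp_all
  have Lk: "L * k $ 1 = of_int n1" "L * k $ 2 = of_int n2" using n assms(2) by simp_all
  have h: "horiz (x + (2 * pi * L) *\<^sub>R axis 1 1) \<bullet> k = horiz x \<bullet> k + 2 * pi * of_int n1"
    "horiz (x + (2 * pi * L) *\<^sub>R axis 2 1) \<bullet> k = horiz x \<bullet> k + 2 * pi * of_int n2" for x
    unfolding inner_horiz axis_components Lk[symmetric] by (simp_all add: algebra_simps)
  have "swave k a (x + (2 * pi * L) *\<^sub>R axis 1 1) = swave k a x" "swave k a (x + (2 * pi * L) *\<^sub>R axis 2 1) = swave k a x"
    "cwave k a (x + (2 * pi * L) *\<^sub>R axis 1 1) = cwave k a x" "cwave k a (x + (2 * pi * L) *\<^sub>R axis 2 1) = cwave k a x" for x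
    unfolding swave_def cwave_def h e axis_components by (rule refl)+
  then show "periodic_on L S (swave k a)" "periodic_on L S (cwave k a)"
    by (simp_all add: periodic_on_def)
qed

lemma wave_arith:
  "swave k a x + swave k b x = swave k (\<lambda>z. a z + b z) x" "cwave k a x + cwave k b x = cwave k (\<lambda>z. a z + b z) x"
  "swave k a x - swave k b x = swave k (\<lambda>z. a z - b z) x" "cwave k a x - cwave k b x = cwave k (\<lambda>z. a z - b z) x"
  "- swave k a x = swave k (\<lambda>z. - a z) x" "- cwave k a x = cwave k (\<lambda>z. - a z) x"
  "m *\<^sub>R swave k a x = swave k (\<lambda>z. m * a z) x" "m *\<^sub>R cwave k a x = cwave k (\<lambda>z. m * a z) x"
  by (simp_all add: swave_def cwave_def scaleR_conv_of_real algebra_simps)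

lemma wave_coeff:
  "g (x $ 3) *\<^sub>R swave k a x = swave k (\<lambda>z. g z * a z) x" "g (x $ 3) *\<^sub>R cwave k a x = cwave k (\<lambda>z. g z * a z) x"
  by (simp_all add: swave_def cwave_def scaleR_conv_of_real)

text \<open>Equations between waves reduce to equations between amplitudes at one height.\<close>

lemma wave_eqI:
  "a (x $ 3) = b (x $ 3) \<Longrightarrow> swave k a x = swave k b x" "a (x $ 3) = b (x $ 3) \<Longrightarrow> cwave k a x = cwave k b x"
  by (simp_all add: swave_def cwave_def)

section \<open>The linearized equations\<close>

text \<open>The spatial profile of the velocity of a mode, and the matrices formed from its derivatives.\<close>

locale mode_velocity =
  fixes c :: params and k :: "real^2" and r s e :: real and f p :: "real \<Rightarrow> real" and S :: "real set" and v :: "real^3 \<Rightarrow> complex^3"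
  assumes S: "open S" and r0: "r \<noteq> 0" and r2: "k $ 1 * k $ 1 + k $ 2 * k $ 2 = r * r"
    and mode: "layer_mode c r s f p S"
    and v1: "\<And>x. v x $ 1 = swave k (\<lambda>z. k $ 1 * (s * e / r * f z)) x"
    and v2: "\<And>x. v x $ 2 = swave k (\<lambda>z. k $ 2 * (s * e / r * f z)) x"
    and v3: "\<And>x. v x $ 3 = cwave k (\<lambda>z. s * e * p z) x"
begin

text \<open>The amplitude of the dilatation rate, that is, of the divergence of \<open>v\<close>.\<close>

definition dil :: "real \<Rightarrow> real" where "dil z = s * e * (r * f z + deriv p z)"

lemma smooth: "C_inf_on S f" "C_inf_on S p" "C_inf_on S (rho0 c)" "C_inf_on S (dP0 c)" "C_inf_on S (eps0 c)" "C_inf_on S (del0 c)"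
  using mode by (auto simp: layer_mode_def smooth_bdd_def coeffs_smooth_def)

lemma df: "z \<in> S \<Longrightarrow> (f has_real_derivative deriv f z) (at z)" and dp: "z \<in> S \<Longrightarrow> (p has_real_derivative deriv p z) (at z)"
  using smooth C_inf_on_has_deriv by auto

lemma v_fun:
  "(\<lambda>y. v y $ 1) = swave k (\<lambda>z. k $ 1 * (s * e / r * f z))" "(\<lambda>y. v y $ 2) = swave k (\<lambda>z. k $ 2 * (s * e / r * f z))"
  "(\<lambda>y. v y $ 3) = cwave k (\<lambda>z. s * e * p z)"
  using v1 v2 v3 by auto

lemma Dmat_v:
  assumes "x \<in> strip S"
  shows "Dmat v x $ 1 $ 1 = cwave k (\<lambda>z. k $ 1 * k $ 1 * (s * e / r * f z)) x"
    "Dmat v x $ 1 $ 2 = cwave k (\<lambda>z. k $ 1 * k $ 2 * (s * e / r * f z)) x"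
    "Dmat v x $ 1 $ 3 = swave k (\<lambda>z. k $ 1 * (s * e / r * deriv f z)) x"
    "Dmat v x $ 2 $ 1 = cwave k (\<lambda>z. k $ 1 * k $ 2 * (s * e / r * f z)) x"
    "Dmat v x $ 2 $ 2 = cwave k (\<lambda>z. k $ 2 * k $ 2 * (s * e / r * f z)) x"
    "Dmat v x $ 2 $ 3 = swave k (\<lambda>z. k $ 2 * (s * e / r * deriv f z)) x"
    "Dmat v x $ 3 $ 1 = swave k (\<lambda>z. - (k $ 1 * (s * e * p z))) x"
    "Dmat v x $ 3 $ 2 = swave k (\<lambda>z. - (k $ 2 * (s * e * p z))) x"
    "Dmat v x $ 3 $ 3 = cwave k (\<lambda>z. s * e * deriv p z) x"
proof -
  have z: "x $ 3 \<in> S" using assms by (simp add: strip_def)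
  have "((\<lambda>z. m * (s * e / r * f z)) has_real_derivative m * (s * e / r * deriv f (x $ 3))) (at (x $ 3))" for m
    by (intro DERIV_cmult df z)
  moreover have "((\<lambda>z. s * e * p z) has_real_derivative s * e * deriv p (x $ 3)) (at (x $ 3))"
    by (intro DERIV_cmult dp z)
  ultimately have V: "pd 3 (swave k (\<lambda>z. m * (s * e / r * f z))) x = swave k (\<lambda>z. m * (s * e / r * deriv f z)) x"
    "pd 3 (cwave k (\<lambda>z. s * e * p z)) x = cwave k (\<lambda>z. s * e * deriv p z) x" for m
    using pd_wave_vertical(1)[where a' = "\<lambda>z. m * (s * e / r * deriv f z)" and a = "\<lambda>z. m * (s * e / r * f z)" and x = x and k = k]
      pd_wave_vertical(2)[where a' = "\<lambda>z. s * e * deriv p z" and a = "\<lambda>z. s * e * p z" and x = x and k = k] by auto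
  show "Dmat v x $ 1 $ 1 = cwave k (\<lambda>z. k $ 1 * k $ 1 * (s * e / r * f z)) x"
    "Dmat v x $ 1 $ 2 = cwave k (\<lambda>z. k $ 1 * k $ 2 * (s * e / r * f z)) x"
    "Dmat v x $ 1 $ 3 = swave k (\<lambda>z. k $ 1 * (s * e / r * deriv f z)) x"
    "Dmat v x $ 2 $ 1 = cwave k (\<lambda>z. k $ 1 * k $ 2 * (s * e / r * f z)) x"
    "Dmat v x $ 2 $ 2 = cwave k (\<lambda>z. k $ 2 * k $ 2 * (s * e / r * f z)) x"
    "Dmat v x $ 2 $ 3 = swave k (\<lambda>z. k $ 2 * (s * e / r * deriv f z)) x"
    "Dmat v x $ 3 $ 1 = swave k (\<lambda>z. - (k $ 1 * (s * e * p z))) x"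
    "Dmat v x $ 3 $ 2 = swave k (\<lambda>z. - (k $ 2 * (s * e * p z))) x"
    "Dmat v x $ 3 $ 3 = cwave k (\<lambda>z. s * e * deriv p z) x"
    unfolding Dmat_def vec_lambda_beta v_fun pd_wave_horizontal V by (simp_all only: mult_ac)
qed

lemma divg_v:
  assumes "x \<in> strip S"
  shows "divg v x = cwave k dil x"
proof -
  have "divg v x = Dmat v x $ 1 $ 1 + Dmat v x $ 2 $ 2 + Dmat v x $ 3 $ 3"
    by (simp add: divg_def Dmat_def sum_3)
  also have "\<dots> = cwave k dil x"
    unfolding Dmat_v[OF assms] wave_arith
  proof (rule wave_eqI(2))
    have "k $ 1 * k $ 1 * (s * e / r * y) + k $ 2 * k $ 2 * (s * e / r * y) = s * e * (r * y)" for y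
    proof -
      have "k $ 1 * k $ 1 * (s * e / r * y) + k $ 2 * k $ 2 * (s * e / r * y) = (k $ 1 * k $ 1 + k $ 2 * k $ 2) * (s * e / r * y)"
        by (simp add: distrib_right add_divide_distrib)
      then show ?thesis using r0 unfolding r2 by simp
    qed
    then show "k $ 1 * k $ 1 * (s * e / r * f (x $ 3)) + k $ 2 * k $ 2 * (s * e / r * f (x $ 3)) + s * e * deriv p (x $ 3) = dil (x $ 3)"
      by (simp add: dil_def distrib_left)
  qed
  finally show ?thesis .
qed

text \<open>The amplitudes of the entries of the viscous stress. Those in the last column are, up to constants and up
  to the pressure, the two fluxes of the profile, whose derivatives are known.\<close>

definition shear :: "real \<Rightarrow> real" where "shear z = e / r * flux_phi c r s f p z"
definition normal :: "real \<Rightarrow> real" where "normal z = eps0 c z * (2 * (s * e * deriv p z) - 2/3 * dil z) + del0 c z * dil z"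
definition lateral :: "real \<Rightarrow> real \<Rightarrow> real" where
  "lateral m z = eps0 c z * (2 * (m * (s * e / r * f z)) - 2/3 * dil z) + del0 c z * dil z"

lemma visc_stress_v:
  assumes x: "x \<in> strip S"
  shows "visc_stress c v x $ 1 $ 1 = cwave k (lateral (k $ 1 * k $ 1)) x"
    "visc_stress c v x $ 1 $ 2 = cwave k (\<lambda>z. eps0 c z * (2 * (k $ 1 * k $ 2 * (s * e / r * f z)))) x"
    "visc_stress c v x $ 1 $ 3 = swave k (\<lambda>z. k $ 1 * shear z) x"
    "visc_stress c v x $ 2 $ 1 = cwave k (\<lambda>z. eps0 c z * (2 * (k $ 1 * k $ 2 * (s * e / r * f z)))) x"
    "visc_stress c v x $ 2 $ 2 = cwave k (lateral (k $ 2 * k $ 2)) x"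
    "visc_stress c v x $ 2 $ 3 = swave k (\<lambda>z. k $ 2 * shear z) x"
    "visc_stress c v x $ 3 $ 1 = swave k (\<lambda>z. k $ 1 * shear z) x"
    "visc_stress c v x $ 3 $ 2 = swave k (\<lambda>z. k $ 2 * shear z) x"
    "visc_stress c v x $ 3 $ 3 = cwave k normal x"
  unfolding visc_stress_def
  by (simp_all add: transpose_def mat_def Dmat_v[OF x] divg_v[OF x] wave_arith wave_coeff)
     (rule wave_eqI; use r0 in \<open>simp add: lateral_def normal_def shear_def flux_phi_def field_simps\<close>)+

lemma jump_stress_v:
  assumes x: "x \<in> strip S" and q: "q x = cwave k (\<lambda>z. - (e * (rho0 c z * (r * f z + deriv p z)))) x"
  shows "(jump_stress c q v x *v e3) $ 1 = swave k (\<lambda>z. - (k $ 1 * shear z)) x"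
    "(jump_stress c q v x *v e3) $ 2 = swave k (\<lambda>z. - (k $ 2 * shear z)) x"
    "(jump_stress c q v x *v e3) $ 3 = cwave k (\<lambda>z. - (e * flux_psi c r s f p z)) x"
  unfolding jump_stress_def
  by (simp_all add: matrix_vector_mult_def sum_3 axis_def transpose_def mat_def Dmat_v[OF x] divg_v[OF x] q wave_arith wave_coeff)
     (rule wave_eqI; use r0 in \<open>simp add: dil_def shear_def flux_phi_def flux_psi_def field_simps\<close>)+

lemma pd_v_cong:
  assumes "x \<in> strip S" "\<And>y. y \<in> strip S \<Longrightarrow> F y = G y"
  shows "pd i F x = pd i G x"
  by (rule pd_cong_open(1)[OF open_strip[OF S] assms])

text \<open>The horizontal components are the equation for \<open>flux_phi\<close> multiplied by a component of \<open>k\<close>, the vertical one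
  is the equation for \<open>flux_psi\<close>; the two horizontal derivatives of the shear stress combine to \<open>r * flux_phi\<close>.\<close>

lemma momentum_equation:
  assumes x: "x \<in> strip S"
    and q: "\<And>x. q x = cwave k (\<lambda>z. - (e * (rho0 c z * (r * f z + deriv p z)))) x"
    and w: "\<And>x. w x = cwave k (\<lambda>z. e * p z) x"
  shows "rho0 c (x $ 3) *\<^sub>R (s *\<^sub>R v x) + grad (\<lambda>y. dP0 c (y $ 3) *\<^sub>R q y) x + (grav c *\<^sub>R q x) *s e3
     + (grav c * rho0 c (x $ 3)) *\<^sub>R grad w x = divm (visc_stress c v) x"
proof -
  let ?z = "x $ 3"
  have z: "?z \<in> S" using x by (simp add: strip_def)
  define Pr where "Pr z = e * (dP0 c z * (rho0 c z * (r * f z + deriv p z)))" for z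
  have Pf: "(\<lambda>y. dP0 c (y $ 3) *\<^sub>R q y) = cwave k (\<lambda>z. - Pr z)"
    by (rule ext) (simp add: q wave_coeff Pr_def algebra_simps)
  have wf: "w = cwave k (\<lambda>z. e * p z)" using w by auto
  have PrC: "C_inf_on S Pr"
    unfolding Pr_def by (intro C_inf_on_intros S smooth C_inf_on_deriv)
  note dPr = C_inf_on_has_deriv[OF PrC z]
  have dshear: "(shear has_real_derivative e / r * rhs_phi c r s f p ?z) (at ?z)"
    unfolding shear_def[abs_def] using mode z by (intro DERIV_cmult) (simp add: layer_mode_def)
  have normal_eq: "normal = (\<lambda>z. e * flux_psi c r s f p z - Pr z)"
    by (rule ext) (simp add: normal_def dil_def flux_psi_def Pr_def field_simps)
  have dnormal: "(normal has_real_derivative e * rhs_psi c r s f p ?z - deriv Pr ?z) (at ?z)"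
    unfolding normal_eq using mode z by (intro DERIV_diff DERIV_cmult dPr) (simp add: layer_mode_def)
  have p3: "pd 3 (cwave k (\<lambda>z. - Pr z)) x = cwave k (\<lambda>z. - deriv Pr z) x"
    by (rule pd_wave_vertical(2)) (rule DERIV_minus[OF dPr])
  have w3: "pd 3 (cwave k (\<lambda>z. e * p z)) x = cwave k (\<lambda>z. e * deriv p z) x"
    by (rule pd_wave_vertical(2)) (rule DERIV_cmult[OF dp[OF z]])
  have s3: "pd 3 (swave k (\<lambda>z. m * shear z)) x = swave k (\<lambda>z. m * (e / r * rhs_phi c r s f p z)) x" for m
    by (rule pd_wave_vertical(1)) (rule DERIV_cmult[OF dshear])
  have n3: "pd 3 (cwave k normal) x = cwave k (\<lambda>z. e * rhs_psi c r s f p z - deriv Pr z) x"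
    by (rule pd_wave_vertical(2)) (rule dnormal)
  note st = visc_stress_v[THEN pd_v_cong[OF x]]
  have d1: "divm (visc_stress c v) x $ 1 = swave k (\<lambda>z. - (k $ 1 * lateral (k $ 1 * k $ 1) z)) x
      + swave k (\<lambda>z. - (k $ 2 * (eps0 c z * (2 * (k $ 1 * k $ 2 * (s * e / r * f z)))))) x
      + swave k (\<lambda>z. k $ 1 * (e / r * rhs_phi c r s f p z)) x"
    by (simp add: divm_def sum_3 st pd_wave_horizontal s3)
  have d2: "divm (visc_stress c v) x $ 2 = swave k (\<lambda>z. - (k $ 1 * (eps0 c z * (2 * (k $ 1 * k $ 2 * (s * e / r * f z)))))) x
      + swave k (\<lambda>z. - (k $ 2 * lateral (k $ 2 * k $ 2) z)) x
      + swave k (\<lambda>z. k $ 2 * (e / r * rhs_phi c r s f p z)) x"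
    by (simp add: divm_def sum_3 st pd_wave_horizontal s3)
  have d3: "divm (visc_stress c v) x $ 3 = cwave k (\<lambda>z. k $ 1 * (k $ 1 * shear z)) x + cwave k (\<lambda>z. k $ 2 * (k $ 2 * shear z)) x
      + cwave k (\<lambda>z. e * rhs_psi c r s f p z - deriv Pr z) x"
    by (simp add: divm_def sum_3 st pd_wave_horizontal n3)
  have hor: "rho0 c ?z * (s * (m * (s * e / r * f ?z))) + m * Pr ?z + (grav c * rho0 c ?z) * - (m * (e * p ?z))
     = - (m * lateral (m * m) ?z) + - (n * (eps0 c ?z * (2 * (m * n * (s * e / r * f ?z))))) + m * (e / r * rhs_phi c r s f p ?z)"
    if mn: "m * m + n * n = r * r" for m n
  proof -
    have L: "- (m * lateral (m * m) ?z) + - (n * (eps0 c ?z * (2 * (m * n * (s * e / r * f ?z)))))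
       = m * (- (eps0 c ?z * (2 * ((m * m + n * n) * (s * e / r * f ?z)) - 2/3 * dil ?z)) - del0 c ?z * dil ?z)"
      by (simp add: lateral_def algebra_simps add_divide_distrib)
    have R: "e / r * rhs_phi c r s f p ?z = rho0 c ?z * (s * (s * e / r * f ?z)) + Pr ?z - (grav c * rho0 c ?z) * (e * p ?z)
       + (eps0 c ?z * (2 * ((r * r) * (s * e / r * f ?z)) - 2/3 * dil ?z) + del0 c ?z * dil ?z)"
      using r0 by (simp add: rhs_phi_def Pr_def dil_def power2_eq_square field_simps)
    show ?thesis
      unfolding L R mn by (simp add: algebra_simps)
  qed
  have ver: "rho0 c ?z * (s * (s * e * p ?z)) + - deriv Pr ?z + grav c * - (e * (rho0 c ?z * (r * f ?z + deriv p ?z))) + (grav c * rho0 c ?z) * (e * deriv p ?z)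
     = k $ 1 * (k $ 1 * shear ?z) + k $ 2 * (k $ 2 * shear ?z) + (e * rhs_psi c r s f p ?z - deriv Pr ?z)"
  proof -
    have "k $ 1 * (k $ 1 * shear ?z) + k $ 2 * (k $ 2 * shear ?z) = (k $ 1 * k $ 1 + k $ 2 * k $ 2) * shear ?z"
      by (simp add: algebra_simps)
    also have "\<dots> = e * (r * flux_phi c r s f p ?z)" using r0 by (simp add: r2 shear_def)
    finally show ?thesis by (simp add: rhs_psi_def power2_eq_square algebra_simps)
  qed
  show ?thesis
    unfolding vec_eq_iff forall_3
  proof (intro conjI)
    show "(rho0 c ?z *\<^sub>R (s *\<^sub>R v x) + grad (\<lambda>y. dP0 c (y $ 3) *\<^sub>R q y) x + (grav c *\<^sub>R q x) *s e3 + (grav c * rho0 c ?z) *\<^sub>R grad w x) $ 1 = divm (visc_stress c v) x $ 1"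
      unfolding d1 using hor[OF r2]
      by (simp add: grad_def Pf wf pd_wave_horizontal v1 axis_def wave_arith) (rule wave_eqI(1), simp)
    have r2': "k $ 2 * k $ 2 + k $ 1 * k $ 1 = r * r" using r2 by simp
    show "(rho0 c ?z *\<^sub>R (s *\<^sub>R v x) + grad (\<lambda>y. dP0 c (y $ 3) *\<^sub>R q y) x + (grav c *\<^sub>R q x) *s e3 + (grav c * rho0 c ?z) *\<^sub>R grad w x) $ 2 = divm (visc_stress c v) x $ 2"
      unfolding d2 using hor[OF r2']
      by (simp add: grad_def Pf wf pd_wave_horizontal v2 axis_def wave_arith) (rule wave_eqI(1), simp add: mult_ac)
    show "(rho0 c ?z *\<^sub>R (s *\<^sub>R v x) + grad (\<lambda>y. dP0 c (y $ 3) *\<^sub>R q y) x + (grav c *\<^sub>R q x) *s e3 + (grav c * rho0 c ?z) *\<^sub>R grad w x) $ 3 = divm (visc_stress c v) x $ 3"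
      unfolding d3 using ver
      by (simp add: grad_def Pf wf p3 w3 v3 q[of x] axis_def wave_arith) (rule wave_eqI(2), simp)
  qed
qed

end

section \<open>Traces on the interface and the boundary\<close>

text \<open>One-sided limits of the amplitude are traces of the field.\<close>

lemma tendsto_vertical:
  fixes g :: "real \<Rightarrow> real" and y :: "real^3"
  assumes lim: "(g \<longlongrightarrow> l) (at (y $ 3) within S)" and yS: "y $ 3 \<notin> S"
  shows "((\<lambda>x. g (x $ 3)) \<longlongrightarrow> l) (at y within strip S)"
proof -
  have c: "((\<lambda>x. x $ 3) \<longlongrightarrow> y $ 3) (at y within strip S)"
    by (intro tendsto_intros)
  have "\<forall>\<^sub>F x in at y within strip S. x $ 3 \<in> S \<and> x $ 3 \<noteq> y $ 3"
    unfolding eventually_at_filter by (rule always_eventually) (use yS in \<open>auto simp: strip_def\<close>)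
  then have "filterlim (\<lambda>x. x $ 3) (at (y $ 3) within S) (at y within strip S)"
    using c by (auto simp: filterlim_at elim: eventually_mono)
  then show ?thesis by (rule filterlim_compose[OF lim])
qed

lemma wave_tendsto:
  assumes "(g \<longlongrightarrow> l) (at (y $ 3) within S)" "y $ 3 \<notin> S"
  shows "(swave k g \<longlongrightarrow> complex_of_real (l * sin (horiz y \<bullet> k))) (at y within strip S)"
    and "(cwave k g \<longlongrightarrow> complex_of_real (l * cos (horiz y \<bullet> k))) (at y within strip S)"
proof -
  have h: "((\<lambda>x. horiz x \<bullet> k) \<longlongrightarrow> horiz y \<bullet> k) (at y within strip S)"
    unfolding inner_horiz by (intro tendsto_intros)
  show "(swave k g \<longlongrightarrow> complex_of_real (l * sin (horiz y \<bullet> k))) (at y within strip S)"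
    "(cwave k g \<longlongrightarrow> complex_of_real (l * cos (horiz y \<bullet> k))) (at y within strip S)"
    unfolding swave_def cwave_def
    by (intro tendsto_of_real tendsto_mult tendsto_sin tendsto_cos h tendsto_vertical assms)+
qed

lemma strip_accumulation:
  assumes "at (y $ 3) within S \<noteq> bot"
  shows "at y within strip S \<noteq> (bot :: (real^3) filter)"
proof -
  have isl: "y $ 3 islimpt S" using assms by (simp add: trivial_limit_within)
  have "y islimpt strip S"
    unfolding islimpt_approachable
  proof (intro allI impI)
    fix e :: real assume "e > 0"
    then obtain z where z: "z \<in> S" "z \<noteq> y $ 3" "dist z (y $ 3) < e"
      using isl unfolding islimpt_approachable by blast
    let ?x = "y + (z - y $ 3) *\<^sub>R axis 3 1"
    have "?x $ 3 = z" by (simp add: axis_def)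
    then have "?x \<in> strip S" "?x \<noteq> y" using z by (auto simp: strip_def)
    moreover have "dist ?x y < e" using z(3) by (simp add: dist_norm)
    ultimately show "\<exists>x'\<in>strip S. x' \<noteq> y \<and> dist x' y < e" by blast
  qed
  then show ?thesis by (simp add: trivial_limit_within)
qed

lemma pd_cong_plane:
  assumes "i = 1 \<or> i = 2" "\<And>x. x $ 3 = y $ 3 \<Longrightarrow> f x = g x"
  shows "pd i f y = pd i g y" "has_pd i f y \<longleftrightarrow> has_pd i g y"
proof -
  have "(y + h *\<^sub>R axis i 1) $ 3 = y $ 3" for h using assms(1) by (auto simp: axis_def)
  then have "(\<lambda>h. f (y + h *\<^sub>R axis i 1)) = (\<lambda>h. g (y + h *\<^sub>R axis i 1))" using assms(2) by auto
  then show "pd i f y = pd i g y" "has_pd i f y \<longleftrightarrow> has_pd i g y" by (simp_all add: pd_def has_pd_def)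
qed

lemma Omega_strip:
  "Omega_p c = strip {0<..<height c}" "Omega_m c = strip {- depth c<..<0}"
  by (auto simp: Omega_p_def Omega_m_def strip_def)

lemma tendsto_vec3:
  fixes f :: "'b \<Rightarrow> complex^3"
  assumes "((\<lambda>x. f x $ 1) \<longlongrightarrow> a1) F" "((\<lambda>x. f x $ 2) \<longlongrightarrow> a2) F" "((\<lambda>x. f x $ 3) \<longlongrightarrow> a3) F"
  shows "(f \<longlongrightarrow> vector [a1, a2, a3]) F"
proof (rule vec_tendstoI)
  fix i :: 3
  show "((\<lambda>x. f x $ i) \<longlongrightarrow> vector [a1, a2, a3] $ i) F"
    using UNIV_3_cases[of i] assms by auto
qed

section \<open>The growing mode solves the linearized problem\<close>

locale growing_mode =
  fixes c :: params and k :: "real^2" and r s :: real and f p :: "real \<Rightarrow> real"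
    and \<eta> v :: "real \<Rightarrow> real^3 \<Rightarrow> complex^3" and q :: "real \<Rightarrow> real^3 \<Rightarrow> complex"
  assumes std: "standing c" and rpos: "r \<noteq> 0" and r2: "k $ 1 * k $ 1 + k $ 2 * k $ 2 = r * r"
    and lat: "k \<in> lattice (perL c)" and mode: "classical_mode c r s f p"
    and \<eta>1: "\<And>t x. \<eta> t x $ 1 = swave k (\<lambda>z. 2 * exp (s * t) * k $ 1 / r * f z) x"
    and \<eta>2: "\<And>t x. \<eta> t x $ 2 = swave k (\<lambda>z. 2 * exp (s * t) * k $ 2 / r * f z) x"
    and \<eta>3: "\<And>t x. \<eta> t x $ 3 = cwave k (\<lambda>z. 2 * exp (s * t) * p z) x"
    and v_eq: "\<And>t x. v t x = s *\<^sub>R \<eta> t x"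
    and q_eq: "\<And>t x. q t x = cwave k (\<lambda>z. - (2 * exp (s * t) * (rho0 c z * (r * f z + deriv p z)))) x"
begin

lemma pos: "depth c > 0" "height c > 0" "perL c > 0"
  using std by (auto simp: standing_def)

lemma cont: "continuous_on {- depth c..height c} f" "continuous_on {- depth c..height c} p"
  and ends: "f (- depth c) = 0" "f (height c) = 0" "p (- depth c) = 0" "p (height c) = 0"
  using mode by (auto simp: classical_mode_def)

lemma layer: "S = {0<..<height c} \<or> S = {- depth c<..<0} \<Longrightarrow> layer_mode c r s f p S"
  using mode by (auto simp: classical_mode_def)

lemma v_comp:
  "v t x $ 1 = swave k (\<lambda>z. k $ 1 * (s * (2 * exp (s * t)) / r * f z)) x"
  "v t x $ 2 = swave k (\<lambda>z. k $ 2 * (s * (2 * exp (s * t)) / r * f z)) x"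
  "v t x $ 3 = cwave k (\<lambda>z. s * (2 * exp (s * t)) * p z) x"
  unfolding v_eq vector_scaleR_component \<eta>1 \<eta>2 \<eta>3 wave_arith by (rule wave_eqI; simp)+

lemma velocity:
  assumes "S = {0<..<height c} \<or> S = {- depth c<..<0}"
  shows "mode_velocity c k r s (2 * exp (s * t)) f p S (v t)"
  by (rule mode_velocity.intro[OF _ rpos r2 layer[OF assms] v_comp]) (use assms in auto)

lemma growth: "\<eta> t x = exp (s * t) *\<^sub>R \<eta> 0 x" "v t x = exp (s * t) *\<^sub>R v 0 x" "q t x = exp (s * t) *\<^sub>R q 0 x"
proof -
  show *: "\<eta> t x = exp (s * t) *\<^sub>R \<eta> 0 x"
    unfolding vec_eq_iff forall_3
    by (simp add: \<eta>1 \<eta>2 \<eta>3 wave_arith) (intro conjI wave_eqI; simp)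
  show "v t x = exp (s * t) *\<^sub>R v 0 x" unfolding v_eq * by (simp add: mult.commute)
  show "q t x = exp (s * t) *\<^sub>R q 0 x" by (simp add: q_eq wave_arith) (rule wave_eqI, simp)
qed

lemma time_deriv:
  fixes w :: "real \<Rightarrow> real^3 \<Rightarrow> 'a::real_normed_vector"
  assumes "\<And>t x. w t x = exp (s * t) *\<^sub>R w 0 x"
  shows "((\<lambda>t. w t x) has_vector_derivative s *\<^sub>R w t x) (at t)"
proof -
  have "((\<lambda>t. exp (s * t)) has_vector_derivative s * exp (s * t)) (at t)"
    unfolding has_real_derivative_iff_has_vector_derivative[symmetric] by (auto intro!: derivative_eq_intros)
  then have "((\<lambda>t. exp (s * t) *\<^sub>R w 0 x) has_vector_derivative (s * exp (s * t)) *\<^sub>R w 0 x) (at t)"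
    by (rule bounded_linear.has_vector_derivative[OF bounded_linear_scaleR_left])
  moreover have "(\<lambda>t. w t x) = (\<lambda>t. exp (s * t) *\<^sub>R w 0 x)" by (rule ext) (rule assms)
  moreover have "s *\<^sub>R w t x = (s * exp (s * t)) *\<^sub>R w 0 x" by (subst assms) simp
  ultimately show ?thesis by (simp only:)
qed

lemma dt_eq: "dt \<eta> t x = v t x" "dt v t x = s *\<^sub>R v t x" "dt q t x = s *\<^sub>R q t x"
proof -
  show "dt \<eta> t x = v t x"
    unfolding dt_def v_eq by (rule vector_derivative_at[OF time_deriv[of \<eta>, OF growth(1)]])
  show "dt v t x = s *\<^sub>R v t x"
    unfolding dt_def by (rule vector_derivative_at[OF time_deriv[of v, OF growth(2)]])
  show "dt q t x = s *\<^sub>R q t x"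
    unfolding dt_def by (rule vector_derivative_at[OF time_deriv[of q, OF growth(3)]])
qed

lemma Ck_on_components: 
  assumes "S = {0<..<height c} \<or> S = {- depth c<..<0}"
  shows "Ck_on n (strip S) (\<eta> t)" "Ck_on n (strip S) (v t)" "Ck_on n (strip S) (q t)"
proof -
  have S: "open S" using assms by auto
  have sm: "C_inf_on S f" "C_inf_on S p" "C_inf_on S (\<lambda>z. rho0 c z * (r * f z + deriv p z))"
    using layer[OF assms] by (auto simp: layer_mode_def smooth_bdd_def)
  have W: "Ck_on n (strip S) (swave k (\<lambda>z. m * g z))" "Ck_on n (strip S) (cwave k (\<lambda>z. m * g z))" if "C_inf_on S g" for g m
    using Ck_on_wave[OF S C_inf_on_cmult[OF S that, of m]] by auto
  have N: "- (a * b) = (- a) * b" for a b :: real by simp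
  show "Ck_on n (strip S) (\<eta> t)" "Ck_on n (strip S) (v t)"
  proof (rule_tac [!] Ck_on_vec[OF open_strip[OF S]])
    fix i :: 3
    show "Ck_on n (strip S) (\<lambda>x. \<eta> t x $ i)"
      using UNIV_3_cases[of i]
      by (elim disjE; hypsubst) (unfold \<eta>1 \<eta>2 \<eta>3, (rule W(1)[OF sm(1)] W(2)[OF sm(2)])+)
    show "Ck_on n (strip S) (\<lambda>x. v t x $ i)"
      using UNIV_3_cases[of i]
      by (elim disjE; hypsubst) (unfold v_comp, (rule W(1)[OF C_inf_on_cmult[OF S sm(1)]] W(2)[OF sm(2)])+)
  qed
  show "Ck_on n (strip S) (q t)"
    unfolding q_eq[abs_def] N by (rule W(2)[OF sm(3)])
qed

lemma trace_\<eta>3: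
  assumes "y $ 3 = 0"
  shows "trace0 c (\<lambda>x. \<eta> t x $ 3) y = cwave k (\<lambda>z. 2 * exp (s * t) * p 0) y"
proof -
  have "isCont p 0" using continuous_on_interior[OF cont(2), of 0] pos by simp
  then have "((\<lambda>z. 2 * exp (s * t) * p z) \<longlongrightarrow> 2 * exp (s * t) * p 0) (at (y $ 3) within {0<..<height c})"
    unfolding assms isCont_def by (intro tendsto_intros) (rule tendsto_mono[OF at_le[OF subset_UNIV]])
  then have "(cwave k (\<lambda>z. 2 * exp (s * t) * p z) \<longlongrightarrow> complex_of_real (2 * exp (s * t) * p 0 * cos (horiz y \<bullet> k))) (at y within strip {0<..<height c})"
    by (rule wave_tendsto(2)) (use assms in simp)
  then have "((\<lambda>x. \<eta> t x $ 3) \<longlongrightarrow> cwave k (\<lambda>z. 2 * exp (s * t) * p 0) y) (at y within Omega_p c)"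
    unfolding Omega_strip \<eta>3 cwave_def[of k "\<lambda>z. 2 * exp (s * t) * p 0"] .
  moreover have "at y within Omega_p c \<noteq> bot"
    unfolding Omega_strip by (rule strip_accumulation) (use assms pos in \<open>simp add: trivial_limit_within islimpt_greaterThanLessThan1\<close>)
  ultimately show ?thesis unfolding trace0_def by (intro tendsto_Lim) auto
qed

text \<open>Tangential derivatives of the trace only use its values on the interface plane.\<close>

lemma trace_\<eta>3_pd:
  fixes t :: real
  assumes y: "y $ 3 = 0" and i: "i = 1 \<or> i = 2"
  defines "T \<equiv> trace0 c (\<lambda>x. \<eta> t x $ 3)" and "m \<equiv> (if i = 1 then k $ 1 else k $ 2)"
  shows "has_pd i T y" "has_pd i (pd i T) y" "pd i (pd i T) y = cwave k (\<lambda>z. - (m * (m * (2 * exp (s * t) * p 0)))) y"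
proof -
  let ?a = "\<lambda>z::real. 2 * exp (s * t) * p 0"
  have T: "T x = cwave k ?a x" if "x $ 3 = 0" for x using trace_\<eta>3[OF that] by (simp add: T_def)
  have h: "has_pd i (cwave k a) x" "has_pd i (swave k a) x" for a x
    unfolding has_pd_def using i wave_deriv_horizontal[of k a x] by (auto intro: differentiableI_vector)
  show "has_pd i T y" using pd_cong_plane(2)[OF i, of y T "cwave k ?a"] T y h by simp
  have 1: "pd i T x = swave k (\<lambda>z. - (m * ?a z)) x" if "x $ 3 = 0" for x
    using pd_cong_plane(1)[OF i, of x T "cwave k ?a"] T that i by (auto simp: pd_wave_horizontal m_def)
  show "has_pd i (pd i T) y" using pd_cong_plane(2)[OF i, of y "pd i T" "swave k (\<lambda>z. - (m * ?a z))"] 1 y h by simp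
  show "pd i (pd i T) y = cwave k (\<lambda>z. - (m * (m * ?a z))) y"
    using pd_cong_plane(1)[OF i, of y "pd i T" "swave k (\<lambda>z. - (m * ?a z))"] 1 y i by (auto simp: pd_wave_horizontal m_def)
qed

lemma regularity: "classical_regularity c \<eta> v q"
  unfolding classical_regularity_def
proof (intro allI impI conjI ballI)
  fix t :: real
  have P: "periodic_on (perL c) U (swave k a)" "periodic_on (perL c) U (cwave k a)" for U a
    using wave_periodic[OF lat pos(3)] by auto
  have per: "periodic_on (perL c) U w" if "\<And>i. periodic_on (perL c) U (\<lambda>x. w x $ i)" for U and w :: "real^3 \<Rightarrow> complex^3"
    using that by (simp add: periodic_on_def vec_eq_iff)
  have p\<eta>: "periodic_on (perL c) (Omega c) (\<eta> t)" for t
  proof (rule per)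
    fix i show "periodic_on (perL c) (Omega c) (\<lambda>x. \<eta> t x $ i)"
      using UNIV_3_cases[of i] P by (auto simp: \<eta>1 \<eta>2 \<eta>3)
  qed
  then show "periodic_on (perL c) (Omega c) (\<eta> t)" .
  from p\<eta>[of t] show "periodic_on (perL c) (Omega c) (v t)" by (simp add: periodic_on_def v_eq)
  show "periodic_on (perL c) (Omega_p c \<union> Omega_m c) (q t)"
    unfolding q_eq[abs_def] using P(2) by auto
  fix U assume "U \<in> {Omega_p c, Omega_m c}"
  then obtain S where S: "S = {0<..<height c} \<or> S = {- depth c<..<0}" "U = strip S"
    by (auto simp: Omega_strip)
  show "Ck_on 2 U (\<eta> t)" "Ck_on 2 U (v t)" "Ck_on 1 U (q t)"
    unfolding S(2) by (rule Ck_on_components[OF S(1)])+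
  fix x
  show "(\<lambda>s. \<eta> s x) differentiable (at t)" by (rule differentiableI_vector[OF time_deriv[of \<eta>, OF growth(1)]])
  show "(\<lambda>s. v s x) differentiable (at t)" by (rule differentiableI_vector[OF time_deriv[of v, OF growth(2)]])
  show "(\<lambda>s. q s x) differentiable (at t)" by (rule differentiableI_vector[OF time_deriv[of q, OF growth(3)]])
next
  fix t and y :: "real^3" and i :: 3 assume "y $ 3 = 0" "i \<in> {1, 2}"
  then show "has_pd i (trace0 c (\<lambda>x. \<eta> t x $ 3)) y" "has_pd i (pd i (trace0 c (\<lambda>x. \<eta> t x $ 3))) y"
    using trace_\<eta>3_pd(1,2)[of y i t] by auto
qed

lemma trace_velocity:
  assumes y: "y $ 3 \<in> {- depth c..height c}" and S: "S \<subseteq> {- depth c..height c}" "y $ 3 \<notin> S"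
  shows "(\<eta> t \<longlongrightarrow> vector [complex_of_real (2 * exp (s * t) * k $ 1 / r * f (y $ 3) * sin (horiz y \<bullet> k)),
      complex_of_real (2 * exp (s * t) * k $ 2 / r * f (y $ 3) * sin (horiz y \<bullet> k)),
      complex_of_real (2 * exp (s * t) * p (y $ 3) * cos (horiz y \<bullet> k))]) (at y within strip S)"
proof -
  have "(g \<longlongrightarrow> g (y $ 3)) (at (y $ 3) within S)" if "continuous_on {- depth c..height c} g" for g :: "real \<Rightarrow> real"
  proof -
    have "(g \<longlongrightarrow> g (y $ 3)) (at (y $ 3) within {- depth c..height c})"
      using that y by (simp add: continuous_on_def)
    then show ?thesis by (rule tendsto_mono[OF at_le[OF S(1)]])
  qed
  then have fl: "(f \<longlongrightarrow> f (y $ 3)) (at (y $ 3) within S)" and pl: "(p \<longlongrightarrow> p (y $ 3)) (at (y $ 3) within S)"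
    using cont by auto
  show ?thesis
    by (rule tendsto_vec3; unfold \<eta>1 \<eta>2 \<eta>3; rule wave_tendsto[OF tendsto_mult[OF tendsto_const fl] S(2)] wave_tendsto[OF tendsto_mult[OF tendsto_const pl] S(2)])
qed

lemma jump_velocity:
  assumes "y $ 3 = 0"
  shows "has_jump c (\<eta> t) y 0" "has_jump c (v t) y 0"
proof -
  have s: "{0<..<height c} \<subseteq> {- depth c..height c}" "{- depth c<..<0} \<subseteq> {- depth c..height c}"
    and y: "y $ 3 \<in> {- depth c..height c}" "y $ 3 \<notin> {0<..<height c}" "y $ 3 \<notin> {- depth c<..<0}"
    using pos assms by auto
  note lim = trace_velocity[OF y(1) s(1) y(2), of t] trace_velocity[OF y(1) s(2) y(3), of t]
  show "has_jump c (\<eta> t) y 0"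
    unfolding has_jump_def Omega_strip using lim by (intro exI conjI) (assumption+, simp)
  have "(v t \<longlongrightarrow> s *\<^sub>R l) F" if "(\<eta> t \<longlongrightarrow> l) F" for l F
    using tendsto_scaleR[OF tendsto_const that, of s] by (simp add: v_eq[abs_def])
  from this[OF lim(1)] this[OF lim(2)]
  show "has_jump c (v t) y 0"
    unfolding has_jump_def Omega_strip by (intro exI conjI) (assumption+, simp)
qed

lemma boundary_velocity:
  "y $ 3 = - depth c \<Longrightarrow> (v t \<longlongrightarrow> 0) (at y within Omega_m c)"
  "y $ 3 = height c \<Longrightarrow> (v t \<longlongrightarrow> 0) (at y within Omega_p c)"
proof -
  have z: "vector [0, 0, 0] = (0 :: complex^3)" by (simp add: vec_eq_iff forall_3)
  have v0: "(v t \<longlongrightarrow> 0) F" if "(\<eta> t \<longlongrightarrow> 0) F" for F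
    using tendsto_scaleR[OF tendsto_const that, of s] by (simp add: v_eq[abs_def])
  show "(v t \<longlongrightarrow> 0) (at y within Omega_m c)" if "y $ 3 = - depth c"
    using trace_velocity[of y "{- depth c<..<0}" t] that pos ends z by (intro v0) (simp add: Omega_strip subset_eq)
  show "(v t \<longlongrightarrow> 0) (at y within Omega_p c)" if "y $ 3 = height c"
    using trace_velocity[of y "{0<..<height c}" t] that pos ends z by (intro v0) (simp add: Omega_strip subset_eq)
qed

text \<open>The last column of the stress consists of waves whose amplitudes are multiples of the fluxes.\<close>

lemma trace_stress:
  assumes SS: "S = {0<..<height c} \<or> S = {- depth c<..<0}" and y: "y $ 3 = 0"
    and lim: "(flux_phi c r s f p \<longlongrightarrow> a) (at 0 within S)" "(flux_psi c r s f p \<longlongrightarrow> b) (at 0 within S)"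
  shows "((\<lambda>x. jump_stress c (q t) (v t) x *v e3) \<longlongrightarrow>
     vector [complex_of_real (- (k $ 1 * (2 * exp (s * t) / r * a)) * sin (horiz y \<bullet> k)),
       complex_of_real (- (k $ 2 * (2 * exp (s * t) / r * a)) * sin (horiz y \<bullet> k)),
       complex_of_real (- (2 * exp (s * t) * b) * cos (horiz y \<bullet> k))]) (at y within strip S)"
proof -
  interpret mode_velocity c k r s "2 * exp (s * t)" f p S "v t" by (rule velocity[OF SS])
  have y': "y $ 3 \<notin> S" using SS y by auto
  have ev: "\<forall>\<^sub>F x in at y within strip S. x \<in> strip S" by (auto simp: eventually_at_filter)
  have sl: "(shear \<longlongrightarrow> 2 * exp (s * t) / r * a) (at (y $ 3) within S)"
    unfolding shear_def[abs_def] y by (intro tendsto_intros lim rpos)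
  have fl: "((\<lambda>z. - (2 * exp (s * t) * flux_psi c r s f p z)) \<longlongrightarrow> - (2 * exp (s * t) * b)) (at (y $ 3) within S)"
    unfolding y by (intro tendsto_intros lim)
  have sm: "((\<lambda>z. - (m * shear z)) \<longlongrightarrow> - (m * (2 * exp (s * t) / r * a))) (at (y $ 3) within S)" for m
    by (intro tendsto_intros sl)
  show ?thesis
  proof (rule tendsto_vec3)
    show "((\<lambda>x. (jump_stress c (q t) (v t) x *v e3) $ 1) \<longlongrightarrow> complex_of_real (- (k $ 1 * (2 * exp (s * t) / r * a)) * sin (horiz y \<bullet> k))) (at y within strip S)"
      by (rule Lim_transform_eventually[OF wave_tendsto(1)[OF sm y']]) (use ev in eventually_elim, use jump_stress_v(1)[where q = "q t", OF _ q_eq] in simp)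
    show "((\<lambda>x. (jump_stress c (q t) (v t) x *v e3) $ 2) \<longlongrightarrow> complex_of_real (- (k $ 2 * (2 * exp (s * t) / r * a)) * sin (horiz y \<bullet> k))) (at y within strip S)"
      by (rule Lim_transform_eventually[OF wave_tendsto(1)[OF sm y']]) (use ev in eventually_elim, use jump_stress_v(2)[where q = "q t", OF _ q_eq] in simp)
    show "((\<lambda>x. (jump_stress c (q t) (v t) x *v e3) $ 3) \<longlongrightarrow> complex_of_real (- (2 * exp (s * t) * b) * cos (horiz y \<bullet> k))) (at y within strip S)"
      by (rule Lim_transform_eventually[OF wave_tendsto(2)[OF fl y']]) (use ev in eventually_elim, use jump_stress_v(3)[where q = "q t", OF _ q_eq] in simp)
  qed
qed

text \<open>The jump of \<open>flux_psi\<close> is \<open>surf c * r\<^sup>2 * p 0\<close>, and the horizontal Laplacian multiplies the trace of the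
  vertical displacement by \<open>- r\<^sup>2\<close>.\<close>

lemma jump_stress_condition:
  assumes y: "y $ 3 = 0"
  shows "has_jump c (\<lambda>x. jump_stress c (q t) (v t) x *v e3) y ((surf c *\<^sub>R horiz_laplacian (trace0 c (\<lambda>x. \<eta> t x $ 3)) y) *s e3)"
proof -
  obtain a b where lim: "(flux_phi c r s f p \<longlongrightarrow> a) (at_right 0)" "(flux_phi c r s f p \<longlongrightarrow> a) (at_left 0)"
      "(flux_psi c r s f p \<longlongrightarrow> b + surf c * r\<^sup>2 * p 0) (at_right 0)" "(flux_psi c r s f p \<longlongrightarrow> b) (at_left 0)"
    using mode by (auto simp: classical_mode_def)
  have sub: "(g \<longlongrightarrow> l) (at 0 within {0<..<height c})" if "(g \<longlongrightarrow> l) (at_right 0)" for g :: "real \<Rightarrow> real" and l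
    using that by (rule tendsto_mono[OF at_le, rotated]) auto
  have sub': "(g \<longlongrightarrow> l) (at 0 within {- depth c<..<0})" if "(g \<longlongrightarrow> l) (at_left 0)" for g :: "real \<Rightarrow> real" and l
    using that by (rule tendsto_mono[OF at_le, rotated]) auto
  note up = trace_stress[OF disjI1[OF refl] y sub[OF lim(1)] sub[OF lim(3)], of t]
  note lo = trace_stress[OF disjI2[OF refl] y sub'[OF lim(2)] sub'[OF lim(4)], of t]
  have hl: "horiz_laplacian (trace0 c (\<lambda>x. \<eta> t x $ 3)) y = cwave k (\<lambda>z. - (r * r * (2 * exp (s * t) * p 0))) y"
    unfolding horiz_laplacian_def
    using trace_\<eta>3_pd(3)[OF y, of 1 t] trace_\<eta>3_pd(3)[OF y, of 2 t]
    by (simp add: wave_arith) (rule wave_eqI, simp add: r2[symmetric] algebra_simps)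
  show ?thesis
    unfolding has_jump_def Omega_strip
    by (intro exI conjI, rule up, rule lo)
       (simp add: hl vec_eq_iff forall_3 axis_def cwave_def scaleR_conv_of_real power2_eq_square algebra_simps)
qed

theorem solves: "linearized_solution c \<eta> v q"
  unfolding linearized_solution_def
proof (intro conjI allI impI ballI regularity)
  fix t x assume "x \<in> Omega_p c \<union> Omega_m c"
  then obtain S where SS: "S = {0<..<height c} \<or> S = {- depth c<..<0}" "x \<in> strip S"
    by (auto simp: Omega_strip)
  interpret mode_velocity c k r s "2 * exp (s * t)" f p S "v t" by (rule velocity[OF SS(1)])
  show "dt \<eta> t x = v t x" by (rule dt_eq)
  show "dt q t x + rho0 c (x $ 3) *\<^sub>R divg (v t) x = 0"
    unfolding dt_eq(3) divg_v[OF SS(2)] q_eq wave_arith wave_coeff by (simp add: cwave_def dil_def)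
  show "rho0 c (x $ 3) *\<^sub>R dt v t x + grad (\<lambda>y. dP0 c (y $ 3) *\<^sub>R q t y) x + (grav c *\<^sub>R q t x) *s e3
      + (grav c * rho0 c (x $ 3)) *\<^sub>R grad (\<lambda>y. \<eta> t y $ 3) x = divm (visc_stress c (v t)) x"
    unfolding dt_eq(2) by (rule momentum_equation[OF SS(2) q_eq \<eta>3])
qed (use jump_velocity jump_stress_condition boundary_velocity in auto)

lemma real_valued: "\<eta> t x $ i \<in> \<real>" "v t x $ i \<in> \<real>" "q t x \<in> \<real>"
proof -
  have w: "swave k a x \<in> \<real>" "cwave k a x \<in> \<real>" for a by (simp_all add: swave_def cwave_def)
  show "\<eta> t x $ i \<in> \<real>" "v t x $ i \<in> \<real>" using UNIV_3_cases[of i] w by (auto simp: \<eta>1 \<eta>2 \<eta>3 v_comp)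
  show "q t x \<in> \<real>" by (simp add: q_eq w)
qed

end

section \<open>Weak derivatives of smooth functions\<close>

lemma smooth_bdd_deriv: "smooth_bdd S g \<Longrightarrow> smooth_bdd S (deriv g)"
  unfolding smooth_bdd_def
proof (intro conjI allI)
  assume g: "C_inf_on S g \<and> (\<forall>n. bounded ((deriv ^^ n) g ` S))"
  then show "C_inf_on S (deriv g)" by (auto intro: C_inf_on_deriv)
  fix n
  have "bounded ((deriv ^^ Suc n) g ` S)" using g by blast
  then show "bounded ((deriv ^^ n) (deriv g) ` S)" by (simp add: funpow_swap1)
qed

lemma smooth_bdd_higher_deriv: "smooth_bdd S g \<Longrightarrow> smooth_bdd S ((deriv ^^ n) g)"
  by (induction n) (auto intro: smooth_bdd_deriv)

lemma smooth_bdd_cmult: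
  assumes "open S" "smooth_bdd S g"
  shows "smooth_bdd S (\<lambda>z. m * g z)"
proof -
  have g: "C_inf_on S g" "\<And>n. bounded ((deriv ^^ n) g ` S)" using assms(2) by (auto simp: smooth_bdd_def)
  have "bounded ((\<lambda>z. m * (deriv ^^ n) g z) ` S)" for n
  proof -
    have "bounded ((\<lambda>y. m *\<^sub>R y) ` ((deriv ^^ n) g ` S))" by (rule bounded_scaling[OF g(2)])
    then show ?thesis by (simp add: image_image)
  qed
  moreover have "(deriv ^^ n) (\<lambda>z. m * g z) ` S = (\<lambda>z. m * (deriv ^^ n) g z) ` S" for n
    by (rule image_cong[OF refl]) (rule higher_deriv_cmult[OF assms(1) _ g(1)])
  ultimately show ?thesis
    unfolding smooth_bdd_def using C_inf_on_cmult[OF assms(1) g(1)] by simp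
qed

lemma smooth_bdd_L2:
  assumes "smooth_bdd {a<..<b} g"
  shows "in_L2 a b g"
proof (rule L2_bounded)
  have c: "continuous_on {a<..<b} g" using assms C_inf_on_continuous_on by (auto simp: smooth_bdd_def)
  show "g \<in> borel_measurable (lebesgue_on {a<..<b})"
    by (rule continuous_imp_measurable_on_sets_lebesgue[OF c]) simp
  have "bounded ((deriv ^^ 0) g ` {a<..<b})" using assms unfolding smooth_bdd_def by blast
  then show "bounded (g ` {a<..<b})" by simp
qed

text \<open>The product with the test function vanishes near both ends, so the fundamental theorem of calculus
  applies on a slightly smaller closed interval.\<close>

lemma smooth_integration_by_parts:
  assumes ab: "a < b" and g: "smooth_bdd {a<..<b} g" and u: "test_fun a b u"
  shows "(LINT z:{a<..<b}|lebesgue. deriv u z * g z) = - (LINT z:{a<..<b}|lebesgue. u z * deriv g z)"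
proof -
  obtain c d where cd: "a < c" "c < d" "d < b" "\<And>z. z \<notin> {c..d} \<Longrightarrow> u z = 0"
    using test_fun_support[OF u ab] by blast
  (* slightly larger than the support, so that u vanishes at the end points *)
  define c' d' where "c' = (a + c) / 2" and "d' = (d + b) / 2"
  have c': "a < c'" "c' < c" "d < d'" "d' < b" "c' \<le> d'" using cd by (auto simp: c'_def d'_def)
  let ?F = "\<lambda>z. deriv u z * g z + u z * deriv g z"
  have sub: "z \<in> {a<..<b}" if "z \<in> {c'..d'}" for z using that c' by auto
  have gC: "C_inf_on {a<..<b} g" using g by (simp add: smooth_bdd_def)
  have gc: "continuous_on {c'..d'} g" "continuous_on {c'..d'} (deriv g)"
    using continuous_on_subset[OF C_inf_on_continuous_on[OF gC]] continuous_on_subset[OF C_inf_on_continuous_on[OF C_inf_on_deriv[OF gC]]] sub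
    by (auto simp: subset_eq)
  have Fc: "continuous_on {c'..d'} ?F"
    by (intro continuous_intros gc test_fun_continuous[OF u] test_fun_continuous[OF test_fun_deriv[OF u ab]])
  have "(?F has_integral (u d' * g d' - u c' * g c')) {c'..d'}"
  proof (rule fundamental_theorem_of_calculus[OF c'(5)])
    fix x assume "x \<in> {c'..d'}"
    then have "((\<lambda>z. u z * g z) has_real_derivative ?F x) (at x)"
      using DERIV_mult[OF test_fun_has_deriv[OF u] C_inf_on_has_deriv[OF gC sub]] by (simp add: mult.commute)
    then show "((\<lambda>z. u z * g z) has_vector_derivative ?F x) (at x within {c'..d'})"
      unfolding has_real_derivative_iff_has_vector_derivative[symmetric] by (rule has_field_derivative_at_within)
  qed
  moreover have "u c' = 0" "u d' = 0" using cd(4) c' by auto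
  ultimately have i0: "integral {c'..d'} ?F = 0" by (simp add: integral_unique)
  have ind: "indicat_real {a<..<b} z *\<^sub>R ?F z = indicat_real {c'..d'} z *\<^sub>R ?F z" for z
    using cd(4)[of z] deriv_eq_0_outside[of c d u z] cd(4) c' by (auto simp: indicator_def)
  have "(LINT z:{a<..<b}|lebesgue. ?F z) = (LINT z:{c'..d'}|lebesgue. ?F z)"
    unfolding set_lebesgue_integral_def by (simp only: ind)
  also have "\<dots> = integral {c'..d'} ?F"
    by (rule set_lebesgue_integral_eq_integral(2)[OF absolutely_integrable_continuous_real[OF Fc]])
  finally have "(LINT z:{a<..<b}|lebesgue. ?F z) = 0" using i0 by simp
  moreover have "(\<lambda>z. deriv u z * g z) absolutely_integrable_on {a<..<b}" "(\<lambda>z. u z * deriv g z) absolutely_integrable_on {a<..<b}"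
    by (intro L2_mult_integrable smooth_bdd_L2 g smooth_bdd_deriv L2_continuous test_fun_continuous[OF u] test_fun_continuous[OF test_fun_deriv[OF u ab]])+
  ultimately show ?thesis by (simp add: set_integral_add(2))
qed

lemma smooth_bdd_weak_deriv:
  assumes ab: "a < b" and g: "smooth_bdd {a<..<b} g"
  shows "is_weak_deriv j a b g ((deriv ^^ j) g)"
proof -
  have "(LINT z:{a<..<b}|lebesgue. (deriv ^^ j) u z * g z) = (-1) ^ j * (LINT z:{a<..<b}|lebesgue. u z * (deriv ^^ j) g z)"
    if "test_fun a b u" for u
    using that
  proof (induction j arbitrary: u)
    case (Suc j)
    have "(LINT z:{a<..<b}|lebesgue. (deriv ^^ Suc j) u z * g z) = (LINT z:{a<..<b}|lebesgue. (deriv ^^ j) (deriv u) z * g z)"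
      by (simp add: funpow_swap1)
    also have "\<dots> = (-1) ^ j * (LINT z:{a<..<b}|lebesgue. deriv u z * (deriv ^^ j) g z)"
      by (rule Suc.IH[OF test_fun_deriv[OF Suc.prems ab]])
    also have "(LINT z:{a<..<b}|lebesgue. deriv u z * (deriv ^^ j) g z) = - (LINT z:{a<..<b}|lebesgue. u z * deriv ((deriv ^^ j) g) z)"
      by (rule smooth_integration_by_parts[OF ab smooth_bdd_higher_deriv[OF g] Suc.prems])
    finally show ?case by simp
  qed simp
  moreover have "loc_integrable a b ((deriv ^^ n) g)" for n
    by (intro loc_integrable_if_integrable L2_integrable smooth_bdd_L2 smooth_bdd_higher_deriv g)
  from this[of 0] this[of j] have "loc_integrable a b g" "loc_integrable a b ((deriv ^^ j) g)" by auto
  ultimately show ?thesis unfolding is_weak_deriv_def by simp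
qed

lemma is_weak_deriv_of_real:
  assumes "is_weak_deriv j a b g h"
  shows "is_weak_deriv j a b (\<lambda>z. complex_of_real (g z)) (\<lambda>z. complex_of_real (h z))"
proof -
  have L: "(LINT z:A|lebesgue. u z *\<^sub>R complex_of_real (w z)) = complex_of_real (LINT z:A|lebesgue. u z *\<^sub>R w z)" for A and u w :: "real \<Rightarrow> real"
  proof -
    have "indicat_real A z *\<^sub>R u z *\<^sub>R complex_of_real (w z) = complex_of_real (indicat_real A z *\<^sub>R u z *\<^sub>R w z)" for z
      by (simp add: scaleR_conv_of_real)
    then show ?thesis unfolding set_lebesgue_integral_def by (simp only: integral_complex_of_real)
  qed
  have I: "loc_integrable a b (\<lambda>z. complex_of_real (w z))" if "loc_integrable a b w" for w
    unfolding loc_integrable_def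
  proof (intro allI impI)
    fix K assume "compact K \<and> K \<subseteq> {a<..<b}"
    then have "integrable lebesgue (\<lambda>z. indicat_real K z *\<^sub>R w z)" using that by (simp add: loc_integrable_def set_integrable_def)
    then have "integrable lebesgue (\<lambda>z. complex_of_real (indicat_real K z *\<^sub>R w z))" by (rule integrable_of_real)
    then show "set_integrable lebesgue K (\<lambda>z. complex_of_real (w z))"
      by (simp add: set_integrable_def scaleR_conv_of_real)
  qed
  show ?thesis
    unfolding is_weak_deriv_def L
  proof (intro conjI allI impI)
    fix u assume "test_fun a b u"
    then have "(LINT z:{a<..<b}|lebesgue. (deriv ^^ j) u z *\<^sub>R g z) = (-1) ^ j *\<^sub>R (LINT z:{a<..<b}|lebesgue. u z *\<^sub>R h z)"
      using assms unfolding is_weak_deriv_def by blast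
    then show "complex_of_real (LINT z:{a<..<b}|lebesgue. (deriv ^^ j) u z *\<^sub>R g z) = (-1) ^ j *\<^sub>R complex_of_real (LINT z:{a<..<b}|lebesgue. u z *\<^sub>R h z)"
      by (simp add: scaleR_conv_of_real)
  qed (use assms I in \<open>auto simp: is_weak_deriv_def\<close>)
qed

section \<open>Fourier coefficients of waves\<close>

lemma lattice_diff: "k \<in> lattice L \<Longrightarrow> l \<in> lattice L \<Longrightarrow> k - l \<in> lattice L"
  unfolding lattice_def
proof (intro CollectI allI)
  fix i assume "k \<in> {\<xi>. \<forall>i. \<exists>n::int. \<xi> $ i = of_int n / L}" "l \<in> {\<xi>. \<forall>i. \<exists>n::int. \<xi> $ i = of_int n / L}"
  then have "\<exists>n::int. k $ i = of_int n / L" "\<exists>m::int. l $ i = of_int m / L" by simp_all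
  then obtain n m :: int where "k $ i = of_int n / L" "l $ i = of_int m / L" by (elim exE)
  then show "\<exists>n::int. (k - l) $ i = of_int n / L"
    by (intro exI[of _ "n - m"]) (simp add: diff_divide_distrib)
qed

lemma lattice_uminus: "k \<in> lattice L \<Longrightarrow> - k \<in> lattice L"
  using lattice_diff[of 0 L k] by (force simp: lattice_def intro: exI[of _ "0::int"])

lemma integral_cis_period:
  assumes "L > 0" "n \<noteq> 0"
  shows "(\<integral>t. indicat_real {0..2 * pi * L} t *\<^sub>R cis (t * (of_int n / L)) \<partial>lborel) = 0"
proof -
  define w where "w = of_int n / L"
  have w: "w \<noteq> 0" using assms by (simp add: w_def)
  let ?F = "\<lambda>t. cis (t * w) / (\<i> * of_real w)"
  have "(\<integral>t. indicat_real {0..2 * pi * L} t *\<^sub>R cis (t * w) \<partial>lborel) = ?F (2 * pi * L) - ?F 0"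
  proof (rule integral_FTC_Icc)
    show "0 \<le> 2 * pi * L" using assms by simp
    fix t
    have "((\<lambda>t. cis (t * w)) has_vector_derivative w *\<^sub>R (\<i> * cis (t * w))) (at t within {0..2 * pi * L})"
      unfolding has_vector_derivative_def
      by (rule has_derivative_eq_rhs, (rule derivative_eq_intros refl)+) (auto simp: scaleR_conv_of_real fun_eq_iff)
    then have "(?F has_vector_derivative (w *\<^sub>R (\<i> * cis (t * w))) / (\<i> * of_real w)) (at t within {0..2 * pi * L})"
      by (rule has_vector_derivative_divide)
    then show "(?F has_vector_derivative cis (t * w)) (at t within {0..2 * pi * L})"
      using w by (simp add: scaleR_conv_of_real)
  qed (auto intro!: continuous_intros)
  also have "cis (2 * pi * L * w) = 1"
  proof -
    have e: "2 * pi * L * w = 2 * pi * of_int n" using assms by (simp add: w_def)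
    show ?thesis unfolding e by (simp add: complex_eq_iff cis.ctr sin_int_2pin cos_int_2pin)
  qed
  finally show ?thesis by (simp add: w_def)
qed

text \<open>Lebesgue measure is the image of the product measure over the coordinates.\<close>

lemma integral_lborel_prod:
  fixes g :: "'a::euclidean_space \<Rightarrow> real \<Rightarrow> complex"
  assumes g: "\<And>b. b \<in> Basis \<Longrightarrow> integrable lborel (g b)"
  shows "(\<integral>y. (\<Prod>b\<in>Basis. g b (y \<bullet> b)) \<partial>lborel) = (\<Prod>b\<in>Basis. \<integral>t. g b t \<partial>lborel)"
proof -
  interpret product_sigma_finite "\<lambda>b::'a. lborel :: real measure" ..
  have [measurable]: "b \<in> Basis \<Longrightarrow> g b \<in> borel_measurable borel" for b using g[of b] by (auto simp: integrable_iff_bounded)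
  have "(\<integral>y. (\<Prod>b\<in>Basis. g b (y \<bullet> b)) \<partial>lborel) =
    (\<integral>h. (\<Prod>b\<in>Basis. g b ((\<Sum>b'\<in>Basis. h b' *\<^sub>R b') \<bullet> b)) \<partial>(\<Pi>\<^sub>M b\<in>Basis. lborel))"
    unfolding lborel_def[where 'a='a] lborel_eq_real
    by (subst integral_distr) (simp_all, measurable)
  also have "\<dots> = (\<integral>h. (\<Prod>b\<in>Basis. g b (h b)) \<partial>(\<Pi>\<^sub>M b\<in>Basis. lborel))"
    by (rule Bochner_Integration.integral_cong) (auto intro!: prod.cong)
  also have "\<dots> = (\<Prod>b\<in>Basis. \<integral>t. g b t \<partial>lborel)"
    by (rule product_integral_prod) (use g in auto)
  finally show ?thesis .
qed

lemma prod_cis: "finite A \<Longrightarrow> (\<Prod>b\<in>A. cis (g b)) = cis (\<Sum>b\<in>A. g b)"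
  by (induction A rule: finite_induct) (simp_all add: cis_mult)

definition cell :: "real \<Rightarrow> (real^2) set" where
  "cell L = cbox 0 (\<chi> i. 2 * pi * L)"

text \<open>The integral over the cell factorizes; a nonzero lattice frequency has a nonzero component, whose
  one-dimensional integral runs over full periods.\<close>

lemma integral_cis_lattice:
  assumes L: "L > 0" and k: "k \<in> lattice L" "k \<noteq> 0"
  shows "(LINT y:cell L|lebesgue. cis (y \<bullet> k)) = 0"
proof -
  define g where "g b t = indicat_real {0..2 * pi * L} t *\<^sub>R cis (t * (k \<bullet> b))" for b :: "real^2" and t
  have gi: "integrable lborel (g b)" for b
  proof -
    have "continuous_on {0..2 * pi * L} (\<lambda>t. cis (t * (k \<bullet> b)))" by (intro continuous_intros)
    from borel_integrable_atLeastAtMost'[OF this] show ?thesis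
      by (simp add: set_integrable_def g_def[abs_def])
  qed
  have fac: "indicat_real (cell L) y *\<^sub>R cis (y \<bullet> k) = (\<Prod>b\<in>Basis. g b (y \<bullet> b))" for y
  proof -
    have "(\<Prod>b\<in>Basis. g b (y \<bullet> b)) = (\<Prod>b\<in>Basis. complex_of_real (indicat_real {0..2 * pi * L} (y \<bullet> b))) * (\<Prod>b\<in>Basis. cis ((y \<bullet> b) * (k \<bullet> b)))"
      by (simp add: g_def prod.distrib scaleR_conv_of_real)
    also have "(\<Prod>b\<in>Basis. cis ((y \<bullet> b) * (k \<bullet> b))) = cis (\<Sum>b\<in>Basis. (y \<bullet> b) * (k \<bullet> b))"
      by (rule prod_cis) simp
    also have "(\<Sum>b\<in>Basis. (y \<bullet> b) * (k \<bullet> b)) = y \<bullet> k" by (rule euclidean_inner[symmetric])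
    also have "(\<Prod>b\<in>Basis. complex_of_real (indicat_real {0..2 * pi * L} (y \<bullet> b))) = complex_of_real (indicat_real (cell L) y)"
    proof (cases "y \<in> cell L")
      case True
      then have "\<forall>b\<in>Basis. y \<bullet> b \<in> {0..2 * pi * L}"
        by (auto simp: cell_def mem_box_cart Basis_vec_def inner_axis)
      then show ?thesis using True by simp
    next
      case False
      then obtain i where "y $ i \<notin> {0..2 * pi * L}" by (auto simp: cell_def mem_box_cart)
      then have "axis i 1 \<in> (Basis :: (real^2) set)" "y \<bullet> axis i 1 \<notin> {0..2 * pi * L}"
        by (auto simp: inner_axis axis_in_Basis_iff)
      then have "\<exists>b\<in>Basis. complex_of_real (indicat_real {0..2 * pi * L} (y \<bullet> b)) = 0"
        by (intro bexI[of _ "axis i 1"]) auto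
      then show ?thesis using False by simp
    qed
    finally show ?thesis by (simp add: scaleR_conv_of_real)
  qed
  obtain i where i: "k $ i \<noteq> 0" using k(2) by (auto simp: vec_eq_iff)
  obtain n :: int where n: "k $ i = of_int n / L" using k(1) by (auto simp: lattice_def)
  have "integral\<^sup>L lborel (g (axis i 1)) = 0"
    using integral_cis_period[OF L, of n] n i by (auto simp: g_def[abs_def] inner_axis)
  moreover have "axis i 1 \<in> (Basis :: (real^2) set)" by (simp add: axis_in_Basis_iff)
  ultimately have "(\<Prod>b\<in>Basis. integral\<^sup>L lborel (g b)) = 0" by auto
  then have "(\<integral>y. indicat_real (cell L) y *\<^sub>R cis (y \<bullet> k) \<partial>lborel) = 0"
    unfolding fac integral_lborel_prod[OF gi] .
  moreover have "(\<lambda>y. indicat_real (cell L) y *\<^sub>R cis (y \<bullet> k)) \<in> borel_measurable borel"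
    unfolding cell_def by (rule borel_measurable_continuous_on_indicator) (auto intro!: continuous_intros)
  ultimately show ?thesis
    unfolding set_lebesgue_integral_def by (subst integral_completion) auto
qed

section \<open>Separated functions in the piecewise Sobolev spaces\<close>

text \<open>The Sobolev norms are computed for functions that separate into a vertical amplitude and a bounded
  horizontal factor with finitely many nonzero Fourier coefficients.\<close>

locale separated =
  fixes L a b :: real and T :: "real^2 \<Rightarrow> real" and F :: "(real^2) set"
  assumes L: "L > 0" and ab: "a < b" and T: "continuous_on UNIV T" "\<And>y. \<bar>T y\<bar> \<le> 1" and F: "finite F"
    and coeff: "\<And>\<xi>. \<xi> \<in> lattice L \<Longrightarrow> \<xi> \<notin> F \<Longrightarrow> (LINT y:cell L|lebesgue. complex_of_real (T y) * cis (- (y \<bullet> \<xi>))) = 0"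
    and per: "\<And>g. periodic_on L (layer a b) (\<lambda>x. complex_of_real (g (x $ 3) * T (horiz x)))"
begin

definition sep :: "(real \<Rightarrow> real) \<Rightarrow> real^3 \<Rightarrow> complex" where
  "sep g x = complex_of_real (g (x $ 3) * T (horiz x))"

definition coef :: "real^2 \<Rightarrow> complex" where
  "coef \<xi> = (LINT y:cell L|lebesgue. complex_of_real (T y) * cis (- (y \<bullet> \<xi>)))"

text \<open>The amplitude factors out of the horizontal integral.\<close>

lemma fhat_sep: "fhat L (sep g) \<xi> z = coef \<xi> * complex_of_real (g z)"
proof -
  have h: "horiz (vector [y $ 1, y $ 2, z]) = y" for y :: "real^2"
    by (simp add: horiz_def vec_eq_iff forall_2)
  have "indicat_real (cell L) y *\<^sub>R (sep g (vector [y $ 1, y $ 2, z]) * cis (- (y \<bullet> \<xi>)))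
      = complex_of_real (g z) * (indicat_real (cell L) y *\<^sub>R (complex_of_real (T y) * cis (- (y \<bullet> \<xi>))))" for y
    by (simp add: sep_def h)
  then show ?thesis
    unfolding fhat_def coef_def cell_def[symmetric] set_lebesgue_integral_def
    by (simp only: integral_mult_right_zero mult.commute)
qed

lemma fhat_weak_deriv:
  assumes g: "smooth_bdd {a<..<b} g"
  shows "is_weak_deriv j a b (fhat L (sep g) \<xi>) (\<lambda>z. coef \<xi> * complex_of_real ((deriv ^^ j) g z))"
    and "in_L2 a b (\<lambda>z. coef \<xi> * complex_of_real ((deriv ^^ j) g z))"
    and "L2sq a b (weak_derivative j a b (fhat L (sep g) \<xi>)) = ennreal ((norm (coef \<xi>))\<^sup>2) * L2sq a b ((deriv ^^ j) g)"
proof -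
  have e: "fhat L (sep g) \<xi> = (\<lambda>z. coef \<xi> * complex_of_real (g z))" by (rule ext) (rule fhat_sep)
  show w: "is_weak_deriv j a b (fhat L (sep g) \<xi>) (\<lambda>z. coef \<xi> * complex_of_real ((deriv ^^ j) g z))"
    unfolding e by (intro is_weak_deriv_cmult is_weak_deriv_of_real smooth_bdd_weak_deriv ab g)
  have gL: "in_L2 a b ((deriv ^^ j) g)" by (intro smooth_bdd_L2 smooth_bdd_higher_deriv g)
  have of: "in_L2 a b (\<lambda>z. complex_of_real ((deriv ^^ j) g z))" "L2sq a b (\<lambda>z. complex_of_real ((deriv ^^ j) g z)) = L2sq a b ((deriv ^^ j) g)"
  proof -
    show l: "L2sq a b (\<lambda>z. complex_of_real ((deriv ^^ j) g z)) = L2sq a b ((deriv ^^ j) g)"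
      unfolding L2sq_def by simp
    have "(\<lambda>z. complex_of_real ((deriv ^^ j) g z)) \<in> borel_measurable (lebesgue_on {a<..<b})"
      using in_L2_measurable[OF gL] by measurable
    then show "in_L2 a b (\<lambda>z. complex_of_real ((deriv ^^ j) g z))"
      using gL l by (simp add: in_L2_def set_borel_measurable_lebesgue_on)
  qed
  have sc: "L2sq a b (\<lambda>z. coef \<xi> * complex_of_real ((deriv ^^ j) g z)) = ennreal ((norm (coef \<xi>))\<^sup>2) * L2sq a b ((deriv ^^ j) g)"
    unfolding L2sq_cmult[OF of(1)] of(2) ..
  show "L2sq a b (weak_derivative j a b (fhat L (sep g) \<xi>)) = ennreal ((norm (coef \<xi>))\<^sup>2) * L2sq a b ((deriv ^^ j) g)"
    using L2sq_cong_AE[OF weak_derivative_AE_eq[OF w]] sc by simp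
  have "(\<lambda>z. coef \<xi> * complex_of_real ((deriv ^^ j) g z)) \<in> borel_measurable (lebesgue_on {a<..<b})"
    using in_L2_measurable[OF of(1)] by measurable
  moreover have "L2sq a b (\<lambda>z. coef \<xi> * complex_of_real ((deriv ^^ j) g z)) < \<infinity>"
    unfolding sc using gL by (simp add: in_L2_def ennreal_mult_less_top)
  ultimately show "in_L2 a b (\<lambda>z. coef \<xi> * complex_of_real ((deriv ^^ j) g z))"
    by (simp add: in_L2_def set_borel_measurable_lebesgue_on)
qed

text \<open>Only frequencies in \<open>F\<close> contribute, so the infinite sum is a finite one.\<close>

lemma Hk_sq_sep:
  assumes g: "smooth_bdd {a<..<b} g"
  shows "Hk_sq_layer L a b n (sep g) = (\<Sum>j\<le>n. \<Sum>\<xi>\<in>F \<inter> lattice L. ennreal ((1 + (norm \<xi>)\<^sup>2) ^ (n - j)) * (ennreal ((norm (coef \<xi>))\<^sup>2) * L2sq a b ((deriv ^^ j) g)))"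
  unfolding Hk_sq_layer_def
proof (rule sum.cong[OF refl])
  fix j assume "j \<in> {..n}"
  let ?t = "\<lambda>\<xi>. ennreal ((1 + (norm \<xi>)\<^sup>2) ^ (n - j)) * (ennreal ((norm (coef \<xi>))\<^sup>2) * L2sq a b ((deriv ^^ j) g))"
  have "(\<Sum>\<^sub>\<infinity>\<xi>\<in>lattice L. ennreal ((1 + (norm \<xi>)\<^sup>2) ^ (n - j)) * L2sq a b (weak_derivative j a b (fhat L (sep g) \<xi>))) = (\<Sum>\<^sub>\<infinity>\<xi>\<in>lattice L. ?t \<xi>)"
    by (simp only: fhat_weak_deriv(3)[OF g])
  also have "\<dots> = (\<Sum>\<^sub>\<infinity>\<xi>\<in>F \<inter> lattice L. ?t \<xi>)"
    by (rule infsum_cong_neutral) (use coeff in \<open>auto simp: coef_def\<close>)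
  also have "\<dots> = (\<Sum>\<xi>\<in>F \<inter> lattice L. ?t \<xi>)"
    using F by (intro infsum_finite) auto
  finally show "(\<Sum>\<^sub>\<infinity>\<xi>\<in>lattice L. ennreal ((1 + (norm \<xi>)\<^sup>2) ^ (n - j)) * L2sq a b (weak_derivative j a b (fhat L (sep g) \<xi>))) = (\<Sum>\<xi>\<in>F \<inter> lattice L. ?t \<xi>)" .
qed

lemma layer_cell_lmeasurable: "layer_cell L a b \<in> sets borel" "layer_cell L a b \<in> lmeasurable"
proof -
  have "layer_cell L a b = strip {a<..<b} \<inter> ({x. 0 \<le> x $ 1} \<inter> {x. x $ 1 \<le> 2 * pi * L} \<inter> ({x. 0 \<le> x $ 2} \<inter> {x. x $ 2 \<le> 2 * pi * L}))"
    by (auto simp: layer_cell_def layer_def strip_def)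
  moreover have "open (strip {a<..<b})" by (rule open_strip) simp
  moreover have "closed ({x :: real^3. 0 \<le> x $ 1} \<inter> {x. x $ 1 \<le> 2 * pi * L} \<inter> ({x. 0 \<le> x $ 2} \<inter> {x. x $ 2 \<le> 2 * pi * L}))"
    by (intro closed_Int closed_Collect_le continuous_intros)
  ultimately show b: "layer_cell L a b \<in> sets borel" by auto
  have "layer_cell L a b \<subseteq> cbox (vector [0, 0, a]) (vector [2 * pi * L, 2 * pi * L, b])"
    by (auto simp: layer_cell_def layer_def mem_box_cart forall_3)
  then have "bounded (layer_cell L a b)" by (rule bounded_subset[OF bounded_cbox])
  then show "layer_cell L a b \<in> lmeasurable" using b by (intro bounded_set_imp_lmeasurable) auto
qed

lemma in_Hk_sep:
  assumes g: "smooth_bdd {a<..<b} g"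
  shows "in_Hk_layer L a b n (sep g)"
  unfolding in_Hk_layer_def
proof (intro conjI ballI allI impI)
  show "periodic_on L (layer a b) (sep g)" using per[of g] by (simp add: sep_def[abs_def])
  have gc: "continuous_on {a<..<b} g" using g C_inf_on_continuous_on by (auto simp: smooth_bdd_def)
  have "continuous_on (strip {a<..<b}) (\<lambda>x. g (x $ 3))"
    by (rule continuous_on_compose2[OF gc]) (auto intro!: continuous_intros simp: strip_def)
  moreover have "continuous_on (strip {a<..<b}) (\<lambda>x. T (horiz x))"
  proof (rule continuous_on_compose2[OF T(1)])
    have "horiz = (\<lambda>x. \<chi> i. if i = 1 then x $ 1 else x $ 2)"
      by (auto simp: horiz_def vec_eq_iff forall_2)
    moreover have "continuous_on (strip {a<..<b}) (\<lambda>x::real^3. \<chi> i::2. if i = 1 then x $ 1 else x $ 2)"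
    proof (rule continuous_on_vec_lambda)
      fix i :: 2
      show "continuous_on (strip {a<..<b}) (\<lambda>x::real^3. if i = 1 then x $ 1 else x $ 2)"
        by (cases "i = 1") (auto intro!: continuous_intros)
    qed
    ultimately show "continuous_on (strip {a<..<b}) horiz" by (simp only:)
  qed simp
  ultimately have "continuous_on (strip {a<..<b}) (sep g)"
    unfolding sep_def[abs_def] by (intro continuous_intros)
  then have "continuous_on (layer_cell L a b) (sep g)"
    by (rule continuous_on_subset) (auto simp: layer_cell_def layer_def strip_def)
  then have "(\<lambda>x. indicator (layer_cell L a b) x *\<^sub>R sep g x) \<in> borel_measurable borel"
    by (rule borel_measurable_continuous_on_indicator[OF layer_cell_lmeasurable(1)])
  then show "set_borel_measurable lebesgue (layer_cell L a b) (sep g)"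
    unfolding set_borel_measurable_def by (intro measurable_completion) simp
  have "bounded ((deriv ^^ 0) g ` {a<..<b})" using g unfolding smooth_bdd_def by blast
  then obtain M where M: "\<forall>z\<in>{a<..<b}. \<bar>g z\<bar> \<le> M" by (auto simp: bounded_iff)
  have "(\<integral>\<^sup>+x\<in>layer_cell L a b. ennreal ((norm (sep g x))\<^sup>2) \<partial>lebesgue) \<le> (\<integral>\<^sup>+x. ennreal (M\<^sup>2) * indicator (layer_cell L a b) x \<partial>lebesgue)"
  proof (rule nn_integral_mono)
    fix x
    have "(norm (sep g x))\<^sup>2 \<le> M\<^sup>2" if "x \<in> layer_cell L a b"
    proof -
      have "\<bar>g (x $ 3)\<bar> \<le> M" using M that by (auto simp: layer_cell_def layer_def)
      then have "\<bar>g (x $ 3)\<bar> * \<bar>T (horiz x)\<bar> \<le> M * 1" using T(2) by (intro mult_mono) auto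
      then show ?thesis by (intro power_mono) (simp_all add: sep_def norm_mult abs_mult del: of_real_mult)
    qed
    then show "ennreal ((norm (sep g x))\<^sup>2) * indicator (layer_cell L a b) x \<le> ennreal (M\<^sup>2) * indicator (layer_cell L a b) x"
      by (auto simp: indicator_def intro: ennreal_leI)
  qed
  also have "\<dots> = ennreal (M\<^sup>2) * emeasure lebesgue (layer_cell L a b)"
    using layer_cell_lmeasurable(2) by (intro nn_integral_cmult_indicator) auto
  also have "\<dots> < \<infinity>"
    using layer_cell_lmeasurable(2) by (auto simp: fmeasurable_def ennreal_mult_less_top)
  finally show "(\<integral>\<^sup>+x\<in>layer_cell L a b. ennreal ((norm (sep g x))\<^sup>2) \<partial>lebesgue) < \<infinity>" .
  show "\<exists>h. is_weak_deriv j a b (fhat L (sep g) \<xi>) h \<and> in_L2 a b h" for \<xi> j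
    using fhat_weak_deriv(1,2)[OF g] by blast
  have "L2sq a b ((deriv ^^ j) g) < \<infinity>" for j
    using smooth_bdd_L2[OF smooth_bdd_higher_deriv[OF g]] by (auto simp: in_L2_def)
  then show "Hk_sq_layer L a b n (sep g) < \<infinity>"
    unfolding Hk_sq_sep[OF g] using F by (auto simp: ennreal_mult_less_top)
qed

lemma Hk_sq_scale:
  assumes g: "smooth_bdd {a<..<b} g"
  shows "Hk_sq_layer L a b n (sep (\<lambda>z. m * g z)) = ennreal (m\<^sup>2) * Hk_sq_layer L a b n (sep g)"
proof -
  have mg: "smooth_bdd {a<..<b} (\<lambda>z. m * g z)" by (rule smooth_bdd_cmult[OF _ g]) simp
  have "L2sq a b ((deriv ^^ j) (\<lambda>z. m * g z)) = ennreal (m\<^sup>2) * L2sq a b ((deriv ^^ j) g)" for j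
  proof -
    have "L2sq a b ((deriv ^^ j) (\<lambda>z. m * g z)) = L2sq a b (\<lambda>z. m * (deriv ^^ j) g z)"
      by (rule L2sq_cong_AE) (use g higher_deriv_cmult[of "{a<..<b}"] in \<open>auto simp: smooth_bdd_def\<close>)
    also have "\<dots> = ennreal ((norm m)\<^sup>2) * L2sq a b ((deriv ^^ j) g)"
      by (rule L2sq_cmult[OF smooth_bdd_L2[OF smooth_bdd_higher_deriv[OF g]]])
    finally show ?thesis by simp
  qed
  then show ?thesis
    unfolding Hk_sq_sep[OF g] Hk_sq_sep[OF mg] by (simp add: sum_distrib_left mult_ac)
qed

end

text \<open>By the product formulas the Fourier coefficient at \<open>\<xi>\<close> is a combination of integrals of waves with the lattice
  frequencies \<open>k - \<xi>\<close> and \<open>- k - \<xi>\<close>, which vanish unless one of these is zero.\<close>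

lemma wave_separated:
  assumes L: "L > 0" and ab: "a < b" and k: "k \<in> lattice L"
  shows "separated L a b (\<lambda>y. sin (y \<bullet> k)) {k, - k}" and "separated L a b (\<lambda>y. cos (y \<bullet> k)) {k, - k}"
proof -
  have ci: "(\<lambda>y. cis (y \<bullet> l)) absolutely_integrable_on cell L" for l
    unfolding cell_def by (intro absolutely_integrable_continuous continuous_intros)
  have z: "(LINT y:cell L|lebesgue. cis (y \<bullet> (k - \<xi>))) = 0" "(LINT y:cell L|lebesgue. cis (y \<bullet> (- k - \<xi>))) = 0"
    if "\<xi> \<in> lattice L" "\<xi> \<notin> {k, - k}" for \<xi>
    using integral_cis_lattice[OF L lattice_diff[OF k that(1)]] integral_cis_lattice[OF L lattice_diff[OF lattice_uminus[OF k] that(1)]] that(2)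
    by auto
  have trig: "complex_of_real (sin (y \<bullet> k)) * cis (- (y \<bullet> \<xi>)) = (- \<i> / 2) * (cis (y \<bullet> (k - \<xi>)) - cis (y \<bullet> (- k - \<xi>)))"
    "complex_of_real (cos (y \<bullet> k)) * cis (- (y \<bullet> \<xi>)) = (1 / 2) * (cis (y \<bullet> (k - \<xi>)) + cis (y \<bullet> (- k - \<xi>)))" for y \<xi> :: "real^2"
    by (simp_all add: complex_eq_iff cis.ctr inner_diff_right sin_diff cos_diff sin_add cos_add field_simps)
  have s: "(LINT y:cell L|lebesgue. complex_of_real (sin (y \<bullet> k)) * cis (- (y \<bullet> \<xi>))) = 0"
    "(LINT y:cell L|lebesgue. complex_of_real (cos (y \<bullet> k)) * cis (- (y \<bullet> \<xi>))) = 0"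
    if "\<xi> \<in> lattice L" "\<xi> \<notin> {k, - k}" for \<xi>
    unfolding trig set_integral_mult_right set_integral_diff(2)[OF ci ci] set_integral_add(2)[OF ci ci]
    by (simp_all only: z[OF that] diff_self add_0 mult_zero_right)
  show "separated L a b (\<lambda>y. sin (y \<bullet> k)) {k, - k}"
    by unfold_locales (use L ab s wave_periodic(1)[OF k L] in \<open>auto intro!: continuous_intros simp: swave_def[abs_def]\<close>)
  show "separated L a b (\<lambda>y. cos (y \<bullet> k)) {k, - k}"
    by unfold_locales (use L ab s wave_periodic(2)[OF k L] in \<open>auto intro!: continuous_intros simp: cwave_def[abs_def]\<close>)
qed

lemma wave_Hk:
  assumes L: "L > 0" and ab: "a < b" and k: "k \<in> lattice L" and g: "smooth_bdd {a<..<b} g"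
  shows "in_Hk_layer L a b n (swave k (\<lambda>z. m * g z))" "in_Hk_layer L a b n (cwave k (\<lambda>z. m * g z))"
    "Hk_sq_layer L a b n (swave k (\<lambda>z. m * g z)) = ennreal (m\<^sup>2) * Hk_sq_layer L a b n (swave k g)"
    "Hk_sq_layer L a b n (cwave k (\<lambda>z. m * g z)) = ennreal (m\<^sup>2) * Hk_sq_layer L a b n (cwave k g)"
proof -
  have mg: "smooth_bdd {a<..<b} (\<lambda>z. m * g z)" by (rule smooth_bdd_cmult[OF _ g]) simp
  interpret S: separated L a b "\<lambda>y. sin (y \<bullet> k)" "{k, - k}" by (rule wave_separated(1)[OF L ab k])
  interpret C: separated L a b "\<lambda>y. cos (y \<bullet> k)" "{k, - k}" by (rule wave_separated(2)[OF L ab k])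
  have e: "swave k h = S.sep h" "cwave k h = C.sep h" for h
    by (auto simp: swave_def cwave_def S.sep_def C.sep_def)
  show "in_Hk_layer L a b n (swave k (\<lambda>z. m * g z))" "in_Hk_layer L a b n (cwave k (\<lambda>z. m * g z))"
    "Hk_sq_layer L a b n (swave k (\<lambda>z. m * g z)) = ennreal (m\<^sup>2) * Hk_sq_layer L a b n (swave k g)"
    "Hk_sq_layer L a b n (cwave k (\<lambda>z. m * g z)) = ennreal (m\<^sup>2) * Hk_sq_layer L a b n (cwave k g)"
    unfolding e by (rule S.in_Hk_sep[OF mg] C.in_Hk_sep[OF mg] S.Hk_sq_scale[OF g] C.Hk_sq_scale[OF g])+
qed

context growing_mode
begin

lemma wave_in_Hk:
  assumes "smooth_bdd {0<..<height c} g" "smooth_bdd {- depth c<..<0} g"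
  shows "in_Hk c n (swave k (\<lambda>z. m * g z))" "in_Hk c n (cwave k (\<lambda>z. m * g z))"
    "Hk_sq c n (swave k (\<lambda>z. m * g z)) = ennreal (m\<^sup>2) * Hk_sq c n (swave k g)"
    "Hk_sq c n (cwave k (\<lambda>z. m * g z)) = ennreal (m\<^sup>2) * Hk_sq c n (cwave k g)"
  using wave_Hk[OF pos(3) pos(2) lat assms(1)] wave_Hk[OF pos(3) _ lat assms(2)] pos
  by (auto simp: in_Hk_def Hk_sq_def distrib_left)

lemma amplitudes:
  "smooth_bdd {0<..<height c} f" "smooth_bdd {- depth c<..<0} f" "smooth_bdd {0<..<height c} p" "smooth_bdd {- depth c<..<0} p"
  "smooth_bdd {0<..<height c} (\<lambda>z. rho0 c z * (r * f z + deriv p z))" "smooth_bdd {- depth c<..<0} (\<lambda>z. rho0 c z * (r * f z + deriv p z))"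
  using layer[of "{0<..<height c}"] layer[of "{- depth c<..<0}"] by (auto simp: layer_mode_def)

lemma \<eta>_fun:
  "(\<lambda>x. \<eta> t x $ 1) = swave k (\<lambda>z. (2 * exp (s * t) * k $ 1 / r) * f z)" "(\<lambda>x. \<eta> t x $ 2) = swave k (\<lambda>z. (2 * exp (s * t) * k $ 2 / r) * f z)"
  "(\<lambda>x. \<eta> t x $ 3) = cwave k (\<lambda>z. (2 * exp (s * t)) * p z)"
  using \<eta>1 \<eta>2 \<eta>3 by auto

lemma v_fun:
  "(\<lambda>x. v t x $ 1) = swave k (\<lambda>z. (s * (2 * exp (s * t) * k $ 1 / r)) * f z)" "(\<lambda>x. v t x $ 2) = swave k (\<lambda>z. (s * (2 * exp (s * t) * k $ 2 / r)) * f z)"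
  "(\<lambda>x. v t x $ 3) = cwave k (\<lambda>z. (s * (2 * exp (s * t))) * p z)"
  unfolding v_eq vector_scaleR_component \<eta>1 \<eta>2 \<eta>3 wave_arith mult.assoc by (rule refl)+

lemma q_fun: "q t = cwave k (\<lambda>z. (- (2 * exp (s * t))) * (rho0 c z * (r * f z + deriv p z)))"
  using q_eq by auto

lemma in_Hk_fields: "in_Hk_vec c n (\<eta> t)" "in_Hk_vec c n (v t)" "in_Hk c n (q t)"
proof -
  show "in_Hk_vec c n (\<eta> t)" "in_Hk_vec c n (v t)"
    unfolding in_Hk_vec_def forall_3 \<eta>_fun v_fun
    by (intro conjI wave_in_Hk(1)[OF amplitudes(1,2)] wave_in_Hk(2)[OF amplitudes(3,4)])+
  show "in_Hk c n (q t)" unfolding q_fun by (rule wave_in_Hk(2)[OF amplitudes(5,6)])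
qed

text \<open>The factor \<open>exp (t s)\<close> is a constant factor of the amplitude of each component.\<close>

lemma Hk_sq_growth:
  "Hk_sq c n (\<lambda>x. \<eta> t x $ i) = ennreal ((exp (t * s))\<^sup>2) * Hk_sq c n (\<lambda>x. \<eta> 0 x $ i)"
  "Hk_sq c n (\<lambda>x. v t x $ i) = ennreal ((exp (t * s))\<^sup>2) * Hk_sq c n (\<lambda>x. v 0 x $ i)"
  "Hk_sq c n (q t) = ennreal ((exp (t * s))\<^sup>2) * Hk_sq c n (q 0)"
proof -
  have e: "ennreal ((m * (2 * exp (s * t)))\<^sup>2) * X = ennreal ((exp (t * s))\<^sup>2) * (ennreal ((m * (2 * exp (s * 0)))\<^sup>2) * X)" for m X
    by (simp add: ennreal_mult[symmetric] power_mult_distrib mult_ac)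
  have c1: "2 * exp (s * u) * k $ 1 / r = (k $ 1 / r) * (2 * exp (s * u))" "2 * exp (s * u) * k $ 2 / r = (k $ 2 / r) * (2 * exp (s * u))"
    "s * ((k $ 1 / r) * (2 * exp (s * u))) = (s * (k $ 1 / r)) * (2 * exp (s * u))" "s * ((k $ 2 / r) * (2 * exp (s * u))) = (s * (k $ 2 / r)) * (2 * exp (s * u))"
    "- (2 * exp (s * u)) = (-1) * (2 * exp (s * u))" for u by simp_all
  note W = wave_in_Hk(3)[OF amplitudes(1,2)] wave_in_Hk(4)[OF amplitudes(3,4)] wave_in_Hk(4)[OF amplitudes(5,6)]
  have \<eta>3': "(\<lambda>x. \<eta> u x $ 3) = cwave k (\<lambda>z. (1 * (2 * exp (s * u))) * p z)" for u unfolding \<eta>_fun by simp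
  show "Hk_sq c n (\<lambda>x. \<eta> t x $ i) = ennreal ((exp (t * s))\<^sup>2) * Hk_sq c n (\<lambda>x. \<eta> 0 x $ i)"
    using UNIV_3_cases[of i] by (elim disjE; hypsubst) (unfold \<eta>3' \<eta>_fun(1,2) c1 W, (rule e)+)
  show "Hk_sq c n (\<lambda>x. v t x $ i) = ennreal ((exp (t * s))\<^sup>2) * Hk_sq c n (\<lambda>x. v 0 x $ i)"
    using UNIV_3_cases[of i] by (elim disjE; hypsubst) (unfold v_fun c1 W, (rule e)+)
  show "Hk_sq c n (q t) = ennreal ((exp (t * s))\<^sup>2) * Hk_sq c n (q 0)"
    unfolding q_fun c1(5) W by (rule e)
qed

lemma norm_growth:
  "Hk_norm_vec c n (\<eta> t) = exp (t * s) * Hk_norm_vec c n (\<eta> 0)"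
  "Hk_norm_vec c n (v t) = exp (t * s) * Hk_norm_vec c n (v 0)"
  "Hk_norm c n (q t) = exp (t * s) * Hk_norm c n (q 0)"
  unfolding Hk_norm_vec_def Hk_norm_def Hk_sq_growth(1)[of n t] Hk_sq_growth(2)[of n t] Hk_sq_growth(3)[of n t]
  by (simp_all add: sum_distrib_left[symmetric] enn2real_mult real_sqrt_mult)

end

theorem theorem2p2:
  fixes c :: params
    and \<phi> \<psi> :: "real \<Rightarrow> real \<Rightarrow> real"
    and \<xi> :: "nat \<Rightarrow> real^2"
  assumes standing: "standing c"
    and L_large: "sqrt (surf c / (grav c * rho_jump c)) < perL c"
    and modes: "\<And>r. 0 < r \<Longrightarrow> ereal r < xi_crit c \<Longrightarrow> is_minimizer c r (lam c r) (\<phi> r) (\<psi> r)"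
    and opposite: "\<xi> 1 = - \<xi> 2"
    and lattice: "\<And>j. j \<in> {1, 2} \<Longrightarrow> \<xi> j \<in> lattice (perL c)"
    and range: "\<And>j. j \<in> {1, 2} \<Longrightarrow> 0 < norm (\<xi> j) \<and> ereal (norm (\<xi> j)) < xi_crit c"
    and maximal: "\<And>j. j \<in> {1, 2} \<Longrightarrow> lam c (norm (\<xi> j)) = Lambda c"
  defines "\<eta> \<equiv> eta_sol c \<phi> \<psi> \<xi>"
    and "v \<equiv> v_sol c \<phi> \<psi> \<xi>"
    and "q \<equiv> q_sol c \<phi> \<psi> \<xi>"
  shows "(\<forall>t\<ge>0. (\<forall>x\<in>Omega c. \<forall>i. \<eta> t x $ i \<in> \<real> \<and> v t x $ i \<in> \<real>) \<and>
                 (\<forall>x\<in>Omega_p c \<union> Omega_m c. q t x \<in> \<real>)) \<and>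
         linearized_solution c \<eta> v q \<and>
         (\<forall>k. \<forall>t\<ge>0.
            in_Hk_vec c k (\<eta> t) \<and> in_Hk_vec c k (v t) \<and> in_Hk c k (q t) \<and>
            Hk_norm_vec c k (\<eta> t) = exp (t * Lambda c) * Hk_norm_vec c k (\<eta> 0) \<and>
            Hk_norm_vec c k (v t) = exp (t * Lambda c) * Hk_norm_vec c k (v 0) \<and>
            Hk_norm c k (q t) = exp (t * Lambda c) * Hk_norm c k (q 0))"
proof -
  let ?k = "\<xi> 1"
  let ?r = "norm ?k"
  have r: "?r > 0" "ereal ?r < xi_crit c" and L: "lam c ?r = Lambda c" and lat: "?k \<in> lattice (perL c)"
    using range[of 1] maximal[of 1] lattice[of 1] by simp_all
  have nz: "?k \<noteq> 0" using r by auto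
  have mode: "classical_mode c ?r (Lambda c) (\<phi> ?r) (\<psi> ?r)"
    using minimizer_is_classical_mode[OF standing r modes[OF r]] unfolding L .
  have r2: "?k $ 1 * ?k $ 1 + ?k $ 2 * ?k $ 2 = ?r * ?r"
    using norm_sq_2[of ?k] by (simp add: power2_eq_square)
  interpret growing_mode c ?k ?r "Lambda c" "\<phi> ?r" "\<psi> ?r" \<eta> v q
    unfolding \<eta>_def v_def q_def
    by (rule growing_mode.intro[OF standing _ r2 lat mode]) (use nz explicit_solution[OF opposite nz] in auto)
  show ?thesis
    using real_valued solves in_Hk_fields norm_growth by blast
qed

end
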